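(* Let $\Omega=(0,l\pi)$, $l>0$, with homogeneous Neumann boundary conditions, and suppose that a $(k_1,k_2)$-mode Hopf--steady state bifurcation with $k_1=k_2=0$ occurs at the trivial equilibrium when $\alpha=(0,0)$ for $$\dot u(t)=D(\alpha)\Delta u(t)+L(\alpha)u_t+G(u_t,\alpha).$$ Then the coefficients $a_{11},a_{23},a_{111},a_{123},b_{12},b_{112},b_{223}$ of the third order normal form on the center manifold $$\begin{aligned} \dot z_1&=a_1(\alpha)z_1+a_{11}z_1^2+a_{23}z_2\bar z_2+a_{111}z_1^3+a_{123}z_1z_2\bar z_2+h.o.t.,\\ \dot z_2&=\mathrm i\omega_0z_2+b_2(\alpha)z_2+b_{12}z_1z_2+b_{112}z_1^2z_2+b_{223}z_2^2\bar z_2+h.o.t. \end{aligned}$$ (together with the complex conjugate of the second equation) are $$a_{11}=\tfrac12\psi_1(0)Q_{\phi_1\phi_1},\quad a_{23}=\psi_1(0)Q_{\bar\phi_2\phi_2},\quad b_{12}=\psi_2(0)Q_{\phi_1\phi_2},$$ $$\begin{aligned} a_{111}=&\tfrac16\psi_1(0)C_{\phi_1\phi_1\phi_1}+\tfrac1{\omega_0}\psi_1(0)\mathrm{Re}(\mathrm iQ_{\phi_1\phi_2}\psi_2(0))Q_{\phi_1\phi_1}+\psi_1(0)Q_{\phi_1}h_{200}^0,\\ a_{123}=&\psi_1(0)C_{\phi_1\phi_2\bar\phi_2}+\tfrac2{\omega_0}\psi_1(0)\mathrm{Re}(\mathrm iQ_{\phi_1\phi_2}\psi_2(0))Q_{\phi_2\bar\phi_2}+\tfrac1{\omega_0}\psi_1(0)\mathrm{Re}(\mathrm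 iQ_{\phi_2\phi_2}\psi_2(0)Q_{\phi_1\bar\phi_2})\\ &+\psi_1(0)(Q_{\phi_1}h_{011}^0+Q_{\phi_2}h_{101}^0+Q_{\bar\phi_2}h_{110}^0),\\ b_{112}=&\tfrac12\psi_2(0)C_{\phi_1\phi_1\phi_2}+\tfrac1{2\mathrm i\omega_0}\psi_2(0)\{[2Q_{\phi_1\phi_1}\psi_1(0)+Q_{\phi_1\bar\phi_2}\bar\psi_2(0)]Q_{\phi_1\phi_2}\\ &+[-Q_{\phi_2\phi_2}\psi_2(0)+Q_{\phi_2\bar\phi_2}\bar\psi_2(0)]Q_{\phi_1\phi_1}\}+\psi_2(0)(Q_{\phi_1}h_{110}^0+Q_{\phi_2}h_{200}^0),\\ b_{223}=&\tfrac12\psi_2(0)C_{\phi_2\phi_2\bar\phi_2}+\tfrac1{4\mathrm i\omega_0}\psi_2(0)\{Q_{\phi_1\bar\phi_2}\psi_1(0)Q_{\phi_2\phi_2}+\tfrac23Q_{\bar\phi_2\bar\phi_2}\bar\psi_2(0)Q_{\phi_2\phi_2}\\ &+[-2Q_{\phi_2\phi_2}\psi_2(0)+4Q_{\phi_2\bar\phi_2}\bar\psi_2(0)]Q_{\phi_2\bar\phi_2}\}+\psi_2(0)(Q_{\phi_2}h_{011}^0+Q_{\bar\phi_2}h_{020}^0), \end{aligned}$$ where, for $\theta\in[-r,0]$, $$\begin{aligned} h_{200}^0(\theta)&=\tfrac12[\theta\phi_1(0)\psi_1(0)+\tfrac1{\mathrm i\omega_0}(\phi_2(\theta)\psi_2(0)-\bar\phi_2(\theta)\bar\psi_2(0))]Q_{\phi_1\phi_1}+E_{200},\\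 h_{011}^0(\theta)&=[\theta\phi_1(0)\psi_1(0)+\tfrac1{\mathrm i\omega_0}(\phi_2(\theta)\psi_2(0)-\bar\phi_2(\theta)\bar\psi_2(0))]Q_{\phi_2\bar\phi_2}+E_{011},\\ h_{020}^0(\theta)&=-\tfrac1{2\mathrm i\omega_0}[\tfrac12\phi_1(0)\psi_1(0)+\phi_2(\theta)\psi_2(0)+\tfrac13\bar\phi_2(\theta)\bar\psi_2(0)]Q_{\phi_2\phi_2}+E_{020}e^{2\mathrm i\omega_0\theta},\\ h_{110}^0(\theta)&=\tfrac1{\mathrm i\omega_0}[-\phi_1(0)\psi_1(0)+\mathrm i\omega_0\theta\phi_2(\theta)\psi_2(0)-\tfrac12\bar\phi_2(\theta)\bar\psi_2(0)]Q_{\phi_1\phi_2}+E_{110}e^{\mathrm i\omega_0\theta},\\ h_{002}^0(\theta)&=\overline{h_{020}^0(\theta)},\qquad h_{101}^0(\theta)=\overline{h_{110}^0(\theta)}, \end{aligned}$$ and the constant vectors $E_{200},E_{011},E_{020},E_{110}\in\mathbb C^m$ satisfy $$\begin{aligned} \Big[\int_{-r}^0d\eta_0(\theta)\Big]E_{200}&=\tfrac12\Big[-I+\Big(I-\int_{-r}^0\theta\,d\eta_0(\theta)\Big)\phi_1(0)\psi_1(0)\Big]Q_{\phi_1\phi_1},\\ \Big[\int_{-r}^0d\eta_0(\theta)\Big]E_{011}&=\Big[-I+\Big(I-\int_{-r}^0\theta\,d\eta_0(\theta)\Big)\phi_1(0)\psi_1(0)\Big]Q_{\phi_2\bar\phi_2},\\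 E_{020}&=\tfrac12\Big[2\mathrm i\omega_0I-\int_{-r}^0e^{2\mathrm i\omega_0\theta}d\eta_0(\theta)\Big]^{-1}Q_{\phi_2\phi_2},\\ \Big[\mathrm i\omega_0I-\int_{-r}^0e^{\mathrm i\omega_0\theta}d\eta_0(\theta)\Big]E_{110}&=\Big[I-\phi_2(0)\psi_2(0)+\int_{-r}^0\theta\,d\eta_0(\theta)\phi_2(\theta)\psi_2(0)\Big]Q_{\phi_1\phi_2}, \end{aligned}$$ the remaining freedom in $E_{200},E_{011},E_{110}$ being fixed by the requirement $(\Psi_i,h_q^0)_0=0$, $i=1,2$ (i.e. $h_q\in\mathcal Q^1$).
   Context: **Equation.** $\Omega=(0,l\pi)$, $l>0$; $X$ is a Hilbert space of complex-valued functions on $[0,l\pi]$ with $\langle u,v\rangle=\frac1{l\pi}\int_0^{l\pi}u\bar v\,dx$. With homogeneous Neumann conditions, $-\Delta$ has eigenvalues $\mu_k=k^2/l^2$, $k\in\mathbb N_0$, with orthonormal eigenfunctions $\beta_0=1$, $\beta_k(x)=\sqrt2\cos(kx/l)$. Fix $m\in\mathbb N$, $r>0$; $\mathcal C=C([-r,0];X^m)$ and $C([-r,0];\mathbb C^m)$ carry the sup norm. $u_t(\theta)=u(t+\theta)$. $dom(\Delta)$ is the set of $u\in (W^{2,2})^m$ satisfying the Neumann condition. $D(\alpha)=\mathrm{diag}(d_1(\alpha),\dots,d_m(\alpha))$, $d_i(0)>0$; $\alpha=(\alpha_1,\alpha_2)$ lies in a neighborhood $V$ of $0\in\mathbb R^2$;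 $\alpha\mapsto L(\alpha)$ is a $C^1$ map into bounded linear operators $\mathcal C\to X^m$; $G:\mathcal C\times V\to X^m$ is $C^k$, $k\ge3$, with $G(0,\alpha)=0$ and $D_\varphi G(0,\alpha)=0$. $L$ and $G$ are real on real functions. $L_0=L(0)$, $D_0=D(0)$. Formal Taylor expansions: $L(\alpha)=L_0+\frac12L_1(\alpha)+\cdots$, $D(\alpha)=D_0+\frac12D_1(\alpha)+\cdots$ with $L_1,D_1$ linear in $\alpha$, and $G(v,0)=\frac1{2!}Q(v,v)+\frac1{3!}C(v,v,v)+O(|v|^4)$ with $Q,C$ symmetric multilinear (extended complex-multilinearly). Write $Q_{XY}=Q_XY=Q(X,Y)$, $C_{XYZ}=C(X,Y,Z)$. These operators act pointwise in $x$: $L(\alpha)(\varphi\beta)=(L(\alpha)\varphi)\beta$, $Q(\varphi\beta,\psi\beta')=Q(\varphi,\psi)\beta\beta'$, and similarly for $C$, for $\varphi,\psi\in C([-r,0];\mathbb C^m)$ and scalar functions $\beta,\beta'$ of $x$. For vector functions $\langle v,\beta_k\rangle$ is taken componentwise. **Definition ($(k_1,k_2)$-mode Hopf--steady state bifurcation).** The following four hypotheses hold. (H1) $D_0\Delta$ generates a $C_0$-semigroup $T(t)$ on $X^m$ with $|T(t)|\le Me^{\omega t}$, $t\ge0$, for some $M\ge1$, $\omega\in\mathbb R$, and $T(t)$ is compact for every $t>0$. (H2) $L_0$ extends to a bounded linear operator from $B\mathcal C$ to $X^m$, where $B\mathcal C$ is the space (sup norm) of functions $[-r,0]\to X^m$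 continuous on $[-r,0)$ with a limit as $\theta\to0^-$. (H3) For each $k\in\mathbb N_0$, $L_0$ maps $\mathcal B_k=\{\langle v(\cdot),\beta_k\rangle\beta_k:v\in\mathcal C\}$ into $\mathrm{span}\{e_i\beta_k:1\le i\le m\}$, $e_i$ the canonical basis. (H4) For $\alpha\in V$, the characteristic equation $\det(\lambda I+\mu_kD(\alpha)-L(\alpha)(e^{\lambda\cdot}I))=0$ with $k=k_1$ has a simple real root $\gamma(\alpha)$ with $\gamma(0)=0$, $\frac{\partial\gamma}{\partial\alpha_2}(0)\ne0$; with $k=k_2$ it has a pair of simple complex conjugate roots $\nu(\alpha)\pm\mathrm i\omega(\alpha)$ with $\nu(0)=0$, $\omega(0)=\omega_0>0$, $\frac{\partial\nu}{\partial\alpha_1}(0)\ne0$; all other eigenvalues (over all $k\in\mathbb N_0$) have nonzero real part. **Bases.** $\eta_k$ is the $m\times m$ matrix function of bounded variation with $-\mu_kD_0\psi(0)+L_0\psi=\int_{-r}^0d\eta_k(\theta)\psi(\theta)$ for $\psi\in C([-r,0];\mathbb C^m)$. For $\psi\in C([0,r];\mathbb C^{m*})$ (row vectors), $(\psi,\varphi)_k=\psi(0)\varphi(0)-\int_{-r}^0\int_0^\theta\psi(\xi-\theta)\,d\eta_k(\theta)\varphi(\xi)\,d\xi$. $\phi_1(\theta)\equiv\phi_1(0)$ (real) spans the eigenspace for $\lambda=0$ of $\dot z=-\mu_{k_1}D_0z+L_0z_t$; $\phi_2(\theta)=\phi_2(0)e^{\mathrm i\omega_0\theta}$ that for $\mathrm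 i\omega_0$ of $\dot z=-\mu_{k_2}D_0z+L_0z_t$; $\psi_1(s)\equiv\psi_1(0)$ (real) and $\psi_2(s)=\psi_2(0)e^{-\mathrm i\omega_0s}$ are the corresponding adjoint eigenvectors. With $\Phi_1=\phi_1$, $\Psi_1=\psi_1$, $\Phi_2=(\phi_2,\bar\phi_2)$, $\Psi_2=(\psi_2,\bar\psi_2)^T$ one normalizes $(\Psi_i,\Phi_i)_{k_i}=I$. **Reduction.** $\pi\phi=\sum_{i=1,2}\Phi_i(\Psi_i,\langle\phi(\cdot),\beta_{k_i}\rangle)_{k_i}\beta_{k_i}$ (extended to $B\mathcal C$); $X_0(\theta)=0$ for $\theta<0$, $X_0(0)=I$; $\mathcal Q^1=\{\phi\in\mathcal C:\dot\phi\in\mathcal C,\ \phi(0)\in dom(\Delta),\ \pi\phi=0\}$; $A_1\phi=\dot\phi+X_0[L_0\phi+D_0\Delta\phi(0)-\dot\phi(0)]$ on $\mathcal Q^1$. Writing the solution as $w(z)+y$, $w(z)=\phi_1z_1\beta_{k_1}+(\phi_2z_2+\bar\phi_2\bar z_2)\beta_{k_2}$, $z=(z_1,z_2,\bar z_2)$, $y\in\mathcal Q^1$, the equation becomes $\dot z=Bz+\frac1{2!}f_2^1+\frac1{3!}f_3^1+\cdots$, $\dot y=A_1y+\frac1{2!}f_2^2+\cdots$, with $B=\mathrm{diag}(0,\mathrm i\omega_0,-\mathrm i\omega_0)$, $F_2(v,\alpha)=L_1(\alpha)v+D_1(\alpha)\Delta v(0)+Q(v,v)$, $F_3(v,0)=C(v,v,v)$,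 $f_j^1$ having components $\psi_1(0)\langle F_j,\beta_{k_1}\rangle$, $\psi_2(0)\langle F_j,\beta_{k_2}\rangle$, $\bar\psi_2(0)\langle F_j,\beta_{k_2}\rangle$, and $f_2^2=(I-\pi)X_0F_2$, all evaluated at $v=w(z)+y$. **Normal form.** Let $(M_j^1p)(z,\alpha)=D_zp\,Bz-Bp$ on homogeneous $\mathbb C^3$-valued polynomials of degree $j$. The complement of $\mathrm{Im}(M_2^1)$ is spanned by $z_1^2e_1,z_2\bar z_2e_1,z_1\alpha_ie_1,z_1z_2e_2,z_2\alpha_ie_2,z_1\bar z_2e_3,\bar z_2\alpha_ie_3$ and that of $\mathrm{Im}(M_3^1)$ (with $\alpha=0$) by $z_1^3e_1,z_1z_2\bar z_2e_1,z_1^2z_2e_2,z_2^2\bar z_2e_2,z_1^2\bar z_2e_3,z_2\bar z_2^2e_3$; $\mathrm{Proj}$ is projection onto these complements along the remaining monomials. $U_2^1$ is the combination of the remaining quadratic monomials in $z$ with $M_2^1U_2^1=f_2^1(z,0,0)-\mathrm{Proj}f_2^1(z,0,0)$; $U_2^2=2h$, where $h(z)=h_{200}z_1^2+h_{020}z_2^2+h_{002}\bar z_2^2+h_{110}z_1z_2+h_{101}z_1\bar z_2+h_{011}z_2\bar z_2$ has coefficients in $\mathcal Q^1$ and is the unique solution of $D_zh(z)Bz-A_1h(z)=\frac12f_2^2(z,0,0)$; $h_q^k=\langle h_q,\beta_k\rangle$. After $(z,y)=(\hat z,\hat y)+\frac1{2!}U_2(\hat z)$, $U_2=(U_2^1,U_2^2)$,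 the normal form on the local center manifold is $\dot z=Bz+\frac12g_2^1(z,0,\alpha)+\frac1{3!}g_3^1(z,0,0)+h.o.t.$, $g_2^1(z,0,\alpha)=\mathrm{Proj}f_2^1(z,0,\alpha)$, $g_3^1(z,0,0)=\mathrm{Proj}\{f_3^1(z,0,0)+\frac32[(D_{(z,y)}f_2^1(z,y,0))_{y=0}U_2(z)-D_zU_2^1(z)g_2^1(z,0,0)]\}$; $h.o.t.$ stands for terms of order $\ge4$ in $(z,\alpha)$ and all terms of order $\ge3$ that involve $\alpha$. Also $a_1(\alpha)=\frac12\psi_1(0)(L_1(\alpha)\phi_1-\mu_{k_1}D_1(\alpha)\phi_1(0))$, $b_2(\alpha)=\frac12\psi_2(0)(L_1(\alpha)\phi_2-\mu_{k_2}D_1(\alpha)\phi_2(0))$. *)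

theory Defs
  imports "HOL-Analysis.Analysis"
begin

section \<open>Complex vectors and matrices\<close>

definition vcnj :: "complex^'m \<Rightarrow> complex^'m"
  where "vcnj v = (\<chi> i. cnj (v $ i))"

(* row vector times column vector, no conjugation *)
definition dotc :: "complex^'m \<Rightarrow> complex^'m \<Rightarrow> complex"  (infixl "\<odot>" 70)
  where "p \<odot> v = (\<Sum>i\<in>UNIV. p $ i * v $ i)"

(* column vector times row vector *)
definition outer :: "complex^'m \<Rightarrow> complex^'m \<Rightarrow> complex^'m^'m"  (infixl "\<otimes>\<^sub>v" 75)
  where "v \<otimes>\<^sub>v p = (\<chi> i j. v $ i * p $ j)"

definition mscale :: "complex \<Rightarrow> complex^'m^'m \<Rightarrow> complex^'m^'m"  (infixl "*m" 72)
  where "c *m A = (\<chi> i j. c * A $ i $ j)"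

definition vRe :: "complex^'m \<Rightarrow> complex^'m"
  where "vRe v = (\<chi> i. complex_of_real (Re (v $ i)))"

definition mRe :: "complex^'m^'m \<Rightarrow> complex^'m^'m"
  where "mRe A = (\<chi> i j. complex_of_real (Re (A $ i $ j)))"


section \<open>Riemann--Stieltjes integration on \<open>[-r,0]\<close>\<close>

text \<open>
  The integrator \<open>\<eta>\<close> is matrix valued and may stand in the middle of a product, so an integrand
  is a function \<open>F\<close> of the point \<open>\<theta>\<close> and of the increment \<open>d\<eta>(\<theta>)\<close>, linear in the latter; for
  example \<open>\<lambda>\<theta> A. A *v \<psi> \<theta>\<close> stands for \<open>\<integral> d\<eta>(\<theta>) \<psi>(\<theta>)\<close>.
\<close>

definition has_stieltjes ::
  "real \<Rightarrow> (real \<Rightarrow> 'a::ab_group_add) \<Rightarrow> (real \<Rightarrow> 'a \<Rightarrow> 'b::real_normed_vector) \<Rightarrow> 'b \<Rightarrow> bool"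
  where "has_stieltjes r \<eta> F I \<longleftrightarrow>
    (\<forall>e>0. \<exists>\<delta>>0. \<forall>p. p tagged_division_of {-r..0} \<and> (\<forall>(x, K)\<in>p. diameter K < \<delta>) \<longrightarrow>
       norm ((\<Sum>(x, K)\<in>p. F x (\<eta> (Sup K) - \<eta> (Inf K))) - I) < e)"

definition stieltjes ::
  "real \<Rightarrow> (real \<Rightarrow> 'a::ab_group_add) \<Rightarrow> (real \<Rightarrow> 'a \<Rightarrow> 'b::real_normed_vector) \<Rightarrow> 'b"
  where "stieltjes r \<eta> F = (THE I. has_stieltjes r \<eta> F I)"

definition bounded_variation :: "real \<Rightarrow> (real \<Rightarrow> 'a::real_normed_vector) \<Rightarrow> bool"
  where "bounded_variation r \<eta> \<longleftrightarrow>
    (\<exists>B. \<forall>d. d division_of {-r..0} \<longrightarrow> (\<Sum>K\<in>d. norm (\<eta> (Sup K) - \<eta> (Inf K))) \<le> B)"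


section \<open>The equation and its data\<close>

text \<open>
  A record holds the data of the equation
  \<open>u'(t) = D(\<alpha>) \<Delta>u(t) + L(\<alpha>)u\<^sub>t + G(u\<^sub>t,\<alpha>)\<close> and of its normal form computation.

  The Hilbert space \<open>X\<close> is a type \<open>'x\<close> together with an embedding \<open>ev\<close> which maps each element to a
  representative of its class of functions on \<open>[0,l\<pi>]\<close> modulo null sets.

  \<open>C([-r,0];X^m)\<close> is represented by bounded continuous functions on the real line of which only the
  restriction to \<open>[-r,0]\<close> is used: all operators on histories are required to depend on this
  restriction only (predicate \<open>hist_op\<close> below).  Since continuous functions on \<open>[-r,0]\<close> extend to the
  line by constants with the same sup norm (\<open>hist\<close> below), such operators are the same thing
  as operators on \<open>C([-r,0];X^m)\<close>, with the same operator norm and the same differentiability class.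
  On \<open>C([-r,0];\<complex>^m)\<close>, where no Frechet derivatives are taken, plain functions are used.

  Field names: \<open>Lop1\<close>, \<open>dcoef1\<close> are the first order Taylor terms \<open>L\<^sub>1\<close>, \<open>D\<^sub>1\<close> (the latter as the
  vector of diagonal entries); \<open>kS\<close>, \<open>kH\<close> are the modes \<open>k\<^sub>1\<close> (steady state) and \<open>k\<^sub>2\<close> (Hopf);
  \<open>phi10\<close> is \<open>\<phi>\<^sub>1(0)\<close>, and so on.
\<close>

record (overloaded) ('x, 'm) pfde =
  ell :: real
  delay :: real
  ev :: "'x::{real_inner,banach} \<Rightarrow> real \<Rightarrow> complex"
  nbhd :: "(real^2) set"
  dcoef :: "real^2 \<Rightarrow> real^('m::finite)"
  dcoef1 :: "real^2 \<Rightarrow> real^'m"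
  Lop :: "real^2 \<Rightarrow> (real \<Rightarrow>\<^sub>C ('x^'m)) \<Rightarrow>\<^sub>L ('x^'m)"
  Lop1 :: "real^2 \<Rightarrow> (real \<Rightarrow>\<^sub>C ('x^'m)) \<Rightarrow>\<^sub>L ('x^'m)"
  Gop :: "(real \<Rightarrow>\<^sub>C ('x^'m)) \<times> (real^2) \<Rightarrow> 'x^'m"
  Qop :: "(real \<Rightarrow>\<^sub>C ('x^'m)) \<Rightarrow> (real \<Rightarrow>\<^sub>C ('x^'m)) \<Rightarrow> 'x^'m"
  Cop :: "(real \<Rightarrow>\<^sub>C ('x^'m)) \<Rightarrow> (real \<Rightarrow>\<^sub>C ('x^'m)) \<Rightarrow> (real \<Rightarrow>\<^sub>C ('x^'m)) \<Rightarrow> 'x^'m"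
  kS :: nat
  kH :: nat
  om0 :: real
  eta :: "nat \<Rightarrow> real \<Rightarrow> complex^'m^'m"
  phi10 :: "complex^'m"
  phi20 :: "complex^'m"
  psi10 :: "complex^'m"
  psi20 :: "complex^'m"


subsection \<open>The function space\<close>

definition Om :: "('x::{real_inner,banach}, 'm::finite) pfde \<Rightarrow> real measure"
  where "Om S = lebesgue_on {0..ell S * pi}"

definition ip :: "('x::{real_inner,banach}, 'm::finite) pfde \<Rightarrow> (real \<Rightarrow> complex) \<Rightarrow> (real \<Rightarrow> complex) \<Rightarrow> complex"
  where "ip S f g = complex_of_real (1 / (ell S * pi)) * (\<integral>x. f x * cnj (g x) \<partial>Om S)"

definition mu :: "('x::{real_inner,banach}, 'm::finite) pfde \<Rightarrow> nat \<Rightarrow> real"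
  where "mu S k = (real k)^2 / (ell S)^2"

definition beta :: "('x::{real_inner,banach}, 'm::finite) pfde \<Rightarrow> nat \<Rightarrow> real \<Rightarrow> complex"
  where "beta S k x = (if k = 0 then 1 else complex_of_real (sqrt 2 * cos (real k * x / ell S)))"

text \<open>
  \<open>X\<close> is a Hilbert space of square integrable complex-valued functions containing the
  eigenfunctions.  Its norm is only required to dominate the norm of \<open>L\<^sup>2\<close>, so that
  \<open>X = L\<^sup>2(0,l\<pi>)\<close> with the inner product \<open>ip\<close> is admitted, but also e.g. \<open>X = W^{1,2}(0,l\<pi>)\<close>, on
  which nonlinear superposition operators are smooth; the pairing with the eigenfunctions is always
  \<open>ip\<close>.  The complex structure of \<open>X\<close> is the one of the functions; the inner product of the type is
  the real part of the complex inner product, so multiplication by \<open>\<i>\<close> has to be isometric.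
\<close>

definition function_hilbert_space :: "('x::{real_inner,banach}, 'm::finite) pfde \<Rightarrow> bool"
  where "function_hilbert_space S \<longleftrightarrow>
    (\<forall>u. ev S u \<in> borel_measurable (Om S) \<and> integrable (Om S) (\<lambda>x. (cmod (ev S u x))^2)) \<and>
    (\<forall>u v. AE x in Om S. ev S (u + v) x = ev S u x + ev S v x) \<and>
    (\<forall>c u. AE x in Om S. ev S (c *\<^sub>R u) x = complex_of_real c * ev S u x) \<and>
    (\<forall>u. (AE x in Om S. ev S u x = 0) \<longrightarrow> u = 0) \<and>
    (\<forall>u. \<exists>v. (AE x in Om S. ev S v x = \<i> * ev S u x) \<and> norm v = norm u) \<and>
    (\<exists>K. \<forall>u. (\<integral>x. (cmod (ev S u x))^2 \<partial>Om S) \<le> K * (norm u)^2) \<and>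
    (\<forall>k. \<exists>u. AE x in Om S. ev S u x = beta S k x)"

(* the element of X given by a function *)
definition elt :: "('x::{real_inner,banach}, 'm::finite) pfde \<Rightarrow> (real \<Rightarrow> complex) \<Rightarrow> 'x"
  where "elt S f = (THE u. AE x in Om S. ev S u x = f x)"

definition cscale :: "('x::{real_inner,banach}, 'm::finite) pfde \<Rightarrow> complex \<Rightarrow> 'x^'m \<Rightarrow> 'x^'m"
  where "cscale S c v = (\<chi> i. elt S (\<lambda>x. c * ev S (v $ i) x))"

(* the element v b of X^m for a vector v and a scalar function b of x *)
definition tens :: "('x::{real_inner,banach}, 'm::finite) pfde \<Rightarrow> complex^'m \<Rightarrow> (real \<Rightarrow> complex) \<Rightarrow> 'x^'m"
  where "tens S v b = (\<chi> i. elt S (\<lambda>x. v $ i * b x))"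

(* <v, beta_k> *)
definition mode :: "('x::{real_inner,banach}, 'm::finite) pfde \<Rightarrow> nat \<Rightarrow> 'x^'m \<Rightarrow> complex^'m"
  where "mode S k v = (\<chi> i. ip S (ev S (v $ i)) (beta S k))"

definition real_val :: "('x::{real_inner,banach}, 'm::finite) pfde \<Rightarrow> 'x^'m \<Rightarrow> bool"
  where "real_val S v \<longleftrightarrow> (\<forall>i. AE x in Om S. Im (ev S (v $ i) x) = 0)"


subsection \<open>The Laplacian\<close>

text \<open>
  \<open>f \<in> W^{2,2}(0,l\<pi>)\<close> with weak second derivative \<open>w\<close> and \<open>f'(0) = f'(l\<pi>) = 0\<close>:
  \<open>f\<close> is a.e. equal to a \<open>C\<^sup>1\<close> function whose derivative is the absolutely continuous
  function \<open>s \<mapsto> \<integral>\<^sub>0\<^sup>s w\<close>, with \<open>w \<in> L\<^sup>2\<close>.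
\<close>

definition neumann_second_deriv ::
  "('x::{real_inner,banach}, 'm::finite) pfde \<Rightarrow> (real \<Rightarrow> complex) \<Rightarrow> (real \<Rightarrow> complex) \<Rightarrow> bool"
  where "neumann_second_deriv S f w \<longleftrightarrow>
    w \<in> borel_measurable (Om S) \<and> integrable (Om S) (\<lambda>x. (cmod (w x))^2) \<and>
    integral {0..ell S * pi} w = 0 \<and>
    (\<exists>c. AE x in Om S. f x = c + integral {0..x} (\<lambda>s. integral {0..s} w))"

(* If X is smaller than L^2, this is the part of the Neumann Laplacian in X. *)
definition dom_lap :: "('x::{real_inner,banach}, 'm::finite) pfde \<Rightarrow> ('x^'m) set"
  where "dom_lap S = {v. \<forall>i. \<exists>w. neumann_second_deriv S (ev S (v $ i)) (ev S w)}"

definition lap :: "('x::{real_inner,banach}, 'm::finite) pfde \<Rightarrow> 'x^'m \<Rightarrow> 'x^'m"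
  where "lap S v = (\<chi> i. THE w. neumann_second_deriv S (ev S (v $ i)) (ev S w))"

definition dlap :: "('x::{real_inner,banach}, 'm::finite) pfde \<Rightarrow> real^'m \<Rightarrow> 'x^'m \<Rightarrow> 'x^'m"
  where "dlap S d v = (\<chi> i. d $ i *\<^sub>R lap S v $ i)"


subsection \<open>Histories\<close>

definition hist :: "('x::{real_inner,banach}, 'm::finite) pfde \<Rightarrow> (real \<Rightarrow> 'x^'m) \<Rightarrow> (real \<Rightarrow>\<^sub>C ('x^'m))"
  where "hist S f = Bcontfun (ext_cont f (- delay S) 0)"

definition hist_op :: "('x::{real_inner,banach}, 'm::finite) pfde \<Rightarrow> ((real \<Rightarrow>\<^sub>C ('x^'m)) \<Rightarrow> 'b) \<Rightarrow> bool"
  where "hist_op S F \<longleftrightarrow>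
    (\<forall>\<phi> \<psi>. (\<forall>\<theta>\<in>{- delay S..0}. apply_bcontfun \<phi> \<theta> = apply_bcontfun \<psi> \<theta>) \<longrightarrow> F \<phi> = F \<psi>)"

definition hscale :: "('x::{real_inner,banach}, 'm::finite) pfde \<Rightarrow> complex \<Rightarrow> (real \<Rightarrow>\<^sub>C ('x^'m)) \<Rightarrow> (real \<Rightarrow>\<^sub>C ('x^'m))"
  where "hscale S c \<phi> = hist S (\<lambda>\<theta>. cscale S c (apply_bcontfun \<phi> \<theta>))"

definition real_hist :: "('x::{real_inner,banach}, 'm::finite) pfde \<Rightarrow> (real \<Rightarrow>\<^sub>C ('x^'m)) \<Rightarrow> bool"
  where "real_hist S \<phi> \<longleftrightarrow> (\<forall>\<theta>\<in>{- delay S..0}. real_val S (apply_bcontfun \<phi> \<theta>))"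

(* the history \<phi> b, for \<phi> in C([-r,0]; \<complex>^m) and a scalar function b of x *)
definition htens :: "('x::{real_inner,banach}, 'm::finite) pfde \<Rightarrow> (real \<Rightarrow> complex^'m) \<Rightarrow> (real \<Rightarrow> complex) \<Rightarrow> (real \<Rightarrow>\<^sub>C ('x^'m))"
  where "htens S \<phi> b = hist S (\<lambda>\<theta>. tens S (\<phi> \<theta>) b)"

text \<open>
  The operators induced on \<open>C([-r,0];\<complex>^m)\<close>, by evaluation on functions that do not depend on \<open>x\<close>
  (recall \<open>\<beta>\<^sub>0 = 1\<close>).  That these describe the given operators on all products \<open>\<phi>\<beta>\<close> is the
  hypothesis \<open>acts_pointwise\<close>.
\<close>

definition Lm :: "('x::{real_inner,banach}, 'm::finite) pfde \<Rightarrow> ((real \<Rightarrow>\<^sub>C ('x^'m)) \<Rightarrow>\<^sub>L ('x^'m)) \<Rightarrow> (real \<Rightarrow> complex^'m) \<Rightarrow> complex^'m"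
  where "Lm S T \<phi> = mode S 0 (blinfun_apply T (htens S \<phi> (beta S 0)))"

definition Qm :: "('x::{real_inner,banach}, 'm::finite) pfde \<Rightarrow> (real \<Rightarrow> complex^'m) \<Rightarrow> (real \<Rightarrow> complex^'m) \<Rightarrow> complex^'m"
  where "Qm S \<phi> \<psi> = mode S 0 (Qop S (htens S \<phi> (beta S 0)) (htens S \<psi> (beta S 0)))"

definition Cm :: "('x::{real_inner,banach}, 'm::finite) pfde \<Rightarrow> (real \<Rightarrow> complex^'m) \<Rightarrow> (real \<Rightarrow> complex^'m) \<Rightarrow> (real \<Rightarrow> complex^'m) \<Rightarrow> complex^'m"
  where "Cm S \<phi> \<psi> \<chi>' = mode S 0 (Cop S (htens S \<phi> (beta S 0)) (htens S \<psi> (beta S 0)) (htens S \<chi>' (beta S 0)))"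

definition acts_pointwise :: "('x::{real_inner,banach}, 'm::finite) pfde \<Rightarrow> bool"
  where "acts_pointwise S \<longleftrightarrow>
    (\<forall>\<alpha>\<in>nbhd S. \<forall>\<phi> b i. continuous_on {- delay S..0} \<phi> \<longrightarrow>
       (AE x in Om S. ev S (blinfun_apply (Lop S \<alpha>) (htens S \<phi> (ev S b)) $ i) x
          = Lm S (Lop S \<alpha>) \<phi> $ i * ev S b x)) \<and>
    (\<forall>\<phi> \<psi> b b' i. continuous_on {- delay S..0} \<phi> \<and> continuous_on {- delay S..0} \<psi> \<longrightarrow>
       (AE x in Om S. ev S (Qop S (htens S \<phi> (ev S b)) (htens S \<psi> (ev S b')) $ i) x
          = Qm S \<phi> \<psi> $ i * ev S b x * ev S b' x)) \<and>
    (\<forall>\<phi> \<psi> \<chi>' b b' b'' i.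
       continuous_on {- delay S..0} \<phi> \<and> continuous_on {- delay S..0} \<psi> \<and> continuous_on {- delay S..0} \<chi>' \<longrightarrow>
       (AE x in Om S. ev S (Cop S (htens S \<phi> (ev S b)) (htens S \<psi> (ev S b')) (htens S \<chi>' (ev S b'')) $ i) x
          = Cm S \<phi> \<psi> \<chi>' $ i * ev S b x * ev S b' x * ev S b'' x))"


subsection \<open>Standing assumptions\<close>

definition C1_on :: "('a::real_normed_vector \<Rightarrow> 'b::real_normed_vector) \<Rightarrow> 'a set \<Rightarrow> bool"
  where "C1_on f A \<longleftrightarrow>
    (\<exists>f'. (\<forall>p\<in>A. (f has_derivative blinfun_apply (f' p)) (at p)) \<and> continuous_on A f')"

definition C3_on :: "('a::real_normed_vector \<Rightarrow> 'b::real_normed_vector) \<Rightarrow> 'a set \<Rightarrow> bool"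
  where "C3_on f A \<longleftrightarrow>
    (\<exists>f1 f2 f3. (\<forall>p\<in>A. (f has_derivative blinfun_apply (f1 p)) (at p)) \<and>
       (\<forall>p\<in>A. (f1 has_derivative blinfun_apply (f2 p)) (at p)) \<and>
       (\<forall>p\<in>A. (f2 has_derivative blinfun_apply (f3 p)) (at p)) \<and> continuous_on A f3)"

definition linear_part :: "('x::{real_inner,banach}, 'm::finite) pfde \<Rightarrow> bool"
  where "linear_part S \<longleftrightarrow>
    (\<forall>i. dcoef S 0 $ i > 0) \<and>
    (dcoef S has_derivative (\<lambda>\<alpha>. (1/2) *\<^sub>R dcoef1 S \<alpha>)) (at 0) \<and>
    (\<forall>\<alpha>\<in>nbhd S. hist_op S (blinfun_apply (Lop S \<alpha>)) \<and>
       (\<forall>c \<phi>. blinfun_apply (Lop S \<alpha>) (hscale S c \<phi>) = cscale S c (blinfun_apply (Lop S \<alpha>) \<phi>)) \<and>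
       (\<forall>\<phi>. real_hist S \<phi> \<longrightarrow> real_val S (blinfun_apply (Lop S \<alpha>) \<phi>))) \<and>
    C1_on (Lop S) (nbhd S) \<and>
    (Lop S has_derivative (\<lambda>\<alpha>. (1/2) *\<^sub>R Lop1 S \<alpha>)) (at 0)"

text \<open>
  The Taylor expansion of \<open>G(\<cdot>,0)\<close> is stated for real histories, \<open>Q\<close> and \<open>C\<close> being extended
  complex-multilinearly.  The remainder is \<open>o(|v|^3)\<close>, which is what \<open>C\<^sup>3\<close> provides; it is \<open>O(|v|^4)\<close>
  for smoother \<open>G\<close>.
\<close>

definition nonlinear_part :: "('x::{real_inner,banach}, 'm::finite) pfde \<Rightarrow> bool"
  where "nonlinear_part S \<longleftrightarrow>
    (\<forall>\<alpha>\<in>nbhd S. hist_op S (\<lambda>\<phi>. Gop S (\<phi>, \<alpha>)) \<and>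
       (\<forall>\<phi>. real_hist S \<phi> \<longrightarrow> real_val S (Gop S (\<phi>, \<alpha>))) \<and>
       Gop S (0, \<alpha>) = 0 \<and> ((\<lambda>\<phi>. Gop S (\<phi>, \<alpha>)) has_derivative (\<lambda>_. 0)) (at 0)) \<and>
    C3_on (Gop S) (UNIV \<times> nbhd S) \<and>
    bounded_bilinear (Qop S) \<and>
    (\<forall>u. hist_op S (Qop S u)) \<and>
    (\<forall>u v. Qop S u v = Qop S v u) \<and>
    (\<forall>c u v. Qop S (hscale S c u) v = cscale S c (Qop S u v)) \<and>
    (\<forall>u v. linear (Cop S u v)) \<and>
    (\<exists>K. \<forall>u v w. norm (Cop S u v w) \<le> K * norm u * norm v * norm w) \<and>
    (\<forall>u v. hist_op S (Cop S u v)) \<and>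
    (\<forall>u v w. Cop S u v w = Cop S v u w \<and> Cop S u v w = Cop S u w v) \<and>
    (\<forall>c u v w. Cop S (hscale S c u) v w = cscale S c (Cop S u v w)) \<and>
    (\<forall>e>0. \<exists>\<delta>>0. \<forall>v. real_hist S v \<and> norm v < \<delta> \<longrightarrow>
       norm (Gop S (v, 0) - (1/2) *\<^sub>R Qop S v v - (1/6) *\<^sub>R Cop S v v v) \<le> e * norm v ^ 3)"

definition pfde_setting :: "('x::{real_inner,banach}, 'm::finite) pfde \<Rightarrow> bool"
  where "pfde_setting S \<longleftrightarrow>
    ell S > 0 \<and> delay S > 0 \<and> function_hilbert_space S \<and> open (nbhd S) \<and> 0 \<in> nbhd S \<and>
    linear_part S \<and> nonlinear_part S \<and> acts_pointwise S"


section \<open>Hopf--steady state bifurcation\<close>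

definition C0_semigroup :: "(real \<Rightarrow> ('a::real_normed_vector \<Rightarrow>\<^sub>L 'a)) \<Rightarrow> bool"
  where "C0_semigroup T \<longleftrightarrow>
    T 0 = id_blinfun \<and> (\<forall>s\<ge>0. \<forall>t\<ge>0. T (s + t) = T s o\<^sub>L T t) \<and>
    (\<forall>v. ((\<lambda>t. blinfun_apply (T t) v) \<longlongrightarrow> v) (at_right 0))"

(* the operator A with domain D, domain included, is the infinitesimal generator of T *)
definition generates :: "('a::real_normed_vector \<Rightarrow> 'a) \<Rightarrow> 'a set \<Rightarrow> (real \<Rightarrow> ('a \<Rightarrow>\<^sub>L 'a)) \<Rightarrow> bool"
  where "generates A D T \<longleftrightarrow> C0_semigroup T \<and>
    (\<forall>v y. ((\<lambda>t. (blinfun_apply (T t) v - v) /\<^sub>R t) \<longlongrightarrow> y) (at_right 0) \<longleftrightarrow> v \<in> D \<and> y = A v)"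

definition H1 :: "('x::{real_inner,banach}, 'm::finite) pfde \<Rightarrow> bool"
  where "H1 S \<longleftrightarrow>
    (\<exists>T. generates (dlap S (dcoef S 0)) (dom_lap S) T \<and>
       (\<exists>M\<ge>1. \<exists>w. \<forall>t\<ge>0. norm (T t) \<le> M * exp (w * t)) \<and>
       (\<forall>t>0. compact (closure (blinfun_apply (T t) ` cball 0 1))))"

definition BC :: "('x::{real_inner,banach}, 'm::finite) pfde \<Rightarrow> (real \<Rightarrow> 'x^'m) set"
  where "BC S = {\<phi>. continuous_on {- delay S..<0} \<phi> \<and> (\<exists>y. (\<phi> \<longlongrightarrow> y) (at_left 0))}"

definition H2 :: "('x::{real_inner,banach}, 'm::finite) pfde \<Rightarrow> bool"
  where "H2 S \<longleftrightarrow>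
    (\<exists>T :: (real \<Rightarrow> 'x^'m) \<Rightarrow> 'x^'m.
       (\<forall>\<phi>\<in>BC S. \<forall>\<psi>\<in>BC S. T (\<lambda>\<theta>. \<phi> \<theta> + \<psi> \<theta>) = T \<phi> + T \<psi>) \<and>
       (\<forall>c. \<forall>\<phi>\<in>BC S. T (\<lambda>\<theta>. cscale S c (\<phi> \<theta>)) = cscale S c (T \<phi>)) \<and>
       (\<exists>K. \<forall>\<phi>\<in>BC S. norm (T \<phi>) \<le> K * (SUP \<theta>\<in>{- delay S..0}. norm (\<phi> \<theta>))) \<and>
       (\<forall>\<phi>. continuous_on {- delay S..0} \<phi> \<longrightarrow> T \<phi> = blinfun_apply (Lop S 0) (hist S \<phi>)))"

definition H3 :: "('x::{real_inner,banach}, 'm::finite) pfde \<Rightarrow> bool"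
  where "H3 S \<longleftrightarrow>
    (\<forall>k v. \<exists>c. blinfun_apply (Lop S 0) (htens S (\<lambda>\<theta>. mode S k (apply_bcontfun v \<theta>)) (beta S k))
       = tens S c (beta S k))"

definition char_fun :: "('x::{real_inner,banach}, 'm::finite) pfde \<Rightarrow> nat \<Rightarrow> real^2 \<Rightarrow> complex \<Rightarrow> complex"
  where "char_fun S k \<alpha> \<zeta> = det (mat \<zeta>
      + complex_of_real (mu S k) *m (\<chi> i j. if i = j then complex_of_real (dcoef S \<alpha> $ i) else 0)
      - (\<chi> i j. Lm S (Lop S \<alpha>) (\<lambda>\<theta>. exp (\<zeta> * complex_of_real \<theta>) *s axis j 1) $ i))"

definition simple_root :: "(complex \<Rightarrow> complex) \<Rightarrow> complex \<Rightarrow> bool"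
  where "simple_root f z \<longleftrightarrow> f z = 0 \<and> deriv f z \<noteq> 0"

definition H4 :: "('x::{real_inner,banach}, 'm::finite) pfde \<Rightarrow> bool"
  where "H4 S \<longleftrightarrow> om0 S > 0 \<and>
    (\<exists>\<gamma> \<nu> \<omega>.
       (\<forall>\<alpha>\<in>nbhd S.
          simple_root (char_fun S (kS S) \<alpha>) (complex_of_real (\<gamma> \<alpha>)) \<and>
          \<omega> \<alpha> \<noteq> 0 \<and>
          simple_root (char_fun S (kH S) \<alpha>) (Complex (\<nu> \<alpha>) (\<omega> \<alpha>)) \<and>
          simple_root (char_fun S (kH S) \<alpha>) (Complex (\<nu> \<alpha>) (- \<omega> \<alpha>)) \<and>
          (\<forall>k \<zeta>. char_fun S k \<alpha> \<zeta> = 0 \<and>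
             \<not> (k = kS S \<and> \<zeta> = complex_of_real (\<gamma> \<alpha>)) \<and>
             \<not> (k = kH S \<and> \<zeta> \<in> {Complex (\<nu> \<alpha>) (\<omega> \<alpha>), Complex (\<nu> \<alpha>) (- \<omega> \<alpha>)}) \<longrightarrow> Re \<zeta> \<noteq> 0)) \<and>
       \<gamma> 0 = 0 \<and> \<nu> 0 = 0 \<and> \<omega> 0 = om0 S \<and>
       (\<exists>c. c \<noteq> 0 \<and> ((\<lambda>s. \<gamma> (s *\<^sub>R axis 2 1)) has_real_derivative c) (at 0)) \<and>
       (\<exists>c. c \<noteq> 0 \<and> ((\<lambda>s. \<nu> (s *\<^sub>R axis 1 1)) has_real_derivative c) (at 0)))"

(* the (k1,k2)-mode Hopf--steady state bifurcation, k1 = kS S and k2 = kH S *)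
definition hopf_steady_bifurcation :: "('x::{real_inner,banach}, 'm::finite) pfde \<Rightarrow> bool"
  where "hopf_steady_bifurcation S \<longleftrightarrow> H1 S \<and> H2 S \<and> H3 S \<and> H4 S"


section \<open>Bases of the center space and of its dual\<close>

definition lin_mode :: "('x::{real_inner,banach}, 'm::finite) pfde \<Rightarrow> nat \<Rightarrow> (real \<Rightarrow> complex^'m) \<Rightarrow> complex^'m"
  where "lin_mode S k \<phi> =
    - (\<chi> i. complex_of_real (mu S k * dcoef S 0 $ i) * \<phi> 0 $ i) + Lm S (Lop S 0) \<phi>"

definition phi1 :: "('x::{real_inner,banach}, 'm::finite) pfde \<Rightarrow> real \<Rightarrow> complex^'m"
  where "phi1 S \<theta> = phi10 S"

definition phi2 :: "('x::{real_inner,banach}, 'm::finite) pfde \<Rightarrow> real \<Rightarrow> complex^'m"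
  where "phi2 S \<theta> = exp (\<i> * complex_of_real (om0 S * \<theta>)) *s phi20 S"

definition phi2b :: "('x::{real_inner,banach}, 'm::finite) pfde \<Rightarrow> real \<Rightarrow> complex^'m"
  where "phi2b S \<theta> = vcnj (phi2 S \<theta>)"

definition psi1 :: "('x::{real_inner,banach}, 'm::finite) pfde \<Rightarrow> real \<Rightarrow> complex^'m"
  where "psi1 S s = psi10 S"

definition psi2 :: "('x::{real_inner,banach}, 'm::finite) pfde \<Rightarrow> real \<Rightarrow> complex^'m"
  where "psi2 S s = exp (- \<i> * complex_of_real (om0 S * s)) *s psi20 S"

definition psi2b :: "('x::{real_inner,banach}, 'm::finite) pfde \<Rightarrow> real \<Rightarrow> complex^'m"
  where "psi2b S s = vcnj (psi2 S s)"

text \<open>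
  The bilinear form \<open>(\<psi>,\<phi>)\<^sub>k\<close>; the inner integral \<open>\<integral>\<^sub>0\<^sup>\<theta>\<close> is \<open>-\<integral>\<^sub>\<theta>\<^sup>0\<close> as \<open>\<theta> \<le> 0\<close>.  The formula also
  makes sense for \<open>\<phi>\<close> with a jump at \<open>0\<close>, which gives the extension to \<open>BC\<close>.
\<close>

definition pairing :: "('x::{real_inner,banach}, 'm::finite) pfde \<Rightarrow> nat \<Rightarrow> (real \<Rightarrow> complex^'m) \<Rightarrow> (real \<Rightarrow> complex^'m) \<Rightarrow> complex"
  where "pairing S k \<psi> \<phi> = \<psi> 0 \<odot> \<phi> 0
    - stieltjes (delay S) (eta S k)
        (\<lambda>\<theta> A. - integral {\<theta>..0} (\<lambda>\<xi>. \<psi> (\<xi> - \<theta>) \<odot> (A *v \<phi> \<xi>)))"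

(* eigenfunctions of the generator of z' = - mu_k D_0 z + L_0 z_t *)
definition eigenfun :: "('x::{real_inner,banach}, 'm::finite) pfde \<Rightarrow> nat \<Rightarrow> complex \<Rightarrow> (real \<Rightarrow> complex^'m) \<Rightarrow> bool"
  where "eigenfun S k \<zeta> \<phi> \<longleftrightarrow>
    (\<forall>\<theta>\<in>{- delay S..0}. (\<phi> has_vector_derivative \<zeta> *s \<phi> \<theta>) (at \<theta> within {- delay S..0})) \<and>
    \<zeta> *s \<phi> 0 = lin_mode S k \<phi>"

definition spans_eigenspace :: "('x::{real_inner,banach}, 'm::finite) pfde \<Rightarrow> nat \<Rightarrow> complex \<Rightarrow> (real \<Rightarrow> complex^'m) \<Rightarrow> bool"
  where "spans_eigenspace S k \<zeta> \<phi> \<longleftrightarrow>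
    eigenfun S k \<zeta> \<phi> \<and>
    (\<forall>\<chi>'. eigenfun S k \<zeta> \<chi>' \<longrightarrow> (\<exists>c. \<forall>\<theta>\<in>{- delay S..0}. \<chi>' \<theta> = c *s \<phi> \<theta>))"

(* eigenfunctions of the formal adjoint: - psi' = lambda psi, - psi'(0) = \<integral> psi(-\<theta>) d\<eta>(\<theta>) *)
definition adjoint_eigenfun :: "('x::{real_inner,banach}, 'm::finite) pfde \<Rightarrow> nat \<Rightarrow> complex \<Rightarrow> (real \<Rightarrow> complex^'m) \<Rightarrow> bool"
  where "adjoint_eigenfun S k \<zeta> \<psi> \<longleftrightarrow>
    (\<forall>s\<in>{0..delay S}. (\<psi> has_vector_derivative - (\<zeta> *s \<psi> s)) (at s within {0..delay S})) \<and>
    \<zeta> *s \<psi> 0 = stieltjes (delay S) (eta S k) (\<lambda>\<theta> A. \<psi> (- \<theta>) v* A)"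

definition hopf_steady_bases :: "('x::{real_inner,banach}, 'm::finite) pfde \<Rightarrow> bool"
  where "hopf_steady_bases S \<longleftrightarrow>
    (\<forall>k. bounded_variation (delay S) (eta S k) \<and>
       (\<forall>\<psi>. continuous_on {- delay S..0} \<psi> \<longrightarrow>
          has_stieltjes (delay S) (eta S k) (\<lambda>\<theta> A. A *v \<psi> \<theta>) (lin_mode S k \<psi>))) \<and>
    vcnj (phi10 S) = phi10 S \<and> vcnj (psi10 S) = psi10 S \<and>
    spans_eigenspace S (kS S) 0 (phi1 S) \<and>
    spans_eigenspace S (kH S) (\<i> * complex_of_real (om0 S)) (phi2 S) \<and>
    adjoint_eigenfun S (kS S) 0 (psi1 S) \<and>
    adjoint_eigenfun S (kH S) (\<i> * complex_of_real (om0 S)) (psi2 S) \<and>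
    pairing S (kS S) (psi1 S) (phi1 S) = 1 \<and>
    pairing S (kH S) (psi2 S) (phi2 S) = 1 \<and> pairing S (kH S) (psi2 S) (phi2b S) = 0 \<and>
    pairing S (kH S) (psi2b S) (phi2 S) = 0 \<and> pairing S (kH S) (psi2b S) (phi2b S) = 1"


section \<open>Reduction to the center space\<close>

text \<open>
  \<open>z = (z\<^sub>1,z\<^sub>2,z\<^sub>3) \<in> \<complex>\<^sup>3\<close>, the third coordinate standing for the conjugate of \<open>z\<^sub>2\<close>; all expressions
  are polynomials in these three independent variables.
\<close>

definition Bz :: "('x::{real_inner,banach}, 'm::finite) pfde \<Rightarrow> complex^3 \<Rightarrow> complex^3"
  where "Bz S z = vector [0, \<i> * complex_of_real (om0 S) * z $ 2, - \<i> * complex_of_real (om0 S) * z $ 3]"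

definition wc :: "('x::{real_inner,banach}, 'm::finite) pfde \<Rightarrow> complex^3 \<Rightarrow> (real \<Rightarrow>\<^sub>C ('x^'m))"
  where "wc S z = htens S (\<lambda>\<theta>. z $ 1 *s phi1 S \<theta>) (beta S (kS S))
     + htens S (\<lambda>\<theta>. z $ 2 *s phi2 S \<theta> + z $ 3 *s phi2b S \<theta>) (beta S (kH S))"

definition proj_center :: "('x::{real_inner,banach}, 'm::finite) pfde \<Rightarrow> (real \<Rightarrow> 'x^'m) \<Rightarrow> real \<Rightarrow> 'x^'m"
  where "proj_center S \<phi> \<theta> =
    tens S (pairing S (kS S) (psi1 S) (\<lambda>s. mode S (kS S) (\<phi> s)) *s phi1 S \<theta>) (beta S (kS S))
    + tens S (pairing S (kH S) (psi2 S) (\<lambda>s. mode S (kH S) (\<phi> s)) *s phi2 S \<theta>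
            + pairing S (kH S) (psi2b S) (\<lambda>s. mode S (kH S) (\<phi> s)) *s phi2b S \<theta>) (beta S (kH S))"

definition X0 :: "'a::zero \<Rightarrow> real \<Rightarrow> 'a"
  where "X0 v \<theta> = (if \<theta> = 0 then v else 0)"

definition Q1 :: "('x::{real_inner,banach}, 'm::finite) pfde \<Rightarrow> (real \<Rightarrow> 'x^'m) set"
  where "Q1 S = {\<phi>.
    (\<exists>\<phi>'. continuous_on {- delay S..0} \<phi>' \<and>
       (\<forall>\<theta>\<in>{- delay S..0}. (\<phi> has_vector_derivative \<phi>' \<theta>) (at \<theta> within {- delay S..0}))) \<and>
    \<phi> 0 \<in> dom_lap S \<and> (\<forall>\<theta>\<in>{- delay S..0}. proj_center S \<phi> \<theta> = 0)}"

definition A1 :: "('x::{real_inner,banach}, 'm::finite) pfde \<Rightarrow> (real \<Rightarrow> 'x^'m) \<Rightarrow> real \<Rightarrow> 'x^'m"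
  where "A1 S \<phi> \<theta> = vector_derivative \<phi> (at \<theta> within {- delay S..0})
    + X0 (blinfun_apply (Lop S 0) (hist S \<phi>) + dlap S (dcoef S 0) (\<phi> 0)
          - vector_derivative \<phi> (at 0 within {- delay S..0})) \<theta>"

definition F2 :: "('x::{real_inner,banach}, 'm::finite) pfde \<Rightarrow> (real \<Rightarrow>\<^sub>C ('x^'m)) \<Rightarrow> real^2 \<Rightarrow> 'x^'m"
  where "F2 S v \<alpha> = blinfun_apply (Lop1 S \<alpha>) v + dlap S (dcoef1 S \<alpha>) (apply_bcontfun v 0) + Qop S v v"

(* F_3(v,0) *)
definition F3 :: "('x::{real_inner,banach}, 'm::finite) pfde \<Rightarrow> (real \<Rightarrow>\<^sub>C ('x^'m)) \<Rightarrow> 'x^'m"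
  where "F3 S v = Cop S v v v"

definition center_part :: "('x::{real_inner,banach}, 'm::finite) pfde \<Rightarrow> 'x^'m \<Rightarrow> complex^3"
  where "center_part S F = vector [psi1 S 0 \<odot> mode S (kS S) F,
     psi2 S 0 \<odot> mode S (kH S) F, psi2b S 0 \<odot> mode S (kH S) F]"

definition f21 :: "('x::{real_inner,banach}, 'm::finite) pfde \<Rightarrow> complex^3 \<Rightarrow> (real \<Rightarrow>\<^sub>C ('x^'m)) \<Rightarrow> real^2 \<Rightarrow> complex^3"
  where "f21 S z y \<alpha> = center_part S (F2 S (wc S z + y) \<alpha>)"

definition f31 :: "('x::{real_inner,banach}, 'm::finite) pfde \<Rightarrow> complex^3 \<Rightarrow> complex^3"
  where "f31 S z = center_part S (F3 S (wc S z))"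

(* f_2^2 at y = 0, \<alpha> = 0 *)
definition f22 :: "('x::{real_inner,banach}, 'm::finite) pfde \<Rightarrow> complex^3 \<Rightarrow> real \<Rightarrow> 'x^'m"
  where "f22 S z \<theta> = X0 (F2 S (wc S z) 0) \<theta> - proj_center S (X0 (F2 S (wc S z) 0)) \<theta>"


section \<open>Third order normal form\<close>

text \<open>Monomials in \<open>(z\<^sub>1,z\<^sub>2,z\<^sub>3,\<alpha>\<^sub>1,\<alpha>\<^sub>2)\<close> are given by their exponents.\<close>

type_synonym expo = "nat \<times> nat \<times> nat \<times> nat \<times> nat"

definition zmono :: "expo \<Rightarrow> complex^3 \<Rightarrow> real^2 \<Rightarrow> complex"
  where "zmono q z \<alpha> = (case q of (a, b, c, s, t) \<Rightarrow>
    (z $ 1)^a * (z $ 2)^b * (z $ 3)^c * complex_of_real (\<alpha> $ 1)^s * complex_of_real (\<alpha> $ 2)^t)"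

definition expos :: "nat \<Rightarrow> expo set"
  where "expos j = {(a, b, c, s, t). a + b + c + s + t = j}"

(* coefficients of a homogeneous polynomial of degree j, one family for each component *)
definition hcoeff :: "nat \<Rightarrow> (complex^3 \<Rightarrow> real^2 \<Rightarrow> complex^3) \<Rightarrow> 3 \<Rightarrow> expo \<Rightarrow> complex"
  where "hcoeff j p = (THE c. (\<forall>i q. q \<notin> expos j \<longrightarrow> c i q = 0) \<and>
    (\<forall>z \<alpha> i. p z \<alpha> $ i = (\<Sum>q\<in>expos j. c i q * zmono q z \<alpha>)))"

(* projection of homogeneous polynomials of degree j to the span of the monomials q e_i, q \<in> R i,
   along the remaining monomials *)
definition Proj :: "nat \<Rightarrow> (3 \<Rightarrow> expo set) \<Rightarrow> (complex^3 \<Rightarrow> real^2 \<Rightarrow> complex^3) \<Rightarrow> complex^3 \<Rightarrow> real^2 \<Rightarrow> complex^3"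
  where "Proj j R p z \<alpha> = (\<chi> i. \<Sum>q\<in>R i. hcoeff j p i q * zmono q z \<alpha>)"

definition res2 :: "3 \<Rightarrow> expo set"
  where "res2 i =
    (if i = 1 then {(2,0,0,0,0), (0,1,1,0,0), (1,0,0,1,0), (1,0,0,0,1)}
     else if i = 2 then {(1,1,0,0,0), (0,1,0,1,0), (0,1,0,0,1)}
     else {(1,0,1,0,0), (0,0,1,1,0), (0,0,1,0,1)})"

definition res3 :: "3 \<Rightarrow> expo set"
  where "res3 i =
    (if i = 1 then {(3,0,0,0,0), (1,1,1,0,0)}
     else if i = 2 then {(2,1,0,0,0), (0,2,1,0,0)}
     else {(2,0,1,0,0), (0,1,2,0,0)})"

definition M1 :: "('x::{real_inner,banach}, 'm::finite) pfde \<Rightarrow> (complex^3 \<Rightarrow> complex^3) \<Rightarrow> complex^3 \<Rightarrow> complex^3"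
  where "M1 S p z = frechet_derivative p (at z) (Bz S z) - Bz S (p z)"

definition g21 :: "('x::{real_inner,banach}, 'm::finite) pfde \<Rightarrow> complex^3 \<Rightarrow> real^2 \<Rightarrow> complex^3"
  where "g21 S z \<alpha> = Proj 2 res2 (\<lambda>z \<alpha>. f21 S z 0 \<alpha>) z \<alpha>"

definition is_U21 :: "('x::{real_inner,banach}, 'm::finite) pfde \<Rightarrow> (complex^3 \<Rightarrow> complex^3) \<Rightarrow> bool"
  where "is_U21 S U \<longleftrightarrow>
    (\<exists>u :: 3 \<Rightarrow> expo \<Rightarrow> complex. \<forall>z i. U z $ i =
       (\<Sum>q\<in>{(a, b, c, s, t) \<in> expos 2. s = 0 \<and> t = 0} - res2 i. u i q * zmono q z 0)) \<and>
    (\<forall>z. M1 S U z = f21 S z 0 0 - g21 S z 0)"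

definition hexpos :: "(nat \<times> nat \<times> nat) set"
  where "hexpos = {(2,0,0), (0,2,0), (0,0,2), (1,1,0), (1,0,1), (0,1,1)}"

definition hpoly :: "('x::{real_inner,banach}, 'm::finite) pfde \<Rightarrow> (nat \<times> nat \<times> nat \<Rightarrow> real \<Rightarrow> 'x^'m) \<Rightarrow> complex^3 \<Rightarrow> real \<Rightarrow> 'x^'m"
  where "hpoly S h z \<theta> = (\<Sum>(a, b, c)\<in>hexpos. cscale S ((z $ 1)^a * (z $ 2)^b * (z $ 3)^c) (h (a, b, c) \<theta>))"

(* h solves D_z h(z) B z - A_1 h(z) = f_2^2(z,0,0) / 2 in Q^1; the exponents (2,0,0) etc. stand for
   the indices 200 etc. *)
definition is_h :: "('x::{real_inner,banach}, 'm::finite) pfde \<Rightarrow> (nat \<times> nat \<times> nat \<Rightarrow> real \<Rightarrow> 'x^'m) \<Rightarrow> bool"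
  where "is_h S h \<longleftrightarrow> (\<forall>q\<in>hexpos. h q \<in> Q1 S) \<and>
    (\<forall>z. \<forall>\<theta>\<in>{- delay S..0}.
       frechet_derivative (\<lambda>z. hpoly S h z \<theta>) (at z) (Bz S z) - A1 S (hpoly S h z) \<theta>
         = (1/2) *\<^sub>R f22 S z \<theta>)"

definition g31 :: "('x::{real_inner,banach}, 'm::finite) pfde \<Rightarrow> (complex^3 \<Rightarrow> complex^3) \<Rightarrow>
    (nat \<times> nat \<times> nat \<Rightarrow> real \<Rightarrow> 'x^'m) \<Rightarrow> complex^3 \<Rightarrow> complex^3"
  where "g31 S U h z = Proj 3 res3 (\<lambda>z _. f31 S z + (3/2) *\<^sub>R
      (frechet_derivative (\<lambda>(z, y). f21 S z y 0) (at (z, 0)) (U z, hist S (\<lambda>\<theta>. 2 *\<^sub>R hpoly S h z \<theta>))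
       - frechet_derivative U (at z) (g21 S z 0))) z 0"

(* right-hand side of the normal form on the center manifold, without h.o.t. *)
definition normal_form :: "('x::{real_inner,banach}, 'm::finite) pfde \<Rightarrow> (complex^3 \<Rightarrow> complex^3) \<Rightarrow>
    (nat \<times> nat \<times> nat \<Rightarrow> real \<Rightarrow> 'x^'m) \<Rightarrow> complex^3 \<Rightarrow> real^2 \<Rightarrow> complex^3"
  where "normal_form S U h z \<alpha> = Bz S z + (1/2) *\<^sub>R g21 S z \<alpha> + (1/6) *\<^sub>R g31 S U h z"

end

theory Submission
  imports Defs
begin

text \<open>
  Since both critical modes are constant in space, every quantity in the normal form is a spatial mean,
  and the theorem says that the means obey the formulas of the delay equation
  \<open>z'(t) = L(\<alpha>)z\<^sub>t + G(z\<^sub>t,\<alpha>)\<close> in \<open>\<complex>\<^sup>m\<close>, whose coefficients come from the action of the operators on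
  spatially constant histories.  The Laplacian drops out because the second derivative of a function
  with Neumann boundary values has mean zero (\<open>mode0_dlap\<close>).  The mean of \<open>L\<^sub>0 f\<close> or of \<open>Q(\<phi>\<^sub>1,f)\<close> for a
  history \<open>f\<close> with values in \<open>X\<^sup>m\<close> needs an argument, since \<open>L\<^sub>0\<close> and \<open>Q\<close> are known to act pointwise in \<open>x\<close> only on
  products of a history in \<open>\<complex>\<^sup>m\<close> with a fixed function of \<open>x\<close>: finite sums of such products are dense, and the mean
  of the value depends continuously on the history, so it is the value at the mean (\<open>mode0_hist_op\<close>).

  After this reduction there are two computations.

  First, comparison of the coefficients of the monomials \<open>z\<^sup>q\<close> turns the equation for \<open>h\<close> into a boundary value
  problem for the mean \<open>H\<close> of each \<open>h\<^sub>q\<close> (\<open>is_h_solves\<close>): a linear differential equation with exponent \<open>\<zeta>\<close>, the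
  purely imaginary number with \<open>D\<^sub>z(z\<^sup>q)Bz = \<zeta> z\<^sup>q\<close>, a boundary condition at \<open>\<theta> = 0\<close>, and orthogonality to the
  adjoint eigenfunctions.  A particular solution of the differential equation plus \<open>e\<^bsup>\<zeta>\<theta>\<^esup>E\<close> is its
  general solution, so a linear system for the vector \<open>E\<close> remains, with the characteristic matrix at \<open>\<zeta>\<close>.  If \<open>\<zeta>\<close> is not
  a critical eigenvalue, the matrix is invertible.  If \<open>\<zeta>\<close> is the critical eigenvalue \<open>\<lambda>\<^sub>j\<close>, its kernel is spanned
  by \<open>\<phi>\<^sub>j(0)\<close> and the system is solvable for exactly the right-hand sides annihilated by \<open>\<psi>\<^sub>j(0)\<close>
  (\<open>characteristic_equation_solvable\<close>).  That the given right-hand side is annihilated, and that the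
  orthogonality conditions belonging to the other eigenvalues hold automatically, both follow from the adjoint
  identity \<open>form_derivative\<close>, an integration by parts in the bilinear form.  Orthogonality to \<open>\<psi>\<^sub>j\<close> then fixes the
  multiple of \<open>\<phi>\<^sub>j(0)\<close> that is still free in \<open>E\<close>.

  Second, \<open>M\<^sub>2\<^sup>1\<close> is diagonal in the monomials, with eigenvalue \<open>\<zeta> - \<lambda>\<^sub>i\<close> on \<open>z\<^sup>q e\<^sub>i\<close>, which gives \<open>U\<^sub>2\<^sup>1\<close> by division
  (\<open>is_U21_iff\<close>).  All terms in the formula for \<open>g\<^sub>3\<^sup>1\<close> are cubic forms with known coefficients (\<open>g31_nth\<close>),
  and since a homogeneous polynomial determines its coefficients, \<open>Proj\<close> just selects some of them.
  The third equation is the complex conjugate of the second one, because the operators are real; for \<open>Q\<close> and \<open>C\<close> this is a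
  consequence of the reality of \<open>G\<close> (\<open>imag_part_Qop_Cop_diag\<close>).
\<close>


section \<open>Complex vectors and matrices\<close>

lemma dotc_add [simp]: "p \<odot> (u + v) = p \<odot> u + p \<odot> v"
  by (simp add: dotc_def distrib_left sum.distrib)

lemma dotc_scale [simp]: "p \<odot> (c *s v) = c * (p \<odot> v)"
  by (simp add: dotc_def sum_distrib_left algebra_simps)

lemma dotc_zero [simp]: "p \<odot> 0 = 0"
  by (simp add: dotc_def)

lemma dotc_minus [simp]: "p \<odot> (- v) = - (p \<odot> v)"
  by (simp add: dotc_def sum_negf)

lemma dotc_diff [simp]: "p \<odot> (u - v) = p \<odot> u - p \<odot> v"
  using dotc_add[of p u "- v"] by simp

lemma dotc_scale_left [simp]: "(c *s p) \<odot> v = c * (p \<odot> v)"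
  by (simp add: dotc_def sum_distrib_left algebra_simps)

lemma dotc_sum: "p \<odot> (\<Sum>x\<in>A. f x) = (\<Sum>x\<in>A. p \<odot> f x)"
  by (induction A rule: infinite_finite_induct) auto

lemma dotc_axis [simp]: "axis i 1 \<odot> v = v $ i"
  by (simp add: dotc_def axis_def if_distrib if_distribR cong: if_cong)

lemma vcnj_nth [simp]: "vcnj v $ i = cnj (v $ i)"
  by (simp add: vcnj_def)

lemma vcnj_vcnj [simp]: "vcnj (vcnj v) = v"
  and vcnj_add [simp]: "vcnj (u + v) = vcnj u + vcnj v"
  and vcnj_diff [simp]: "vcnj (u - v) = vcnj u - vcnj v"
  and vcnj_minus [simp]: "vcnj (- v) = - vcnj v"
  and vcnj_zero [simp]: "vcnj 0 = 0"
  and vcnj_scale [simp]: "vcnj (c *s v) = cnj c *s vcnj v"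
  by (simp_all add: vec_eq_iff)

lemma cnj_dotc: "cnj (p \<odot> v) = vcnj p \<odot> vcnj v"
  by (simp add: dotc_def)

lemma outer_mult_vec [simp]: "(v \<otimes>\<^sub>v p) *v w = (p \<odot> w) *s v"
  by (simp add: vec_eq_iff outer_def dotc_def matrix_vector_mult_def sum_distrib_left sum_distrib_right algebra_simps)

lemma mscale_mult_vec [simp]: "(c *m A) *v w = c *s (A *v w)"
  by (simp add: vec_eq_iff mscale_def matrix_vector_mult_def sum_distrib_left algebra_simps)

lemma mat_mult_vec [simp]: "mat c *v w = c *s (w :: complex^'n)"
  by (simp add: vec_eq_iff mat_def matrix_vector_mult_def if_distrib if_distribR cong: if_cong)

lemma vec_mult_dotc: "(p v* A) \<odot> w = p \<odot> (A *v w)"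
proof -
  have "(p v* A) \<odot> w = (\<Sum>j\<in>UNIV. \<Sum>i\<in>UNIV. p $ i * A $ i $ j * w $ j)"
    by (simp add: dotc_def vector_matrix_mult_def sum_distrib_right sum_distrib_left algebra_simps)
  also have "\<dots> = (\<Sum>i\<in>UNIV. \<Sum>j\<in>UNIV. p $ i * A $ i $ j * w $ j)"
    by (rule sum.swap)
  also have "\<dots> = p \<odot> (A *v w)"
    by (simp add: dotc_def matrix_vector_mult_def sum_distrib_left algebra_simps)
  finally show ?thesis .
qed

text \<open>
  The real part is half the sum of a matrix and its conjugate, and the conjugate of a matrix of rank
  one again has rank one.  In this form the real parts in the coefficients \<open>a\<^sub>1\<^sub>1\<^sub>1\<close> and \<open>a\<^sub>1\<^sub>2\<^sub>3\<close> can be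
  compared with the terms produced by the expansion.
\<close>

lemma mRe_outer_mult_vec:
  "mRe (c *m (u \<otimes>\<^sub>v p)) *v w
     = (1/2) *s ((c * (p \<odot> w)) *s u + (cnj c * (vcnj p \<odot> w)) *s vcnj u)"
proof -
  have half: "complex_of_real (Re y) = (1/2) * (y + cnj y)" for y
    by (simp add: complex_eq_iff)
  have "complex_of_real (Re (c * (a * b))) * d = (1/2) * (c * (b * d) * a + cnj c * (cnj b * d) * cnj a)"
    for a b d :: complex
    unfolding half by (simp add: field_simps)
  then show ?thesis
    unfolding vec_eq_iff mRe_def mscale_def outer_def dotc_def matrix_vector_mult_def
    by (simp add: sum_distrib_left sum_distrib_right sum.distrib add_divide_distrib sum_divide_distrib mult.assoc)
qed

lemma vRe_eq: "vRe v = (1/2) *s (v + vcnj v)"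
  by (simp add: vec_eq_iff vRe_def complex_eq_iff)

lemma norm_vscale: "norm (c *s v) = cmod c * norm (v :: complex^'n)"
  by (simp add: norm_vec_def L2_set_def norm_mult power_mult_distrib
      sum_distrib_left[symmetric] real_sqrt_mult)

lemma scaleR_eq_vscale: "r *\<^sub>R v = complex_of_real r *s (v :: complex^'n)"
  unfolding vec_eq_iff vector_scaleR_component vector_smult_component by (simp add: scaleR_conv_of_real)

lemma bounded_bilinear_vscale: "bounded_bilinear ((*s) :: complex \<Rightarrow> complex^'n \<Rightarrow> complex^'n)"
  by (rule bounded_bilinear.intro)
     (auto simp: vec_eq_iff algebra_simps norm_vscale intro!: exI[of _ 1])

interpretation vscale: bounded_bilinear "(*s) :: complex \<Rightarrow> complex^'n \<Rightarrow> complex^'n"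
  by (rule bounded_bilinear_vscale)

lemma bounded_linear_dotc: "bounded_linear ((\<odot>) p)"
proof -
  have "linear ((\<odot>) p)"
    by (rule linearI) (simp_all add: scaleR_eq_vscale scaleR_conv_of_real)
  then show ?thesis
    by (simp add: linear_conv_bounded_linear)
qed

lemma bounded_linear_vcnj: "bounded_linear (vcnj :: complex^'n \<Rightarrow> complex^'n)"
proof -
  have "linear (vcnj :: complex^'n \<Rightarrow> complex^'n)"
    by (rule linearI) (simp_all add: scaleR_eq_vscale)
  then show ?thesis
    by (simp add: linear_conv_bounded_linear)
qed

lemma bounded_linear_matrix_vec: "bounded_linear ((*v) (A :: complex^'n^'m))"
proof -
  have "linear ((*v) A)"
    by (rule linearI) (simp_all add: vec_eq_iff matrix_vector_mult_def scaleR_eq_vscale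
        sum_distrib_left sum.distrib algebra_simps)
  then show ?thesis
    by (simp add: linear_conv_bounded_linear)
qed


section \<open>Homogeneous polynomials and their coefficients\<close>

lemma polynomial_coeffs_zero:
  fixes c :: "nat \<Rightarrow> complex"
  assumes "\<And>x. (\<Sum>i\<le>n. c i * x ^ i) = 0" "i \<le> n"
  shows "c i = 0"
  using assms polyfun_eq_0[of c n] by blast

text \<open>
  The parameters \<open>\<alpha>\<close> are real; the real line is still an infinite set of roots.
\<close>

lemma polynomial_coeffs_zero_real:
  fixes c :: "nat \<Rightarrow> complex"
  assumes "\<And>x. (\<Sum>i\<le>n. c i * complex_of_real x ^ i) = 0" "i \<le> n"
  shows "c i = 0"
proof (rule ccontr)
  assume "c i \<noteq> 0"
  then have "finite {x. (\<Sum>i\<le>n. c i * x ^ i) = 0}"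
    using assms(2) polyfun_finite_roots[of c n] by blast
  moreover have "range complex_of_real \<subseteq> {x. (\<Sum>i\<le>n. c i * x ^ i) = 0}"
    using assms(1) by auto
  ultimately have "finite (range complex_of_real)"
    using finite_subset by blast
  then show False
    using finite_imageD[of complex_of_real UNIV] infinite_UNIV_char_0[where 'a=real]
    by (auto simp: inj_on_def)
qed

lemma expos_subset: "expos j \<subseteq> {..j} \<times> {..j} \<times> {..j} \<times> {..j} \<times> {..j}"
  by (auto simp: expos_def)

lemma finite_expos [simp]: "finite (expos j)"
  by (rule finite_subset[OF expos_subset]) auto

text \<open>
  The polynomial is a polynomial in \<open>z\<^sub>1\<close> whose coefficients are polynomials in \<open>z\<^sub>2\<close>, and so on;
  the one-variable identity theorem is applied to one variable after the other.
\<close>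

lemma homogeneous_coeffs_zero:
  assumes zero: "\<And>z \<alpha>. (\<Sum>q\<in>expos j. c q * zmono q z \<alpha>) = 0" and q: "q \<in> expos j"
  shows "c q = 0"
proof -
  \<comment> \<open>Filling up with zeros turns the sum over a simplex of exponents into nested sums over intervals.\<close>
  define d where "d a b e s t = (if (a,b,e,s,t) \<in> expos j then c (a,b,e,s,t) else 0)" for a b e s t
  have *: "(\<Sum>a\<le>j. (\<Sum>b\<le>j. (\<Sum>e\<le>j. (\<Sum>s\<le>j. (\<Sum>t\<le>j. d a b e s t * complex_of_real v ^ t)
     * complex_of_real u ^ s) * w ^ e) * y ^ b) * x ^ a) = 0" for x y w u v
  proof -
    define z :: "complex^3" where "z = vector [x, y, w]"
    define \<alpha> :: "real^2" where "\<alpha> = vector [u, v]"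
    have zs: "z $ 1 = x" "z $ 2 = y" "z $ 3 = w" "\<alpha> $ 1 = u" "\<alpha> $ 2 = v"
      by (simp_all add: z_def \<alpha>_def vector_3 vector_2)
    have "(\<Sum>a\<le>j. (\<Sum>b\<le>j. (\<Sum>e\<le>j. (\<Sum>s\<le>j. (\<Sum>t\<le>j. d a b e s t * complex_of_real v ^ t)
       * complex_of_real u ^ s) * w ^ e) * y ^ b) * x ^ a)
      = (\<Sum>(a,b,e,s,t)\<in>{..j} \<times> {..j} \<times> {..j} \<times> {..j} \<times> {..j}. d a b e s t * zmono (a,b,e,s,t) z \<alpha>)"
      by (simp add: sum.cartesian_product[symmetric] sum_distrib_right sum_distrib_left zmono_def zs algebra_simps)
    also have "\<dots> = (\<Sum>(a,b,e,s,t)\<in>expos j. d a b e s t * zmono (a,b,e,s,t) z \<alpha>)"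
      by (rule sum.mono_neutral_right) (use expos_subset in \<open>auto simp: d_def\<close>)
    also have "\<dots> = (\<Sum>q\<in>expos j. c q * zmono q z \<alpha>)"
      by (rule sum.cong) (auto simp: d_def)
    finally show ?thesis using zero by simp
  qed
  obtain a b e s t where qq: "q = (a,b,e,s,t)" by (cases q) auto
  then have le: "a \<le> j" "b \<le> j" "e \<le> j" "s \<le> j" "t \<le> j"
    using q by (auto simp: expos_def)
  have 1: "(\<Sum>b\<le>j. (\<Sum>e\<le>j. (\<Sum>s\<le>j. (\<Sum>t\<le>j. d a b e s t * complex_of_real v ^ t)
       * complex_of_real u ^ s) * w ^ e) * y ^ b) = 0" for y w u v
    by (rule polynomial_coeffs_zero[OF *[of v u w y] le(1)])
  have 2: "(\<Sum>e\<le>j. (\<Sum>s\<le>j. (\<Sum>t\<le>j. d a b e s t * complex_of_real v ^ t)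
       * complex_of_real u ^ s) * w ^ e) = 0" for w u v
    by (rule polynomial_coeffs_zero[OF 1[of v u w] le(2)])
  have 3: "(\<Sum>s\<le>j. (\<Sum>t\<le>j. d a b e s t * complex_of_real v ^ t) * complex_of_real u ^ s) = 0" for u v
    by (rule polynomial_coeffs_zero[OF 2[of v u] le(3)])
  have 4: "(\<Sum>t\<le>j. d a b e s t * complex_of_real v ^ t) = 0" for v
    by (rule polynomial_coeffs_zero_real[OF 3[of v] le(4)])
  have "d a b e s t = 0"
    by (rule polynomial_coeffs_zero_real[OF 4 le(5)])
  then show ?thesis using q by (simp add: d_def qq)
qed

text \<open>
  Since the coefficients of a homogeneous polynomial are unique, they may be read off from any
  representation; \<open>K\<close> collects the monomials that occur in it.
\<close>

lemma Proj_eq: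
  assumes rep: "\<And>z \<alpha> i. p z \<alpha> $ i = (\<Sum>q\<in>K. c i q * zmono q z \<alpha>)"
    and K: "K \<subseteq> expos j" and R: "R i \<subseteq> K"
  shows "Proj j R p z \<alpha> $ i = (\<Sum>q\<in>R i. c i q * zmono q z \<alpha>)"
proof -
  define d where "d = (\<lambda>(i::3) q. if q \<in> K then c i q else 0)"
  have d1: "\<forall>i q. q \<notin> expos j \<longrightarrow> d i q = 0"
    using K by (auto simp: d_def)
  have d2: "\<forall>z \<alpha> i. p z \<alpha> $ i = (\<Sum>q\<in>expos j. d i q * zmono q z \<alpha>)"
    unfolding rep by (intro allI sum.mono_neutral_cong_left) (use K in \<open>auto simp: d_def\<close>)
  have "hcoeff j p = d"
    unfolding hcoeff_def
  proof (rule the_equality)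
    show "(\<forall>i q. q \<notin> expos j \<longrightarrow> d i q = 0) \<and>
      (\<forall>z \<alpha> i. p z \<alpha> $ i = (\<Sum>q\<in>expos j. d i q * zmono q z \<alpha>))"
      using d1 d2 by blast
  next
    fix e assume e: "(\<forall>i q. q \<notin> expos j \<longrightarrow> e i q = 0) \<and>
      (\<forall>z \<alpha> i. p z \<alpha> $ i = (\<Sum>q\<in>expos j. e i q * zmono q z \<alpha>))"
    have "e i q = d i q" for i q
    proof (cases "q \<in> expos j")
      case True
      have "(\<Sum>q\<in>expos j. (e i q - d i q) * zmono q z \<alpha>) = 0" for z \<alpha>
        using e d2 by (simp add: left_diff_distrib sum_subtractf)
      from homogeneous_coeffs_zero[OF this True] show ?thesis by simp
    next
      case False
      then show ?thesis using e d1 by metis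
    qed
    then show "e = d" by blast
  qed
  then show ?thesis
    using R by (auto simp: Proj_def d_def intro!: sum.cong)
qed

text \<open>
  Quadratic forms in \<open>z\<close> are given by their coefficients on \<^const>\<open>hexpos\<close>, linear forms by
  their three coefficients, cubic forms by coefficients on \<open>cexpos\<close>.
\<close>

definition quad :: "(nat \<times> nat \<times> nat \<Rightarrow> complex) \<Rightarrow> complex^3 \<Rightarrow> complex"
  where "quad u z = (\<Sum>(a, b, c)\<in>hexpos. u (a, b, c) * ((z $ 1)^a * (z $ 2)^b * (z $ 3)^c))"

lemma sum_hexpos: "(\<Sum>q\<in>hexpos. f q)
  = f (2,0,0) + f (0,2,0) + f (0,0,2) + f (1,1,0) + f (1,0,1) + (f (0,1,1) :: 'a::comm_monoid_add)"
  by (simp add: hexpos_def add.assoc)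

lemma quad_expand: "quad u z = u (2,0,0) * (z$1)\<^sup>2 + u (0,2,0) * (z$2)\<^sup>2 + u (0,0,2) * (z$3)\<^sup>2
    + u (1,1,0) * (z$1 * z$2) + u (1,0,1) * (z$1 * z$3) + u (0,1,1) * (z$2 * z$3)"
  by (simp add: quad_def sum_hexpos)

definition cexpos :: "(nat \<times> nat \<times> nat) set"
  where "cexpos = {(3,0,0), (0,3,0), (0,0,3), (2,1,0), (2,0,1), (1,2,0), (0,2,1), (1,0,2), (0,1,2), (1,1,1)}"

definition cubic :: "(nat \<times> nat \<times> nat \<Rightarrow> complex) \<Rightarrow> complex^3 \<Rightarrow> complex"
  where "cubic u z = (\<Sum>(a, b, c)\<in>cexpos. u (a, b, c) * ((z $ 1)^a * (z $ 2)^b * (z $ 3)^c))"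

text \<open>
  The coefficients of the cubic form that is the product of a linear form and a quadratic form, cf.
  \<open>cubic_lin_quad\<close>.
\<close>

definition lin_quad :: "(3 \<Rightarrow> complex) \<Rightarrow> (nat \<times> nat \<times> nat \<Rightarrow> complex) \<Rightarrow> nat \<times> nat \<times> nat \<Rightarrow> complex"
  where "lin_quad l u = (\<lambda>(a, b, c). (if a = 0 then 0 else l 1 * u (a - 1, b, c))
     + (if b = 0 then 0 else l 2 * u (a, b - 1, c)) + (if c = 0 then 0 else l 3 * u (a, b, c - 1)))"

lemma cubic_expand: "cubic u z = u (3,0,0) * (z$1)^3 + u (0,3,0) * (z$2)^3 + u (0,0,3) * (z$3)^3
   + u (2,1,0) * ((z$1)\<^sup>2 * z$2) + u (2,0,1) * ((z$1)\<^sup>2 * z$3) + u (1,2,0) * (z$1 * (z$2)\<^sup>2)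
   + u (0,2,1) * ((z$2)\<^sup>2 * z$3) + u (1,0,2) * (z$1 * (z$3)\<^sup>2) + u (0,1,2) * (z$2 * (z$3)\<^sup>2)
   + u (1,1,1) * (z$1 * z$2 * z$3)"
  by (simp add: cubic_def cexpos_def add.assoc)

lemma cubic_lin_quad: "cubic (lin_quad l u) z = (l 1 * z$1 + l 2 * z$2 + l 3 * z$3) * quad u z"
  by (simp add: cubic_expand quad_expand lin_quad_def algebra_simps power2_eq_square power3_eq_cube)

lemma quad_zero:
  assumes "\<And>z. quad u z = 0" "q \<in> hexpos"
  shows "u q = 0"
proof -
  have *: "quad u (vector [x, y, w]) = u (2,0,0) * x\<^sup>2 + u (0,2,0) * y\<^sup>2 + u (0,0,2) * w\<^sup>2
    + u (1,1,0) * (x * y) + u (1,0,1) * (x * w) + u (0,1,1) * (y * w)" for x y w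
    by (simp add: quad_expand vector_3)
  have "u (2,0,0) = 0" "u (0,2,0) = 0" "u (0,0,2) = 0"
    using assms(1)[of "vector [1,0,0]"] assms(1)[of "vector [0,1,0]"] assms(1)[of "vector [0,0,1]"]
    by (simp_all add: *)
  moreover from this have "u (1,1,0) = 0" "u (1,0,1) = 0" "u (0,1,1) = 0"
    using assms(1)[of "vector [1,1,0]"] assms(1)[of "vector [1,0,1]"] assms(1)[of "vector [0,1,1]"]
    by (simp_all add: *)
  ultimately show ?thesis using assms(2) by (auto simp: hexpos_def)
qed

lemma quad_eq_coeff:
  assumes "\<And>z. quad u z = quad v z" "q \<in> hexpos"
  shows "u q = v q"
proof -
  have "quad (\<lambda>q. u q - v q) z = 0" for z
    using assms(1)[of z] by (simp add: quad_def case_prod_unfold left_diff_distrib sum_subtractf)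
  from quad_zero[OF this assms(2)] show ?thesis by simp
qed

text \<open>
  \<open>dquad u k j\<close> is the coefficient of \<open>z\<^sub>j\<close> in the partial derivative of \<open>quad u\<close> with respect to \<open>z\<^sub>k\<close>.
\<close>

definition dquad :: "(nat \<times> nat \<times> nat \<Rightarrow> complex) \<Rightarrow> 3 \<Rightarrow> 3 \<Rightarrow> complex"
  where "dquad u k = (if k = 1 then (\<lambda>j. if j = 1 then 2 * u (2,0,0) else if j = 2 then u (1,1,0) else u (1,0,1))
     else if k = 2 then (\<lambda>j. if j = 1 then u (1,1,0) else if j = 2 then 2 * u (0,2,0) else u (0,1,1))
     else (\<lambda>j. if j = 1 then u (1,0,1) else if j = 2 then u (0,1,1) else 2 * u (0,0,2)))"

lemma quad_has_derivative:
  "(quad u has_derivative (\<lambda>d. \<Sum>k\<in>UNIV. (dquad u k 1 * z$1 + dquad u k 2 * z$2 + dquad u k 3 * z$3) * d $ k)) (at z)"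
proof -
  have [derivative_intros]: "((\<lambda>z::complex^3. z $ i) has_derivative (\<lambda>d. d $ i)) (at z)" for i
    by (rule bounded_linear_imp_has_derivative[OF bounded_linear_vec_nth])
  have "(quad u has_derivative (\<lambda>d. u (2,0,0) * (2 * z$1 * d$1) + u (0,2,0) * (2 * z$2 * d$2)
     + u (0,0,2) * (2 * z$3 * d$3) + u (1,1,0) * (d$1 * z$2 + z$1 * d$2)
     + u (1,0,1) * (d$1 * z$3 + z$1 * d$3) + u (0,1,1) * (d$2 * z$3 + z$2 * d$3))) (at z)"
    unfolding quad_expand[abs_def] power2_eq_square
    by (rule derivative_eq_intros refl | simp add: algebra_simps)+
  then show ?thesis
    by (simp add: sum_3 dquad_def algebra_simps)
qed

section \<open>The function space\<close>

text \<open>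
  This gives the uniqueness of the second derivative.  The inner integral \<open>G\<close> is continuous, so the
  left-hand side of the hypothesis is differentiable, hence zero everywhere inside, and so is its derivative \<open>G\<close>.
  At almost every point \<open>G\<close> has the derivative \<open>D\<close>, by Lebesgue's differentiation theorem.
\<close>

lemma zero_if_double_integral_const:
  fixes D :: "real \<Rightarrow> complex"
  assumes a: "0 < a" and D: "D integrable_on {0..a}" and N: "negligible N"
    and eq: "\<And>x. x \<in> {0..a} - N \<Longrightarrow> c + integral {0..x} (\<lambda>s. integral {0..s} D) = 0"
  obtains N' where "negligible N'" "\<And>x. x \<in> {0..a} - N' \<Longrightarrow> D x = 0"
proof -
  define G where "G = (\<lambda>s. integral {0..s} D)"
  define F where "F = (\<lambda>x. c + integral {0..x} G)"
  have G: "continuous_on {0..a} G"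
    unfolding G_def by (rule indefinite_integral_continuous_1[OF D])
  have F': "(F has_vector_derivative G x) (at x)" if "x \<in> {0<..<a}" for x
  proof -
    have "((\<lambda>x. integral {0..x} G) has_vector_derivative G x) (at x within {0..a})"
      using integral_has_vector_derivative[OF G] that by simp
    then have "((\<lambda>x. integral {0..x} G) has_vector_derivative G x) (at x)"
      using that by (simp add: at_within_Icc_at)
    then show ?thesis
      unfolding F_def by (auto intro!: derivative_eq_intros)
  qed
  have "continuous_on {0<..<a} F"
    using F' by (meson has_vector_derivative_continuous continuous_at_imp_continuous_on)
  then have "open ({0<..<a} \<inter> F -` (- {0}))"
    by (rule continuous_open_preimage) auto
  moreover have "{0<..<a} \<inter> F -` (- {0}) \<subseteq> N"
    using eq by (auto simp: F_def G_def)
  ultimately have "{0<..<a} \<inter> F -` (- {0}) = {}"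
    using negligible_subset[OF N] open_not_negligible by blast
  then have F0: "F x = 0" if "x \<in> {0<..<a}" for x
    using that by auto
  have G0: "G x = 0" if "x \<in> {0<..<a}" for x
  proof -
    have "((\<lambda>_. 0) has_vector_derivative G x) (at x)"
      by (rule has_vector_derivative_transform_within_open[OF F'[OF that], of "{0<..<a}"])
         (use that F0 in auto)
    then show ?thesis
      using has_vector_derivative_const vector_derivative_unique_at by blast
  qed
  define g where "g = (\<lambda>x. if x \<in> {0..a} then D x else 0)"
  have "g integrable_on UNIV"
    unfolding g_def using D by (simp only: integrable_restrict_UNIV)
  then have g: "g integrable_on cbox u v" for u v
    using integrable_on_subcbox by blast
  obtain N' where N': "negligible N'"
    "\<And>x e. \<lbrakk>x \<notin> N'; 0 < e\<rbrakk> \<Longrightarrow> \<exists>d>0. \<forall>h. 0 < h \<and> h < d \<longrightarrow>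
        norm (integral (cbox x (x + h *\<^sub>R One)) g /\<^sub>R h ^ DIM(real) - g x) < e"
    using integrable_ccontinuous_explicit[OF g] by metis
  show ?thesis
  proof
    show "negligible (N' \<union> {0, a})"
      using N'(1) by (simp add: negligible_Un)
  next
    fix x assume x: "x \<in> {0..a} - (N' \<union> {0, a})"
    have "norm (D x) < e" if "e > 0" for e
    proof -
      obtain d where d: "d > 0" "\<And>h. 0 < h \<Longrightarrow> h < d \<Longrightarrow>
          norm (integral (cbox x (x + h *\<^sub>R One)) g /\<^sub>R h ^ DIM(real) - g x) < e"
        using N'(2)[of x e] x \<open>e > 0\<close> by auto
      define h where "h = min (d / 2) ((a - x) / 2)"
      have h: "0 < h" "h < d" "x + h < a"
        using d(1) x by (auto simp: h_def min_def field_simps)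
      have "G x + integral {x..x+h} D = G (x + h)"
        unfolding G_def
        by (rule Henstock_Kurzweil_Integration.integral_combine)
           (use x h in \<open>auto intro: integrable_subinterval_real[OF D]\<close>)
      then have "integral {x..x+h} D = 0"
        using G0[of x] G0[of "x + h"] x h by auto
      moreover have "integral {x..x+h} g = integral {x..x+h} D"
        by (rule integral_cong) (use x h in \<open>auto simp: g_def\<close>)
      ultimately show ?thesis
        using d(2)[OF h(1,2)] x by (simp add: g_def)
    qed
    from this[of "norm (D x)"] show "D x = 0"
      by auto
  qed
qed

lemma le_one_plus_square: "t \<le> 1 + t\<^sup>2" for t :: real
proof -
  have "2 * t \<le> t\<^sup>2 + 1"
    using zero_le_power2[of "t - 1"] by (simp add: power2_diff)
  with zero_le_power2[of t] show ?thesis by linarith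
qed

locale function_space =
  fixes S :: "('x::{real_inner,banach}, 'm::finite) pfde"
  assumes fhs: "function_hilbert_space S" and ell_pos: "ell S > 0"
begin

abbreviation len :: real where "len \<equiv> ell S * pi"

lemma len_pos: "len > 0"
  using ell_pos by simp

lemma AE_Om_iff: "(AE x in Om S. P x) \<longleftrightarrow> (\<exists>N. negligible N \<and> (\<forall>x\<in>{0..len} - N. P x))"
proof -
  have "(AE x in Om S. P x) \<longleftrightarrow> (\<exists>N. negligible N \<and> {x. \<not> (x \<in> {0..len} \<longrightarrow> P x)} \<subseteq> N)"
    unfolding Om_def by (simp add: AE_restrict_space_iff eventually_ae_filter_negligible)
  moreover have "{x. \<not> (x \<in> {0..len} \<longrightarrow> P x)} \<subseteq> N \<longleftrightarrow> (\<forall>x\<in>{0..len} - N. P x)" for N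
    by blast
  ultimately show ?thesis by simp
qed

lemma finite_measure_Om: "finite_measure (Om S)"
  unfolding Om_def
  by (rule finite_measureI) (simp add: emeasure_restrict_space emeasure_lborel_Icc_eq)

lemmas fhs_unfolded = fhs[unfolded function_hilbert_space_def]

lemma ev_measurable [measurable]: "ev S u \<in> borel_measurable (Om S)"
  and ev_square_integrable: "integrable (Om S) (\<lambda>x. (cmod (ev S u x))\<^sup>2)"
  using conjunct1[OF fhs_unfolded] by auto

lemma ev_add: "AE x in Om S. ev S (u + v) x = ev S u x + ev S v x"
  using fhs_unfolded by (elim conjE allE)

lemma ev_scaleR: "AE x in Om S. ev S (r *\<^sub>R u) x = complex_of_real r * ev S u x"
  using fhs_unfolded by (elim conjE allE)

lemma ev_zeroD: "AE x in Om S. ev S u x = 0 \<Longrightarrow> u = 0"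
proof -
  have "\<forall>u. (AE x in Om S. ev S u x = 0) \<longrightarrow> u = 0"
    using fhs_unfolded by (elim conjE)
  then show "AE x in Om S. ev S u x = 0 \<Longrightarrow> u = 0" by (elim allE) (erule mp)
qed

lemma beta_exists: "\<exists>u. AE x in Om S. ev S u x = beta S k x"
  using fhs_unfolded by (elim conjE) (rule spec)

lemma L2_norm_bound: "\<exists>K. \<forall>u. (\<integral>x. (cmod (ev S u x))\<^sup>2 \<partial>Om S) \<le> K * (norm u)\<^sup>2"
  using fhs_unfolded by (elim conjE)

lemma imag_exists: "\<exists>v. (AE x in Om S. ev S v x = \<i> * ev S u x) \<and> norm v = norm u"
  using fhs_unfolded by (elim conjE) (rule spec)

lemma ev_integrable: "integrable (Om S) (ev S u)"
proof (rule Bochner_Integration.integrable_bound)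
  show "integrable (Om S) (\<lambda>x. 1 + (cmod (ev S u x))\<^sup>2)"
    using finite_measure.integrable_const[OF finite_measure_Om] ev_square_integrable
    by (intro Bochner_Integration.integrable_add) auto
  show "AE x in Om S. norm (ev S u x) \<le> norm (1 + (cmod (ev S u x))\<^sup>2)"
    by (intro AE_I2) (simp add: abs_of_nonneg add_nonneg_nonneg le_one_plus_square)
qed simp

lemma ev_eqI:
  assumes "AE x in Om S. ev S u x = ev S v x"
  shows "u = v"
proof -
  have "AE x in Om S. ev S (u + (-1) *\<^sub>R v) x = 0"
    using assms ev_add[of u "(-1) *\<^sub>R v"] ev_scaleR[of "-1" v] by eventually_elim simp
  from ev_zeroD[OF this] show ?thesis by simp
qed

lemma elt_eqI:
  assumes u: "AE x in Om S. ev S u x = f x"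
  shows "elt S f = u"
  unfolding elt_def
proof (rule the_equality, rule u)
  fix v assume "AE x in Om S. ev S v x = f x"
  with u have "AE x in Om S. ev S v x = ev S u x" by eventually_elim simp
  then show "v = u" by (rule ev_eqI)
qed

lemma elt_cong:
  assumes fg: "AE x in Om S. f x = g x"
  shows "elt S f = elt S g"
proof -
  have "(AE x in Om S. ev S u x = f x) \<longleftrightarrow> (AE x in Om S. ev S u x = g x)" for u
  proof
    assume "AE x in Om S. ev S u x = f x"
    with fg show "AE x in Om S. ev S u x = g x" by eventually_elim simp
  next
    assume "AE x in Om S. ev S u x = g x"
    with fg show "AE x in Om S. ev S u x = f x" by eventually_elim simp
  qed
  then show ?thesis unfolding elt_def by simp
qed

definition cmul :: "complex \<Rightarrow> 'x \<Rightarrow> 'x"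
  where "cmul c u = elt S (\<lambda>x. c * ev S u x)"

text \<open>
  The space is closed under multiplication by \<open>\<i>\<close> and by real numbers, hence under
  \<open>c u = (Re c) u + (Im c) \<i>u\<close>.
\<close>

lemma ev_cmul: "AE x in Om S. ev S (cmul c u) x = c * ev S u x"
proof -
  obtain v where v: "AE x in Om S. ev S v x = \<i> * ev S u x"
    using imag_exists by blast
  have *: "AE x in Om S. ev S (Re c *\<^sub>R u + Im c *\<^sub>R v) x = c * ev S u x"
    using v ev_add[of "Re c *\<^sub>R u" "Im c *\<^sub>R v"] ev_scaleR[of "Re c" u] ev_scaleR[of "Im c" v]
    by eventually_elim (simp add: complex_eq_iff algebra_simps)
  then show ?thesis
    unfolding cmul_def using elt_eqI[OF *] by simp
qed

lemma cmul_eqI: "AE x in Om S. ev S v x = c * ev S u x \<Longrightarrow> cmul c u = v"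
  unfolding cmul_def by (rule elt_eqI)

lemma norm_cmul_imag: "norm (cmul \<i> u) = norm u"
  using imag_exists[of u] cmul_eqI by blast

lemma cmul_add_right: "cmul c (u + v) = cmul c u + cmul c v"
  by (rule cmul_eqI)
     (use ev_add[of "cmul c u" "cmul c v"] ev_cmul[of c u] ev_cmul[of c v] ev_add[of u v]
       in \<open>eventually_elim, simp add: algebra_simps\<close>)

lemma cmul_add_left: "cmul (c + d) u = cmul c u + cmul d u"
  by (rule cmul_eqI)
     (use ev_add[of "cmul c u" "cmul d u"] ev_cmul[of c u] ev_cmul[of d u]
       in \<open>eventually_elim, simp add: algebra_simps\<close>)

lemma cmul_cmul: "cmul c (cmul d u) = cmul (c * d) u"
  by (rule cmul_eqI)
     (use ev_cmul[of "c * d" u] ev_cmul[of d u] in \<open>eventually_elim, simp\<close>)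

lemma cmul_of_real: "cmul (complex_of_real r) u = r *\<^sub>R u"
  by (rule cmul_eqI) (rule ev_scaleR)

lemma cmul_scaleR_right: "cmul c (r *\<^sub>R u) = r *\<^sub>R cmul c u"
  by (simp add: cmul_of_real[symmetric] cmul_cmul mult.commute)

lemma cmul_scaleR_left: "cmul (r *\<^sub>R c) u = r *\<^sub>R cmul c u"
  by (simp add: cmul_of_real[symmetric] cmul_cmul scaleR_conv_of_real)

lemma norm_cmul_le: "norm (cmul c u) \<le> 2 * cmod c * norm u"
proof -
  have "cmul c u = Re c *\<^sub>R u + Im c *\<^sub>R cmul \<i> u"
    using complex_eq[of c] cmul_add_left[of "complex_of_real (Re c)" "\<i> * complex_of_real (Im c)" u]
    by (simp add: cmul_cmul[symmetric] cmul_of_real cmul_scaleR_right)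
  then have "norm (cmul c u) \<le> norm (Re c *\<^sub>R u) + norm (Im c *\<^sub>R cmul \<i> u)"
    by (metis norm_triangle_ineq)
  also have "\<dots> = (\<bar>Re c\<bar> + \<bar>Im c\<bar>) * norm u"
    by (simp add: norm_cmul_imag distrib_right)
  also have "\<dots> \<le> (cmod c + cmod c) * norm u"
    by (intro mult_right_mono add_mono abs_Re_le_cmod abs_Im_le_cmod) auto
  finally show ?thesis by simp
qed

lemma bounded_bilinear_cmul: "bounded_bilinear cmul"
  by (rule bounded_bilinear.intro)
     (auto simp: cmul_add_left cmul_add_right cmul_scaleR_left cmul_scaleR_right mult.assoc
        intro!: exI[of _ 2] order_trans[OF norm_cmul_le])

lemma cscale_eq: "cscale S c v = (\<chi> i. cmul c (v $ i))"
  by (simp add: cscale_def cmul_def)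

lemma cscale_nth [simp]: "cscale S c v $ i = cmul c (v $ i)"
  by (simp add: cscale_eq)

lemma bounded_bilinear_cscale: "bounded_bilinear (cscale S)"
proof (rule bounded_bilinear.intro)
  show "\<exists>K. \<forall>c v. norm (cscale S c v) \<le> norm c * norm v * K"
  proof (intro exI allI)
    fix c :: complex and v :: "'x^'m"
    have "norm (cscale S c v) \<le> (\<Sum>i\<in>UNIV. norm (cscale S c v $ i))"
      unfolding norm_vec_def by (rule L2_set_le_sum) simp
    also have "\<dots> \<le> (\<Sum>i\<in>(UNIV::'m set). 2 * cmod c * norm v)"
      by (intro sum_mono) (auto intro!: order_trans[OF norm_cmul_le] mult_left_mono Finite_Cartesian_Product.norm_nth_le)
    finally show "norm (cscale S c v) \<le> norm c * norm v * (2 * real CARD('m))"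
      by (simp add: algebra_simps)
  qed
qed (simp_all add: vec_eq_iff cmul_add_left cmul_add_right cmul_scaleR_left cmul_scaleR_right)

sublocale cscale: bounded_bilinear "cscale S"
  by (rule bounded_bilinear_cscale)

subsection \<open>The constant mode\<close>

lemma ip_beta0: "ip S f (beta S 0) = complex_of_real (1 / len) * (\<integral>x. f x \<partial>Om S)"
  by (simp add: ip_def beta_def)

definition one :: 'x
  where "one = elt S (beta S 0)"

lemma ev_one: "AE x in Om S. ev S one x = 1"
proof -
  obtain u where u: "AE x in Om S. ev S u x = beta S 0 x"
    using beta_exists by blast
  then have "one = u" unfolding one_def by (rule elt_eqI)
  with u show ?thesis by (simp add: beta_def)
qed

definition mean :: "'x \<Rightarrow> complex"
  where "mean u = ip S (ev S u) (beta S 0)"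

lemma mean_eq: "mean u = complex_of_real (1 / len) * (\<integral>x. ev S u x \<partial>Om S)"
  by (simp add: mean_def ip_beta0)

lemma mean_add: "mean (u + v) = mean u + mean v"
proof -
  have "(\<integral>x. ev S (u + v) x \<partial>Om S) = (\<integral>x. ev S u x + ev S v x \<partial>Om S)"
    by (rule integral_cong_AE) (auto simp: ev_add)
  then show ?thesis
    by (simp add: mean_eq Bochner_Integration.integral_add ev_integrable distrib_left add_divide_distrib)
qed

lemma mean_cmul: "mean (cmul c u) = c * mean u"
proof -
  have "(\<integral>x. ev S (cmul c u) x \<partial>Om S) = (\<integral>x. c * ev S u x \<partial>Om S)"
    by (rule integral_cong_AE) (auto simp: ev_cmul)
  then show ?thesis
    by (simp add: mean_eq)
qed

lemma measure_Om: "measure (Om S) (space (Om S)) = len"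
  using len_pos by (simp add: Om_def measure_restrict_space)

lemma mean_one [simp]: "mean one = 1"
proof -
  have "(\<integral>x. ev S one x \<partial>Om S) = (\<integral>x. 1 \<partial>Om S)"
    by (rule integral_cong_AE) (auto simp: ev_one)
  then show ?thesis
    using ell_pos measure_Om by (simp add: mean_eq scaleR_conv_of_real)
qed

text \<open>
  By \<open>t \<le> 1 + t\<^sup>2\<close>, a bound for the integral of \<open>\<bar>u\<bar>\<^sup>2\<close> on the unit sphere of \<open>X\<close> gives one for the mean.
\<close>

lemma bounded_linear_mean: "bounded_linear mean"
proof -
  obtain K where K: "\<And>u. (\<integral>x. (cmod (ev S u x))\<^sup>2 \<partial>Om S) \<le> K * (norm u)\<^sup>2"
    using L2_norm_bound by blast
  define C where "C = (len + K) / len"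
  have lin: "mean (u + v) = mean u + mean v" "mean (r *\<^sub>R u) = r *\<^sub>R mean u" for u v r
    by (simp_all add: mean_add mean_cmul cmul_of_real[symmetric] scaleR_conv_of_real)
  have bound1: "cmod (mean u) \<le> C" if "norm u = 1" for u
  proof -
    have "cmod (\<integral>x. ev S u x \<partial>Om S) \<le> (\<integral>x. cmod (ev S u x) \<partial>Om S)"
      by (rule integral_norm_bound)
    also have "\<dots> \<le> (\<integral>x. 1 + (cmod (ev S u x))\<^sup>2 \<partial>Om S)"
    proof (rule integral_mono)
      show "cmod (ev S u x) \<le> 1 + (cmod (ev S u x))\<^sup>2" for x
        by (rule le_one_plus_square)
    qed (use ev_integrable ev_square_integrable finite_measure.integrable_const[OF finite_measure_Om]
          in \<open>auto intro!: Bochner_Integration.integrable_add\<close>)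
    also have "\<dots> = len + (\<integral>x. (cmod (ev S u x))\<^sup>2 \<partial>Om S)"
      using ev_square_integrable finite_measure.integrable_const[OF finite_measure_Om] measure_Om
      by (subst Bochner_Integration.integral_add) auto
    also have "\<dots> \<le> len + K"
      using K[of u] that by simp
    finally show ?thesis
      using ell_pos by (simp add: mean_eq C_def norm_mult norm_divide divide_right_mono)
  qed
  have "cmod (mean u) \<le> norm u * C" for u
  proof (cases "u = 0")
    case True
    then show ?thesis using lin(2)[of 0 0] by simp
  next
    case False
    have "cmod (mean (u /\<^sub>R norm u)) \<le> C"
      by (rule bound1) (use False in simp)
    then show ?thesis
      using False by (simp add: lin field_simps)
  qed
  then show ?thesis
    using lin by (intro bounded_linear_intro) auto
qed

lemma mode0_nth [simp]: "mode S 0 v $ i = mean (v $ i)"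
  by (simp add: mode_def mean_def)

lemma bounded_linear_mode0: "bounded_linear (mode S 0)"
proof -
  interpret mean: bounded_linear mean by (rule bounded_linear_mean)
  obtain K where K: "\<And>u. norm (mean u) \<le> norm u * K" "K > 0"
    using mean.pos_bounded by blast
  show ?thesis
  proof (rule bounded_linear_intro)
    fix v :: "'x^'m"
    have "norm (mode S 0 v) \<le> (\<Sum>i\<in>UNIV. norm (mode S 0 v $ i))"
      unfolding norm_vec_def by (rule L2_set_le_sum) simp
    also have "\<dots> \<le> (\<Sum>i\<in>(UNIV::'m set). norm v * K)"
      by (intro sum_mono) (use K in \<open>auto intro!: order_trans[OF K(1)] mult_right_mono Finite_Cartesian_Product.norm_nth_le\<close>)
    finally show "norm (mode S 0 v) \<le> norm v * (real CARD('m) * K)"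
      by (simp add: algebra_simps)
  qed (simp_all add: vec_eq_iff mean.add mean.scaleR)
qed

sublocale mode0: bounded_linear "mode S 0"
  by (rule bounded_linear_mode0)

lemma mode0_cscale [simp]: "mode S 0 (cscale S c v) = c *s mode S 0 v"
  by (simp add: vec_eq_iff mean_cmul)

text \<open>
  The constant functions of \<open>x\<close>.
\<close>

definition emb :: "complex^'m \<Rightarrow> 'x^'m"
  where "emb p = tens S p (beta S 0)"

lemma tens_cong:
  assumes "AE x in Om S. b x = b' x"
  shows "tens S p b = tens S p b'"
proof -
  have "elt S (\<lambda>x. p $ i * b x) = elt S (\<lambda>x. p $ i * b' x)" for i
    by (rule elt_cong) (use assms in \<open>eventually_elim, simp\<close>)
  then show ?thesis by (simp add: tens_def)
qed

lemma tens_ev_nth: "tens S p (ev S b) $ i = cmul (p $ i) b"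
  by (simp add: tens_def cmul_def)

lemma tens_beta0: "tens S p (beta S 0) = tens S p (ev S one)"
  by (rule tens_cong) (use ev_one in \<open>eventually_elim, simp add: beta_def\<close>)

lemma emb_nth [simp]: "emb p $ i = cmul (p $ i) one"
  by (simp add: emb_def tens_beta0 tens_ev_nth)

lemma ev_emb: "AE x in Om S. ev S (emb p $ i) x = p $ i"
  using ev_cmul[of "p $ i" one] ev_one by (simp, eventually_elim, simp)

lemma mode0_emb [simp]: "mode S 0 (emb p) = p"
  by (simp add: vec_eq_iff mean_cmul)

lemma cscale_emb [simp]: "cscale S c (emb p) = emb (c *s p)"
  by (simp add: vec_eq_iff cmul_cmul)

lemma emb_eqI:
  assumes "\<And>i. AE x in Om S. ev S (v $ i) x = p $ i"
  shows "v = emb p"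
  unfolding vec_eq_iff
proof
  fix i
  show "v $ i = emb p $ i"
    by (rule ev_eqI) (use assms[of i] ev_emb[of p i] in \<open>eventually_elim, simp\<close>)
qed

lemma bounded_linear_emb: "bounded_linear emb"
proof -
  have "linear emb"
    by (rule linearI)
       (simp_all add: vec_eq_iff cmul_add_left cmul_scaleR_left[symmetric])
  then show ?thesis
    by (simp add: linear_conv_bounded_linear)
qed

sublocale emb: bounded_linear emb
  by (rule bounded_linear_emb)


subsection \<open>The Neumann Laplacian\<close>

lemma ev_integrable_on: "ev S u integrable_on {0..len}"
  using has_integral_integral_lebesgue_on[of "{0..len}" "ev S u"] ev_integrable[of u]
  by (auto simp: Om_def)

lemma mean_eq_integral: "mean u = complex_of_real (1 / len) * integral {0..len} (ev S u)"
  using lebesgue_integral_eq_integral[of "{0..len}" "ev S u"] ev_integrable[of u]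
  by (simp add: mean_eq Om_def)

lemma ev_integrable_on_initial: "x \<le> len \<Longrightarrow> ev S u integrable_on {0..x}"
  by (rule integrable_subinterval_real[OF ev_integrable_on]) auto

lemma neumann_second_deriv_unique:
  assumes 1: "neumann_second_deriv S f (ev S w)" and 2: "neumann_second_deriv S f (ev S w')"
  shows "w = w'"
proof -
  let ?D = "\<lambda>s. ev S w s - ev S w' s"
  obtain c where c: "AE x in Om S. f x = c + integral {0..x} (\<lambda>s. integral {0..s} (ev S w))"
    using 1 unfolding neumann_second_deriv_def by blast
  obtain c' where c': "AE x in Om S. f x = c' + integral {0..x} (\<lambda>s. integral {0..s} (ev S w'))"
    using 2 unfolding neumann_second_deriv_def by blast
  have "AE x in Om S. c + integral {0..x} (\<lambda>s. integral {0..s} (ev S w))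
      = c' + integral {0..x} (\<lambda>s. integral {0..s} (ev S w'))"
    using c c' by eventually_elim simp
  then obtain N where N: "negligible N"
    "\<And>x. x \<in> {0..len} - N \<Longrightarrow> c + integral {0..x} (\<lambda>s. integral {0..s} (ev S w))
      = c' + integral {0..x} (\<lambda>s. integral {0..s} (ev S w'))"
    unfolding AE_Om_iff by blast
  have cont: "(\<lambda>s. integral {0..s} (ev S u)) integrable_on {0..x}" if "x \<le> len" for u x
    by (rule integrable_continuous_real,
        rule continuous_on_subset[OF indefinite_integral_continuous_1[OF ev_integrable_on]])
       (use that in auto)
  have const: "(c - c') + integral {0..x} (\<lambda>s. integral {0..s} ?D) = 0" if x: "x \<in> {0..len} - N" for x
  proof -
    have "integral {0..x} (\<lambda>s. integral {0..s} ?D)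
       = integral {0..x} (\<lambda>s. integral {0..s} (ev S w) - integral {0..s} (ev S w'))"
      by (rule integral_cong)
         (use x in \<open>auto intro!: Henstock_Kurzweil_Integration.integral_diff ev_integrable_on_initial\<close>)
    also have "\<dots> = integral {0..x} (\<lambda>s. integral {0..s} (ev S w)) - integral {0..x} (\<lambda>s. integral {0..s} (ev S w'))"
      by (rule Henstock_Kurzweil_Integration.integral_diff) (use x cont in auto)
    finally have *: "integral {0..x} (\<lambda>s. integral {0..s} ?D) = \<dots>" .
    show ?thesis
      unfolding * using N(2)[OF x] by (simp add: algebra_simps)
  qed
  have D: "?D integrable_on {0..len}"
    by (intro Henstock_Kurzweil_Integration.integrable_diff ev_integrable_on)
  obtain N' where N': "negligible N'" "\<And>x. x \<in> {0..len} - N' \<Longrightarrow> ?D x = 0"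
    using zero_if_double_integral_const[OF len_pos D N(1) const] by blast
  have "\<forall>x\<in>{0..len} - N'. ev S w x = ev S w' x"
    using N'(2) by auto
  with N'(1) have "AE x in Om S. ev S w x = ev S w' x"
    unfolding AE_Om_iff by blast
  then show ?thesis by (rule ev_eqI)
qed

lemma lap_nthI:
  assumes "neumann_second_deriv S (ev S (v $ i)) (ev S w)"
  shows "lap S v $ i = w"
  unfolding lap_def using assms neumann_second_deriv_unique by (auto intro!: the_equality)

lemma neumann_second_deriv_combine:
  assumes 1: "neumann_second_deriv S (ev S u) (ev S w)" and 2: "neumann_second_deriv S (ev S u') (ev S w')"
  shows "neumann_second_deriv S (ev S (cmul c u + u')) (ev S (cmul c w + w'))"
proof -
  let ?I = "\<lambda>w x. integral {0..x} (\<lambda>s. integral {0..s} (ev S w))"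
  obtain d where d: "AE x in Om S. ev S u x = d + ?I w x"
    using 1 unfolding neumann_second_deriv_def by blast
  obtain d' where d': "AE x in Om S. ev S u' x = d' + ?I w' x"
    using 2 unfolding neumann_second_deriv_def by blast
  have ev: "AE x in Om S. ev S (cmul c w + w') x = c * ev S w x + ev S w' x" for w w'
    using ev_add[of "cmul c w" w'] ev_cmul[of c w] by eventually_elim simp
  have int: "integral {0..s} (ev S (cmul c w + w')) = c * integral {0..s} (ev S w) + integral {0..s} (ev S w')"
    if "s \<le> len" for s
  proof -
    obtain N where N: "negligible N" "\<forall>x\<in>{0..len} - N. ev S (cmul c w + w') x = c * ev S w x + ev S w' x"
      using ev[of w w'] unfolding AE_Om_iff by blast
    have "integral {0..s} (ev S (cmul c w + w')) = integral {0..s} (\<lambda>x. c * ev S w x + ev S w' x)"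
      by (rule integral_spike[OF N(1)]) (use N(2) that in auto)
    also have "\<dots> = c * integral {0..s} (ev S w) + integral {0..s} (ev S w')"
      using ev_integrable_on_initial[OF that]
      by (subst Henstock_Kurzweil_Integration.integral_add) (auto intro: integrable_on_mult_right)
    finally show ?thesis .
  qed
  have cont: "(\<lambda>s. integral {0..s} (ev S u)) integrable_on {0..x}" if "x \<le> len" for u x
    by (rule integrable_continuous_real,
        rule continuous_on_subset[OF indefinite_integral_continuous_1[OF ev_integrable_on]])
       (use that in auto)
  have int2: "?I (cmul c w + w') x = c * ?I w x + ?I w' x" if "x \<in> {0..len}" for x
  proof -
    have "?I (cmul c w + w') x = integral {0..x} (\<lambda>s. c * integral {0..s} (ev S w) + integral {0..s} (ev S w'))"
      by (rule integral_cong) (use that int in auto)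
    also have "\<dots> = c * ?I w x + ?I w' x"
      using cont that by (subst Henstock_Kurzweil_Integration.integral_add) (auto intro: integrable_on_mult_right)
    finally show ?thesis .
  qed
  have "AE x in Om S. x \<in> {0..len}"
    unfolding AE_Om_iff by (intro exI[of _ "{}"]) auto
  then have "AE x in Om S. ev S (cmul c u + u') x = (c * d + d') + ?I (cmul c w + w') x"
    using d d' ev[of u u'] by eventually_elim (use int2 in \<open>auto simp: algebra_simps\<close>)
  then show ?thesis
    using 1 2 ev_square_integrable int[of len] unfolding neumann_second_deriv_def by auto
qed

lemma dom_lap_combine: "u \<in> dom_lap S \<Longrightarrow> v \<in> dom_lap S \<Longrightarrow> cscale S c u + v \<in> dom_lap S"
  unfolding dom_lap_def using neumann_second_deriv_combine by fastforce

lemma neumann_emb: "neumann_second_deriv S (ev S (emb p $ i)) (ev S 0)"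
proof -
  have z: "AE x in Om S. ev S 0 x = 0"
    using ev_scaleR[of 0 0] by simp
  then obtain N where N: "negligible N" "\<forall>x\<in>{0..len} - N. ev S 0 x = 0"
    unfolding AE_Om_iff by blast
  have int: "integral {0..s} (ev S 0) = 0" if "s \<le> len" for s
    using integral_spike[OF N(1), of "{0..s}" "\<lambda>_. 0" "ev S 0"] N(2) that by auto
  have int2: "integral {0..x} (\<lambda>s. integral {0..s} (ev S 0)) = 0" if "x \<in> {0..len}" for x
    using integral_cong[of "{0..x}" "\<lambda>s. integral {0..s} (ev S 0)" "\<lambda>_. 0"] int that by auto
  have "AE x in Om S. x \<in> {0..len}"
    unfolding AE_Om_iff by (intro exI[of _ "{}"]) auto
  then have "AE x in Om S. ev S (emb p $ i) x = p $ i + integral {0..x} (\<lambda>s. integral {0..s} (ev S 0))"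
    using ev_emb[of p i] by eventually_elim (use int2 in auto)
  then show ?thesis
    unfolding neumann_second_deriv_def using ev_square_integrable int[of len] by auto
qed

lemma emb_in_dom_lap: "emb p \<in> dom_lap S"
  unfolding dom_lap_def using neumann_emb by blast

lemma dlap_emb [simp]: "dlap S d (emb p) = 0"
  using lap_nthI[OF neumann_emb] by (simp add: dlap_def vec_eq_iff)

text \<open>
  The integral of a second derivative is the difference of the first derivatives at the two ends,
  which vanish.
\<close>

lemma mode0_dlap: "v \<in> dom_lap S \<Longrightarrow> mode S 0 (dlap S d v) = 0"
proof -
  assume v: "v \<in> dom_lap S"
  have "mean (lap S v $ i) = 0" for i
  proof -
    obtain w where w: "neumann_second_deriv S (ev S (v $ i)) (ev S w)"
      using v unfolding dom_lap_def by blast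
    then have "integral {0..len} (ev S w) = 0"
      unfolding neumann_second_deriv_def by blast
    then show ?thesis
      using lap_nthI[OF w] by (simp add: mean_eq_integral)
  qed
  then show ?thesis
    by (simp add: vec_eq_iff dlap_def cmul_of_real[symmetric] mean_cmul)
qed

end


section \<open>Histories\<close>

text \<open>
  \<open>K\<close> is covered by finitely many open sets on which \<open>f\<close> varies by less than \<open>e\<close>, and the values of \<open>f\<close> at
  one point of each are combined by a subordinate partition of unity.  What matters later is that the approximation is a
  finite sum of products of a scalar function with a fixed vector.
\<close>

lemma uniform_approximation_finite_rank:
  fixes f :: "'a::metric_space \<Rightarrow> 'b::real_normed_vector"
  assumes K: "compact K" and f: "continuous_on K f" and e: "0 < e"
  obtains \<C> :: "'a set set" and F :: "'a set \<Rightarrow> 'a \<Rightarrow> real" and v :: "'a set \<Rightarrow> 'b"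
  where "finite \<C>" "\<And>U. U \<in> \<C> \<Longrightarrow> continuous_on K (F U)"
    "\<And>x. x \<in> K \<Longrightarrow> norm (f x - (\<Sum>U\<in>\<C>. F U x *\<^sub>R v U)) \<le> e"
proof -
  have "\<exists>U. open U \<and> p \<in> U \<and> (\<forall>x\<in>U \<inter> K. dist (f x) (f p) < e)" if "p \<in> K" for p
  proof -
    have "\<exists>d>0. \<forall>x\<in>K. dist x p < d \<longrightarrow> dist (f x) (f p) < e"
      using f that e unfolding continuous_on_iff by blast
    then obtain d where "d > 0" "\<forall>x\<in>K. dist x p < d \<longrightarrow> dist (f x) (f p) < e"
      by blast
    then show ?thesis
      by (intro exI[of _ "ball p d"]) (auto simp: dist_commute)
  qed
  then obtain W where W: "\<And>p. p \<in> K \<Longrightarrow> open (W p) \<and> p \<in> W p \<and> (\<forall>x\<in>W p \<inter> K. dist (f x) (f p) < e)"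
    by metis
  have "K \<subseteq> \<Union>(W ` K)" using W by blast
  moreover have "open U" if "U \<in> W ` K" for U using W that by blast
  ultimately obtain \<C> where C: "\<C> \<subseteq> W ` K" "finite \<C>" "K \<subseteq> \<Union>\<C>"
    by (rule compactE[OF K])
  have "\<forall>U\<in>\<C>. \<exists>p\<in>K. U = W p" using C(1) by blast
  then obtain p where p: "\<And>U. U \<in> \<C> \<Longrightarrow> p U \<in> K \<and> U = W (p U)"
    by metis
  have opC: "open U" if "U \<in> \<C>" for U
    using p[OF that] W by metis
  have fin: "\<exists>V. open V \<and> x \<in> V \<and> finite {U \<in> \<C>. U \<inter> V \<noteq> {}}" if "x \<in> K" for x
    using C(2) by (intro exI[of _ UNIV]) auto
  have "\<exists>F :: 'a set \<Rightarrow> 'a \<Rightarrow> real. (\<forall>U\<in>\<C>. continuous_on K (F U) \<and> (\<forall>x\<in>K. 0 \<le> F U x)) \<and>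
      (\<forall>U\<in>\<C>. \<forall>x\<in>K. x \<notin> U \<longrightarrow> F U x = 0) \<and> (\<forall>x\<in>K. supp_sum (\<lambda>W. F W x) \<C> = 1)"
  proof (rule subordinate_partition_of_unity[OF C(3) opC fin], goal_cases)
    case (3 F)
    show ?case
      by (intro exI[of _ F] conjI ballI impI;
          (rule 3(1)[THEN conjunct1] | rule 3(1)[THEN conjunct2, THEN bspec] | rule 3(2) | rule 3(3)); assumption)
  qed
  then obtain F :: "'a set \<Rightarrow> 'a \<Rightarrow> real" where
    F0: "\<forall>U\<in>\<C>. continuous_on K (F U) \<and> (\<forall>x\<in>K. 0 \<le> F U x)"
      "\<forall>U\<in>\<C>. \<forall>x\<in>K. x \<notin> U \<longrightarrow> F U x = 0" "\<forall>x\<in>K. supp_sum (\<lambda>W. F W x) \<C> = 1"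
    by (elim exE conjE)
  note F = F0(1)[rule_format] F0(2)[rule_format] F0(3)[rule_format]
  show ?thesis
  proof
    show "finite \<C>" by (rule C(2))
    show "continuous_on K (F U)" if "U \<in> \<C>" for U
      using F(1) that by blast
  next
    fix x assume x: "x \<in> K"
    have "supp_sum (\<lambda>W. F W x) \<C> = (\<Sum>U\<in>\<C>. F U x)"
      unfolding supp_sum_def support_on_def by (rule sum.mono_neutral_left) (use C(2) in auto)
    with F(3)[OF x] have one: "(\<Sum>U\<in>\<C>. F U x) = 1" by simp
    have "norm (f x - (\<Sum>U\<in>\<C>. F U x *\<^sub>R f (p U))) = norm (\<Sum>U\<in>\<C>. F U x *\<^sub>R (f x - f (p U)))"
      by (simp add: scaleR_diff_right sum_subtractf scaleR_sum_left[symmetric] one)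
    also have "\<dots> \<le> (\<Sum>U\<in>\<C>. F U x * e)"
    proof (rule sum_norm_le)
      fix U assume U: "U \<in> \<C>"
      show "norm (F U x *\<^sub>R (f x - f (p U))) \<le> F U x * e"
      proof (cases "x \<in> U")
        case True
        then have "dist (f x) (f (p U)) < e"
          using p[OF U] W[of "p U"] x by auto
        then show ?thesis
          using F(1)[OF U] x by (auto simp: dist_norm intro!: mult_left_mono)
      next
        case False
        then show ?thesis using F(2)[OF U x] by simp
      qed
    qed
    also have "\<dots> = e"
      by (simp add: sum_distrib_right[symmetric] one)
    finally show "norm (f x - (\<Sum>U\<in>\<C>. F U x *\<^sub>R f (p U))) \<le> e" .
  qed
qed

locale history_space = function_space S for S :: "('x::{real_inner,banach}, 'm::finite) pfde" +
  assumes delay_pos: "delay S > 0"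
begin

abbreviation I :: "real set" where "I \<equiv> {- delay S..0}"

lemma zero_in_I [simp]: "0 \<in> I"
  using delay_pos by simp

lemma hist_bcontfun:
  assumes "continuous_on I f"
  shows "ext_cont f (- delay S) 0 \<in> bcontfun"
proof -
  have "bounded (f ` I)"
    by (rule compact_imp_bounded[OF compact_continuous_image[OF assms]]) simp
  moreover have "range (ext_cont f (- delay S) 0) \<subseteq> f ` I"
    using clamp_in_interval[of "- delay S" "0::real"] delay_pos by (auto simp: ext_cont_def cbox_interval)
  ultimately have "bounded (range (ext_cont f (- delay S) 0))"
    using bounded_subset by blast
  moreover have "continuous_on UNIV (ext_cont f (- delay S) 0)"
    by (rule continuous_on_ext_cont) (use assms in simp)
  ultimately show ?thesis by (simp add: bcontfun_def)
qed

lemma apply_hist_clamp: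
  "continuous_on I f \<Longrightarrow> apply_bcontfun (hist S f) \<theta> = f (clamp (- delay S) 0 \<theta>)"
  using hist_bcontfun[of f] by (simp add: hist_def Bcontfun_inverse ext_cont_def)

lemma clamp_in_I: "clamp (- delay S) 0 \<theta> \<in> I"
  using clamp_in_interval[of "- delay S" "0::real" \<theta>] delay_pos by (simp add: cbox_interval)

lemma apply_hist [simp]:
  assumes "continuous_on I f" "\<theta> \<in> I"
  shows "apply_bcontfun (hist S f) \<theta> = f \<theta>"
  using assms by (simp add: apply_hist_clamp)

lemma hist_cong: "(\<And>\<theta>. \<theta> \<in> I \<Longrightarrow> f \<theta> = g \<theta>) \<Longrightarrow> hist S f = hist S g"
  unfolding hist_def ext_cont_def using clamp_in_I by simp

lemma norm_hist_le:
  assumes "continuous_on I f" "\<And>\<theta>. \<theta> \<in> I \<Longrightarrow> norm (f \<theta>) \<le> B"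
  shows "norm (hist S f) \<le> B"
  by (rule norm_bound) (use assms clamp_in_I in \<open>auto simp: apply_hist_clamp\<close>)

lemma hist_add:
  assumes "continuous_on I f" "continuous_on I g"
  shows "hist S (\<lambda>\<theta>. f \<theta> + g \<theta>) = hist S f + hist S g"
  by (rule bcontfun_eqI) (use assms in \<open>simp add: apply_hist_clamp continuous_on_add\<close>)

lemma hist_diff:
  assumes "continuous_on I f" "continuous_on I g"
  shows "hist S (\<lambda>\<theta>. f \<theta> - g \<theta>) = hist S f - hist S g"
  by (rule bcontfun_eqI) (use assms in \<open>simp add: apply_hist_clamp continuous_on_diff\<close>)

lemma hist_zero [simp]: "hist S (\<lambda>\<theta>. 0) = 0"
  by (rule bcontfun_eqI) (simp add: apply_hist_clamp)

lemma hist_scaleR: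
  assumes "continuous_on I f"
  shows "hist S (\<lambda>\<theta>. r *\<^sub>R f \<theta>) = r *\<^sub>R hist S f"
  by (rule bcontfun_eqI) (use assms in \<open>simp add: apply_hist_clamp continuous_on_scaleR\<close>)

lemma continuous_on_cscale: "continuous_on I f \<Longrightarrow> continuous_on I (\<lambda>\<theta>. cscale S c (f \<theta>))"
  by (rule cscale.continuous_on) auto

lemma hscale_hist:
  assumes "continuous_on I f"
  shows "hscale S c (hist S f) = hist S (\<lambda>\<theta>. cscale S c (f \<theta>))"
  unfolding hscale_def by (rule hist_cong) (use assms in simp)

lemma continuous_on_emb: "continuous_on A \<phi> \<Longrightarrow> continuous_on A (\<lambda>\<theta>. emb (\<phi> \<theta>))"
  by (rule emb.continuous_on)

lemma continuous_on_mode0: "continuous_on A f \<Longrightarrow> continuous_on A (\<lambda>\<theta>. mode S 0 (f \<theta>))"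
  by (rule mode0.continuous_on)

lemma htens_beta0: "htens S \<phi> (beta S 0) = hist S (\<lambda>\<theta>. emb (\<phi> \<theta>))"
  by (simp add: htens_def emb_def)

lemma htens_one: "htens S \<phi> (ev S one) = hist S (\<lambda>\<theta>. emb (\<phi> \<theta>))"
  by (simp add: htens_def emb_def tens_beta0)

lemma hscale_htens:
  assumes "continuous_on I \<phi>"
  shows "hscale S c (htens S \<phi> (beta S 0)) = htens S (\<lambda>\<theta>. c *s \<phi> \<theta>) (beta S 0)"
  using assms by (simp add: htens_beta0 hscale_hist continuous_on_emb)

lemma htens_add:
  assumes "continuous_on I \<phi>" "continuous_on I \<psi>"
  shows "htens S (\<lambda>\<theta>. \<phi> \<theta> + \<psi> \<theta>) (beta S 0) = htens S \<phi> (beta S 0) + htens S \<psi> (beta S 0)"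
  using assms by (simp add: htens_beta0 hist_add[symmetric] continuous_on_emb emb.add)

lemma htens_cong:
  "(\<And>\<theta>. \<theta> \<in> I \<Longrightarrow> \<phi> \<theta> = \<psi> \<theta>) \<Longrightarrow> htens S \<phi> b = htens S \<psi> b"
  unfolding htens_def by (rule hist_cong) simp

lemma continuous_on_tens:
  assumes "continuous_on I \<phi>"
  shows "continuous_on I (\<lambda>\<theta>. tens S (\<phi> \<theta>) (ev S b))"
proof -
  have "continuous_on I (\<lambda>\<theta>. cmul (\<phi> \<theta> $ i) b)" for i
    by (rule bounded_bilinear.continuous_on[OF bounded_bilinear_cmul])
       (use assms in \<open>auto intro: continuous_intros\<close>)
  then have "continuous_on I (\<lambda>\<theta>. \<chi> i. cmul (\<phi> \<theta> $ i) b)"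
    by (intro continuous_intros)
  then show ?thesis
    by (simp add: tens_def cmul_def)
qed

text \<open>
  The summand for \<open>i\<close> takes its spatial profile from the component \<open>v\<^sub>i\<close> and points in the direction \<open>e\<^sub>i\<close>.
\<close>

lemma tens_axis_sum: "r *\<^sub>R v = (\<Sum>i\<in>UNIV. tens S (complex_of_real r *s axis i 1) (ev S (v $ i)))"
proof -
  have "cmul ((complex_of_real r *s axis i 1) $ j) (v $ i) = (if i = j then r *\<^sub>R v $ j else 0)" for i j
    using cmul_of_real[of 0] by (simp add: axis_def cmul_of_real)
  then show ?thesis
    by (simp only: vec_eq_iff sum_component tens_ev_nth) simp
qed

lemma mode0_pointwise:
  assumes "\<And>i. AE x in Om S. ev S (u $ i) x = p $ i * ev S b x"
  shows "mode S 0 u = mean b *s p"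
proof -
  have "u $ i = cmul (p $ i) b" for i
    using cmul_eqI[OF assms[of i]] by simp
  then show ?thesis
    by (simp add: vec_eq_iff mean_cmul)
qed

text \<open>
  The difference \<open>D f\<close> of the two sides is linear in \<open>f\<close> and bounded by a multiple of the sup norm of \<open>f\<close>.
  It vanishes on products of a history in \<open>\<complex>\<^sup>m\<close> with a fixed function of \<open>x\<close>, where \<open>T\<close> acts pointwise, so by
  \<open>tens_axis_sum\<close> also on products of a scalar history with a fixed element of \<open>X\<^sup>m\<close>, whose finite sums are dense.
\<close>

proposition mode0_hist_op:
  assumes T: "bounded_linear T" "hist_op S T"
    and hom: "\<And>c v. T (hscale S c v) = cscale S c (T v)"
    and pointwise: "\<And>\<phi> b i. continuous_on I \<phi> \<Longrightarrow>
      AE x in Om S. ev S (T (htens S \<phi> (ev S b)) $ i) x = T0 \<phi> $ i * ev S b x"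
    and f: "continuous_on I f"
  shows "mode S 0 (T (hist S f)) = mode S 0 (T (htens S (\<lambda>\<theta>. mode S 0 (f \<theta>)) (beta S 0)))"
proof -
  interpret T: bounded_linear T by (rule T(1))
  define D where "D f = mode S 0 (T (hist S f)) - mode S 0 (T (hist S (\<lambda>\<theta>. emb (mode S 0 (f \<theta>)))))" for f
  have cont: "continuous_on I (\<lambda>\<theta>. emb (mode S 0 (f \<theta>)))" if "continuous_on I f" for f
    using that by (intro continuous_on_emb continuous_on_mode0)
  have D_add: "D (\<lambda>\<theta>. f \<theta> + g \<theta>) = D f + D g" if "continuous_on I f" "continuous_on I g" for f g
    using that cont by (simp add: D_def hist_add T.add mode0.add emb.add)
  have D_diff: "D (\<lambda>\<theta>. f \<theta> - g \<theta>) = D f - D g" if "continuous_on I f" "continuous_on I g" for f g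
    using that cont by (simp add: D_def hist_diff T.diff mode0.diff emb.diff)
  have D_zero: "D (\<lambda>\<theta>. 0) = 0"
    by (simp add: D_def T.zero mode0.zero emb.zero)
  have D_sum: "D (\<lambda>\<theta>. \<Sum>x\<in>A. f x \<theta>) = (\<Sum>x\<in>A. D (f x))" if "\<And>x. x \<in> A \<Longrightarrow> continuous_on I (f x)"
    for A and f :: "'k \<Rightarrow> _"
    using that
    by (induction A rule: infinite_finite_induct) (simp_all add: D_zero D_add continuous_on_sum)
  have D_tens: "D (\<lambda>\<theta>. tens S (\<phi> \<theta>) (ev S b)) = 0" if \<phi>: "continuous_on I \<phi>" for \<phi> b
  proof -
    have 1: "mode S 0 (T (htens S \<phi> (ev S b))) = mean b *s T0 \<phi>" for b
      by (rule mode0_pointwise[OF pointwise[OF \<phi>]])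
    have 2: "mode S 0 (tens S (\<phi> \<theta>) (ev S b)) = mean b *s \<phi> \<theta>" for \<theta>
      by (simp add: vec_eq_iff tens_ev_nth mean_cmul)
    have "hist S (\<lambda>\<theta>. emb (mean b *s \<phi> \<theta>)) = hscale S (mean b) (htens S \<phi> (ev S one))"
      using \<phi> by (simp add: htens_one hscale_hist continuous_on_emb)
    then show ?thesis
      using 1[of b] 1[of one] by (simp add: D_def 2 hom htens_def[symmetric])
  qed
  have D_scaleR: "D (\<lambda>\<theta>. F \<theta> *\<^sub>R v) = 0" if F: "continuous_on I F" for F v
  proof -
    have cF: "continuous_on I (\<lambda>\<theta>. complex_of_real (F \<theta>) *s axis i 1)" for i
      by (rule vscale.continuous_on) (use F in \<open>auto intro: continuous_intros\<close>)
    show ?thesis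
      unfolding tens_axis_sum[of _ v]
      by (subst D_sum) (auto intro!: continuous_on_tens cF simp: D_tens[OF cF])
  qed
  obtain K where K: "\<And>v. norm (mode S 0 v) \<le> norm v * K" "K > 0"
    using mode0.pos_bounded by blast
  obtain L where L: "\<And>v. norm (emb v) \<le> norm v * L" "L > 0"
    using emb.pos_bounded by blast
  obtain B where B: "\<And>v. norm (T v) \<le> norm v * B" "B > 0"
    using T.pos_bounded by blast
  define M where "M = B * K + K * L * B * K"
  have D_bound: "norm (D g) \<le> e * M" if g: "continuous_on I g" and ge: "\<And>\<theta>. \<theta> \<in> I \<Longrightarrow> norm (g \<theta>) \<le> e" for g e
  proof -
    have TB: "norm (mode S 0 (T v)) \<le> e * B * K" if "norm v \<le> e" for v e
    proof -
      have "norm (mode S 0 (T v)) \<le> norm (T v) * K" by (rule K(1))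
      also have "\<dots> \<le> norm v * B * K" using B(1)[of v] K(2) by (intro mult_right_mono) auto
      also have "\<dots> \<le> e * B * K" using that B(2) K(2) by (intro mult_right_mono) auto
      finally show ?thesis .
    qed
    have "norm (emb (mode S 0 (g \<theta>))) \<le> e * K * L" if "\<theta> \<in> I" for \<theta>
    proof -
      have "norm (emb (mode S 0 (g \<theta>))) \<le> norm (mode S 0 (g \<theta>)) * L" by (rule L(1))
      also have "\<dots> \<le> norm (g \<theta>) * K * L" using K(1) L(2) by (intro mult_right_mono) auto
      also have "\<dots> \<le> e * K * L" using ge[OF that] L(2) K(2) by (intro mult_right_mono) auto
      finally show ?thesis .
    qed
    then have "norm (mode S 0 (T (hist S (\<lambda>\<theta>. emb (mode S 0 (g \<theta>)))))) \<le> e * K * L * B * K"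
      by (intro TB norm_hist_le cont g)
    moreover have "norm (mode S 0 (T (hist S g))) \<le> e * B * K"
      by (intro TB norm_hist_le g ge)
    ultimately show ?thesis
      unfolding D_def M_def
      by (intro order_trans[OF norm_triangle_ineq4]) (simp add: algebra_simps)
  qed
  have M: "M > 0"
    using K(2) L(2) B(2) by (simp add: M_def add_pos_pos)
  have "norm (D f) \<le> e" if "e > 0" for e
  proof -
    have e: "0 < e / M" using that M by simp
    obtain \<C> :: "real set set" and F and v where C: "finite \<C>"
      "\<And>U. U \<in> \<C> \<Longrightarrow> continuous_on I (F U)"
      "\<And>x. x \<in> I \<Longrightarrow> norm (f x - (\<Sum>U\<in>\<C>. F U x *\<^sub>R v U)) \<le> e / M"
      using uniform_approximation_finite_rank[OF compact_Icc f e] by blast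
    have cC: "continuous_on I (\<lambda>x. F U x *\<^sub>R v U)" if "U \<in> \<C>" for U
      using C(2)[OF that] by (intro continuous_intros)
    then have cS: "continuous_on I (\<lambda>x. \<Sum>U\<in>\<C>. F U x *\<^sub>R v U)"
      by (rule continuous_on_sum)
    have "D (\<lambda>x. \<Sum>U\<in>\<C>. F U x *\<^sub>R v U) = 0"
      using cC C(2) by (subst D_sum) (auto simp: D_scaleR)
    then have "D f = D (\<lambda>x. f x - (\<Sum>U\<in>\<C>. F U x *\<^sub>R v U))"
      using D_diff[OF f cS] by simp
    also have "norm \<dots> \<le> e / M * M"
      by (rule D_bound) (use f cS C(3) in \<open>auto intro: continuous_on_diff\<close>)
    finally show ?thesis using M by simp
  qed
  then have "norm (D f) \<le> 0"
    by (rule field_le_epsilon[of _ 0, simplified])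
  then show ?thesis
    by (simp add: D_def htens_beta0)
qed

end


section \<open>The operators on spatially constant histories\<close>

locale pfde_system =
  fixes S :: "('x::{real_inner,banach}, 'm::finite) pfde"
  assumes setting: "pfde_setting S"

sublocale pfde_system \<subseteq> history_space S
  using setting by unfold_locales (simp_all add: pfde_setting_def)

context history_space
begin

text \<open>
  Histories in \<open>\<complex>\<^sup>m\<close> are plain functions on the real line, so linearity is restricted to continuous ones,
  and dependence on the values in \<open>[-r,0]\<close> only is part of the notion.
\<close>

definition history_linear :: "((real \<Rightarrow> complex^'m) \<Rightarrow> complex^'m) \<Rightarrow> bool"
  where "history_linear f \<longleftrightarrow>
    (\<forall>\<phi> \<psi>. continuous_on I \<phi> \<longrightarrow> continuous_on I \<psi> \<longrightarrow> f (\<lambda>\<theta>. \<phi> \<theta> + \<psi> \<theta>) = f \<phi> + f \<psi>) \<and>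
    (\<forall>c \<phi>. continuous_on I \<phi> \<longrightarrow> f (\<lambda>\<theta>. c *s \<phi> \<theta>) = c *s f \<phi>) \<and>
    (\<forall>\<phi> \<psi>. (\<forall>\<theta>\<in>I. \<phi> \<theta> = \<psi> \<theta>) \<longrightarrow> f \<phi> = f \<psi>)"

lemma history_linear_add:
  "history_linear f \<Longrightarrow> continuous_on I \<phi> \<Longrightarrow> continuous_on I \<psi> \<Longrightarrow> f (\<lambda>\<theta>. \<phi> \<theta> + \<psi> \<theta>) = f \<phi> + f \<psi>"
  and history_linear_scale:
  "history_linear f \<Longrightarrow> continuous_on I \<phi> \<Longrightarrow> f (\<lambda>\<theta>. c *s \<phi> \<theta>) = c *s f \<phi>"
  and history_linear_cong:
  "history_linear f \<Longrightarrow> (\<And>\<theta>. \<theta> \<in> I \<Longrightarrow> \<phi> \<theta> = \<psi> \<theta>) \<Longrightarrow> f \<phi> = f \<psi>"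
  unfolding history_linear_def by blast+

lemma continuous_on_vscale_const: "continuous_on A \<phi> \<Longrightarrow> continuous_on A (\<lambda>\<theta>. c *s (\<phi> \<theta> :: complex^'m))"
  by (rule vscale.continuous_on) auto

lemma history_linear_zero: "history_linear f \<Longrightarrow> f (\<lambda>\<theta>. 0) = 0"
  using history_linear_scale[of f "\<lambda>\<theta>. 0" 0] by simp

lemma history_linear_diff:
  assumes "history_linear f" "continuous_on I \<phi>" "continuous_on I \<psi>"
  shows "f (\<lambda>\<theta>. \<phi> \<theta> - \<psi> \<theta>) = f \<phi> - f \<psi>"
proof -
  have "f (\<lambda>\<theta>. \<phi> \<theta> - \<psi> \<theta>) = f (\<lambda>\<theta>. \<phi> \<theta> + (-1) *s \<psi> \<theta>)"
    by (rule arg_cong[where f = f]) (simp add: fun_eq_iff vec_eq_iff)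
  also have "\<dots> = f \<phi> + f (\<lambda>\<theta>. (-1) *s \<psi> \<theta>)"
    by (rule history_linear_add[OF assms(1,2) continuous_on_vscale_const[OF assms(3)]])
  also have "f (\<lambda>\<theta>. (-1) *s \<psi> \<theta>) = (-1) *s f \<psi>"
    by (rule history_linear_scale[OF assms(1,3)])
  finally show ?thesis by (simp add: vec_eq_iff)
qed

lemma history_linear_sum:
  assumes "history_linear f" "\<And>x. x \<in> A \<Longrightarrow> continuous_on I (\<phi> x)"
  shows "f (\<lambda>\<theta>. \<Sum>x\<in>A. \<phi> x \<theta>) = (\<Sum>x\<in>A. f (\<phi> x))"
  using assms(2)
  by (induction A rule: infinite_finite_induct)
     (simp_all add: history_linear_zero[OF assms(1)] history_linear_add[OF assms(1)] continuous_on_sum)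

text \<open>
  Every history is \<open>u + \<i>v\<close> with \<open>u\<close> and \<open>v\<close> real.  Two functionals are admitted because a multilinear
  operator is treated one argument at a time, with the remaining arguments conjugated in \<open>g\<close> but not in \<open>f\<close>.
\<close>

lemma history_linear_conj:
  assumes f: "history_linear f" and g: "history_linear g"
    and real: "\<And>\<phi>. continuous_on I \<phi> \<Longrightarrow> (\<And>\<theta>. vcnj (\<phi> \<theta>) = \<phi> \<theta>) \<Longrightarrow> g \<phi> = vcnj (f \<phi>)"
    and \<phi>: "continuous_on I \<phi>"
  shows "g (\<lambda>\<theta>. vcnj (\<phi> \<theta>)) = vcnj (f \<phi>)"
proof -
  define u where "u = (\<lambda>\<theta>. (1/2) *s (\<phi> \<theta> + vcnj (\<phi> \<theta>)))"
  define v where "v = (\<lambda>\<theta>. (- \<i>/2) *s (\<phi> \<theta> - vcnj (\<phi> \<theta>)))"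
  have c: "continuous_on I (\<lambda>\<theta>. vcnj (\<phi> \<theta>))"
    by (rule bounded_linear.continuous_on[OF bounded_linear_vcnj \<phi>])
  have uv: "continuous_on I u" "continuous_on I v"
    unfolding u_def v_def
    by (intro continuous_on_vscale_const continuous_on_add continuous_on_diff \<phi> c)+
  have 1: "\<phi> = (\<lambda>\<theta>. u \<theta> + \<i> *s v \<theta>)" "(\<lambda>\<theta>. vcnj (\<phi> \<theta>)) = (\<lambda>\<theta>. u \<theta> + (- \<i>) *s v \<theta>)"
    by (simp_all add: fun_eq_iff vec_eq_iff u_def v_def field_simps)
  have "g u = vcnj (f u)" "g v = vcnj (f v)"
    by (rule real[OF uv(1)], simp add: u_def vec_eq_iff add.commute,
        rule real[OF uv(2)], simp add: v_def vec_eq_iff field_simps)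
  moreover have "g (\<lambda>\<theta>. vcnj (\<phi> \<theta>)) = g u + (- \<i>) *s g v"
    unfolding 1(2) history_linear_add[OF g uv(1) continuous_on_vscale_const[OF uv(2)]]
      history_linear_scale[OF g uv(2)] ..
  moreover have "f \<phi> = f u + \<i> *s f v"
    by (subst 1(1), subst history_linear_add[OF f uv(1) continuous_on_vscale_const[OF uv(2)]],
        subst history_linear_scale[OF f uv(2)]) (rule refl)
  ultimately show ?thesis by simp
qed

lemma history_linear_mode0:
  assumes add: "\<And>u v. T (u + v) = T u + T v" and T: "hist_op S T"
    and hom: "\<And>c v. mode S 0 (T (hscale S c v)) = c *s mode S 0 (T v)"
  shows "history_linear (\<lambda>\<phi>. mode S 0 (T (htens S \<phi> (beta S 0))))"
  unfolding history_linear_def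
proof (intro conjI allI impI)
  fix \<phi> \<psi> :: "real \<Rightarrow> complex^'m" and c
  show "mode S 0 (T (htens S (\<lambda>\<theta>. \<phi> \<theta> + \<psi> \<theta>) (beta S 0)))
      = mode S 0 (T (htens S \<phi> (beta S 0))) + mode S 0 (T (htens S \<psi> (beta S 0)))"
    if "continuous_on I \<phi>" "continuous_on I \<psi>"
    using that by (simp add: htens_add add mode0.add)
  show "mode S 0 (T (htens S (\<lambda>\<theta>. c *s \<phi> \<theta>) (beta S 0))) = c *s mode S 0 (T (htens S \<phi> (beta S 0)))"
    if "continuous_on I \<phi>"
    using that by (simp add: hscale_htens[symmetric] hom)
  show "mode S 0 (T (htens S \<phi> (beta S 0))) = mode S 0 (T (htens S \<psi> (beta S 0)))"
    if "\<forall>\<theta>\<in>I. \<phi> \<theta> = \<psi> \<theta>"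
    using that htens_cong[of \<phi> \<psi>] by simp
qed


subsection \<open>Reality\<close>

text \<open>
  Up to the factor \<open>-2\<i>\<close> this is the imaginary part of the mean; it is a bounded real-linear map which
  vanishes on real functions.
\<close>

definition imag_part :: "'x^'m \<Rightarrow> complex^'m"
  where "imag_part v = vcnj (mode S 0 v) - mode S 0 v"

lemma bounded_linear_imag_part: "bounded_linear imag_part"
  unfolding imag_part_def
  by (intro bounded_linear_sub bounded_linear_compose[OF bounded_linear_vcnj] bounded_linear_mode0)

sublocale imag_part: bounded_linear imag_part
  by (rule bounded_linear_imag_part)

lemma imag_part_real:
  assumes "real_val S v"
  shows "imag_part v = 0"
proof -
  have "cnj (mean (v $ i)) = mean (v $ i)" for i
  proof -
    have "AE x in Om S. Im (ev S (v $ i) x) = 0"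
      using assms unfolding real_val_def by blast
    then have "(\<integral>x. Im (ev S (v $ i) x) \<partial>Om S) = 0"
      by (rule integral_eq_zero_AE)
    then have "Im (\<integral>x. ev S (v $ i) x \<partial>Om S) = 0"
      using integral_Im[OF ev_integrable, of "v $ i"] by simp
    then show ?thesis by (simp add: mean_eq complex_eq_iff)
  qed
  then show ?thesis by (simp add: imag_part_def vec_eq_iff)
qed

lemma real_val_add: "real_val S u \<Longrightarrow> real_val S v \<Longrightarrow> real_val S (u + v)"
  unfolding real_val_def
proof
  fix i
  assume "\<forall>i. AE x in Om S. Im (ev S (u $ i) x) = 0" "\<forall>i. AE x in Om S. Im (ev S (v $ i) x) = 0"
  then have "AE x in Om S. Im (ev S (u $ i) x) = 0" "AE x in Om S. Im (ev S (v $ i) x) = 0"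
    by blast+
  then show "AE x in Om S. Im (ev S ((u + v) $ i) x) = 0"
    using ev_add[of "u $ i" "v $ i"] by eventually_elim simp
qed

lemma real_val_scaleR: "real_val S v \<Longrightarrow> real_val S (r *\<^sub>R v)"
  unfolding real_val_def
proof
  fix i
  assume "\<forall>i. AE x in Om S. Im (ev S (v $ i) x) = 0"
  then have "AE x in Om S. Im (ev S (v $ i) x) = 0"
    by blast
  then show "AE x in Om S. Im (ev S ((r *\<^sub>R v) $ i) x) = 0"
    using ev_scaleR[of r "v $ i"] by eventually_elim simp
qed

lemma real_hist_add: "real_hist S u \<Longrightarrow> real_hist S v \<Longrightarrow> real_hist S (u + v)"
  unfolding real_hist_def by (simp add: real_val_add plus_bcontfun.rep_eq)

lemma real_hist_scaleR: "real_hist S v \<Longrightarrow> real_hist S (r *\<^sub>R v)"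
  unfolding real_hist_def by (simp add: real_val_scaleR scaleR_bcontfun.rep_eq)

lemma real_hist_htens:
  assumes "continuous_on I \<phi>" "\<And>\<theta>. vcnj (\<phi> \<theta>) = \<phi> \<theta>"
  shows "real_hist S (htens S \<phi> (beta S 0))"
  unfolding real_hist_def real_val_def
proof (intro ballI allI)
  fix \<theta> i assume "\<theta> \<in> I"
  then have *: "apply_bcontfun (htens S \<phi> (beta S 0)) \<theta> = emb (\<phi> \<theta>)"
    using assms(1) by (simp add: htens_beta0 continuous_on_emb)
  have "Im (\<phi> \<theta> $ i) = 0"
    using assms(2)[of \<theta>] by (simp add: vec_eq_iff complex_eq_iff)
  then show "AE x in Om S. Im (ev S (apply_bcontfun (htens S \<phi> (beta S 0)) \<theta> $ i) x) = 0"
    unfolding * by (intro eventually_mono[OF ev_emb[of "\<phi> \<theta>" i]]) simp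
qed

end

context pfde_system
begin

subsection \<open>The linear part\<close>

lemma zero_in_nbhd: "0 \<in> nbhd S" and open_nbhd: "open (nbhd S)"
  using setting by (simp_all add: pfde_setting_def)

lemma Lop_hist_op: "\<alpha> \<in> nbhd S \<Longrightarrow> hist_op S (blinfun_apply (Lop S \<alpha>))"
  and Lop_hscale: "\<alpha> \<in> nbhd S \<Longrightarrow> blinfun_apply (Lop S \<alpha>) (hscale S c \<phi>) = cscale S c (blinfun_apply (Lop S \<alpha>) \<phi>)"
  and Lop_real: "\<alpha> \<in> nbhd S \<Longrightarrow> real_hist S \<phi> \<Longrightarrow> real_val S (blinfun_apply (Lop S \<alpha>) \<phi>)"
  and Lop_derivative: "(Lop S has_derivative (\<lambda>\<alpha>. (1/2) *\<^sub>R Lop1 S \<alpha>)) (at 0)"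
  using setting by (simp_all add: pfde_setting_def linear_part_def)

text \<open>
  \<open>L\<^sub>1\<close> is twice the derivative of \<open>\<alpha> \<mapsto> L(\<alpha>)\<close> at \<open>0\<close>, so a linear condition satisfied by all \<open>L(\<alpha>)\<close>
  carries over to \<open>L\<^sub>1(\<alpha>)\<close>.
\<close>

lemma Lop1_inherits:
  assumes F: "bounded_linear F" and zero: "\<And>\<alpha>. \<alpha> \<in> nbhd S \<Longrightarrow> F (Lop S \<alpha>) = 0"
  shows "F (Lop1 S \<alpha>) = 0"
proof -
  interpret F: bounded_linear F by (rule F)
  have "((\<lambda>\<alpha>. F (Lop S \<alpha>)) has_derivative (\<lambda>\<alpha>. F ((1/2) *\<^sub>R Lop1 S \<alpha>))) (at 0)"
    by (rule F.has_derivative[OF Lop_derivative])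
  then have "((\<lambda>\<alpha>. 0) has_derivative (\<lambda>\<alpha>. F ((1/2) *\<^sub>R Lop1 S \<alpha>))) (at 0)"
    by (rule has_derivative_transform_within_open[OF _ open_nbhd zero_in_nbhd zero])
  then have "(\<lambda>\<alpha>. F ((1/2) *\<^sub>R Lop1 S \<alpha>)) = (\<lambda>_. 0)"
    by (rule has_derivative_unique) (rule has_derivative_const)
  then have "F ((1/2) *\<^sub>R Lop1 S \<alpha>) = 0" by meson
  then show ?thesis by (simp add: F.scaleR)
qed

lemma linear_Lop1: "linear (Lop1 S)"
proof -
  have "linear (\<lambda>\<alpha>. 2 *\<^sub>R ((1/2) *\<^sub>R Lop1 S \<alpha>))"
    by (rule linear_compose_scale_right[OF has_derivative_linear[OF Lop_derivative]])
  then show ?thesis by simp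
qed

lemma Lop1_expand: "Lop1 S \<alpha> = (\<alpha> $ 1) *\<^sub>R Lop1 S (axis 1 1) + (\<alpha> $ 2) *\<^sub>R Lop1 S (axis 2 1)"
proof -
  have "\<alpha> = (\<alpha> $ 1) *\<^sub>R axis 1 1 + (\<alpha> $ 2) *\<^sub>R axis 2 1"
    by (simp add: vec_eq_iff axis_def forall_2)
  then have "Lop1 S \<alpha> = Lop1 S ((\<alpha> $ 1) *\<^sub>R axis 1 1 + (\<alpha> $ 2) *\<^sub>R axis 2 1)"
    by (rule arg_cong)
  also have "\<dots> = (\<alpha> $ 1) *\<^sub>R Lop1 S (axis 1 1) + (\<alpha> $ 2) *\<^sub>R Lop1 S (axis 2 1)"
    by (simp only: linear_add[OF linear_Lop1] linear_cmul[OF linear_Lop1])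
  finally show ?thesis .
qed

lemma Lop1_hist_op: "hist_op S (blinfun_apply (Lop1 S \<alpha>))"
  unfolding hist_op_def
proof (intro allI impI)
  fix u v :: "real \<Rightarrow>\<^sub>C ('x^'m)"
  assume *: "\<forall>\<theta>\<in>I. apply_bcontfun u \<theta> = apply_bcontfun v \<theta>"
  have "blinfun_apply (Lop1 S \<alpha>) u - blinfun_apply (Lop1 S \<alpha>) v = 0"
  proof (rule Lop1_inherits)
    show "bounded_linear (\<lambda>T. blinfun_apply T u - blinfun_apply T v)"
      by (intro bounded_linear_sub blinfun.bounded_linear_left)
    show "blinfun_apply (Lop S \<alpha>) u - blinfun_apply (Lop S \<alpha>) v = 0" if "\<alpha> \<in> nbhd S" for \<alpha>
      using Lop_hist_op[OF that] * unfolding hist_op_def by simp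
  qed
  then show "blinfun_apply (Lop1 S \<alpha>) u = blinfun_apply (Lop1 S \<alpha>) v" by simp
qed

lemma Lop1_hscale: "blinfun_apply (Lop1 S \<alpha>) (hscale S c \<phi>) = cscale S c (blinfun_apply (Lop1 S \<alpha>) \<phi>)"
proof -
  have "blinfun_apply (Lop1 S \<alpha>) (hscale S c \<phi>) - cscale S c (blinfun_apply (Lop1 S \<alpha>) \<phi>) = 0"
  proof (rule Lop1_inherits)
    show "bounded_linear (\<lambda>T. blinfun_apply T (hscale S c \<phi>) - cscale S c (blinfun_apply T \<phi>))"
      by (intro bounded_linear_sub blinfun.bounded_linear_left
          bounded_linear_compose[OF cscale.bounded_linear_right])
  qed (simp add: Lop_hscale)
  then show ?thesis by simp
qed

lemma Lop1_imag_part: "real_hist S \<phi> \<Longrightarrow> imag_part (blinfun_apply (Lop1 S \<alpha>) \<phi>) = 0"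
  by (rule Lop1_inherits)
     (auto intro!: bounded_linear_compose[OF bounded_linear_imag_part] blinfun.bounded_linear_left
       imag_part_real Lop_real)

lemma history_linear_Lm: "\<alpha> \<in> nbhd S \<Longrightarrow> history_linear (Lm S (Lop S \<alpha>))"
  unfolding Lm_def[abs_def]
  by (rule history_linear_mode0) (simp_all add: blinfun.add_right Lop_hist_op Lop_hscale)

lemma history_linear_Lm1: "history_linear (Lm S (Lop1 S \<alpha>))"
  unfolding Lm_def[abs_def]
  by (rule history_linear_mode0) (simp_all add: blinfun.add_right Lop1_hist_op Lop1_hscale)

lemma imag_part_zeroD: "imag_part v = 0 \<Longrightarrow> vcnj (mode S 0 v) = mode S 0 v"
  by (simp add: imag_part_def)

lemma Lm_conj:
  assumes "\<alpha> \<in> nbhd S" "continuous_on I \<phi>"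
  shows "Lm S (Lop S \<alpha>) (\<lambda>\<theta>. vcnj (\<phi> \<theta>)) = vcnj (Lm S (Lop S \<alpha>) \<phi>)"
proof (rule history_linear_conj[OF history_linear_Lm history_linear_Lm])
  fix \<phi> :: "real \<Rightarrow> complex^'m"
  assume "continuous_on I \<phi>" "\<And>\<theta>. vcnj (\<phi> \<theta>) = \<phi> \<theta>"
  then show "Lm S (Lop S \<alpha>) \<phi> = vcnj (Lm S (Lop S \<alpha>) \<phi>)"
    unfolding Lm_def
    by (intro imag_part_zeroD[symmetric] imag_part_real Lop_real assms real_hist_htens)
qed (use assms in auto)

lemma Lm1_conj:
  assumes "continuous_on I \<phi>"
  shows "Lm S (Lop1 S \<alpha>) (\<lambda>\<theta>. vcnj (\<phi> \<theta>)) = vcnj (Lm S (Lop1 S \<alpha>) \<phi>)"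
proof (rule history_linear_conj[OF history_linear_Lm1 history_linear_Lm1])
  fix \<phi> :: "real \<Rightarrow> complex^'m"
  assume "continuous_on I \<phi>" "\<And>\<theta>. vcnj (\<phi> \<theta>) = \<phi> \<theta>"
  then show "Lm S (Lop1 S \<alpha>) \<phi> = vcnj (Lm S (Lop1 S \<alpha>) \<phi>)"
    unfolding Lm_def
    by (intro imag_part_zeroD[symmetric] Lop1_imag_part real_hist_htens)
qed (use assms in auto)

lemma Lop0_pointwise:
  assumes "continuous_on I \<phi>"
  shows "AE x in Om S. ev S (blinfun_apply (Lop S 0) (htens S \<phi> (ev S b)) $ i) x
          = Lm S (Lop S 0) \<phi> $ i * ev S b x"
  using setting zero_in_nbhd assms unfolding pfde_setting_def acts_pointwise_def by simp

lemma Lop0_emb: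
  assumes "continuous_on I \<phi>"
  shows "blinfun_apply (Lop S 0) (hist S (\<lambda>\<theta>. emb (\<phi> \<theta>))) = emb (Lm S (Lop S 0) \<phi>)"
proof (rule emb_eqI)
  fix i
  show "AE x in Om S. ev S (blinfun_apply (Lop S 0) (hist S (\<lambda>\<theta>. emb (\<phi> \<theta>))) $ i) x = Lm S (Lop S 0) \<phi> $ i"
    using Lop0_pointwise[OF assms, of one i] ev_one unfolding htens_one by eventually_elim simp
qed

lemma mode0_Lop0:
  assumes "continuous_on I f"
  shows "mode S 0 (blinfun_apply (Lop S 0) (hist S f)) = Lm S (Lop S 0) (\<lambda>\<theta>. mode S 0 (f \<theta>))"
  unfolding Lm_def
  by (rule mode0_hist_op[of "blinfun_apply (Lop S 0)" "Lm S (Lop S 0)" f])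
     (use assms in \<open>auto simp: blinfun.bounded_linear_right Lop_hist_op Lop_hscale zero_in_nbhd Lop0_pointwise\<close>)


subsection \<open>The quadratic and the cubic part\<close>

lemma nonlinear: "nonlinear_part S"
  using setting by (simp add: pfde_setting_def)

lemmas nonlinear_conjuncts = nonlinear[unfolded nonlinear_part_def]

lemma bounded_bilinear_Qop: "bounded_bilinear (Qop S)"
  by (rule nonlinear_conjuncts[THEN conjunct2, THEN conjunct2, THEN conjunct1])

lemma Qop_hist_op: "hist_op S (Qop S u)"
  by (rule nonlinear_conjuncts[THEN conjunct2, THEN conjunct2, THEN conjunct2, THEN conjunct1, THEN spec])

lemma Qop_commute: "Qop S u v = Qop S v u"
  by (rule nonlinear_conjuncts[THEN conjunct2, THEN conjunct2, THEN conjunct2, THEN conjunct2, THEN conjunct1, THEN spec, THEN spec])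

lemma Qop_hscale_left: "Qop S (hscale S c u) v = cscale S c (Qop S u v)"
  by (rule nonlinear_conjuncts[THEN conjunct2, THEN conjunct2, THEN conjunct2, THEN conjunct2, THEN conjunct2, THEN conjunct1, THEN spec, THEN spec, THEN spec])

lemma linear_Cop: "linear (Cop S u v)"
  by (rule nonlinear_conjuncts[THEN conjunct2, THEN conjunct2, THEN conjunct2, THEN conjunct2, THEN conjunct2, THEN conjunct2, THEN conjunct1, THEN spec, THEN spec])

lemma Cop_hist_op: "hist_op S (Cop S u v)"
  by (rule nonlinear_conjuncts[THEN conjunct2, THEN conjunct2, THEN conjunct2, THEN conjunct2, THEN conjunct2, THEN conjunct2, THEN conjunct2, THEN conjunct2, THEN conjunct1, THEN spec, THEN spec])

lemma Cop_swap12: "Cop S u v w = Cop S v u w"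
  and Cop_swap23: "Cop S u v w = Cop S u w v"
  using nonlinear_conjuncts[THEN conjunct2, THEN conjunct2, THEN conjunct2, THEN conjunct2, THEN conjunct2, THEN conjunct2, THEN conjunct2, THEN conjunct2, THEN conjunct2, THEN conjunct1, THEN spec, THEN spec, THEN spec] by auto

lemma Cop_hscale_left: "Cop S (hscale S c u) v w = cscale S c (Cop S u v w)"
  by (rule nonlinear_conjuncts[THEN conjunct2, THEN conjunct2, THEN conjunct2, THEN conjunct2, THEN conjunct2, THEN conjunct2, THEN conjunct2, THEN conjunct2, THEN conjunct2, THEN conjunct2, THEN conjunct1, THEN spec, THEN spec, THEN spec, THEN spec])

lemma taylor: "\<forall>e>0. \<exists>\<delta>>0. \<forall>v. real_hist S v \<and> norm v < \<delta> \<longrightarrow>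
       norm (Gop S (v, 0) - (1/2) *\<^sub>R Qop S v v - (1/6) *\<^sub>R Cop S v v v) \<le> e * norm v ^ 3"
  by (rule nonlinear_conjuncts[THEN conjunct2, THEN conjunct2, THEN conjunct2, THEN conjunct2, THEN conjunct2, THEN conjunct2, THEN conjunct2, THEN conjunct2, THEN conjunct2, THEN conjunct2, THEN conjunct2])

lemma Gop_real: "\<alpha> \<in> nbhd S \<Longrightarrow> real_hist S u \<Longrightarrow> real_val S (Gop S (u, \<alpha>))"
  using nonlinear_conjuncts[THEN conjunct1] by simp

sublocale Qop: bounded_bilinear "Qop S"
  by (rule bounded_bilinear_Qop)

lemma Qop_hscale_right: "Qop S u (hscale S c v) = cscale S c (Qop S u v)"
  by (metis Qop_commute Qop_hscale_left)

lemma Cop_hscale_right: "Cop S u v (hscale S c w) = cscale S c (Cop S u v w)"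
  by (metis Cop_swap12 Cop_swap23 Cop_hscale_left)

lemma Cop_add: "Cop S u v (w + w') = Cop S u v w + Cop S u v w'"
  "Cop S u (w + w') v = Cop S u w v + Cop S u w' v"
  "Cop S (w + w') u v = Cop S w u v + Cop S w' u v"
proof -
  show 3: "Cop S u v (w + w') = Cop S u v w + Cop S u v w'" for u v
    by (rule linear_add[OF linear_Cop])
  show 2: "Cop S u (w + w') v = Cop S u w v + Cop S u w' v"
    by (simp only: Cop_swap23[of _ _ v] 3)
  show "Cop S (w + w') u v = Cop S w u v + Cop S w' u v"
    by (simp only: Cop_swap12[of "w + w'" u v] Cop_swap12[of w u v] Cop_swap12[of w' u v] 2)
qed

lemma Cop_scaleR: "Cop S u v (r *\<^sub>R w) = r *\<^sub>R Cop S u v w"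
  "Cop S u (r *\<^sub>R w) v = r *\<^sub>R Cop S u w v"
  "Cop S (r *\<^sub>R w) u v = r *\<^sub>R Cop S w u v"
proof -
  show 3: "Cop S u v (r *\<^sub>R w) = r *\<^sub>R Cop S u v w" for u v
    by (rule linear_cmul[OF linear_Cop])
  show 2: "Cop S u (r *\<^sub>R w) v = r *\<^sub>R Cop S u w v"
    by (simp only: Cop_swap23[of _ _ v] 3)
  show "Cop S (r *\<^sub>R w) u v = r *\<^sub>R Cop S w u v"
    by (simp only: Cop_swap12[of "r *\<^sub>R w" u v] Cop_swap12[of w u v] 2)
qed

text \<open>
  Let \<open>a\<close> and \<open>b\<close> be the imaginary parts of the means of \<open>\<onehalf>Q(u,u)\<close> and \<open>C(u,u,u)/6\<close>.  The remainder in the Taylor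
  expansion of \<open>G(tu,0)\<close> is \<open>o(t\<^sup>3)\<close>, and as \<open>G(tu,0)\<close> is real, the imaginary part of its mean is \<open>-t\<^sup>2(a + tb)\<close>.  So
  \<open>a + tb = o(t)\<close>; hence \<open>a = 0\<close> and then \<open>b = 0\<close>.
\<close>

lemma imag_part_Qop_Cop_diag:
  assumes u: "real_hist S u"
  shows "imag_part (Qop S u u) = 0" "imag_part (Cop S u u u) = 0"
proof -
  define a where "a = (1/2) *\<^sub>R imag_part (Qop S u u)"
  define b where "b = (1/6) *\<^sub>R imag_part (Cop S u u u)"
  obtain K where K: "\<And>v. norm (imag_part v) \<le> norm v * K" "K > 0"
    using imag_part.pos_bounded by blast
  define M where "M = (norm u ^ 3 + 1) * K"
  have M: "M > 0" using K(2) by (simp add: M_def add_nonneg_pos)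
  have est: "\<exists>d>0. \<forall>t. 0 < t \<and> t < d \<longrightarrow> norm (a + t *\<^sub>R b) \<le> e * t * M" if e: "e > 0" for e
  proof -
    obtain \<delta> where \<delta>: "\<delta> > 0" "\<And>v. real_hist S v \<Longrightarrow> norm v < \<delta> \<Longrightarrow>
       norm (Gop S (v, 0) - (1/2) *\<^sub>R Qop S v v - (1/6) *\<^sub>R Cop S v v v) \<le> e * norm v ^ 3"
      using taylor e by blast
    have "norm (a + t *\<^sub>R b) \<le> e * t * M" if t: "0 < t" "t < \<delta> / (norm u + 1)" for t
    proof -
      define R where "R = Gop S (t *\<^sub>R u, 0) - (1/2) *\<^sub>R Qop S (t *\<^sub>R u) (t *\<^sub>R u)
         - (1/6) *\<^sub>R Cop S (t *\<^sub>R u) (t *\<^sub>R u) (t *\<^sub>R u)"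
      have "t * norm u \<le> t * (norm u + 1)" using t by simp
      also have "\<dots> < \<delta>"
        using t(2) pos_less_divide_eq[of "norm u + 1" t \<delta>] by (simp add: add_nonneg_pos)
      finally have "norm (t *\<^sub>R u) < \<delta>" using t by simp
      then have "norm R \<le> e * norm (t *\<^sub>R u) ^ 3"
        unfolding R_def by (intro \<delta> real_hist_scaleR u)
      then have R: "norm R \<le> e * t ^ 3 * norm u ^ 3"
        using t by (simp add: power_mult_distrib mult.assoc)
      have "imag_part (Gop S (t *\<^sub>R u, 0)) = 0"
        by (intro imag_part_real Gop_real zero_in_nbhd real_hist_scaleR u)
      then have "imag_part R = - ((t * t) *\<^sub>R (a + t *\<^sub>R b))"
        by (simp add: R_def a_def b_def imag_part.diff imag_part.scaleR Qop.scaleR_left Qop.scaleR_right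
            Cop_scaleR scaleR_add_right mult_ac)
      then have "(t * t) * norm (a + t *\<^sub>R b) = norm (imag_part R)" by simp
      also have "\<dots> \<le> norm R * K" by (rule K(1))
      also have "\<dots> \<le> (e * t ^ 3 * norm u ^ 3) * K" using R K(2) by (intro mult_right_mono) auto
      also have "\<dots> \<le> (t * t) * (e * t * M)"
        using e t K(2) by (simp add: M_def power3_eq_cube algebra_simps)
      finally show ?thesis using t by (simp add: mult_le_cancel_left)
    qed
    moreover have "\<delta> / (norm u + 1) > 0" using \<delta>(1) by (simp add: add_nonneg_pos)
    ultimately show ?thesis by blast
  qed
  have "norm a \<le> 0"
  proof (rule field_le_epsilon)
    fix e :: real assume e: "e > 0"
    obtain d where d: "d > 0" "\<And>t. 0 < t \<Longrightarrow> t < d \<Longrightarrow> norm (a + t *\<^sub>R b) \<le> 1 * t * M"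
      using est[of 1] by auto
    define t where "t = min (d / 2) (e / (M + norm b))"
    have Mb: "M + norm b > 0" using M by (simp add: add_pos_nonneg)
    have "t \<le> e / (M + norm b)" by (simp add: t_def)
    then have t: "0 < t" "t < d" "t * (M + norm b) \<le> e"
      using d(1) e Mb pos_le_divide_eq[OF Mb, of t e] by (auto simp: t_def min_less_iff_disj)
    have "norm a \<le> norm (a + t *\<^sub>R b) + norm (t *\<^sub>R b)"
      using norm_triangle_ineq4[of "a + t *\<^sub>R b" "t *\<^sub>R b"] by simp
    also have "\<dots> \<le> t * M + t * norm b"
      using d(2)[OF t(1,2)] t(1) by simp
    also have "\<dots> \<le> 0 + e" using t(3) by (simp add: algebra_simps)
    finally show "norm a \<le> 0 + e" .
  qed
  then have a: "a = 0" by simp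
  have "norm b \<le> 0"
  proof (rule field_le_epsilon)
    fix e :: real assume e: "e > 0"
    obtain d where d: "d > 0" "\<And>t. 0 < t \<Longrightarrow> t < d \<Longrightarrow> norm (a + t *\<^sub>R b) \<le> (e / M) * t * M"
      using est[of "e / M"] e M by auto
    have "norm (a + (d/2) *\<^sub>R b) \<le> (e / M) * (d/2) * M"
      by (rule d(2)) (use d(1) in auto)
    then show "norm b \<le> 0 + e"
      using d(1) M by (simp add: a)
  qed
  then have b: "b = 0" by simp
  show "imag_part (Qop S u u) = 0" using a by (simp add: a_def)
  show "imag_part (Cop S u u u) = 0" using b by (simp add: b_def)
qed

lemma imag_part_Qop:
  assumes "real_hist S u" "real_hist S v"
  shows "imag_part (Qop S u v) = 0"
proof -
  have "imag_part (Qop S (u + v) (u + v)) = 0"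
    by (intro imag_part_Qop_Cop_diag real_hist_add assms)
  then have "2 *\<^sub>R imag_part (Qop S u v) = 0"
    using imag_part_Qop_Cop_diag assms
    by (simp add: Qop.add_left Qop.add_right imag_part.add Qop_commute[of v u] scaleR_2)
  then show ?thesis by simp
qed

text \<open>
  Polarization in two steps: from \<open>u \<plusminus> v\<close> to \<open>C(u,u,v)\<close>, and from there to \<open>C(u,v,w)\<close>.
\<close>

lemma imag_part_Cop:
  assumes u: "real_hist S u" and v: "real_hist S v" and w: "real_hist S w"
  shows "imag_part (Cop S u v w) = 0"
proof -
  have uuv: "imag_part (Cop S u u v) = 0" if u: "real_hist S u" and v: "real_hist S v" for u v
  proof -
    have e: "Cop S (u + v) (u + v) (u + v) = Cop S u u u + 3 *\<^sub>R Cop S u u v + 3 *\<^sub>R Cop S u v v + Cop S v v v" for u v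
      using Cop_swap12[of v u] Cop_swap23[of u v u] Cop_swap23[of v u v]
      by (simp add: Cop_add scaleR_left_distrib[of 1 2, simplified] scaleR_2 algebra_simps)
    define X where "X = imag_part (Cop S u u v)"
    define Y where "Y = imag_part (Cop S u v v)"
    have diag: "imag_part (Cop S (u + v) (u + v) (u + v)) = 0" "imag_part (Cop S u u u) = 0"
      "imag_part (Cop S v v v) = 0" if "real_hist S u" "real_hist S v" for u v
      by (intro imag_part_Qop_Cop_diag real_hist_add that)+
    have p: "3 *\<^sub>R X + 3 *\<^sub>R Y = 0"
      using diag[OF u v] by (simp add: e imag_part.add imag_part.scaleR X_def Y_def)
    \<comment> \<open>Replacing v by -v changes the sign of X only.\<close>
    have m: "- (3 *\<^sub>R X) + 3 *\<^sub>R Y = 0"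
      using diag[OF u real_hist_scaleR[OF v, of "-1"]]
      by (simp only: e imag_part.add imag_part.scaleR X_def Y_def Cop_scaleR) simp
    have "3 *\<^sub>R Y = 3 *\<^sub>R X + (- (3 *\<^sub>R X) + 3 *\<^sub>R Y)" by simp
    then have "3 *\<^sub>R Y = 3 *\<^sub>R X" unfolding m by simp
    then have "(3 + 3) *\<^sub>R X = 0" using p by (simp only: scaleR_add_left)
    then show ?thesis by (simp add: X_def)
  qed
  have "imag_part (Cop S (u + v) (u + v) w) = 0"
    by (intro uuv real_hist_add u v w)
  then have "2 *\<^sub>R imag_part (Cop S u v w) = 0"
    using uuv[OF u w] uuv[OF v w]
    by (simp add: Cop_add imag_part.add Cop_swap12[of v u] scaleR_2)
  then show ?thesis by simp
qed

lemma history_linear_Qm: "history_linear (Qm S \<phi>)"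
  unfolding Qm_def[abs_def]
  by (rule history_linear_mode0) (simp_all add: Qop.add_right Qop_hist_op Qop_hscale_right)

lemma history_linear_Cm: "history_linear (Cm S \<phi> \<psi>)"
  unfolding Cm_def[abs_def]
  by (rule history_linear_mode0) (simp_all add: Cop_add Cop_hist_op Cop_hscale_right)

lemma Qm_commute: "Qm S \<phi> \<psi> = Qm S \<psi> \<phi>"
  by (simp add: Qm_def Qop_commute)

lemma Cm_swap12: "Cm S \<phi> \<psi> \<zeta> = Cm S \<psi> \<phi> \<zeta>"
  unfolding Cm_def by (subst Cop_swap12) simp

lemma Cm_swap23: "Cm S \<phi> \<psi> \<zeta> = Cm S \<phi> \<zeta> \<psi>"
  unfolding Cm_def by (subst Cop_swap23) simp

lemma history_linear_Qm_left: "history_linear (\<lambda>\<phi>. Qm S \<phi> \<psi>)"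
  using history_linear_Qm[of \<psi>] by (simp add: Qm_commute[of _ \<psi>])

lemma history_linear_Cm_middle: "history_linear (\<lambda>\<phi>. Cm S \<psi> \<phi> \<zeta>)"
  using history_linear_Cm[of \<psi> \<zeta>] by (simp add: Cm_swap23[of \<psi> _ \<zeta>])

lemma history_linear_Cm_left: "history_linear (\<lambda>\<phi>. Cm S \<phi> \<psi> \<zeta>)"
  using history_linear_Cm_middle[of \<psi> \<zeta>] by (simp add: Cm_swap12[of _ \<psi> \<zeta>])

lemma Qm_conj:
  assumes \<phi>: "continuous_on I \<phi>" and \<psi>: "continuous_on I \<psi>"
  shows "Qm S (\<lambda>\<theta>. vcnj (\<phi> \<theta>)) (\<lambda>\<theta>. vcnj (\<psi> \<theta>)) = vcnj (Qm S \<phi> \<psi>)"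
proof (rule history_linear_conj[OF history_linear_Qm_left history_linear_Qm_left _ \<phi>])
  fix \<phi> :: "real \<Rightarrow> complex^'m" assume \<phi>: "continuous_on I \<phi>" "\<And>\<theta>. vcnj (\<phi> \<theta>) = \<phi> \<theta>"
  show "Qm S \<phi> (\<lambda>\<theta>. vcnj (\<psi> \<theta>)) = vcnj (Qm S \<phi> \<psi>)"
  proof (rule history_linear_conj[OF history_linear_Qm history_linear_Qm _ \<psi>])
    fix \<psi> :: "real \<Rightarrow> complex^'m" assume "continuous_on I \<psi>" "\<And>\<theta>. vcnj (\<psi> \<theta>) = \<psi> \<theta>"
    with \<phi> show "Qm S \<phi> \<psi> = vcnj (Qm S \<phi> \<psi>)"
      unfolding Qm_def by (intro imag_part_zeroD[symmetric] imag_part_Qop real_hist_htens)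
  qed
qed

lemma Cm_conj:
  assumes \<phi>: "continuous_on I \<phi>" and \<psi>: "continuous_on I \<psi>" and \<zeta>: "continuous_on I \<zeta>"
  shows "Cm S (\<lambda>\<theta>. vcnj (\<phi> \<theta>)) (\<lambda>\<theta>. vcnj (\<psi> \<theta>)) (\<lambda>\<theta>. vcnj (\<zeta> \<theta>)) = vcnj (Cm S \<phi> \<psi> \<zeta>)"
proof (rule history_linear_conj[OF history_linear_Cm_left history_linear_Cm_left _ \<phi>])
  fix \<phi> :: "real \<Rightarrow> complex^'m" assume \<phi>: "continuous_on I \<phi>" "\<And>\<theta>. vcnj (\<phi> \<theta>) = \<phi> \<theta>"
  show "Cm S \<phi> (\<lambda>\<theta>. vcnj (\<psi> \<theta>)) (\<lambda>\<theta>. vcnj (\<zeta> \<theta>)) = vcnj (Cm S \<phi> \<psi> \<zeta>)"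
  proof (rule history_linear_conj[OF history_linear_Cm_middle history_linear_Cm_middle _ \<psi>])
    fix \<psi> :: "real \<Rightarrow> complex^'m" assume \<psi>: "continuous_on I \<psi>" "\<And>\<theta>. vcnj (\<psi> \<theta>) = \<psi> \<theta>"
    show "Cm S \<phi> \<psi> (\<lambda>\<theta>. vcnj (\<zeta> \<theta>)) = vcnj (Cm S \<phi> \<psi> \<zeta>)"
    proof (rule history_linear_conj[OF history_linear_Cm history_linear_Cm _ \<zeta>])
      fix \<zeta> :: "real \<Rightarrow> complex^'m" assume "continuous_on I \<zeta>" "\<And>\<theta>. vcnj (\<zeta> \<theta>) = \<zeta> \<theta>"
      with \<phi> \<psi> show "Cm S \<phi> \<psi> \<zeta> = vcnj (Cm S \<phi> \<psi> \<zeta>)"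
        unfolding Cm_def by (intro imag_part_zeroD[symmetric] imag_part_Cop real_hist_htens)
    qed
  qed
qed

lemma Qop_pointwise:
  assumes "continuous_on I \<phi>" "continuous_on I \<psi>"
  shows "AE x in Om S. ev S (Qop S (htens S \<phi> (ev S b)) (htens S \<psi> (ev S b')) $ i) x
          = Qm S \<phi> \<psi> $ i * ev S b x * ev S b' x"
  using setting assms unfolding pfde_setting_def acts_pointwise_def by simp

lemma Qop_pointwise_one:
  assumes "continuous_on I \<phi>" "continuous_on I \<psi>"
  shows "AE x in Om S. ev S (Qop S (htens S \<phi> (beta S 0)) (htens S \<psi> (ev S b)) $ i) x
          = Qm S \<phi> \<psi> $ i * ev S b x"
  using Qop_pointwise[OF assms, of one b i] ev_one
  unfolding htens_one htens_beta0 by eventually_elim simp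

lemma Qop_emb:
  assumes "continuous_on I \<phi>" "continuous_on I \<psi>"
  shows "Qop S (htens S \<phi> (beta S 0)) (htens S \<psi> (beta S 0)) = emb (Qm S \<phi> \<psi>)"
proof (rule emb_eqI)
  fix i
  show "AE x in Om S. ev S (Qop S (htens S \<phi> (beta S 0)) (htens S \<psi> (beta S 0)) $ i) x = Qm S \<phi> \<psi> $ i"
    using Qop_pointwise_one[OF assms, of one i] ev_one unfolding htens_one htens_beta0[of \<psi>]
    by eventually_elim simp
qed

lemma mode0_Qop:
  assumes "continuous_on I \<phi>" "continuous_on I f"
  shows "mode S 0 (Qop S (htens S \<phi> (beta S 0)) (hist S f)) = Qm S \<phi> (\<lambda>\<theta>. mode S 0 (f \<theta>))"
  unfolding Qm_def
  by (rule mode0_hist_op[of "Qop S (htens S \<phi> (beta S 0))" "Qm S \<phi>" f])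
     (use assms in \<open>auto simp: Qop.bounded_linear_right Qop_hist_op Qop_hscale_right Qop_pointwise_one\<close>)

end


section \<open>Stieltjes integrals and the bilinear form\<close>

lemma fine_tagged_division_exists:
  assumes "\<delta> > 0"
  shows "\<exists>p. p tagged_division_of {a..b::real} \<and> (\<forall>(x, K)\<in>p. diameter K < \<delta>)"
proof -
  have "gauge (\<lambda>x::real. ball x (\<delta> / 3))"
    using assms by (intro gauge_ball) auto
  then obtain p where p: "p tagged_division_of {a..b}" "(\<lambda>x. ball x (\<delta> / 3)) fine p"
    using fine_division_exists_real by blast
  have "diameter K < \<delta>" if "(x, K) \<in> p" for x K
  proof -
    have "K \<subseteq> ball x (\<delta> / 3)" using p(2) that unfolding fine_def by auto
    then have "diameter K \<le> diameter (ball x (\<delta> / 3))"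
      by (rule diameter_subset) simp
    also have "\<dots> < \<delta>" using assms by (simp add: diameter_ball)
    finally show ?thesis .
  qed
  with p(1) show ?thesis by blast
qed

lemma has_stieltjes_unique:
  assumes 1: "has_stieltjes r \<eta> F I" and 2: "has_stieltjes r \<eta> F J"
  shows "I = J"
proof -
  have "norm (I - J) \<le> e" if "e > 0" for e
  proof -
    have e: "e / 2 > 0" using that by simp
    obtain d1 where d1: "d1 > 0" "\<forall>p. p tagged_division_of {-r..0} \<and> (\<forall>(x, K)\<in>p. diameter K < d1) \<longrightarrow>
       norm ((\<Sum>(x, K)\<in>p. F x (\<eta> (Sup K) - \<eta> (Inf K))) - I) < e / 2"
      using 1 e unfolding has_stieltjes_def by blast
    obtain d2 where d2: "d2 > 0" "\<forall>p. p tagged_division_of {-r..0} \<and> (\<forall>(x, K)\<in>p. diameter K < d2) \<longrightarrow>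
       norm ((\<Sum>(x, K)\<in>p. F x (\<eta> (Sup K) - \<eta> (Inf K))) - J) < e / 2"
      using 2 e unfolding has_stieltjes_def by blast
    obtain p where p: "p tagged_division_of {-r..0}" "\<forall>(x, K)\<in>p. diameter K < min d1 d2"
      using fine_tagged_division_exists[of "min d1 d2" "-r" 0] d1(1) d2(1) by auto
    let ?s = "\<Sum>(x, K)\<in>p. F x (\<eta> (Sup K) - \<eta> (Inf K))"
    have "norm (?s - I) < e / 2" "norm (?s - J) < e / 2"
      using d1(2) d2(2) p by auto
    moreover have "norm (I - J) \<le> norm (?s - I) + norm (?s - J)"
      using norm_triangle_ineq4[of "?s - J" "?s - I"] by simp
    ultimately show ?thesis by simp
  qed
  then have "norm (I - J) \<le> 0"
    by (rule field_le_epsilon[of _ 0, simplified])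
  then show ?thesis by simp
qed

lemma stieltjes_eqI: "has_stieltjes r \<eta> F I \<Longrightarrow> stieltjes r \<eta> F = I"
  unfolding stieltjes_def using has_stieltjes_unique by (intro the_equality)

lemma has_stieltjes_cong:
  assumes "has_stieltjes r \<eta> F I" "\<And>x A. x \<in> {-r..0} \<Longrightarrow> F x A = G x A"
  shows "has_stieltjes r \<eta> G I"
proof -
  have eq: "(\<Sum>(x, K)\<in>p. G x (\<eta> (Sup K) - \<eta> (Inf K))) = (\<Sum>(x, K)\<in>p. F x (\<eta> (Sup K) - \<eta> (Inf K)))"
    if "p tagged_division_of {-r..0}" for p
    by (rule sum.cong) (use tagged_division_ofD(2,3)[OF that] assms(2) in force)+
  show ?thesis
    using assms(1) unfolding has_stieltjes_def by (simp add: eq cong: conj_cong imp_cong)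
qed

lemma has_stieltjes_linear:
  assumes g: "bounded_linear g" and F: "has_stieltjes r \<eta> F I"
  shows "has_stieltjes r \<eta> (\<lambda>x A. g (F x A)) (g I)"
  unfolding has_stieltjes_def
proof (intro allI impI)
  interpret g: bounded_linear g by (rule g)
  fix e :: real assume e: "e > 0"
  obtain B where B: "\<And>v. norm (g v) \<le> norm v * B" "B > 0"
    using g.pos_bounded by blast
  have "e / B > 0" using e B(2) by simp
  then obtain d where d: "d > 0" "\<forall>p. p tagged_division_of {-r..0} \<and> (\<forall>(x, K)\<in>p. diameter K < d) \<longrightarrow>
       norm ((\<Sum>(x, K)\<in>p. F x (\<eta> (Sup K) - \<eta> (Inf K))) - I) < e / B"
    using F unfolding has_stieltjes_def by blast
  have "norm ((\<Sum>(x, K)\<in>p. g (F x (\<eta> (Sup K) - \<eta> (Inf K)))) - g I) < e"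
    if "p tagged_division_of {-r..0}" "\<forall>(x, K)\<in>p. diameter K < d" for p
  proof -
    let ?s = "\<Sum>(x, K)\<in>p. F x (\<eta> (Sup K) - \<eta> (Inf K))"
    have "(\<Sum>(x, K)\<in>p. g (F x (\<eta> (Sup K) - \<eta> (Inf K)))) - g I = g (?s - I)"
      by (simp add: g.diff g.sum case_prod_unfold)
    also have "norm \<dots> \<le> norm (?s - I) * B" by (rule B(1))
    also have "\<dots> < e / B * B" using d(2) that B(2) by (intro mult_strict_right_mono) blast+
    finally show ?thesis using B(2) by simp
  qed
  then show "\<exists>\<delta>>0. \<forall>p. p tagged_division_of {-r..0} \<and> (\<forall>(x, K)\<in>p. diameter K < \<delta>) \<longrightarrow>
       norm ((\<Sum>(x, K)\<in>p. g (F x (\<eta> (Sup K) - \<eta> (Inf K)))) - g I) < e"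
    using d(1) by blast
qed

lemma has_stieltjes_zero: "has_stieltjes r \<eta> (\<lambda>_ _. 0) 0"
  unfolding has_stieltjes_def by (auto intro: exI[of _ 1])

lemma has_stieltjes_add:
  assumes F: "has_stieltjes r \<eta> F I" and G: "has_stieltjes r \<eta> G J"
  shows "has_stieltjes r \<eta> (\<lambda>x A. F x A + G x A) (I + J)"
  unfolding has_stieltjes_def
proof (intro allI impI)
  fix e :: real assume "e > 0"
  then have e: "e / 2 > 0" by simp
  obtain d1 where d1: "d1 > 0" "\<forall>p. p tagged_division_of {-r..0} \<and> (\<forall>(x, K)\<in>p. diameter K < d1) \<longrightarrow>
     norm ((\<Sum>(x, K)\<in>p. F x (\<eta> (Sup K) - \<eta> (Inf K))) - I) < e / 2"
    using F e unfolding has_stieltjes_def by blast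
  obtain d2 where d2: "d2 > 0" "\<forall>p. p tagged_division_of {-r..0} \<and> (\<forall>(x, K)\<in>p. diameter K < d2) \<longrightarrow>
     norm ((\<Sum>(x, K)\<in>p. G x (\<eta> (Sup K) - \<eta> (Inf K))) - J) < e / 2"
    using G e unfolding has_stieltjes_def by blast
  have "norm ((\<Sum>(x, K)\<in>p. F x (\<eta> (Sup K) - \<eta> (Inf K)) + G x (\<eta> (Sup K) - \<eta> (Inf K))) - (I + J)) < e"
    if p: "p tagged_division_of {-r..0}" "\<forall>(x, K)\<in>p. diameter K < min d1 d2" for p
  proof -
    have "norm ((\<Sum>(x, K)\<in>p. F x (\<eta> (Sup K) - \<eta> (Inf K))) - I) < e / 2"
      "norm ((\<Sum>(x, K)\<in>p. G x (\<eta> (Sup K) - \<eta> (Inf K))) - J) < e / 2"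
      using d1(2) d2(2) p by auto
    from add_strict_mono[OF this] show ?thesis
      by (intro le_less_trans[OF _ \<open>_ < e / 2 + e / 2\<close>[simplified]] order_trans[OF _ norm_triangle_ineq])
         (simp add: case_prod_unfold sum.distrib algebra_simps)
  qed
  then show "\<exists>\<delta>>0. \<forall>p. p tagged_division_of {-r..0} \<and> (\<forall>(x, K)\<in>p. diameter K < \<delta>) \<longrightarrow>
       norm ((\<Sum>(x, K)\<in>p. F x (\<eta> (Sup K) - \<eta> (Inf K)) + G x (\<eta> (Sup K) - \<eta> (Inf K))) - (I + J)) < e"
    using d1(1) d2(1) by (intro exI[of _ "min d1 d2"]) auto
qed

lemma has_stieltjes_sum:
  assumes "finite B" "\<And>j. j \<in> B \<Longrightarrow> has_stieltjes r \<eta> (F j) (J j)"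
  shows "has_stieltjes r \<eta> (\<lambda>x A. \<Sum>j\<in>B. F j x A) (\<Sum>j\<in>B. J j)"
  using assms by (induction B rule: finite_induct) (simp_all add: has_stieltjes_zero has_stieltjes_add)

text \<open>
  The hypothesis on \<open>\<eta>\<^sub>0\<close> concerns vector-valued integrands \<open>d\<eta>\<^sub>0(\<theta>) \<psi>(\<theta>)\<close>; a matrix-valued integral is
  assembled from its columns.
\<close>

lemma matrix_eq_sum_columns:
  "c *m A = (\<Sum>j\<in>UNIV. (\<chi> i k. if k = j then (A *v (c *s axis j 1)) $ i else 0))"
  by (simp add: vec_eq_iff mscale_def matrix_vector_mult_def axis_def if_distrib mult.commute
      cong: if_cong)

lemma bounded_linear_column:
  "bounded_linear (\<lambda>v :: complex^'n. (\<chi> i k. if k = j then v $ i else 0) :: complex^'n^'n)"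
proof -
  have "linear (\<lambda>v :: complex^'n. (\<chi> i k. if k = j then v $ i else 0) :: complex^'n^'n)"
    by (rule linearI) (simp_all add: vec_eq_iff)
  then show ?thesis by (simp add: linear_conv_bounded_linear)
qed

locale hopf_steady = pfde_system S for S :: "('x::{real_inner,banach}, 'm::finite) pfde" +
  assumes bifurcation: "hopf_steady_bifurcation S"
    and bases: "hopf_steady_bases S"
    and modes: "kS S = 0" "kH S = 0"
begin

abbreviation \<Lambda> :: "(real \<Rightarrow> complex^'m) \<Rightarrow> complex^'m"
  where "\<Lambda> \<equiv> Lm S (Lop S 0)"

lemma history_linear_\<Lambda>: "history_linear \<Lambda>"
  by (rule history_linear_Lm[OF zero_in_nbhd])

lemmas \<Lambda>_add = history_linear_add[OF history_linear_\<Lambda>]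
  and \<Lambda>_diff = history_linear_diff[OF history_linear_\<Lambda>]
  and \<Lambda>_scale = history_linear_scale[OF history_linear_\<Lambda>]
  and \<Lambda>_sum = history_linear_sum[OF history_linear_\<Lambda>]
  and \<Lambda>_cong = history_linear_cong[OF history_linear_\<Lambda>]
  and \<Lambda>_conj = Lm_conj[OF zero_in_nbhd]

lemma mu_0 [simp]: "mu S 0 = 0"
  by (simp add: mu_def)

lemma lin_mode_0: "lin_mode S 0 = \<Lambda>"
  by (simp add: fun_eq_iff vec_eq_iff lin_mode_def)

lemma has_stieltjes_eta:
  "continuous_on I \<psi> \<Longrightarrow> has_stieltjes (delay S) (eta S 0) (\<lambda>\<theta> A. A *v \<psi> \<theta>) (\<Lambda> \<psi>)"
  using bases unfolding hopf_steady_bases_def lin_mode_0[symmetric] by blast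

text \<open>
  The matrix \<open>\<integral>f(\<theta>) d\<eta>\<^sub>0(\<theta>)\<close>.
\<close>

definition eta_integral :: "(real \<Rightarrow> complex) \<Rightarrow> complex^'m^'m"
  where "eta_integral f = stieltjes (delay S) (eta S 0) (\<lambda>\<theta> A. f \<theta> *m A)"

lemma continuous_on_vscale [continuous_intros]:
  "continuous_on A f \<Longrightarrow> continuous_on A g \<Longrightarrow> continuous_on A (\<lambda>\<theta>. f \<theta> *s (g \<theta> :: complex^'m))"
  by (rule vscale.continuous_on)

lemma has_stieltjes_eta_integral:
  assumes f: "continuous_on I f"
  shows "has_stieltjes (delay S) (eta S 0) (\<lambda>\<theta> A. f \<theta> *m A) (eta_integral f)"
    and eta_integral_mult_vec: "eta_integral f *v E = \<Lambda> (\<lambda>\<theta>. f \<theta> *s E)"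
proof -
  define M where "M = (\<Sum>j\<in>UNIV. (\<chi> i k. if k = j then \<Lambda> (\<lambda>\<theta>. f \<theta> *s axis j 1) $ i else 0) :: complex^'m^'m)"
  have cont: "continuous_on I (\<lambda>\<theta>. f \<theta> *s v)" for v :: "complex^'m"
    by (intro continuous_intros f)
  have "has_stieltjes (delay S) (eta S 0) (\<lambda>\<theta> A. f \<theta> *m A) M"
    unfolding M_def matrix_eq_sum_columns
    by (intro has_stieltjes_sum has_stieltjes_linear[OF bounded_linear_column] has_stieltjes_eta cont) simp
  moreover from this have M: "eta_integral f = M"
    unfolding eta_integral_def by (rule stieltjes_eqI)
  ultimately show "has_stieltjes (delay S) (eta S 0) (\<lambda>\<theta> A. f \<theta> *m A) (eta_integral f)"
    by simp
  have "E = (\<Sum>j\<in>UNIV. E $ j *s axis j 1)"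
    by (simp add: vec_eq_iff axis_def if_distrib cong: if_cong)
  then have "(\<lambda>\<theta>. f \<theta> *s E) = (\<lambda>\<theta>. \<Sum>j\<in>UNIV. E $ j *s (f \<theta> *s axis j 1))"
    by (simp add: fun_eq_iff vec_eq_iff axis_def if_distrib mult.commute cong: if_cong)
  then have "\<Lambda> (\<lambda>\<theta>. f \<theta> *s E) = \<Lambda> (\<lambda>\<theta>. \<Sum>j\<in>UNIV. E $ j *s (f \<theta> *s axis j 1))"
    by (rule arg_cong)
  also have "\<dots> = (\<Sum>j\<in>UNIV. \<Lambda> (\<lambda>\<theta>. E $ j *s (f \<theta> *s axis j 1)))"
    by (rule \<Lambda>_sum) (rule continuous_on_vscale_const[OF cont])
  also have "\<dots> = (\<Sum>j\<in>UNIV. E $ j *s \<Lambda> (\<lambda>\<theta>. f \<theta> *s axis j 1))"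
    by (rule sum.cong[OF refl], rule \<Lambda>_scale[OF cont])
  also have "\<dots> = M *v E"
    by (simp add: vec_eq_iff M_def matrix_vector_mult_def mult.commute if_distrib if_distribR cong: if_cong)
  finally show "eta_integral f *v E = \<Lambda> (\<lambda>\<theta>. f \<theta> *s E)"
    by (simp add: M)
qed


subsection \<open>The three critical eigenvalues\<close>

text \<open>
  The critical eigenvalues \<open>0\<close>, \<open>\<i>\<omega>\<^sub>0\<close>, \<open>-\<i>\<omega>\<^sub>0\<close> and the vectors \<open>\<phi>\<^sub>j(0)\<close>, \<open>\<psi>\<^sub>j(0)\<close> belonging to them are
  indexed by the type \<open>3\<close>, like the coordinates of \<open>z\<close>, so that the three cases can be treated together; the index
  \<open>3\<close> stands for the complex conjugate of the index \<open>2\<close>.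
\<close>

definition lam :: "3 \<Rightarrow> complex"
  where "lam j = (if j = 1 then 0 else if j = 2 then \<i> * complex_of_real (om0 S) else - \<i> * complex_of_real (om0 S))"

definition phi_vec :: "3 \<Rightarrow> complex^'m"
  where "phi_vec j = (if j = 1 then phi10 S else if j = 2 then phi20 S else vcnj (phi20 S))"

definition psi_vec :: "3 \<Rightarrow> complex^'m"
  where "psi_vec j = (if j = 1 then psi10 S else if j = 2 then psi20 S else vcnj (psi20 S))"

definition expo_fun :: "complex \<Rightarrow> complex^'m \<Rightarrow> real \<Rightarrow> complex^'m"
  where "expo_fun \<mu> v \<theta> = exp (\<mu> * complex_of_real \<theta>) *s v"

definition Phi :: "3 \<Rightarrow> real \<Rightarrow> complex^'m"
  where "Phi j = expo_fun (lam j) (phi_vec j)"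

definition conj3 :: "3 \<Rightarrow> 3"
  where "conj3 j = (if j = 1 then 1 else if j = 2 then 3 else 2)"

lemma exhaust_index3: "j = 1 \<or> j = 2 \<or> j = 3" for j :: 3
  using exhaust_3[of j] by auto

lemma om0_pos: "om0 S > 0"
  using bifurcation by (simp add: hopf_steady_bifurcation_def H4_def)

lemma lam_simps [simp]: "lam 1 = 0" "lam 2 = \<i> * complex_of_real (om0 S)" "lam 3 = - \<i> * complex_of_real (om0 S)"
  by (simp_all add: lam_def)

lemma phi1_eq: "phi1 S = Phi 1" and phi2_eq: "phi2 S = Phi 2" and phi2b_eq: "phi2b S = Phi 3"
  by (simp_all add: fun_eq_iff phi1_def phi2_def phi2b_def Phi_def expo_fun_def phi_vec_def
      exp_cnj mult.assoc)

lemma psi1_eq: "psi1 S = expo_fun (- lam 1) (psi_vec 1)"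
  and psi2_eq: "psi2 S = expo_fun (- lam 2) (psi_vec 2)"
  and psi2b_eq: "psi2b S = expo_fun (- lam 3) (psi_vec 3)"
  by (simp_all add: fun_eq_iff psi1_def psi2_def psi2b_def expo_fun_def psi_vec_def exp_cnj mult.assoc)

lemma lam_conj3: "lam (conj3 j) = cnj (lam j)"
  using exhaust_index3[of j] by (auto simp: conj3_def)

lemma real_vectors: "vcnj (phi10 S) = phi10 S" "vcnj (psi10 S) = psi10 S"
  using bases by (simp_all add: hopf_steady_bases_def)

lemma phi_vec_conj3: "phi_vec (conj3 j) = vcnj (phi_vec j)"
  and psi_vec_conj3: "psi_vec (conj3 j) = vcnj (psi_vec j)"
  using exhaust_index3[of j] by (auto simp: conj3_def phi_vec_def psi_vec_def real_vectors)

lemma expo_fun_0 [simp]: "expo_fun \<mu> v 0 = v"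
  by (simp add: expo_fun_def)

lemma expo_fun_cnj: "vcnj (expo_fun \<mu> v \<theta>) = expo_fun (cnj \<mu>) (vcnj v) \<theta>"
  by (simp add: expo_fun_def exp_cnj)

lemma expo_fun_scale: "c *s expo_fun \<mu> v \<theta> = expo_fun \<mu> (c *s v) \<theta>"
  by (simp add: expo_fun_def mult.commute)

lemma exp_has_vector_derivative:
  "((\<lambda>\<theta>. exp (\<mu> * complex_of_real \<theta>)) has_vector_derivative \<mu> * exp (\<mu> * complex_of_real \<theta>)) (at \<theta> within A)"
proof -
  have "((\<lambda>z. exp (\<mu> * z)) has_field_derivative \<mu> * exp (\<mu> * complex_of_real \<theta>)) (at (complex_of_real \<theta>))"
    by (auto intro!: derivative_eq_intros simp: mult.commute)
  then show ?thesis by (rule has_vector_derivative_real_field)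
qed

lemma expo_fun_derivative:
  "(expo_fun \<mu> v has_vector_derivative \<mu> *s expo_fun \<mu> v \<theta>) (at \<theta> within A)"
proof -
  from bounded_linear.has_vector_derivative[OF vscale.bounded_linear_left[of v] exp_has_vector_derivative]
  show ?thesis by (simp add: expo_fun_def[abs_def])
qed

lemma continuous_on_expo_fun [continuous_intros]: "continuous_on A (expo_fun \<mu> v)"
  by (rule continuous_on_vector_derivative) (rule expo_fun_derivative)

lemma continuous_on_Phi [continuous_intros]: "continuous_on A (Phi j)"
  by (simp add: Phi_def continuous_on_expo_fun)

lemma Phi_0 [simp]: "Phi j 0 = phi_vec j"
  by (simp add: Phi_def)

lemma Phi_conj3: "Phi (conj3 j) \<theta> = vcnj (Phi j \<theta>)"
  by (simp add: Phi_def expo_fun_cnj lam_conj3 phi_vec_conj3)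

lemma \<Lambda>_expo_conj: "\<Lambda> (expo_fun (cnj \<mu>) (vcnj v)) = vcnj (\<Lambda> (expo_fun \<mu> v))"
  using \<Lambda>_conj[OF continuous_on_expo_fun, of \<mu> v] by (simp add: expo_fun_cnj)

lemma eigenspace_12:
  assumes "j = 1 \<or> j = 2"
  shows "\<Lambda> (Phi j) = lam j *s phi_vec j"
    and "\<Lambda> (expo_fun (lam j) E) = lam j *s E \<Longrightarrow> \<exists>c. E = c *s phi_vec j"
proof -
  have sp: "spans_eigenspace S 0 (lam j) (Phi j)"
    using assms bases modes phi1_eq phi2_eq unfolding hopf_steady_bases_def by auto
  then show "\<Lambda> (Phi j) = lam j *s phi_vec j"
    unfolding spans_eigenspace_def eigenfun_def lin_mode_0 by simp
  assume E: "\<Lambda> (expo_fun (lam j) E) = lam j *s E"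
  have "eigenfun S 0 (lam j) (expo_fun (lam j) E)"
    unfolding eigenfun_def lin_mode_0 using E expo_fun_derivative by auto
  then obtain c where "\<forall>\<theta>\<in>I. expo_fun (lam j) E \<theta> = c *s Phi j \<theta>"
    using sp unfolding spans_eigenspace_def by blast
  then have "expo_fun (lam j) E 0 = c *s Phi j 0" using zero_in_I by blast
  then show "\<exists>c. E = c *s phi_vec j" by auto
qed

lemma \<Lambda>_Phi: "\<Lambda> (Phi j) = lam j *s phi_vec j"
proof -
  have "\<Lambda> (Phi 3) = lam 3 *s phi_vec 3"
    using eigenspace_12(1)[of 2] \<Lambda>_expo_conj[of "lam 2" "phi_vec 2"]
      lam_conj3[of 2] phi_vec_conj3[of 2]
    by (simp add: Phi_def conj3_def)
  then show ?thesis
    using exhaust_index3[of j] eigenspace_12(1) by auto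
qed

text \<open>
  Conjugation maps the eigenspace of \<open>\<i>\<omega>\<^sub>0\<close> onto that of \<open>-\<i>\<omega>\<^sub>0\<close>.
\<close>

lemma eigenspace:
  assumes "\<Lambda> (expo_fun (lam j) E) = lam j *s E"
  shows "\<exists>c. E = c *s phi_vec j"
proof (cases "j = 3")
  case True
  have "\<Lambda> (expo_fun (lam 2) (vcnj E)) = lam 2 *s vcnj E"
    using assms \<Lambda>_expo_conj[of "lam 3" E] by (simp add: True)
  then obtain c where c: "vcnj E = c *s phi_vec 2"
    using eigenspace_12(2)[of 2 "vcnj E"] by auto
  have "E = vcnj (vcnj E)" by simp
  also have "\<dots> = cnj c *s phi_vec 3"
    unfolding c using phi_vec_conj3[of 2] by (simp add: conj3_def)
  finally have "E = cnj c *s phi_vec 3" .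
  then show ?thesis using True by blast
next
  case False
  then have "j = 1 \<or> j = 2" using exhaust_index3[of j] by simp
  then show ?thesis using assms by (rule eigenspace_12(2))
qed

text \<open>
  The eigenvalue equation of the adjoint says that the row vector \<open>\<psi>\<^sub>j(0)\<close> annihilates
  \<open>\<lambda>\<^sub>j - \<integral>e\<^bsup>\<lambda>\<^sub>j\<theta>\<^esup> d\<eta>\<^sub>0(\<theta>)\<close> from the left; here it is applied to \<open>v\<close>.
\<close>

lemma adjoint_12:
  assumes "j = 1 \<or> j = 2"
  shows "psi_vec j \<odot> \<Lambda> (expo_fun (lam j) v) = lam j * (psi_vec j \<odot> v)"
proof -
  let ?\<psi> = "expo_fun (- lam j) (psi_vec j)"
  have "adjoint_eigenfun S 0 (lam j) ?\<psi>"
    using assms bases modes psi1_eq psi2_eq unfolding hopf_steady_bases_def by auto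
  then have 1: "lam j *s psi_vec j = stieltjes (delay S) (eta S 0) (\<lambda>\<theta> A. ?\<psi> (- \<theta>) v* A)"
    unfolding adjoint_eigenfun_def by simp
  let ?f = "\<lambda>\<theta>. exp (lam j * complex_of_real \<theta>)"
  have f: "continuous_on I ?f" by (intro continuous_intros)
  have "linear ((v*) (psi_vec j))"
    by (rule linearI) (simp_all add: vec_eq_iff vector_matrix_mult_def sum.distrib sum_distrib_left
        scaleR_conv_of_real[where 'a = complex] algebra_simps)
  then have "bounded_linear ((v*) (psi_vec j))"
    by (simp add: linear_conv_bounded_linear)
  from has_stieltjes_linear[OF this has_stieltjes_eta_integral(1)[OF f]]
  have "has_stieltjes (delay S) (eta S 0) (\<lambda>\<theta> A. ?\<psi> (- \<theta>) v* A) (psi_vec j v* eta_integral ?f)"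
    by (rule has_stieltjes_cong)
       (simp add: vec_eq_iff vector_matrix_mult_def expo_fun_def mscale_def mult_ac)
  then have "lam j *s psi_vec j = psi_vec j v* eta_integral ?f"
    unfolding 1 by (rule stieltjes_eqI)
  then have "(lam j *s psi_vec j) \<odot> v = psi_vec j \<odot> (eta_integral ?f *v v)"
    by (simp only: vec_mult_dotc)
  then show ?thesis
    by (simp add: eta_integral_mult_vec[OF f] expo_fun_def[abs_def])
qed

lemma adjoint: "psi_vec j \<odot> \<Lambda> (expo_fun (lam j) v) = lam j * (psi_vec j \<odot> v)"
proof (cases "j = 3")
  case True
  have "psi_vec 3 \<odot> \<Lambda> (expo_fun (lam 3) v) = cnj (psi_vec 2 \<odot> \<Lambda> (expo_fun (lam 2) (vcnj v)))"
    using \<Lambda>_expo_conj[of "lam 2" "vcnj v"] psi_vec_conj3[of 2] by (simp add: cnj_dotc conj3_def)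
  also have "\<dots> = cnj (lam 2 * (psi_vec 2 \<odot> vcnj v))"
    by (subst adjoint_12) auto
  also have "\<dots> = lam 3 * (psi_vec 3 \<odot> v)"
    using psi_vec_conj3[of 2] by (simp add: cnj_dotc conj3_def)
  finally show ?thesis by (simp add: True)
next
  case False
  then have "j = 1 \<or> j = 2" using exhaust_index3[of j] by simp
  then show ?thesis by (rule adjoint_12)
qed

lemma char_fun_0: "char_fun S 0 0 \<zeta> = det (mat \<zeta> - eta_integral (\<lambda>\<theta>. exp (\<zeta> * complex_of_real \<theta>)))"
proof -
  have "continuous_on I (\<lambda>\<theta>. exp (\<zeta> * complex_of_real \<theta>))"
    by (intro continuous_intros)
  note * = eta_integral_mult_vec[OF this, symmetric]
  have col: "(A *v axis j 1) $ i = A $ i $ j" for A :: "complex^'m^'m" and i j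
    by (simp add: matrix_vector_mult_def axis_def if_distrib cong: if_cong)
  have "(\<chi> i j. \<Lambda> (\<lambda>\<theta>. exp (\<zeta> * complex_of_real \<theta>) *s axis j 1) $ i)
      = eta_integral (\<lambda>\<theta>. exp (\<zeta> * complex_of_real \<theta>))"
    by (simp add: vec_eq_iff * col)
  moreover have "(0 :: complex) *m D = 0" for D :: "complex^'m^'m"
    by (simp add: vec_eq_iff mscale_def)
  ultimately show ?thesis
    unfolding char_fun_def by simp
qed

text \<open>
  The determinant is the characteristic function of the mode \<open>0\<close>, and all its roots other than the
  critical eigenvalues lie off the imaginary axis.
\<close>

lemma invertible_characteristic:
  assumes "Re \<zeta> = 0" "\<And>j. \<zeta> \<noteq> lam j"
  shows "invertible (mat \<zeta> - eta_integral (\<lambda>\<theta>. exp (\<zeta> * complex_of_real \<theta>)))"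
proof -
  have "H4 S" using bifurcation by (simp add: hopf_steady_bifurcation_def)
  then have "char_fun S 0 0 \<zeta> \<noteq> 0"
    unfolding H4_def
  proof (elim conjE exE)
    fix \<gamma> \<nu> \<omega>
    assume roots: "\<forall>\<alpha>\<in>nbhd S.
          simple_root (char_fun S (kS S) \<alpha>) (complex_of_real (\<gamma> \<alpha>)) \<and>
          \<omega> \<alpha> \<noteq> 0 \<and>
          simple_root (char_fun S (kH S) \<alpha>) (Complex (\<nu> \<alpha>) (\<omega> \<alpha>)) \<and>
          simple_root (char_fun S (kH S) \<alpha>) (Complex (\<nu> \<alpha>) (- \<omega> \<alpha>)) \<and>
          (\<forall>k \<zeta>. char_fun S k \<alpha> \<zeta> = 0 \<and>
             \<not> (k = kS S \<and> \<zeta> = complex_of_real (\<gamma> \<alpha>)) \<and>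
             \<not> (k = kH S \<and> \<zeta> \<in> {Complex (\<nu> \<alpha>) (\<omega> \<alpha>), Complex (\<nu> \<alpha>) (- \<omega> \<alpha>)}) \<longrightarrow> Re \<zeta> \<noteq> 0)"
      and at_0: "\<gamma> 0 = 0" "\<nu> 0 = 0" "\<omega> 0 = om0 S"
    have lam: "Complex 0 (om0 S) = lam 2" "Complex 0 (- om0 S) = lam 3"
      by (simp_all add: complex_eq_iff)
    have other: "\<forall>k \<zeta>. char_fun S k 0 \<zeta> = 0 \<and>
             \<not> (k = kS S \<and> \<zeta> = complex_of_real (\<gamma> 0)) \<and>
             \<not> (k = kH S \<and> \<zeta> \<in> {Complex (\<nu> 0) (\<omega> 0), Complex (\<nu> 0) (- \<omega> 0)}) \<longrightarrow> Re \<zeta> \<noteq> 0"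
      using bspec[OF roots zero_in_nbhd] by (elim conjE)
    show "char_fun S 0 0 \<zeta> \<noteq> 0"
    proof
      assume "char_fun S 0 0 \<zeta> = 0"
      moreover have "\<zeta> \<noteq> 0" "\<zeta> \<noteq> lam 2" "\<zeta> \<noteq> lam 3"
        using assms(2)[of 1] assms(2)[of 2] assms(2)[of 3] by simp_all
      ultimately have "Re \<zeta> \<noteq> 0"
        by (intro other[rule_format, of 0]) (simp only: at_0 lam of_real_0 insert_iff empty_iff, blast)
      with assms(1) show False by simp
    qed
  qed
  then show ?thesis
    by (simp add: char_fun_0 invertible_det_nz)
qed

subsection \<open>The bilinear form\<close>

text \<open>
  \<open>\<integral>\<^sub>\<theta>\<^sup>0 e\<^bsup>\<mu>(\<theta>-\<xi>)\<^esup>\<phi>(\<xi>) d\<xi>\<close>, the inner integral of the bilinear form against an exponential, without its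
  constant row vector.
\<close>

definition conv :: "complex \<Rightarrow> (real \<Rightarrow> complex^'m) \<Rightarrow> real \<Rightarrow> complex^'m"
  where "conv \<mu> \<phi> \<theta> = exp (\<mu> * complex_of_real \<theta>) *s integral {\<theta>..0} (\<lambda>\<xi>. exp (- \<mu> * complex_of_real \<xi>) *s \<phi> \<xi>)"

text \<open>
  The bilinear form with the eigenfunction \<open>\<psi>\<^sub>j\<close>, its Stieltjes integral being expressed by \<open>L\<^sub>0\<close>; see
  \<open>pairing_eq_form\<close>.
\<close>

definition form :: "3 \<Rightarrow> (real \<Rightarrow> complex^'m) \<Rightarrow> complex"
  where "form j \<phi> = psi_vec j \<odot> (\<phi> 0 + \<Lambda> (conv (lam j) \<phi>))"

lemma continuous_on_weighted:
  assumes "continuous_on I \<phi>"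
  shows "continuous_on I (\<lambda>\<xi>. exp (- \<mu> * complex_of_real \<xi>) *s (\<phi> \<xi> :: complex^'m))"
  by (rule continuous_on_vscale[OF _ assms]) (intro continuous_intros)

lemma weighted_integrable:
  assumes "continuous_on I \<phi>" "\<theta> \<in> I"
  shows "(\<lambda>\<xi>. exp (- \<mu> * complex_of_real \<xi>) *s (\<phi> \<xi> :: complex^'m)) integrable_on {\<theta>..0}"
  by (rule integrable_continuous_real, rule continuous_on_subset[OF continuous_on_weighted[OF assms(1)]])
     (use assms(2) in auto)

lemma continuous_on_conv:
  assumes "continuous_on I \<phi>"
  shows "continuous_on I (conv \<mu> \<phi>)"
proof -
  have "continuous_on I (\<lambda>\<theta>. integral {\<theta>..0} (\<lambda>\<xi>. exp (- \<mu> * complex_of_real \<xi>) *s \<phi> \<xi>))"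
    by (rule continuous_on_vector_derivative,
        rule integral_has_vector_derivative'[OF continuous_on_weighted[OF assms]]) auto
  then show ?thesis
    unfolding conv_def[abs_def] by (intro continuous_on_vscale) (intro continuous_intros)
qed

lemma conv_eq_integral:
  assumes \<phi>: "continuous_on I \<phi>" and \<theta>: "\<theta> \<in> I"
  shows "integral {\<theta>..0} (\<lambda>\<xi>. expo_fun (- \<mu>) p (\<xi> - \<theta>) \<odot> (A *v \<phi> \<xi>)) = p \<odot> (A *v conv \<mu> \<phi> \<theta>)"
proof -
  have bl: "bounded_linear (\<lambda>v. p \<odot> (A *v v))"
    by (rule bounded_linear_compose[OF bounded_linear_dotc bounded_linear_matrix_vec])
  have "expo_fun (- \<mu>) p (\<xi> - \<theta>) \<odot> (A *v \<phi> \<xi>)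
      = exp (\<mu> * complex_of_real \<theta>) * (p \<odot> (A *v (exp (- \<mu> * complex_of_real \<xi>) *s \<phi> \<xi>)))" for \<xi>
    unfolding expo_fun_def vector_scalar_commute dotc_scale dotc_scale_left mult.assoc[symmetric] exp_add[symmetric]
    by (simp add: algebra_simps)
  then have "integral {\<theta>..0} (\<lambda>\<xi>. expo_fun (- \<mu>) p (\<xi> - \<theta>) \<odot> (A *v \<phi> \<xi>))
      = exp (\<mu> * complex_of_real \<theta>) * integral {\<theta>..0} (\<lambda>\<xi>. p \<odot> (A *v (exp (- \<mu> * complex_of_real \<xi>) *s \<phi> \<xi>)))"
    by simp
  also have "\<dots> = exp (\<mu> * complex_of_real \<theta>) * (p \<odot> (A *v integral {\<theta>..0} (\<lambda>\<xi>. exp (- \<mu> * complex_of_real \<xi>) *s \<phi> \<xi>)))"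
    using integral_linear[OF weighted_integrable[OF \<phi> \<theta>, of \<mu>] bl] by (simp add: o_def)
  finally show ?thesis
    by (simp add: conv_def vector_scalar_commute)
qed

lemma pairing_eq_form:
  assumes \<phi>: "continuous_on I \<phi>"
  shows "pairing S 0 (expo_fun (- lam j) (psi_vec j)) \<phi> = form j \<phi>"
proof -
  have bl: "bounded_linear (\<lambda>v. - (psi_vec j \<odot> v))"
    by (intro bounded_linear_minus bounded_linear_dotc)
  have "has_stieltjes (delay S) (eta S 0)
      (\<lambda>\<theta> A. - integral {\<theta>..0} (\<lambda>\<xi>. expo_fun (- lam j) (psi_vec j) (\<xi> - \<theta>) \<odot> (A *v \<phi> \<xi>)))
      (- (psi_vec j \<odot> \<Lambda> (conv (lam j) \<phi>)))"
    by (rule has_stieltjes_cong[OF has_stieltjes_linear[OF bl has_stieltjes_eta[OF continuous_on_conv[OF \<phi>]]]])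
       (simp add: conv_eq_integral[OF \<phi>])
  from stieltjes_eqI[OF this] show ?thesis
    by (simp add: pairing_def form_def)
qed

text \<open>
  A single point does not contribute to the inner integral.
\<close>

lemma pairing_X0:
  "pairing S 0 (expo_fun (- lam j) (psi_vec j)) (X0 F) = psi_vec j \<odot> F"
proof -
  have "integral {\<theta>..0} (\<lambda>\<xi>. \<psi> (\<xi> - \<theta>) \<odot> (A *v X0 F \<xi>)) = integral {\<theta>..0} (\<lambda>_. 0)"
    for \<psi> \<theta> and A :: "complex^'m^'m"
    by (rule integral_spike[of "{0}"]) (auto simp: X0_def)
  then show ?thesis
    using stieltjes_eqI[OF has_stieltjes_zero] by (simp add: pairing_def X0_def)
qed

lemma conv_add:
  assumes "continuous_on I \<phi>" "continuous_on I \<psi>" "\<theta> \<in> I"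
  shows "conv \<mu> (\<lambda>\<theta>. \<phi> \<theta> + \<psi> \<theta>) \<theta> = conv \<mu> \<phi> \<theta> + conv \<mu> \<psi> \<theta>"
  using Henstock_Kurzweil_Integration.integral_add[OF weighted_integrable[OF assms(1,3), of \<mu>] weighted_integrable[OF assms(2,3), of \<mu>]]
  by (simp add: conv_def vec.scale_right_distrib)

lemma conv_scale:
  assumes "continuous_on I \<phi>" "\<theta> \<in> I"
  shows "conv \<mu> (\<lambda>\<theta>. c *s \<phi> \<theta>) \<theta> = c *s conv \<mu> \<phi> \<theta>"
  using integral_linear[OF weighted_integrable[OF assms, of \<mu>] vscale.bounded_linear_right[of c]]
  by (simp add: conv_def o_def mult.commute mult.left_commute)

lemma conv_conj:
  assumes "continuous_on I \<phi>" "\<theta> \<in> I"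
  shows "conv (cnj \<mu>) (\<lambda>\<theta>. vcnj (\<phi> \<theta>)) \<theta> = vcnj (conv \<mu> \<phi> \<theta>)"
  using integral_linear[OF weighted_integrable[OF assms, of \<mu>] bounded_linear_vcnj]
  by (simp add: conv_def o_def exp_cnj)

lemma form_add:
  assumes "continuous_on I \<phi>" "continuous_on I \<psi>"
  shows "form j (\<lambda>\<theta>. \<phi> \<theta> + \<psi> \<theta>) = form j \<phi> + form j \<psi>"
proof -
  have "\<Lambda> (conv (lam j) (\<lambda>\<theta>. \<phi> \<theta> + \<psi> \<theta>)) = \<Lambda> (\<lambda>\<theta>. conv (lam j) \<phi> \<theta> + conv (lam j) \<psi> \<theta>)"
    by (rule \<Lambda>_cong) (rule conv_add[OF assms])
  then show ?thesis
    using assms by (simp add: form_def \<Lambda>_add continuous_on_conv algebra_simps)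
qed

lemma form_scale:
  assumes "continuous_on I \<phi>"
  shows "form j (\<lambda>\<theta>. c *s \<phi> \<theta>) = c * form j \<phi>"
proof -
  have "\<Lambda> (conv (lam j) (\<lambda>\<theta>. c *s \<phi> \<theta>)) = \<Lambda> (\<lambda>\<theta>. c *s conv (lam j) \<phi> \<theta>)"
    by (rule \<Lambda>_cong) (rule conv_scale[OF assms])
  then show ?thesis
    using assms by (simp add: form_def \<Lambda>_scale continuous_on_conv algebra_simps)
qed

lemma form_cong: "(\<And>\<theta>. \<theta> \<in> I \<Longrightarrow> \<phi> \<theta> = \<psi> \<theta>) \<Longrightarrow> form j \<phi> = form j \<psi>"
  unfolding form_def
proof -
  assume *: "\<And>\<theta>. \<theta> \<in> I \<Longrightarrow> \<phi> \<theta> = \<psi> \<theta>"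
  have "\<Lambda> (conv (lam j) \<phi>) = \<Lambda> (conv (lam j) \<psi>)"
    by (rule \<Lambda>_cong) (auto simp: conv_def * intro!: arg_cong[where f="\<lambda>v. _ *s v"] integral_cong)
  then show "psi_vec j \<odot> (\<phi> 0 + \<Lambda> (conv (lam j) \<phi>)) = psi_vec j \<odot> (\<psi> 0 + \<Lambda> (conv (lam j) \<psi>))"
    using *[OF zero_in_I] by simp
qed

lemma form_diff:
  assumes "continuous_on I \<phi>" "continuous_on I \<psi>"
  shows "form j (\<lambda>\<theta>. \<phi> \<theta> - \<psi> \<theta>) = form j \<phi> - form j \<psi>"
proof -
  have "form j (\<lambda>\<theta>. \<phi> \<theta> - \<psi> \<theta>) = form j (\<lambda>\<theta>. \<phi> \<theta> + (-1) *s \<psi> \<theta>)"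
    by (rule form_cong) (simp add: vec_eq_iff)
  also have "\<dots> = form j \<phi> + (-1) * form j \<psi>"
    by (simp only: form_add[OF assms(1) continuous_on_vscale_const[OF assms(2)]] form_scale[OF assms(2)])
  finally show ?thesis by simp
qed

lemma form_zero [simp]: "form j (\<lambda>\<theta>. 0) = 0"
  using form_scale[of "\<lambda>\<theta>. 0" j 0] by simp

lemma form_sum:
  assumes "\<And>x. x \<in> A \<Longrightarrow> continuous_on I (\<phi> x)"
  shows "form j (\<lambda>\<theta>. \<Sum>x\<in>A. \<phi> x \<theta>) = (\<Sum>x\<in>A. form j (\<phi> x))"
  using assms by (induction A rule: infinite_finite_induct) (simp_all add: form_add continuous_on_sum)

lemma form_conj:
  assumes "continuous_on I \<phi>"
  shows "form (conj3 j) (\<lambda>\<theta>. vcnj (\<phi> \<theta>)) = cnj (form j \<phi>)"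
proof -
  have "\<Lambda> (conv (cnj (lam j)) (\<lambda>\<theta>. vcnj (\<phi> \<theta>))) = \<Lambda> (\<lambda>\<theta>. vcnj (conv (lam j) \<phi> \<theta>))"
    by (rule \<Lambda>_cong) (rule conv_conj[OF assms])
  then show ?thesis
    using assms by (simp add: form_def lam_conj3 psi_vec_conj3 cnj_dotc \<Lambda>_conj continuous_on_conv)
qed

text \<open>
  Integration by parts in \<open>conv\<close> produces the factor \<open>\<lambda>\<^sub>j\<close> and boundary terms, which cancel because \<open>\<psi>\<^sub>j\<close>
  is an eigenvector of the adjoint.  The left-hand side is the form applied to \<open>A\<phi> = \<phi>' + X\<^sub>0(L\<^sub>0\<phi> - \<phi>'(0))\<close>, so the
  lemma says \<open>(\<psi>\<^sub>j, A\<phi>) = \<lambda>\<^sub>j (\<psi>\<^sub>j, \<phi>)\<close>.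
\<close>

lemma form_derivative:
  assumes deriv: "\<And>\<theta>. \<theta> \<in> I \<Longrightarrow> (\<phi> has_vector_derivative \<phi>' \<theta>) (at \<theta> within I)"
    and \<phi>': "continuous_on I \<phi>'"
  shows "form j \<phi>' + psi_vec j \<odot> (\<Lambda> \<phi> - \<phi>' 0) = lam j * form j \<phi>"
proof -
  let ?\<mu> = "lam j"
  have \<phi>: "continuous_on I \<phi>"
    by (rule continuous_on_vector_derivative) (rule deriv)
  have conv': "conv ?\<mu> \<phi>' \<theta> = expo_fun ?\<mu> (\<phi> 0) \<theta> - \<phi> \<theta> + ?\<mu> *s conv ?\<mu> \<phi> \<theta>" if \<theta>: "\<theta> \<in> I" for \<theta>
  proof -
    let ?e = "\<lambda>\<xi>. exp (- ?\<mu> * complex_of_real \<xi>)"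
    have "((\<lambda>\<xi>. ?e \<xi> *s \<phi> \<xi>) has_vector_derivative ?e \<xi> *s \<phi>' \<xi> + (- ?\<mu> * ?e \<xi>) *s \<phi> \<xi>) (at \<xi> within {\<theta>..0})"
      if "\<xi> \<in> {\<theta>..0}" for \<xi>
    proof (rule vscale.has_vector_derivative)
      show "(?e has_vector_derivative - ?\<mu> * ?e \<xi>) (at \<xi> within {\<theta>..0})"
        by (rule exp_has_vector_derivative)
      show "(\<phi> has_vector_derivative \<phi>' \<xi>) (at \<xi> within {\<theta>..0})"
        by (rule has_vector_derivative_within_subset[OF deriv]) (use that \<theta> in auto)
    qed
    then have "((\<lambda>\<xi>. ?e \<xi> *s \<phi>' \<xi> + (- ?\<mu> * ?e \<xi>) *s \<phi> \<xi>) has_integral (?e 0 *s \<phi> 0 - ?e \<theta> *s \<phi> \<theta>)) {\<theta>..0}"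
      by (intro fundamental_theorem_of_calculus) (use \<theta> in auto)
    moreover have "((\<lambda>\<xi>. ?\<mu> *s (?e \<xi> *s \<phi> \<xi>)) has_integral ?\<mu> *s integral {\<theta>..0} (\<lambda>\<xi>. ?e \<xi> *s \<phi> \<xi>)) {\<theta>..0}"
      using has_integral_linear[OF integrable_integral[OF weighted_integrable[OF \<phi> \<theta>, of ?\<mu>]] vscale.bounded_linear_right[of ?\<mu>]]
      by (simp add: o_def)
    ultimately have "((\<lambda>\<xi>. (?e \<xi> *s \<phi>' \<xi> + (- ?\<mu> * ?e \<xi>) *s \<phi> \<xi>) + ?\<mu> *s (?e \<xi> *s \<phi> \<xi>)) has_integral
        (?e 0 *s \<phi> 0 - ?e \<theta> *s \<phi> \<theta>) + ?\<mu> *s integral {\<theta>..0} (\<lambda>\<xi>. ?e \<xi> *s \<phi> \<xi>)) {\<theta>..0}"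
      by (rule has_integral_add)
    moreover have "(?e \<xi> *s \<phi>' \<xi> + (- ?\<mu> * ?e \<xi>) *s \<phi> \<xi>) + ?\<mu> *s (?e \<xi> *s \<phi> \<xi>) = ?e \<xi> *s \<phi>' \<xi>" for \<xi>
      by (simp add: vec_eq_iff algebra_simps)
    ultimately have "integral {\<theta>..0} (\<lambda>\<xi>. ?e \<xi> *s \<phi>' \<xi>)
        = (\<phi> 0 - ?e \<theta> *s \<phi> \<theta>) + ?\<mu> *s integral {\<theta>..0} (\<lambda>\<xi>. ?e \<xi> *s \<phi> \<xi>)"
      by (simp add: integral_unique)
    moreover have "exp (?\<mu> * complex_of_real \<theta>) *s (?e \<theta> *s v) = v" for v :: "complex^'m"
      by (simp add: exp_minus)
    ultimately show ?thesis
      by (simp add: conv_def expo_fun_def vec.scale_right_distrib vec.scale_right_diff_distrib mult.commute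
          del: vector_smult_assoc)
  qed
  have "\<Lambda> (conv ?\<mu> \<phi>') = \<Lambda> (\<lambda>\<theta>. (expo_fun ?\<mu> (\<phi> 0) \<theta> - \<phi> \<theta>) + ?\<mu> *s conv ?\<mu> \<phi> \<theta>)"
    by (rule \<Lambda>_cong) (rule conv')
  also have "\<dots> = (\<Lambda> (expo_fun ?\<mu> (\<phi> 0)) - \<Lambda> \<phi>) + ?\<mu> *s \<Lambda> (conv ?\<mu> \<phi>)"
    using \<phi> continuous_on_conv[OF \<phi>]
    by (simp add: \<Lambda>_add \<Lambda>_diff \<Lambda>_scale continuous_on_diff continuous_on_expo_fun continuous_on_vscale_const)
  finally have eq: "\<Lambda> (conv ?\<mu> \<phi>') = \<dots>" .
  show ?thesis
    by (simp add: form_def eq adjoint algebra_simps)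
qed

lemma normalization:
  "form 1 (Phi 1) = 1" "form 2 (Phi 2) = 1" "form 2 (Phi 3) = 0" "form 3 (Phi 2) = 0" "form 3 (Phi 3) = 1"
proof -
  have "pairing S 0 (psi1 S) (phi1 S) = 1" "pairing S 0 (psi2 S) (phi2 S) = 1"
    "pairing S 0 (psi2 S) (phi2b S) = 0" "pairing S 0 (psi2b S) (phi2 S) = 0"
    "pairing S 0 (psi2b S) (phi2b S) = 1"
    using bases modes by (simp_all add: hopf_steady_bases_def)
  then show "form 1 (Phi 1) = 1" "form 2 (Phi 2) = 1" "form 2 (Phi 3) = 0" "form 3 (Phi 2) = 0" "form 3 (Phi 3) = 1"
    unfolding phi1_eq phi2_eq phi2b_eq psi1_eq psi2_eq psi2b_eq pairing_eq_form[OF continuous_on_Phi]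
    by - assumption+
qed

text \<open>
  Applied to the eigenfunction \<open>\<phi>\<^sub>k\<close>, the adjoint identity gives \<open>(\<lambda>\<^sub>k - \<lambda>\<^sub>j) (\<psi>\<^sub>j, \<phi>\<^sub>k) = 0\<close>.  So the two
  normalized pairs of bases, which belong to the same mode, are also biorthogonal to each other.
\<close>

lemma form_Phi: "form j (Phi k) = (if j = k then 1 else 0)"
proof (cases "j = k")
  case True
  then show ?thesis using normalization exhaust_index3[of j] by auto
next
  case False
  have "(Phi k has_vector_derivative lam k *s Phi k \<theta>) (at \<theta> within I)" for \<theta>
    unfolding Phi_def by (rule expo_fun_derivative)
  from form_derivative[OF this, of j]
  have "lam k * form j (Phi k) = lam j * form j (Phi k)"
    by (simp add: form_scale continuous_on_Phi continuous_on_vscale_const \<Lambda>_Phi)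
  moreover have "lam j \<noteq> lam k"
    using False om0_pos exhaust_index3[of j] exhaust_index3[of k] by (auto simp: complex_eq_iff)
  ultimately show ?thesis using False by simp
qed


section \<open>The equation for the quadratic part of the center manifold\<close>

text \<open>
  The projection of the jump \<open>X\<^sub>0 F\<close> to the center space.
\<close>

definition center :: "complex^'m \<Rightarrow> real \<Rightarrow> complex^'m"
  where "center F \<theta> = (\<Sum>j\<in>UNIV. (psi_vec j \<odot> F) *s Phi j \<theta>)"

lemma continuous_on_center: "continuous_on A (center F)"
  unfolding center_def[abs_def]
  by (intro continuous_on_sum continuous_on_vscale_const continuous_on_Phi)

lemma form_combination: "form j (\<lambda>\<theta>. \<Sum>k\<in>UNIV. c k *s Phi k \<theta>) = c j"
  by (simp add: form_sum form_scale continuous_on_vscale_const continuous_on_Phi form_Phi if_distrib cong: if_cong)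

lemma form_center: "form j (center F) = psi_vec j \<odot> F"
  unfolding center_def[abs_def] by (rule form_combination)

lemma center_conj: "vcnj (center F \<theta>) = center (vcnj F) \<theta>"
  using psi_vec_conj3[of 1] psi_vec_conj3[of 2] psi_vec_conj3[of 3]
    Phi_conj3[of 1 \<theta>] Phi_conj3[of 2 \<theta>] Phi_conj3[of 3 \<theta>]
  by (simp add: center_def sum_3 conj3_def cnj_dotc add_ac)

lemma center_add: "center (F + G) \<theta> = center F \<theta> + center G \<theta>"
  by (simp add: center_def vec.scale_left_distrib sum.distrib)

lemma center_scale: "center (c *s F) \<theta> = c *s center F \<theta>"
  by (simp add: center_def vec.scale_sum_right)

text \<open>
  The boundary value problem for the mean of a coefficient \<open>h\<^sub>q\<close>, where \<open>F\<close> is the coefficient of \<open>z\<^sup>q\<close> in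
  \<open>Q(w(z),w(z))\<close>.  It says \<open>\<zeta>H - AH = \<onehalf>(X\<^sub>0 F - center F)\<close>, separately for \<open>\<theta> < 0\<close> and \<open>\<theta> = 0\<close>, and that \<open>H\<close> lies in the
  complement of the center space.
\<close>

definition solves :: "complex \<Rightarrow> complex^'m \<Rightarrow> (real \<Rightarrow> complex^'m) \<Rightarrow> bool"
  where "solves \<zeta> F H \<longleftrightarrow>
    (\<forall>\<theta>\<in>I. (H has_vector_derivative \<zeta> *s H \<theta> + (1/2) *s center F \<theta>) (at \<theta> within I)) \<and>
    \<Lambda> H = \<zeta> *s H 0 - (1/2) *s (F - center F 0) \<and> (\<forall>j. form j H = 0)"

lemma solves_continuous: "solves \<zeta> F H \<Longrightarrow> continuous_on I H"
  unfolding solves_def by (rule continuous_on_vector_derivative) blast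

lemma solves_cong:
  assumes "solves \<zeta> F H" "\<And>\<theta>. \<theta> \<in> I \<Longrightarrow> H \<theta> = K \<theta>"
  shows "solves \<zeta> F K"
  unfolding solves_def
proof (intro conjI ballI allI)
  fix \<theta> assume \<theta>: "\<theta> \<in> I"
  have "(H has_vector_derivative \<zeta> *s H \<theta> + (1/2) *s center F \<theta>) (at \<theta> within I)"
    using assms(1) \<theta> unfolding solves_def by blast
  then show "(K has_vector_derivative \<zeta> *s K \<theta> + (1/2) *s center F \<theta>) (at \<theta> within I)"
    unfolding assms(2)[OF \<theta>] by (rule has_vector_derivative_transform[OF \<theta> assms(2)[symmetric], rotated])
next
  show "\<Lambda> K = \<zeta> *s K 0 - (1/2) *s (F - center F 0)"
    using assms(1) \<Lambda>_cong[OF assms(2)] assms(2)[OF zero_in_I] unfolding solves_def by simp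
  show "form j K = 0" for j
    using assms(1) form_cong[OF assms(2)] unfolding solves_def by simp
qed

lemma linear_ode:
  assumes "\<And>\<theta>. \<theta> \<in> I \<Longrightarrow> (D has_vector_derivative \<zeta> *s D \<theta>) (at \<theta> within I)" "\<theta> \<in> I"
  shows "D \<theta> = expo_fun \<zeta> (D 0) \<theta>"
proof -
  have "((\<lambda>\<theta>. exp (- \<zeta> * complex_of_real \<theta>) *s D \<theta>) has_vector_derivative 0) (at \<theta> within I)" if "\<theta> \<in> I" for \<theta>
  proof -
    have "((\<lambda>\<theta>. exp (- \<zeta> * complex_of_real \<theta>) *s D \<theta>) has_vector_derivative
        exp (- \<zeta> * complex_of_real \<theta>) *s (\<zeta> *s D \<theta>) + (- \<zeta> * exp (- \<zeta> * complex_of_real \<theta>)) *s D \<theta>) (at \<theta> within I)"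
      by (rule vscale.has_vector_derivative[OF exp_has_vector_derivative assms(1)[OF that]])
    moreover have "exp (- \<zeta> * complex_of_real \<theta>) *s (\<zeta> *s D \<theta>) + (- \<zeta> * exp (- \<zeta> * complex_of_real \<theta>)) *s D \<theta> = 0"
      by (simp add: vec_eq_iff)
    ultimately show ?thesis by (simp only:)
  qed
  from has_vector_derivative_zero_constant[OF convex_real_interval(5) this]
  obtain c where c: "\<And>\<theta>. \<theta> \<in> I \<Longrightarrow> exp (- \<zeta> * complex_of_real \<theta>) *s D \<theta> = c"
    by blast
  have "exp (- \<zeta> * complex_of_real \<theta>) *s D \<theta> = D 0"
    using c[OF assms(2)] c[OF zero_in_I] by simp
  then have "expo_fun \<zeta> (D 0) \<theta> = exp (\<zeta> * complex_of_real \<theta>) *s (exp (- \<zeta> * complex_of_real \<theta>) *s D \<theta>)"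
    by (simp add: expo_fun_def)
  also have "\<dots> = D \<theta>" by (simp add: exp_minus)
  finally show ?thesis ..
qed

definition char_matrix :: "complex \<Rightarrow> complex^'m^'m"
  where "char_matrix \<zeta> = mat \<zeta> - eta_integral (\<lambda>\<theta>. exp (\<zeta> * complex_of_real \<theta>))"

lemma char_matrix_mult_vec: "char_matrix \<zeta> *v E = \<zeta> *s E - \<Lambda> (expo_fun \<zeta> E)"
proof -
  have "continuous_on I (\<lambda>\<theta>. exp (\<zeta> * complex_of_real \<theta>))" by (intro continuous_intros)
  from eta_integral_mult_vec[OF this, of E] show ?thesis
    by (simp add: char_matrix_def matrix_vector_mult_diff_rdistrib expo_fun_def[abs_def])
qed

lemma invertible_char_matrix: "Re \<zeta> = 0 \<Longrightarrow> (\<And>j. \<zeta> \<noteq> lam j) \<Longrightarrow> invertible (char_matrix \<zeta>)"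
  unfolding char_matrix_def by (rule invertible_characteristic)

text \<open>
  A vector in the kernel of the characteristic matrix at \<open>\<lambda>\<^sub>j\<close> is a multiple \<open>c \<phi>\<^sub>j(0)\<close>, and the form with
  \<open>\<psi>\<^sub>j\<close> returns \<open>c\<close>.
\<close>

lemma homogeneous_solution_zero:
  assumes \<zeta>: "Re \<zeta> = 0" and E: "char_matrix \<zeta> *v E = 0" and orth: "\<And>j. form j (expo_fun \<zeta> E) = 0"
  shows "E = 0"
proof (cases "\<exists>j. \<zeta> = lam j")
  case True
  then obtain j where j: "\<zeta> = lam j" by blast
  then have "\<Lambda> (expo_fun (lam j) E) = lam j *s E"
    using E by (simp add: char_matrix_mult_vec)
  then obtain c where c: "E = c *s phi_vec j" using eigenspace by blast
  have "form j (expo_fun \<zeta> E) = form j (\<lambda>\<theta>. c *s Phi j \<theta>)"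
    by (rule form_cong) (simp add: Phi_def j c expo_fun_scale)
  then have "c = 0"
    using orth[of j] by (simp add: form_scale continuous_on_Phi form_Phi)
  then show ?thesis using c by simp
next
  case False
  then have "invertible (char_matrix \<zeta>)" using invertible_char_matrix \<zeta> by blast
  then obtain B where "B ** char_matrix \<zeta> = mat 1"
    unfolding invertible_def by blast
  then have "E = B *v (char_matrix \<zeta> *v E)" by (simp add: matrix_vector_mul_assoc)
  then show ?thesis using E by simp
qed

text \<open>
  The difference of two solutions is an exponential \<open>e\<^bsup>\<zeta>\<theta>\<^esup>E\<close> satisfying the homogeneous conditions.
\<close>

lemma solves_unique:
  assumes \<zeta>: "Re \<zeta> = 0" and H: "solves \<zeta> F H" and K: "solves \<zeta> F K" and \<theta>: "\<theta> \<in> I"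
  shows "H \<theta> = K \<theta>"
proof -
  define D where "D = (\<lambda>\<theta>. H \<theta> - K \<theta>)"
  have c: "continuous_on I H" "continuous_on I K" using H K solves_continuous by blast+
  have "(D has_vector_derivative \<zeta> *s D \<theta>) (at \<theta> within I)" if "\<theta> \<in> I" for \<theta>
  proof -
    have "(D has_vector_derivative (\<zeta> *s H \<theta> + (1/2) *s center F \<theta>) - (\<zeta> *s K \<theta> + (1/2) *s center F \<theta>)) (at \<theta> within I)"
      unfolding D_def using H K that unfolding solves_def by (intro has_vector_derivative_diff) blast+
    then show ?thesis by (simp add: D_def vec.scale_right_diff_distrib)
  qed
  then have D: "D \<theta> = expo_fun \<zeta> (D 0) \<theta>" if "\<theta> \<in> I" for \<theta>
    using linear_ode that by blast
  have "\<Lambda> (expo_fun \<zeta> (D 0)) = \<Lambda> D" by (rule \<Lambda>_cong) (rule D[symmetric])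
  also have "\<dots> = \<zeta> *s D 0"
    using H K unfolding D_def by (simp add: \<Lambda>_diff[OF c] solves_def vec.scale_right_diff_distrib)
  finally have 1: "char_matrix \<zeta> *v D 0 = 0" by (simp add: char_matrix_mult_vec)
  have 2: "form j (expo_fun \<zeta> (D 0)) = 0" for j
  proof -
    have "form j (expo_fun \<zeta> (D 0)) = form j D" by (rule form_cong) (rule D[symmetric])
    also have "\<dots> = 0" using H K unfolding D_def by (simp add: form_diff[OF c] solves_def)
    finally show ?thesis .
  qed
  have "D 0 = 0" by (rule homogeneous_solution_zero[OF \<zeta> 1 2])
  then show ?thesis using D[OF \<theta>] by (simp add: D_def expo_fun_def)
qed

lemma solves_conj:
  assumes "solves \<zeta> F H"
  shows "solves (cnj \<zeta>) (vcnj F) (\<lambda>\<theta>. vcnj (H \<theta>))"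
  unfolding solves_def
proof (intro conjI ballI allI)
  have c: "continuous_on I H" using assms by (rule solves_continuous)
  show "((\<lambda>\<theta>. vcnj (H \<theta>)) has_vector_derivative cnj \<zeta> *s vcnj (H \<theta>) + (1/2) *s center (vcnj F) \<theta>) (at \<theta> within I)"
    if "\<theta> \<in> I" for \<theta>
  proof -
    have "(H has_vector_derivative \<zeta> *s H \<theta> + (1/2) *s center F \<theta>) (at \<theta> within I)"
      using assms that unfolding solves_def by blast
    from bounded_linear.has_vector_derivative[OF bounded_linear_vcnj this]
    show ?thesis by (simp add: center_conj)
  qed
  show "\<Lambda> (\<lambda>\<theta>. vcnj (H \<theta>)) = cnj \<zeta> *s vcnj (H 0) - (1/2) *s (vcnj F - center (vcnj F) 0)"
    using assms by (simp add: \<Lambda>_conj[OF c] solves_def center_conj)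
  show "form j (\<lambda>\<theta>. vcnj (H \<theta>)) = 0" for j
  proof -
    have "j = conj3 (conj3 j)" using exhaust_index3[of j] by (auto simp: conj3_def)
    then have "form j (\<lambda>\<theta>. vcnj (H \<theta>)) = cnj (form (conj3 j) H)"
      using form_conj[OF c, of "conj3 j"] by simp
    then show ?thesis using assms by (simp add: solves_def)
  qed
qed


subsection \<open>A particular solution\<close>

text \<open>
  A solution of \<open>\<rho>' = (\<zeta> - \<lambda>\<^sub>j)\<rho> + 1\<close>.
\<close>

definition resonance :: "complex \<Rightarrow> 3 \<Rightarrow> real \<Rightarrow> complex"
  where "resonance \<zeta> j \<theta> = (if lam j = \<zeta> then complex_of_real \<theta> else 1 / (lam j - \<zeta>))"

text \<open>
  The ansatz \<open>\<Sum>\<^sub>j \<rho>\<^sub>j \<phi>\<^sub>j\<close> for the differential equation in \<open>solves\<close>, whose inhomogeneity is a combination of the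
  \<open>\<phi>\<^sub>j\<close>, leads to the equation solved by \<open>resonance\<close>.
\<close>

definition partic :: "complex \<Rightarrow> complex^'m \<Rightarrow> real \<Rightarrow> complex^'m"
  where "partic \<zeta> F \<theta> = (1/2) *s (\<Sum>j\<in>UNIV. ((psi_vec j \<odot> F) * resonance \<zeta> j \<theta>) *s Phi j \<theta>)"

lemma partic_derivative:
  "(partic \<zeta> F has_vector_derivative \<zeta> *s partic \<zeta> F \<theta> + (1/2) *s center F \<theta>) (at \<theta> within A)"
proof -
  have res: "(resonance \<zeta> j has_vector_derivative (if lam j = \<zeta> then 1 else 0)) (at \<theta> within A)" for j
  proof (cases "lam j = \<zeta>")
    case True
    have "(complex_of_real has_vector_derivative 1) (at \<theta> within A)"
      using bounded_linear.has_vector_derivative[OF bounded_linear_of_real has_vector_derivative_id]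
      by simp
    then show ?thesis using True by (simp add: resonance_def[abs_def])
  qed (simp add: resonance_def[abs_def])
  have summand: "((\<lambda>\<theta>. ((psi_vec j \<odot> F) * resonance \<zeta> j \<theta>) *s Phi j \<theta>) has_vector_derivative
      \<zeta> *s (((psi_vec j \<odot> F) * resonance \<zeta> j \<theta>) *s Phi j \<theta>) + (psi_vec j \<odot> F) *s Phi j \<theta>) (at \<theta> within A)" for j
  proof -
    have "((\<lambda>\<theta>. (psi_vec j \<odot> F) * resonance \<zeta> j \<theta>) has_vector_derivative
        (psi_vec j \<odot> F) * (if lam j = \<zeta> then 1 else 0)) (at \<theta> within A)"
      by (rule bounded_linear.has_vector_derivative[OF bounded_linear_mult_right res])
    from vscale.has_vector_derivative[OF this expo_fun_derivative[of "lam j" "phi_vec j"]]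
    show ?thesis
      unfolding Phi_def
      by (rule has_vector_derivative_eq_rhs)
         (auto simp: resonance_def vec_eq_iff field_simps)
  qed
  have "((\<lambda>\<theta>. \<Sum>j\<in>UNIV. ((psi_vec j \<odot> F) * resonance \<zeta> j \<theta>) *s Phi j \<theta>) has_vector_derivative
      (\<Sum>j\<in>UNIV. \<zeta> *s (((psi_vec j \<odot> F) * resonance \<zeta> j \<theta>) *s Phi j \<theta>) + (psi_vec j \<odot> F) *s Phi j \<theta>)) (at \<theta> within A)"
    by (rule has_vector_derivative_sum) (rule summand)
  from bounded_linear.has_vector_derivative[OF vscale.bounded_linear_right[of "1/2"] this]
  show ?thesis
    unfolding partic_def[abs_def]
    by (rule has_vector_derivative_eq_rhs)
       (simp only: center_def sum.distrib vec.scale_right_distrib vec.scale_sum_right[symmetric]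
         vec.scale_left_commute[of \<zeta> "1/2"])
qed

lemma continuous_on_partic: "continuous_on A (partic \<zeta> F)"
  by (rule continuous_on_vector_derivative) (rule partic_derivative)

text \<open>
  What the boundary condition in \<open>solves\<close> demands of \<open>E\<close> after inserting \<open>partic\<close> plus \<open>e\<^bsup>\<zeta>\<theta>\<^esup>E\<close>; see \<open>solves_iff\<close>.
\<close>

definition boundary_rhs :: "complex \<Rightarrow> complex^'m \<Rightarrow> complex^'m"
  where "boundary_rhs \<zeta> F = \<Lambda> (partic \<zeta> F) - \<zeta> *s partic \<zeta> F 0 + (1/2) *s (F - center F 0)"

lemma half_combination:
  assumes "A - B = C - (D :: complex^'m)"
  shows "(1/2) *s A - (1/2) *s B + (1/2) *s (F - C) = (1/2) *s (F - D)"
proof -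
  have "(1/2) *s A - (1/2) *s B + (1/2) *s (F - C) = (1/2) *s ((A - B) + (F - C))"
    by (simp only: vec.scale_right_distrib vec.scale_right_diff_distrib)
  then show ?thesis unfolding assms by simp
qed

text \<open>
  A nonresonant summand of \<open>partic\<close> is a multiple of the eigenfunction \<open>\<phi>\<^sub>j\<close>, and its contribution to the
  boundary condition cancels against that of \<open>center F 0\<close>; only the resonant index is left.
\<close>

lemma boundary_rhs_eq:
  "boundary_rhs \<zeta> F = (1/2) *s (F - (\<Sum>j | lam j = \<zeta>.
     (psi_vec j \<odot> F) *s (phi_vec j - \<Lambda> (\<lambda>\<theta>. complex_of_real \<theta> *s Phi j \<theta>))))"
proof -
  let ?T = "\<lambda>j. \<Lambda> (\<lambda>\<theta>. complex_of_real \<theta> *s Phi j \<theta>)"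
  have res: "continuous_on I (resonance \<zeta> j)" for j
    by (cases "lam j = \<zeta>") (auto simp: resonance_def[abs_def] intro!: continuous_intros)
  have c: "continuous_on I (\<lambda>\<theta>. resonance \<zeta> j \<theta> *s Phi j \<theta>)" for j
    by (rule continuous_on_vscale[OF res continuous_on_Phi])
  have L: "\<Lambda> (\<lambda>\<theta>. resonance \<zeta> j \<theta> *s Phi j \<theta>)
      = (if lam j = \<zeta> then ?T j else (1 / (lam j - \<zeta>)) *s (lam j *s phi_vec j))" for j
    by (simp add: resonance_def \<Lambda>_scale[OF continuous_on_Phi] \<Lambda>_Phi)
  have "\<Lambda> (partic \<zeta> F) = \<Lambda> (\<lambda>\<theta>. (1/2) *s (\<Sum>j\<in>UNIV. (psi_vec j \<odot> F) *s (resonance \<zeta> j \<theta> *s Phi j \<theta>)))"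
    by (simp add: partic_def[abs_def])
  also have "\<dots> = (1/2) *s \<Lambda> (\<lambda>\<theta>. \<Sum>j\<in>UNIV. (psi_vec j \<odot> F) *s (resonance \<zeta> j \<theta> *s Phi j \<theta>))"
    by (rule \<Lambda>_scale) (intro continuous_on_sum continuous_on_vscale_const c)
  also have "\<Lambda> (\<lambda>\<theta>. \<Sum>j\<in>UNIV. (psi_vec j \<odot> F) *s (resonance \<zeta> j \<theta> *s Phi j \<theta>))
      = (\<Sum>j\<in>UNIV. \<Lambda> (\<lambda>\<theta>. (psi_vec j \<odot> F) *s (resonance \<zeta> j \<theta> *s Phi j \<theta>)))"
    by (rule \<Lambda>_sum) (intro continuous_on_vscale_const c)
  also have "\<dots> = (\<Sum>j\<in>UNIV. (psi_vec j \<odot> F) *s (if lam j = \<zeta> then ?T j else (1 / (lam j - \<zeta>)) *s (lam j *s phi_vec j)))"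
    by (rule sum.cong[OF refl]) (simp only: \<Lambda>_scale[OF c] L)
  finally have 1: "\<Lambda> (partic \<zeta> F) = (1/2) *s (\<Sum>j\<in>UNIV. (psi_vec j \<odot> F) *s (if lam j = \<zeta> then ?T j else (1 / (lam j - \<zeta>)) *s (lam j *s phi_vec j)))" .
  have 2: "\<zeta> *s partic \<zeta> F 0 = (1/2) *s (\<Sum>j\<in>UNIV. (psi_vec j \<odot> F) *s (if lam j = \<zeta> then 0 else (\<zeta> / (lam j - \<zeta>)) *s phi_vec j))"
  proof -
    have "\<zeta> *s partic \<zeta> F 0 = (1/2) *s (\<zeta> *s (\<Sum>j\<in>UNIV. ((psi_vec j \<odot> F) * resonance \<zeta> j 0) *s phi_vec j))"
      by (simp add: partic_def mult.commute)
    also have "\<zeta> *s (\<Sum>j\<in>UNIV. ((psi_vec j \<odot> F) * resonance \<zeta> j 0) *s phi_vec j)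
        = (\<Sum>j\<in>UNIV. (psi_vec j \<odot> F) *s (if lam j = \<zeta> then 0 else (\<zeta> / (lam j - \<zeta>)) *s phi_vec j))"
      unfolding vec.scale_sum_right
      by (rule sum.cong[OF refl]) (auto simp: resonance_def vec_eq_iff)
    finally show ?thesis .
  qed
  have 3: "center F 0 = (\<Sum>j\<in>UNIV. (psi_vec j \<odot> F) *s phi_vec j)"
    by (simp add: center_def)
  have 4: "(\<Sum>j | lam j = \<zeta>. (psi_vec j \<odot> F) *s (phi_vec j - ?T j))
      = (\<Sum>j\<in>UNIV. (psi_vec j \<odot> F) *s (if lam j = \<zeta> then phi_vec j - ?T j else 0))"
    by (simp add: sum.inter_filter[symmetric, of UNIV, simplified] if_distrib cong: if_cong)
  have "(\<Sum>j\<in>UNIV. (psi_vec j \<odot> F) *s (if lam j = \<zeta> then ?T j else (1 / (lam j - \<zeta>)) *s (lam j *s phi_vec j)))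
     - (\<Sum>j\<in>UNIV. (psi_vec j \<odot> F) *s (if lam j = \<zeta> then 0 else (\<zeta> / (lam j - \<zeta>)) *s phi_vec j))
     = (\<Sum>j\<in>UNIV. (psi_vec j \<odot> F) *s phi_vec j)
     - (\<Sum>j\<in>UNIV. (psi_vec j \<odot> F) *s (if lam j = \<zeta> then phi_vec j - ?T j else 0))"
    unfolding sum_subtractf[symmetric]
  proof (rule sum.cong[OF refl])
    fix j :: 3
    show "(psi_vec j \<odot> F) *s (if lam j = \<zeta> then ?T j else (1 / (lam j - \<zeta>)) *s (lam j *s phi_vec j))
        - (psi_vec j \<odot> F) *s (if lam j = \<zeta> then 0 else (\<zeta> / (lam j - \<zeta>)) *s phi_vec j)
      = (psi_vec j \<odot> F) *s phi_vec j - (psi_vec j \<odot> F) *s (if lam j = \<zeta> then phi_vec j - ?T j else 0)"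
    proof (cases "lam j = \<zeta>")
      case True
      then show ?thesis by (simp add: vec.scale_right_diff_distrib)
    next
      case False
      then have "(1 / (lam j - \<zeta>)) *s (lam j *s v) - (\<zeta> / (lam j - \<zeta>)) *s v = v" for v :: "complex^'m"
        by (simp add: vec.scale_left_diff_distrib[symmetric] diff_divide_distrib[symmetric])
      then show ?thesis
        using False by (simp only: if_False vec.scale_right_diff_distrib[symmetric] vec.scale_zero_right diff_zero)
    qed
  qed
  then show ?thesis
    unfolding boundary_rhs_def 1 2 3 4 by (rule half_combination)
qed

lemma sum_partic_derivative:
  "((\<lambda>\<theta>. partic \<zeta> F \<theta> + expo_fun \<zeta> E \<theta>) has_vector_derivative
     \<zeta> *s (partic \<zeta> F \<theta> + expo_fun \<zeta> E \<theta>) + (1/2) *s center F \<theta>) (at \<theta> within A)"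
  using has_vector_derivative_add[OF partic_derivative[of \<zeta> F \<theta> A] expo_fun_derivative[of \<zeta> E \<theta> A]]
  by (simp add: vec.scale_right_distrib add_ac)

lemma \<Lambda>_sum_partic: "\<Lambda> (\<lambda>\<theta>. partic \<zeta> F \<theta> + expo_fun \<zeta> E \<theta>) = \<Lambda> (partic \<zeta> F) + \<Lambda> (expo_fun \<zeta> E)"
  by (rule \<Lambda>_add) (rule continuous_on_partic continuous_on_expo_fun)+

lemma solves_iff:
  "solves \<zeta> F (\<lambda>\<theta>. partic \<zeta> F \<theta> + expo_fun \<zeta> E \<theta>) \<longleftrightarrow>
    char_matrix \<zeta> *v E = boundary_rhs \<zeta> F \<and> (\<forall>j. form j (\<lambda>\<theta>. partic \<zeta> F \<theta> + expo_fun \<zeta> E \<theta>) = 0)"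
proof -
  have "\<Lambda> (\<lambda>\<theta>. partic \<zeta> F \<theta> + expo_fun \<zeta> E \<theta>)
      = \<zeta> *s (partic \<zeta> F 0 + expo_fun \<zeta> E 0) - (1/2) *s (F - center F 0)
    \<longleftrightarrow> char_matrix \<zeta> *v E = boundary_rhs \<zeta> F"
    by (simp add: \<Lambda>_sum_partic char_matrix_mult_vec boundary_rhs_def vec.scale_right_distrib)
       (auto simp: algebra_simps)
  then show ?thesis
    unfolding solves_def using sum_partic_derivative by simp
qed

lemma solves_shape:
  assumes H: "solves \<zeta> F H"
  shows "\<exists>E. \<forall>\<theta>\<in>I. H \<theta> = partic \<zeta> F \<theta> + expo_fun \<zeta> E \<theta>"
proof -
  define D where "D = (\<lambda>\<theta>. H \<theta> - partic \<zeta> F \<theta>)"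
  have "(D has_vector_derivative \<zeta> *s D \<theta>) (at \<theta> within I)" if "\<theta> \<in> I" for \<theta>
  proof -
    have "(D has_vector_derivative (\<zeta> *s H \<theta> + (1/2) *s center F \<theta>) - (\<zeta> *s partic \<zeta> F \<theta> + (1/2) *s center F \<theta>)) (at \<theta> within I)"
      unfolding D_def using H that unfolding solves_def by (intro has_vector_derivative_diff partic_derivative) blast
    then show ?thesis by (simp add: D_def vec.scale_right_diff_distrib)
  qed
  note D' = this
  have "\<forall>\<theta>\<in>I. D \<theta> = expo_fun \<zeta> (D 0) \<theta>"
    by (intro ballI, rule linear_ode[OF D'])
  then have "H \<theta> = partic \<zeta> F \<theta> + expo_fun \<zeta> (D 0) \<theta>" if "\<theta> \<in> I" for \<theta>
    using that unfolding D_def by (metis diff_add_cancel add.commute)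
  then show ?thesis by blast
qed

text \<open>
  By \<open>form_derivative\<close>, a function satisfying the differential equation and the boundary condition has
  \<open>(\<zeta> - \<lambda>\<^sub>j) (\<psi>\<^sub>j, H) = 0\<close>, since \<open>X\<^sub>0 F - center F\<close> is annihilated by the form with \<open>\<psi>\<^sub>j\<close>.
\<close>

lemma form_zero_nonresonant:
  assumes E: "char_matrix \<zeta> *v E = boundary_rhs \<zeta> F" and j: "lam j \<noteq> \<zeta>"
  shows "form j (\<lambda>\<theta>. partic \<zeta> F \<theta> + expo_fun \<zeta> E \<theta>) = 0"
proof -
  let ?H = "\<lambda>\<theta>. partic \<zeta> F \<theta> + expo_fun \<zeta> E \<theta>"
  have c: "continuous_on I ?H"
    by (intro continuous_on_add continuous_on_partic continuous_on_expo_fun)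
  have c': "continuous_on I (\<lambda>\<theta>. \<zeta> *s ?H \<theta> + (1/2) *s center F \<theta>)"
    by (intro continuous_on_add continuous_on_vscale_const c continuous_on_center)
  have f: "form j (\<lambda>\<theta>. \<zeta> *s ?H \<theta> + (1/2) *s center F \<theta>) = \<zeta> * form j ?H + (1/2) * (psi_vec j \<odot> F)"
    by (simp only: form_add[OF continuous_on_vscale_const[OF c] continuous_on_vscale_const[OF continuous_on_center]]
        form_scale[OF c] form_scale[OF continuous_on_center] form_center)
  have b: "\<Lambda> ?H - (\<zeta> *s ?H 0 + (1/2) *s center F 0) = - ((1/2) *s F)"
    unfolding \<Lambda>_sum_partic
    using E by (simp add: char_matrix_mult_vec boundary_rhs_def vec.scale_right_distrib
        vec.scale_right_diff_distrib algebra_simps)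
  have "\<zeta> * form j ?H + (1/2) * (psi_vec j \<odot> F) + psi_vec j \<odot> (- ((1/2) *s F)) = lam j * form j ?H"
    using form_derivative[OF sum_partic_derivative c', of j] unfolding f b .
  then have "(\<zeta> - lam j) * form j ?H = 0"
    by (simp only: dotc_minus dotc_scale left_diff_distrib) simp
  then show ?thesis using j by auto
qed

text \<open>
  The solvability condition of the resonant case is \<open>form_derivative\<close> for the particular solution: the
  terms with \<open>\<lambda>\<^sub>j (\<psi>\<^sub>j, partic)\<close> cancel.
\<close>

lemma boundary_rhs_orthogonal:
  "psi_vec j \<odot> boundary_rhs (lam j) F = 0"
proof -
  let ?p = "partic (lam j) F"
  have c': "continuous_on I (\<lambda>\<theta>. lam j *s ?p \<theta> + (1/2) *s center F \<theta>)"
    by (intro continuous_on_add continuous_on_vscale_const continuous_on_partic continuous_on_center)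
  have f: "form j (\<lambda>\<theta>. lam j *s ?p \<theta> + (1/2) *s center F \<theta>) = lam j * form j ?p + (1/2) * (psi_vec j \<odot> F)"
    by (simp only: form_add[OF continuous_on_vscale_const[OF continuous_on_partic] continuous_on_vscale_const[OF continuous_on_center]]
        form_scale[OF continuous_on_partic] form_scale[OF continuous_on_center] form_center)
  have "lam j * form j ?p + (1/2) * (psi_vec j \<odot> F)
      + psi_vec j \<odot> (\<Lambda> ?p - (lam j *s ?p 0 + (1/2) *s center F 0)) = lam j * form j ?p"
    using form_derivative[OF partic_derivative c', of j] unfolding f .
  then show ?thesis
    by (simp add: boundary_rhs_def algebra_simps)
qed

text \<open>
  The kernel and the cokernel of the characteristic matrix at \<open>\<lambda>\<^sub>j\<close> are spanned by \<open>\<phi>\<^sub>j(0)\<close> and \<open>\<psi>\<^sub>j(0)\<close>.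
  Adding \<open>e\<^sub>i e\<^sub>k\<^sup>T\<close>, where the \<open>i\<close>-th component of \<open>\<psi>\<^sub>j(0)\<close> and the \<open>k\<close>-th component of \<open>\<phi>\<^sub>j(0)\<close> are nonzero,
  makes it invertible.  If the perturbed system has a right-hand side annihilated by \<open>\<psi>\<^sub>j(0)\<close>, its solution has a vanishing
  \<open>k\<close>-th component, so the perturbation has no effect on it.
\<close>

lemma characteristic_equation_solvable:
  assumes R: "psi_vec j \<odot> R = 0"
  shows "\<exists>E. char_matrix (lam j) *v E = R"
proof -
  have one: "psi_vec j \<odot> (phi_vec j + \<Lambda> (conv (lam j) (Phi j))) = 1"
    using form_Phi[of j j] by (simp add: form_def)
  have "psi_vec j \<noteq> 0"
    using one by (auto simp: dotc_def)
  then obtain i where i: "psi_vec j $ i \<noteq> 0" by (auto simp: vec_eq_iff)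
  have "phi_vec j \<noteq> 0"
  proof
    assume "phi_vec j = 0"
    then have "Phi j = (\<lambda>\<theta>. 0)" by (simp add: Phi_def expo_fun_def[abs_def])
    then show False using form_Phi[of j j] by simp
  qed
  then obtain k where k: "phi_vec j $ k \<noteq> 0" by (auto simp: vec_eq_iff)
  define N where "N = char_matrix (lam j) + axis i 1 \<otimes>\<^sub>v axis k 1"
  have psi_i: "psi_vec j \<odot> axis i 1 = psi_vec j $ i"
    by (simp add: dotc_def axis_def if_distrib cong: if_cong)
  have psi_char: "psi_vec j \<odot> (char_matrix (lam j) *v E) = 0" for E
    by (simp add: char_matrix_mult_vec adjoint)
  have N_mult: "N *v E = char_matrix (lam j) *v E + (E $ k) *s axis i 1" for E
    by (simp add: N_def matrix_vector_mult_add_rdistrib)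
  have psi_N: "psi_vec j \<odot> (N *v E) = E $ k * psi_vec j $ i" for E
    by (simp add: N_mult psi_char psi_i)
  have inj: "E = 0" if "N *v E = 0" for E
  proof -
    have Ek: "E $ k = 0" using psi_N[of E] that i by simp
    then have "\<Lambda> (expo_fun (lam j) E) = lam j *s E"
      using that by (simp add: N_mult char_matrix_mult_vec)
    then obtain c where c: "E = c *s phi_vec j" using eigenspace by blast
    then show ?thesis using Ek k by simp
  qed
  then obtain B where B: "B ** N = mat 1"
    using matrix_left_invertible_ker[of N] by blast
  then have "N ** B = mat 1" by (simp add: matrix_left_right_inverse)
  then have NB: "N *v (B *v R) = R" by (simp add: matrix_vector_mul_assoc)
  then have "(B *v R) $ k = 0" using psi_N[of "B *v R"] R i by simp
  then have "char_matrix (lam j) *v (B *v R) = R" using NB by (simp add: N_mult)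
  then show ?thesis by blast
qed

lemma lam_inj: "lam j = lam k \<longleftrightarrow> j = k"
  using om0_pos exhaust_index3[of j] exhaust_index3[of k] by (auto simp: complex_eq_iff)

text \<open>
  In the resonant case the multiple of \<open>\<phi>\<^sub>j(0)\<close> left free in \<open>E\<close> is adjusted to the orthogonality to \<open>\<psi>\<^sub>j\<close>.
\<close>

lemma solves_exists:
  assumes \<zeta>: "Re \<zeta> = 0"
  shows "\<exists>H. solves \<zeta> F H"
proof (cases "\<exists>j. \<zeta> = lam j")
  case True
  then obtain j where j: "\<zeta> = lam j" by blast
  obtain E where E: "char_matrix \<zeta> *v E = boundary_rhs \<zeta> F"
    using characteristic_equation_solvable[OF boundary_rhs_orthogonal] unfolding j by blast
  define c where "c = form j (\<lambda>\<theta>. partic \<zeta> F \<theta> + expo_fun \<zeta> E \<theta>)"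
  \<comment> \<open>The vector phi_vec j is in the kernel, so subtracting c times it keeps the equation and shifts the form by -c.\<close>
  define E' where "E' = E - c *s phi_vec j"
  have "char_matrix \<zeta> *v phi_vec j = 0"
    using \<Lambda>_Phi[of j] by (simp add: j char_matrix_mult_vec Phi_def)
  then have E': "char_matrix \<zeta> *v E' = boundary_rhs \<zeta> F"
    by (simp add: E'_def matrix_vector_mult_diff_distrib vector_scalar_commute E)
  have "form k (\<lambda>\<theta>. partic \<zeta> F \<theta> + expo_fun \<zeta> E' \<theta>) = 0" for k
  proof (cases "k = j")
    case True
    have "form j (\<lambda>\<theta>. partic \<zeta> F \<theta> + expo_fun \<zeta> E' \<theta>)
        = form j (\<lambda>\<theta>. (partic \<zeta> F \<theta> + expo_fun \<zeta> E \<theta>) - c *s Phi j \<theta>)"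
      by (rule form_cong) (simp add: E'_def Phi_def j expo_fun_def vec.scale_right_diff_distrib mult.commute)
    also have "\<dots> = c - c * form j (Phi j)"
      unfolding c_def
      by (subst form_diff) (auto intro!: continuous_on_add continuous_on_partic continuous_on_expo_fun
          continuous_on_vscale_const continuous_on_Phi simp: form_scale continuous_on_Phi)
    finally show ?thesis using True by (simp add: form_Phi)
  next
    case False
    then show ?thesis using form_zero_nonresonant[OF E', of k] lam_inj[of k j] j by simp
  qed
  with E' show ?thesis using solves_iff by blast
next
  case False
  then have "invertible (char_matrix \<zeta>)" using invertible_char_matrix \<zeta> by blast
  then obtain B where "char_matrix \<zeta> ** B = mat 1"
    unfolding invertible_def by blast
  then have "char_matrix \<zeta> *v (B *v boundary_rhs \<zeta> F) = boundary_rhs \<zeta> F"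
    by (simp add: matrix_vector_mul_assoc)
  moreover from this have "form k (\<lambda>\<theta>. partic \<zeta> F \<theta> + expo_fun \<zeta> (B *v boundary_rhs \<zeta> F) \<theta>) = 0" for k
    by (rule form_zero_nonresonant) (use False in auto)
  ultimately show ?thesis using solves_iff by blast
qed


section \<open>Reduction to the constant mode\<close>

definition monomial :: "nat \<times> nat \<times> nat \<Rightarrow> complex^3 \<Rightarrow> complex"
  where "monomial q z = (case q of (a, b, c) \<Rightarrow> (z $ 1)^a * (z $ 2)^b * (z $ 3)^c)"

text \<open>
  The factor by which the derivation \<open>p \<mapsto> D\<^sub>z p Bz\<close> multiplies \<open>z\<^sup>q\<close>.
\<close>

definition weight :: "nat \<times> nat \<times> nat \<Rightarrow> complex"
  where "weight q = (case q of (a, b, c) \<Rightarrow> of_nat b * lam 2 + of_nat c * lam 3)"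

lemma quad_monomial: "quad u z = (\<Sum>q\<in>hexpos. u q * monomial q z)"
  by (simp add: quad_def monomial_def case_prod_unfold)

lemma finite_hexpos [simp]: "finite hexpos"
  by (simp add: hexpos_def)

lemma Bz_nth: "Bz S z $ k = lam k * z $ k"
  using exhaust_index3[of k] by (auto simp: Bz_def vector_3)

lemma dquad_Bz:
  "(\<Sum>k\<in>UNIV. (dquad u k 1 * z$1 + dquad u k 2 * z$2 + dquad u k 3 * z$3) * Bz S z $ k)
    = quad (\<lambda>q. weight q * u q) z"
  by (simp add: sum_3 dquad_def quad_expand weight_def Bz_nth algebra_simps power2_eq_square)

lemma monomial_derivative:
  assumes "q \<in> hexpos"
  shows "\<exists>D. (monomial q has_derivative D) (at z) \<and> D (Bz S z) = weight q * monomial q z"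
proof -
  define u where "u = (\<lambda>q'. if q' = q then 1 else (0::complex))"
  have "monomial q = quad u"
    using assms by (simp add: fun_eq_iff quad_monomial u_def if_distrib if_distribR cong: if_cong)
  moreover have "quad (\<lambda>q. weight q * u q) z = weight q * monomial q z"
    using assms by (simp add: quad_monomial u_def if_distrib if_distribR cong: if_cong)
  ultimately show ?thesis
    using quad_has_derivative[of u z] dquad_Bz[of u z] by auto
qed

lemma monomial_sum_zero:
  assumes "\<And>z. (\<Sum>q\<in>hexpos. monomial q z *s V q) = (0 :: complex^'m)" "q \<in> hexpos"
  shows "V q = 0"
proof -
  have "V q $ i = 0" for i
  proof (rule quad_zero[OF _ assms(2)])
    fix z
    have "(\<Sum>q\<in>hexpos. monomial q z *s V q) $ i = 0" using assms(1)[of z] by simp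
    then show "quad (\<lambda>q. V q $ i) z = 0" by (simp add: quad_monomial mult.commute)
  qed
  then show ?thesis by (simp add: vec_eq_iff)
qed

text \<open>
  The \<open>\<complex>\<^sup>m\<close>-valued history which, constant in space, is \<open>w(z)\<close>.
\<close>

definition center_hist :: "complex^3 \<Rightarrow> real \<Rightarrow> complex^'m"
  where "center_hist z \<theta> = (\<Sum>k\<in>UNIV. z $ k *s Phi k \<theta>)"

lemma continuous_on_center_hist: "continuous_on A (center_hist z)"
  unfolding center_hist_def[abs_def] by (intro continuous_on_sum continuous_on_vscale_const continuous_on_Phi)

lemma wc_eq: "wc S z = htens S (center_hist z) (beta S 0)"
proof -
  have "wc S z = htens S (\<lambda>\<theta>. z $ 1 *s Phi 1 \<theta> + (z $ 2 *s Phi 2 \<theta> + z $ 3 *s Phi 3 \<theta>)) (beta S 0)"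
    unfolding wc_def modes phi1_eq phi2_eq phi2b_eq
    by (rule htens_add[symmetric]) (intro continuous_on_add continuous_on_vscale_const continuous_on_Phi)+
  then show ?thesis by (simp add: center_hist_def[abs_def] sum_3 add.assoc)
qed

definition Q_phi :: "3 \<Rightarrow> 3 \<Rightarrow> complex^'m"
  where "Q_phi j k = Qm S (Phi j) (Phi k)"

lemma Q_phi_commute: "Q_phi j k = Q_phi k j"
  by (simp add: Q_phi_def Qm_commute)

text \<open>
  The coefficients of \<open>Q(w(z),w(z))\<close>, cf. \<open>Qm_center_hist\<close>; the mixed terms occur twice.
\<close>

definition F_coeff :: "nat \<times> nat \<times> nat \<Rightarrow> complex^'m"
  where "F_coeff q = (if q = (2,0,0) then Q_phi 1 1 else if q = (0,2,0) then Q_phi 2 2 else if q = (0,0,2) then Q_phi 3 3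
     else if q = (1,1,0) then 2 *s Q_phi 1 2 else if q = (1,0,1) then 2 *s Q_phi 1 3 else 2 *s Q_phi 2 3)"

definition F_poly :: "complex^3 \<Rightarrow> complex^'m"
  where "F_poly z = (\<Sum>q\<in>hexpos. monomial q z *s F_coeff q)"

lemma Qm_center_hist_left: "Qm S (center_hist z) \<psi> = (\<Sum>k\<in>UNIV. z $ k *s Qm S (Phi k) \<psi>)"
proof -
  have "Qm S (center_hist z) \<psi> = (\<Sum>k\<in>UNIV. Qm S (\<lambda>\<theta>. z $ k *s Phi k \<theta>) \<psi>)"
    unfolding center_hist_def[abs_def]
    by (rule history_linear_sum[OF history_linear_Qm_left]) (intro continuous_on_vscale_const continuous_on_Phi)
  also have "\<dots> = (\<Sum>k\<in>UNIV. z $ k *s Qm S (Phi k) \<psi>)"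
    by (rule sum.cong[OF refl], rule history_linear_scale[OF history_linear_Qm_left continuous_on_Phi])
  finally show ?thesis .
qed

lemma Qm_center_hist_right: "Qm S \<psi> (center_hist z) = (\<Sum>k\<in>UNIV. z $ k *s Qm S \<psi> (Phi k))"
  using Qm_center_hist_left[of z \<psi>] by (simp add: Qm_commute[of \<psi>])

lemma Qm_center_hist: "Qm S (center_hist z) (center_hist z) = F_poly z"
proof -
  have "Qm S (center_hist z) (center_hist z) = (\<Sum>k\<in>UNIV. z $ k *s (\<Sum>l\<in>UNIV. z $ l *s Q_phi k l))"
    by (subst Qm_center_hist_left) (simp only: Qm_center_hist_right Q_phi_def)
  also have "\<dots> = F_poly z"
    using Q_phi_commute[of 2 1] Q_phi_commute[of 3 1] Q_phi_commute[of 3 2]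
    by (simp add: F_poly_def sum_hexpos sum_3 monomial_def F_coeff_def vec_eq_iff algebra_simps power2_eq_square)
  finally show ?thesis .
qed

lemma Lop1_zero [simp]: "Lop1 S 0 = 0"
  by (rule linear_0[OF linear_Lop1])

lemma dcoef1_zero [simp]: "dcoef1 S 0 = 0"
proof -
  have "(dcoef S has_derivative (\<lambda>\<alpha>. (1/2) *\<^sub>R dcoef1 S \<alpha>)) (at 0)"
    using setting by (simp add: pfde_setting_def linear_part_def)
  from linear_0[OF has_derivative_linear[OF this]] show ?thesis by simp
qed

lemma dlap_zero [simp]: "dlap S 0 v = 0"
  by (simp add: dlap_def vec_eq_iff)

lemma F2_wc: "F2 S (wc S z) 0 = emb (F_poly z)"
  by (simp add: F2_def wc_eq Qop_emb[OF continuous_on_center_hist continuous_on_center_hist] Qm_center_hist)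

lemma proj_center_eq:
  "proj_center S \<phi> \<theta> = emb (\<Sum>j\<in>UNIV. pairing S 0 (expo_fun (- lam j) (psi_vec j)) (\<lambda>s. mode S 0 (\<phi> s)) *s Phi j \<theta>)"
  unfolding proj_center_def modes psi1_eq psi2_eq psi2b_eq phi1_eq phi2_eq phi2b_eq
  by (simp add: sum_3 emb_def[symmetric] emb.add add.assoc)

lemma f22_eq: "f22 S z \<theta> = emb (X0 (F_poly z) \<theta> - center (F_poly z) \<theta>)"
proof -
  have X: "X0 (emb F) s = emb (X0 F s)" for F s
    by (simp add: X0_def emb.zero)
  have "(\<lambda>s. mode S 0 (X0 (F2 S (wc S z) 0) s)) = X0 (F_poly z)"
    by (simp add: F2_wc X fun_eq_iff)
  then show ?thesis
    unfolding f22_def proj_center_eq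
    by (simp add: pairing_X0 F2_wc X center_def emb.diff)
qed

text \<open>
  The projection is the combination of the \<open>\<phi>\<^sub>j\<close> with the values of the forms as coefficients, and applying a form
  to this combination recovers its coefficient.
\<close>

lemma form_zero_iff_proj_center_zero:
  assumes "continuous_on I (\<lambda>\<theta>. mode S 0 (\<phi> \<theta>))"
  shows "(\<forall>\<theta>\<in>I. proj_center S \<phi> \<theta> = 0) \<longleftrightarrow> (\<forall>j. form j (\<lambda>\<theta>. mode S 0 (\<phi> \<theta>)) = 0)"
proof
  assume *: "\<forall>\<theta>\<in>I. proj_center S \<phi> \<theta> = 0"
  have z: "(\<Sum>j\<in>UNIV. form j (\<lambda>\<theta>. mode S 0 (\<phi> \<theta>)) *s Phi j \<theta>) = 0" if "\<theta> \<in> I" for \<theta>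
  proof -
    have "mode S 0 (proj_center S \<phi> \<theta>) = 0" using * that by (simp add: mode0.zero)
    then show ?thesis by (simp add: proj_center_eq pairing_eq_form[OF assms])
  qed
  show "\<forall>j. form j (\<lambda>\<theta>. mode S 0 (\<phi> \<theta>)) = 0"
  proof
    fix k
    have "form k (\<lambda>\<theta>. mode S 0 (\<phi> \<theta>)) = form k (\<lambda>\<theta>. \<Sum>j\<in>UNIV. form j (\<lambda>\<theta>. mode S 0 (\<phi> \<theta>)) *s Phi j \<theta>)"
      by (simp only: form_combination)
    also have "\<dots> = form k (\<lambda>\<theta>. 0)" by (rule form_cong) (rule z)
    finally show "form k (\<lambda>\<theta>. mode S 0 (\<phi> \<theta>)) = 0" by simp
  qed
next
  assume "\<forall>j. form j (\<lambda>\<theta>. mode S 0 (\<phi> \<theta>)) = 0"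
  then show "\<forall>\<theta>\<in>I. proj_center S \<phi> \<theta> = 0"
    by (simp add: proj_center_eq pairing_eq_form[OF assms] emb.zero)
qed

lemma hpoly_eq: "hpoly S h z \<theta> = (\<Sum>q\<in>hexpos. cscale S (monomial q z) (h q \<theta>))"
  by (simp add: hpoly_def monomial_def case_prod_unfold)

lemma mode0_hpoly: "mode S 0 (hpoly S h z \<theta>) = (\<Sum>q\<in>hexpos. monomial q z *s mode S 0 (h q \<theta>))"
  by (simp add: hpoly_eq mode0.sum)

lemma frechet_hpoly:
  "frechet_derivative (\<lambda>z. hpoly S h z \<theta>) (at z) (Bz S z) = (\<Sum>q\<in>hexpos. cscale S (weight q * monomial q z) (h q \<theta>))"
proof -
  have "\<forall>q\<in>hexpos. \<exists>D. (monomial q has_derivative D) (at z) \<and> D (Bz S z) = weight q * monomial q z"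
    using monomial_derivative by blast
  then obtain D where D: "\<And>q. q \<in> hexpos \<Longrightarrow> (monomial q has_derivative D q) (at z) \<and> D q (Bz S z) = weight q * monomial q z"
    by metis
  have "((\<lambda>z. \<Sum>q\<in>hexpos. cscale S (monomial q z) (h q \<theta>)) has_derivative (\<lambda>d. \<Sum>q\<in>hexpos. cscale S (D q d) (h q \<theta>))) (at z)"
    by (rule has_derivative_sum)
       (use D in \<open>auto intro: bounded_linear.has_derivative[OF cscale.bounded_linear_left]\<close>)
  from frechet_derivative_at[OF this, symmetric] show ?thesis
    unfolding hpoly_eq using D by simp
qed

lemma hpoly_derivative:
  assumes "\<And>q. q \<in> hexpos \<Longrightarrow> (h q has_vector_derivative h' q) (at \<theta> within A)"
  shows "(hpoly S h z has_vector_derivative (\<Sum>q\<in>hexpos. cscale S (monomial q z) (h' q))) (at \<theta> within A)"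
  unfolding hpoly_eq[abs_def]
  by (rule has_vector_derivative_sum)
     (rule bounded_linear.has_vector_derivative[OF cscale.bounded_linear_right], rule assms)

lemma A1_eq:
  assumes "\<And>\<theta>. \<theta> \<in> I \<Longrightarrow> (\<phi> has_vector_derivative \<phi>' \<theta>) (at \<theta> within I)" "\<theta> \<in> I"
  shows "A1 S \<phi> \<theta> = \<phi>' \<theta> + X0 (blinfun_apply (Lop S 0) (hist S \<phi>) + dlap S (dcoef S 0) (\<phi> 0) - \<phi>' 0) \<theta>"
proof -
  have "vector_derivative \<phi> (at \<theta> within I) = \<phi>' \<theta>" if "\<theta> \<in> I" for \<theta>
    by (rule vector_derivative_within_cbox[of "- delay S" 0, unfolded cbox_interval])
       (use assms(1) that delay_pos in auto)
  then show ?thesis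
    unfolding A1_def using assms(2) zero_in_I by simp
qed

lemma center_F_poly: "center (F_poly z) \<theta> = (\<Sum>q\<in>hexpos. monomial q z *s center (F_coeff q) \<theta>)"
proof -
  have "center (\<Sum>q\<in>A. monomial q z *s F_coeff q) \<theta> = (\<Sum>q\<in>A. monomial q z *s center (F_coeff q) \<theta>)" for A
    by (induction A rule: infinite_finite_induct) (simp_all add: center_add center_scale center_def[of 0])
  then show ?thesis by (simp add: F_poly_def)
qed

lemma dom_lap_hpoly:
  assumes "\<And>q. q \<in> hexpos \<Longrightarrow> h q \<theta> \<in> dom_lap S"
  shows "hpoly S h z \<theta> \<in> dom_lap S"
proof -
  have z: "0 \<in> dom_lap S" using emb_in_dom_lap[of 0] by (simp add: emb.zero)
  have "(\<Sum>q\<in>A. cscale S (monomial q z) (h q \<theta>)) \<in> dom_lap S" if "A \<subseteq> hexpos" "finite A" for A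
    using that(2,1) by (induction A rule: finite_induct) (auto intro!: z dom_lap_combine assms)
  then show ?thesis by (simp add: hpoly_eq)
qed

text \<open>
  The mean of the equation for \<open>h\<close> is an identity between quadratic forms in \<open>z\<close>, so their coefficients agree.
  For \<open>\<theta> < 0\<close>, where \<open>X\<^sub>0\<close> vanishes, this is the differential equation; at \<open>\<theta> = 0\<close> the derivative of \<open>h\<close> cancels in
  \<open>A\<^sub>1 h\<close> and the boundary condition remains.
\<close>

lemma is_h_solves:
  assumes h: "is_h S h" and q: "q \<in> hexpos"
  shows "solves (weight q) (F_coeff q) (\<lambda>\<theta>. mode S 0 (h q \<theta>))"
proof -
  define H where "H = (\<lambda>q \<theta>. mode S 0 (h q \<theta>))"
  have Q1: "h q \<in> Q1 S" if "q \<in> hexpos" for q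
    using h that unfolding is_h_def by blast
  then have "\<forall>q\<in>hexpos. \<exists>\<phi>'. continuous_on I \<phi>' \<and> (\<forall>\<theta>\<in>I. (h q has_vector_derivative \<phi>' \<theta>) (at \<theta> within I))"
    unfolding Q1_def by blast
  then obtain h' where h': "\<And>q. q \<in> hexpos \<Longrightarrow> continuous_on I (h' q)"
    "\<And>q \<theta>. q \<in> hexpos \<Longrightarrow> \<theta> \<in> I \<Longrightarrow> (h q has_vector_derivative h' q \<theta>) (at \<theta> within I)"
    by metis
  define H' where "H' = (\<lambda>q \<theta>. mode S 0 (h' q \<theta>))"
  have cH': "continuous_on I (H' q)" if "q \<in> hexpos" for q
    unfolding H'_def by (rule continuous_on_mode0[OF h'(1)[OF that]])
  have dH: "(H q has_vector_derivative H' q \<theta>) (at \<theta> within I)" if "q \<in> hexpos" "\<theta> \<in> I" for q \<theta>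
    unfolding H_def H'_def by (rule bounded_linear.has_vector_derivative[OF bounded_linear_mode0 h'(2)[OF that]])
  have cH: "continuous_on I (H q)" if "q \<in> hexpos" for q
    by (rule continuous_on_vector_derivative[OF dH[OF that]])
  have form0: "form j (H q) = 0" if "q \<in> hexpos" for j q
    using Q1[OF that] form_zero_iff_proj_center_zero[of "h q"] cH[OF that] unfolding Q1_def H_def by simp
  have dpoly: "(hpoly S h z has_vector_derivative (\<Sum>q\<in>hexpos. cscale S (monomial q z) (h' q \<theta>))) (at \<theta> within I)"
    if "\<theta> \<in> I" for z \<theta>
    by (rule hpoly_derivative) (rule h'(2)[OF _ that])
  have cpoly: "continuous_on I (hpoly S h z)" for z
    by (rule continuous_on_vector_derivative[OF dpoly])
  have dom: "hpoly S h z 0 \<in> dom_lap S" for z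
    by (rule dom_lap_hpoly) (use Q1 in \<open>auto simp: Q1_def\<close>)
  have Lam: "\<Lambda> (\<lambda>\<theta>. mode S 0 (hpoly S h z \<theta>)) = (\<Sum>q\<in>hexpos. monomial q z *s \<Lambda> (H q))" for z
  proof -
    have "\<Lambda> (\<lambda>\<theta>. mode S 0 (hpoly S h z \<theta>)) = \<Lambda> (\<lambda>\<theta>. \<Sum>q\<in>hexpos. monomial q z *s H q \<theta>)"
      by (simp add: mode0_hpoly H_def)
    also have "\<dots> = (\<Sum>q\<in>hexpos. \<Lambda> (\<lambda>\<theta>. monomial q z *s H q \<theta>))"
      by (rule \<Lambda>_sum) (rule continuous_on_vscale_const[OF cH])
    also have "\<dots> = (\<Sum>q\<in>hexpos. monomial q z *s \<Lambda> (H q))"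
      by (rule sum.cong[OF refl]) (rule \<Lambda>_scale[OF cH])
    finally show ?thesis .
  qed
  have eq: "(\<Sum>q\<in>hexpos. (weight q * monomial q z) *s H q \<theta>)
      - ((\<Sum>q\<in>hexpos. monomial q z *s H' q \<theta>)
         + X0 ((\<Sum>q\<in>hexpos. monomial q z *s \<Lambda> (H q)) - (\<Sum>q\<in>hexpos. monomial q z *s H' q 0)) \<theta>)
      = (1/2) *s (X0 (F_poly z) \<theta> - center (F_poly z) \<theta>)" if \<theta>: "\<theta> \<in> I" for z \<theta>
  proof -
    have X: "mode S 0 (X0 v \<theta>) = X0 (mode S 0 v) \<theta>" for v
      by (simp add: X0_def mode0.zero)
    have "mode S 0 (frechet_derivative (\<lambda>z. hpoly S h z \<theta>) (at z) (Bz S z) - A1 S (hpoly S h z) \<theta>)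
        = mode S 0 ((1/2) *\<^sub>R f22 S z \<theta>)"
      using h \<theta> unfolding is_h_def by simp
    moreover have "mode S 0 ((1/2) *\<^sub>R f22 S z \<theta>) = (1/2) *s (X0 (F_poly z) \<theta> - center (F_poly z) \<theta>)"
      by (simp only: mode0.scaleR f22_eq mode0_emb scaleR_eq_vscale) simp
    ultimately show ?thesis
      by (simp only: frechet_hpoly A1_eq[OF dpoly \<theta>] mode0.diff mode0.add mode0.sum mode0_cscale X
          mode0_Lop0[OF cpoly] mode0_dlap[OF dom] Lam H_def[symmetric] H'_def[symmetric] add_0_right)
         (simp only: H_def H'_def)
  qed
  have interior: "H' q \<theta> = weight q *s H q \<theta> + (1/2) *s center (F_coeff q) \<theta>" if q: "q \<in> hexpos" and \<theta>: "\<theta> \<in> {- delay S..<0}" for q \<theta>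
  proof -
    have "(\<Sum>q\<in>hexpos. monomial q z *s (weight q *s H q \<theta> - H' q \<theta> + (1/2) *s center (F_coeff q) \<theta>)) = 0" for z
    proof -
      have "(\<Sum>q\<in>hexpos. (weight q * monomial q z) *s H q \<theta>) - (\<Sum>q\<in>hexpos. monomial q z *s H' q \<theta>)
          = - ((1/2) *s (\<Sum>q\<in>hexpos. monomial q z *s center (F_coeff q) \<theta>))"
        using eq[of \<theta> z] \<theta> by (simp add: X0_def center_F_poly)
      then show ?thesis
        by (simp add: vec.scale_right_distrib vec.scale_right_diff_distrib sum.distrib sum_subtractf
            vec.scale_sum_right mult.commute)
    qed
    from monomial_sum_zero[OF this q] show ?thesis by (simp add: algebra_simps)
  qed
  \<comment> \<open>At the right end the differential equation holds because both of its sides are continuous.\<close>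
  have deriv: "H' q \<theta> = weight q *s H q \<theta> + (1/2) *s center (F_coeff q) \<theta>" if q: "q \<in> hexpos" and \<theta>: "\<theta> \<in> I" for q \<theta>
  proof -
    define D where "D = (\<lambda>\<theta>. H' q \<theta> - (weight q *s H q \<theta> + (1/2) *s center (F_coeff q) \<theta>))"
    have cl: "closure {- delay S..<0} = I" using delay_pos by (simp add: closure_atLeastLessThan)
    have "continuous_on (closure {- delay S..<0}) D"
      unfolding cl D_def
      by (intro continuous_on_diff continuous_on_add continuous_on_vscale_const continuous_on_center cH cH' q)
    then have "D \<theta> = 0"
      by (rule continuous_constant_on_closure) (use interior[OF q] \<theta> cl in \<open>auto simp: D_def\<close>)
    then show ?thesis by (simp add: D_def)
  qed
  have boundary: "\<Lambda> (H q) = weight q *s H q 0 - (1/2) *s (F_coeff q - center (F_coeff q) 0)" if q: "q \<in> hexpos" for q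
  proof -
    have "(\<Sum>q\<in>hexpos. monomial q z *s (weight q *s H q 0 - \<Lambda> (H q) - (1/2) *s (F_coeff q - center (F_coeff q) 0))) = 0" for z
    proof -
      have "(\<Sum>q\<in>hexpos. (weight q * monomial q z) *s H q 0) - (\<Sum>q\<in>hexpos. monomial q z *s \<Lambda> (H q))
          = (1/2) *s (F_poly z - (\<Sum>q\<in>hexpos. monomial q z *s center (F_coeff q) 0))"
        using eq[OF zero_in_I, of z] by (simp add: X0_def center_F_poly)
      then show ?thesis
        by (simp add: F_poly_def vec.scale_right_distrib vec.scale_right_diff_distrib sum.distrib sum_subtractf
            vec.scale_sum_right mult.commute)
    qed
    from monomial_sum_zero[OF this q] show ?thesis by (simp add: algebra_simps)
  qed
  have "solves (weight q) (F_coeff q) (H q)"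
    unfolding solves_def using dH[OF q] deriv[OF q] boundary[OF q] form0[OF q] by simp
  then show ?thesis by (simp add: H_def)
qed

lemma Re_weight: "Re (weight q) = 0"
  by (cases q) (simp add: weight_def)

text \<open>
  Solutions of the boundary value problems in \<open>\<complex>\<^sup>m\<close>, regarded as constant in space, solve the full equation:
  the Laplacian vanishes on them, and \<open>L\<^sub>0\<close> and \<open>Q\<close> map spatially constant histories to constants.
\<close>

lemma is_h_exists: "\<exists>h. is_h S h"
proof -
  have "\<forall>q. \<exists>H. solves (weight q) (F_coeff q) H"
    using solves_exists[OF Re_weight] by blast
  then obtain H where H: "\<And>q. solves (weight q) (F_coeff q) (H q)" by metis
  define H' where "H' = (\<lambda>q \<theta>. weight q *s H q \<theta> + (1/2) *s center (F_coeff q) \<theta>)"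
  define h where "h = (\<lambda>q \<theta>. emb (H q \<theta>))"
  have cH: "continuous_on I (H q)" for q by (rule solves_continuous[OF H])
  have cH': "continuous_on I (H' q)" for q
    unfolding H'_def by (intro continuous_on_add continuous_on_vscale_const continuous_on_center cH)
  have dh: "(h q has_vector_derivative emb (H' q \<theta>)) (at \<theta> within I)" if "\<theta> \<in> I" for q \<theta>
  proof -
    have "(H q has_vector_derivative H' q \<theta>) (at \<theta> within I)"
      using H[of q] that unfolding solves_def H'_def by blast
    from bounded_linear.has_vector_derivative[OF bounded_linear_emb this]
    show ?thesis by (simp add: h_def)
  qed
  have m: "(\<lambda>\<theta>. mode S 0 (h q \<theta>)) = H q" for q
    by (simp add: h_def fun_eq_iff)
  have "h q \<in> Q1 S" for q
  proof -
    have "\<forall>\<theta>\<in>I. proj_center S (h q) \<theta> = 0"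
      using H[of q] form_zero_iff_proj_center_zero[of "h q"] cH unfolding m solves_def by blast
    moreover have "\<exists>\<phi>'. continuous_on I \<phi>' \<and> (\<forall>\<theta>\<in>I. (h q has_vector_derivative \<phi>' \<theta>) (at \<theta> within I))"
      by (rule exI[of _ "\<lambda>\<theta>. emb (H' q \<theta>)"]) (use dh continuous_on_emb[OF cH'] in blast)
    moreover have "h q 0 \<in> dom_lap S" by (simp add: h_def emb_in_dom_lap)
    ultimately show ?thesis unfolding Q1_def by blast
  qed
  moreover have "frechet_derivative (\<lambda>z. hpoly S h z \<theta>) (at z) (Bz S z) - A1 S (hpoly S h z) \<theta>
      = (1/2) *\<^sub>R f22 S z \<theta>" if \<theta>: "\<theta> \<in> I" for z \<theta>
  proof -
    define P where "P = (\<lambda>\<theta>. \<Sum>q\<in>hexpos. monomial q z *s H q \<theta>)"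
    have P: "hpoly S h z = (\<lambda>\<theta>. emb (P \<theta>))"
      by (simp add: fun_eq_iff hpoly_eq h_def P_def emb.sum)
    have cP: "continuous_on I P"
      unfolding P_def by (intro continuous_on_sum continuous_on_vscale_const cH)
    have LP: "\<Lambda> P = (\<Sum>q\<in>hexpos. monomial q z *s \<Lambda> (H q))"
    proof -
      have "\<Lambda> P = (\<Sum>q\<in>hexpos. \<Lambda> (\<lambda>\<theta>. monomial q z *s H q \<theta>))"
        unfolding P_def by (rule \<Lambda>_sum) (rule continuous_on_vscale_const[OF cH])
      also have "\<dots> = (\<Sum>q\<in>hexpos. monomial q z *s \<Lambda> (H q))"
        by (rule sum.cong[OF refl]) (rule \<Lambda>_scale[OF cH])
      finally show ?thesis .
    qed
    have dP: "(hpoly S h z has_vector_derivative emb (\<Sum>q\<in>hexpos. monomial q z *s H' q \<theta>)) (at \<theta> within I)"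
      if "\<theta> \<in> I" for \<theta>
      using hpoly_derivative[of h "\<lambda>q. emb (H' q \<theta>)", OF dh[OF that]] by (simp add: emb.sum)
    have X: "X0 (emb v) \<theta> = emb (X0 v \<theta>)" for v
      by (simp add: X0_def emb.zero)
    have H'eq: "(\<Sum>q\<in>hexpos. monomial q z *s H' q \<theta>)
        = (\<Sum>q\<in>hexpos. (weight q * monomial q z) *s H q \<theta>) + (1/2) *s center (F_poly z) \<theta>" for \<theta>
      by (simp add: H'_def center_F_poly vec.scale_right_distrib sum.distrib vec.scale_sum_right mult.commute)
    have Leq: "\<Lambda> P = (\<Sum>q\<in>hexpos. (weight q * monomial q z) *s H q 0) - (1/2) *s (F_poly z - center (F_poly z) 0)"
    proof -
      have "\<Lambda> (H q) = weight q *s H q 0 - (1/2) *s (F_coeff q - center (F_coeff q) 0)" for q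
        using H[of q] unfolding solves_def by blast
      then show ?thesis
        unfolding LP center_F_poly
        by (simp add: F_poly_def vec.scale_right_diff_distrib sum_subtractf vec.scale_sum_right mult.commute)
    qed
    have "A1 S (hpoly S h z) \<theta> = emb ((\<Sum>q\<in>hexpos. monomial q z *s H' q \<theta>) + X0 (\<Lambda> P - (\<Sum>q\<in>hexpos. monomial q z *s H' q 0)) \<theta>)"
    proof -
      have "A1 S (hpoly S h z) \<theta> = emb (\<Sum>q\<in>hexpos. monomial q z *s H' q \<theta>)
          + X0 (blinfun_apply (Lop S 0) (hist S (hpoly S h z)) + dlap S (dcoef S 0) (hpoly S h z 0)
              - emb (\<Sum>q\<in>hexpos. monomial q z *s H' q 0)) \<theta>"
        by (rule A1_eq[OF dP \<theta>])
      also have "\<dots> = emb ((\<Sum>q\<in>hexpos. monomial q z *s H' q \<theta>) + X0 (\<Lambda> P - (\<Sum>q\<in>hexpos. monomial q z *s H' q 0)) \<theta>)"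
        unfolding P by (simp only: Lop0_emb[OF cP] dlap_emb add_0_right emb.add emb.diff[symmetric] X)
      finally show ?thesis .
    qed
    moreover have "frechet_derivative (\<lambda>z. hpoly S h z \<theta>) (at z) (Bz S z)
        = emb (\<Sum>q\<in>hexpos. (weight q * monomial q z) *s H q \<theta>)"
      unfolding frechet_hpoly by (simp add: h_def emb.sum)
    moreover have "(\<Sum>q\<in>hexpos. (weight q * monomial q z) *s H q \<theta>)
        - ((\<Sum>q\<in>hexpos. monomial q z *s H' q \<theta>) + X0 (\<Lambda> P - (\<Sum>q\<in>hexpos. monomial q z *s H' q 0)) \<theta>)
        = (1/2) *s (X0 (F_poly z) \<theta> - center (F_poly z) \<theta>)"
      unfolding H'eq Leq by (cases "\<theta> = 0") (simp_all add: X0_def vec.scale_right_diff_distrib)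
    ultimately show ?thesis
      by (simp only: f22_eq emb.diff[symmetric] emb.scaleR[symmetric] scaleR_eq_vscale) simp
  qed
  ultimately show ?thesis unfolding is_h_def by blast
qed


section \<open>The coefficients of the normal form\<close>

text \<open>
  The exponents \<open>q\<close> for which \<open>M\<^sub>2\<^sup>1\<close> vanishes on \<open>z\<^sup>q e\<^sub>i\<close>.
\<close>

definition resonant :: "3 \<Rightarrow> (nat \<times> nat \<times> nat) set"
  where "resonant i = (if i = 1 then {(2,0,0), (0,1,1)} else if i = 2 then {(1,1,0)} else {(1,0,1)})"

text \<open>
  The coefficients of the \<open>i\<close>-th component of \<open>U\<^sub>2\<^sup>1\<close>, and below those of \<open>g\<^sub>2\<^sup>1(z,0,0)\<close>.
\<close>

definition U_coeff :: "3 \<Rightarrow> nat \<times> nat \<times> nat \<Rightarrow> complex"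
  where "U_coeff i q = (if q \<in> resonant i then 0 else (psi_vec i \<odot> F_coeff q) / (weight q - lam i))"

definition g_coeff :: "3 \<Rightarrow> nat \<times> nat \<times> nat \<Rightarrow> complex"
  where "g_coeff i q = (if q \<in> resonant i then psi_vec i \<odot> F_coeff q else 0)"

lemma nonresonant: "q \<in> hexpos \<Longrightarrow> q \<notin> resonant i \<Longrightarrow> weight q \<noteq> lam i"
  using om0_pos exhaust_index3[of i]
  by (auto simp: hexpos_def resonant_def weight_def complex_eq_iff split: if_splits)

lemma center_part_nth: "center_part S F $ j = psi_vec j \<odot> mode S 0 F"
  using exhaust_index3[of j]
  by (auto simp: center_part_def modes psi1_eq psi2_eq psi2b_eq vector_3)

lemma Lm1_center_hist: "Lm S (Lop1 S \<alpha>) (center_hist z) = (\<Sum>k\<in>UNIV. z $ k *s Lm S (Lop1 S \<alpha>) (Phi k))"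
proof -
  have "Lm S (Lop1 S \<alpha>) (center_hist z) = (\<Sum>k\<in>UNIV. Lm S (Lop1 S \<alpha>) (\<lambda>\<theta>. z $ k *s Phi k \<theta>))"
    unfolding center_hist_def[abs_def]
    by (rule history_linear_sum[OF history_linear_Lm1]) (intro continuous_on_vscale_const continuous_on_Phi)
  also have "\<dots> = (\<Sum>k\<in>UNIV. z $ k *s Lm S (Lop1 S \<alpha>) (Phi k))"
    by (rule sum.cong[OF refl], rule history_linear_scale[OF history_linear_Lm1 continuous_on_Phi])
  finally show ?thesis .
qed

lemma Lm1_expand: "Lm S (Lop1 S \<alpha>) \<phi> = complex_of_real (\<alpha> $ 1) *s Lm S (Lop1 S (axis 1 1)) \<phi>
    + complex_of_real (\<alpha> $ 2) *s Lm S (Lop1 S (axis 2 1)) \<phi>"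
  unfolding Lm_def
  by (subst Lop1_expand) (simp only: blinfun.add_left blinfun.scaleR_left mode0.add mode0.scaleR scaleR_eq_vscale)

lemma f21_nth: "f21 S z 0 \<alpha> $ j = (\<Sum>k\<in>UNIV. z $ k * (psi_vec j \<odot> Lm S (Lop1 S \<alpha>) (Phi k)))
    + quad (\<lambda>q. psi_vec j \<odot> F_coeff q) z"
proof -
  have wc0: "apply_bcontfun (wc S z) 0 = emb (center_hist z 0)"
    unfolding wc_eq htens_beta0 by (rule apply_hist[OF continuous_on_emb[OF continuous_on_center_hist] zero_in_I])
  have "mode S 0 (F2 S (wc S z) \<alpha>) = Lm S (Lop1 S \<alpha>) (center_hist z) + F_poly z"
    unfolding F2_def wc0
    by (simp add: mode0.add mode0.zero wc_eq Qop_emb[OF continuous_on_center_hist continuous_on_center_hist] Qm_center_hist Lm_def)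
  then show ?thesis
    unfolding f21_def center_part_nth
    by (simp add: Lm1_center_hist F_poly_def dotc_sum quad_monomial mult.commute)
qed

lemma g21_nth: "g21 S z \<alpha> $ j = z $ j * (psi_vec j \<odot> Lm S (Lop1 S \<alpha>) (Phi j)) + quad (g_coeff j) z"
proof -
  define K :: "expo set" where "K = {(2,0,0,0,0), (0,2,0,0,0), (0,0,2,0,0), (1,1,0,0,0), (1,0,1,0,0), (0,1,1,0,0),
    (1,0,0,1,0), (0,1,0,1,0), (0,0,1,1,0), (1,0,0,0,1), (0,1,0,0,1), (0,0,1,0,1)}"
  define c where "c = (\<lambda>(i::3) q. case q of (a::nat, b::nat, d::nat, s::nat, t::nat) \<Rightarrow>
    if s = 0 \<and> t = 0 then psi_vec i \<odot> F_coeff (a, b, d)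
    else psi_vec i \<odot> Lm S (Lop1 S (if s = 1 then axis 1 1 else axis 2 1)) (Phi (if a = 1 then 1 else if b = 1 then 2 else 3)))"
  have rep: "f21 S z 0 \<alpha> $ i = (\<Sum>q\<in>K. c i q * zmono q z \<alpha>)" for z \<alpha> i
    unfolding f21_nth Lm1_expand[of \<alpha>] quad_expand
    by (simp add: K_def c_def zmono_def sum_3 algebra_simps)
  have "Proj 2 res2 (\<lambda>z \<alpha>. f21 S z 0 \<alpha>) z \<alpha> $ j = (\<Sum>q\<in>res2 j. c j q * zmono q z \<alpha>)"
    by (rule Proj_eq[OF rep]) (auto simp: K_def expos_def res2_def)
  then show ?thesis
    unfolding g21_def Lm1_expand[of \<alpha>] quad_expand
    using exhaust_index3[of j] by (auto simp: res2_def c_def zmono_def g_coeff_def resonant_def algebra_simps)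
qed

lemma g21_zero: "g21 S z 0 $ j = quad (g_coeff j) z"
  using Lm1_expand[of 0] by (simp add: g21_nth)

lemma f21_zero: "f21 S z 0 0 $ j = quad (\<lambda>q. psi_vec j \<odot> F_coeff q) z"
  using Lm1_expand[of 0] by (simp add: f21_nth)

lemma vector_polynomial:
  assumes "\<And>z i. U z $ i = quad (u i) z"
  shows "U = (\<lambda>z. \<Sum>i\<in>UNIV. quad (u i) z *s axis i 1)"
  by (simp add: fun_eq_iff vec_eq_iff axis_def if_distrib assms cong: if_cong)

lemma frechet_vector_polynomial:
  fixes U :: "complex^3 \<Rightarrow> complex^3"
  assumes "\<And>z i. U z $ i = quad (u i) z"
  shows "frechet_derivative U (at z) d $ i
    = (\<Sum>k\<in>UNIV. (dquad (u i) k 1 * z$1 + dquad (u i) k 2 * z$2 + dquad (u i) k 3 * z$3) * d $ k)"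
proof -
  let ?D = "\<lambda>i d. \<Sum>k\<in>UNIV. (dquad (u i) k 1 * z$1 + dquad (u i) k 2 * z$2 + dquad (u i) k 3 * z$3) * d $ k"
  have "(U has_derivative (\<lambda>d. \<Sum>i\<in>UNIV. ?D i d *s axis i 1)) (at z)"
    unfolding vector_polynomial[OF assms]
    by (rule has_derivative_sum, rule bounded_linear.has_derivative[OF vscale.bounded_linear_left quad_has_derivative])
  from frechet_derivative_at[OF this, symmetric]
  show ?thesis by (simp add: axis_def if_distrib cong: if_cong)
qed

text \<open>
  \<open>M\<^sub>2\<^sup>1\<close> is diagonal in the monomials.
\<close>

lemma M1_vector_polynomial:
  assumes "\<And>z i. U z $ i = quad (u i) z"
  shows "M1 S U z $ i = quad (\<lambda>q. (weight q - lam i) * u i q) z"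
proof -
  have "M1 S U z $ i = quad (\<lambda>q. weight q * u i q) z - lam i * quad (u i) z"
    unfolding M1_def vector_minus_component frechet_vector_polynomial[OF assms] dquad_Bz
    by (simp add: Bz_nth assms)
  then show ?thesis
    by (simp add: quad_monomial sum_distrib_left sum_subtractf[symmetric] algebra_simps)
qed

lemma sum_nonresonant:
  "(\<Sum>q\<in>{(a, b, c, s, t) \<in> expos 2. s = 0 \<and> t = 0} - res2 i. u q * zmono q z 0)
    = quad (\<lambda>(a, b, c). if (a, b, c) \<in> resonant i then 0 else u (a, b, c, 0, 0)) z"
proof -
  have set: "{(a, b, c, s, t) \<in> expos 2. s = 0 \<and> t = 0}
      = {(2,0,0,0,0), (0,2,0,0,0), (0,0,2,0,0), (1,1,0,0,0), (1,0,1,0,0), (0,1,1,0,0)}"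
  proof -
    have "a + b + c = 2 \<longleftrightarrow> (a, b, c) \<in> hexpos" for a b c :: nat
      unfolding hexpos_def by (simp, presburger)
    then show ?thesis by (auto simp: expos_def hexpos_def)
  qed
  show ?thesis
    unfolding set using exhaust_index3[of i]
    by (auto simp: res2_def resonant_def quad_expand zmono_def insert_Diff_if)
qed

text \<open>
  On the nonresonant monomials the eigenvalues of \<open>M\<^sub>2\<^sup>1\<close> are nonzero, so the homological equation is solved
  by division, and its solution is unique because the coefficients of a quadratic form are.
\<close>

lemma is_U21_iff: "is_U21 S U \<longleftrightarrow> (\<forall>z i. U z $ i = quad (U_coeff i) z)"
proof
  assume U: "is_U21 S U"
  then obtain u :: "3 \<Rightarrow> expo \<Rightarrow> complex" where u: "\<And>z i. U z $ i =
       (\<Sum>q\<in>{(a, b, c, s, t) \<in> expos 2. s = 0 \<and> t = 0} - res2 i. u i q * zmono q z 0)"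
    unfolding is_U21_def by blast
  define v where "v = (\<lambda>i (a, b, c). if (a, b, c) \<in> resonant i then 0 else u i (a, b, c, 0, 0))"
  have Uv: "U z $ i = quad (v i) z" for z i
    unfolding u sum_nonresonant v_def ..
  have "v i q = U_coeff i q" if q: "q \<in> hexpos" for i q
  proof -
    have "M1 S U z $ i = f21 S z 0 0 $ i - g21 S z 0 $ i" for z
      using U unfolding is_U21_def by simp
    then have "quad (\<lambda>q. (weight q - lam i) * v i q) z = quad (\<lambda>q. (psi_vec i \<odot> F_coeff q) - g_coeff i q) z" for z
      unfolding M1_vector_polynomial[OF Uv] f21_zero g21_zero
      by (simp add: quad_monomial left_diff_distrib sum_subtractf)
    from quad_eq_coeff[OF this q] show ?thesis
      using nonresonant[OF q, of i] by (cases q) (auto simp: U_coeff_def g_coeff_def v_def field_simps)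
  qed
  then show "\<forall>z i. U z $ i = quad (U_coeff i) z"
    by (simp add: Uv quad_monomial)
next
  assume *: "\<forall>z i. U z $ i = quad (U_coeff i) z"
  show "is_U21 S U"
    unfolding is_U21_def
  proof (intro conjI allI)
    have "U z $ i = (\<Sum>q\<in>{(a, b, c, s, t) \<in> expos 2. s = 0 \<and> t = 0} - res2 i.
        (case q of (a, b, c, s, t) \<Rightarrow> U_coeff i (a, b, c)) * zmono q z 0)" for z i
      unfolding sum_nonresonant using * by (auto simp: quad_monomial U_coeff_def intro!: sum.cong)
    then show "\<exists>u. \<forall>z i. U z $ i =
       (\<Sum>q\<in>{(a, b, c, s, t) \<in> expos 2. s = 0 \<and> t = 0} - res2 i. u i q * zmono q z 0)"
      by (intro exI[of _ "\<lambda>i q. case q of (a, b, c, s, t) \<Rightarrow> U_coeff i (a, b, c)"]) blast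
    fix z
    have "M1 S U z $ i = (f21 S z 0 0 - g21 S z 0) $ i" for i
    proof -
      have "M1 S U z $ i = quad (\<lambda>q. (weight q - lam i) * U_coeff i q) z"
        by (rule M1_vector_polynomial) (use * in blast)
      also have "\<dots> = quad (\<lambda>q. (psi_vec i \<odot> F_coeff q) - g_coeff i q) z"
        unfolding quad_monomial by (rule sum.cong[OF refl]) (use nonresonant[of _ i] in \<open>auto simp: U_coeff_def g_coeff_def\<close>)
      also have "\<dots> = (f21 S z 0 0 - g21 S z 0) $ i"
        by (simp add: f21_zero g21_zero quad_monomial left_diff_distrib sum_subtractf)
      finally show ?thesis .
    qed
    then show "M1 S U z = f21 S z 0 0 - g21 S z 0"
      by (simp add: vec_eq_iff)
  qed
qed

lemma is_U21_exists: "\<exists>U. is_U21 S U"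
  unfolding is_U21_iff by (rule exI[of _ "\<lambda>z. \<chi> i. quad (U_coeff i) z"]) simp


subsection \<open>Cubic terms\<close>

text \<open>
  The numbers \<open>\<psi>\<^sub>j(0) C(\<phi>\<^sub>k,\<phi>\<^sub>l,\<phi>\<^sub>m)\<close>, \<open>\<psi>\<^sub>j(0) Q(\<phi>\<^sub>k,\<phi>\<^sub>l)\<close> and \<open>\<psi>\<^sub>j(0) Q(\<phi>\<^sub>k,h\<^sub>q)\<close>, out of which all
  coefficients are built.
\<close>

definition C_psi :: "3 \<Rightarrow> 3 \<Rightarrow> 3 \<Rightarrow> 3 \<Rightarrow> complex"
  where "C_psi j k l m = psi_vec j \<odot> Cm S (Phi k) (Phi l) (Phi m)"

definition Q_psi :: "3 \<Rightarrow> 3 \<Rightarrow> 3 \<Rightarrow> complex"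
  where "Q_psi j k l = psi_vec j \<odot> Q_phi k l"

definition Qh_psi :: "(nat \<times> nat \<times> nat \<Rightarrow> real \<Rightarrow> 'x^'m) \<Rightarrow> 3 \<Rightarrow> 3 \<Rightarrow> nat \<times> nat \<times> nat \<Rightarrow> complex"
  where "Qh_psi h j k q = psi_vec j \<odot> Qm S (Phi k) (\<lambda>\<theta>. mode S 0 (h q \<theta>))"

lemma Q_psi_commute: "Q_psi j k l = Q_psi j l k"
  by (simp add: Q_psi_def Q_phi_commute)

lemma C_psi_swap: "C_psi j k l m = C_psi j l k m" "C_psi j k l m = C_psi j k m l"
  unfolding C_psi_def by (subst Cm_swap12, rule refl) (subst Cm_swap23, rule refl)

text \<open>
  The coefficients of \<open>\<psi>\<^sub>j(0) C(w(z),w(z),w(z))\<close>, with the multinomial factors.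
\<close>

definition C_coeff :: "3 \<Rightarrow> nat \<times> nat \<times> nat \<Rightarrow> complex"
  where "C_coeff j q = (if q = (3,0,0) then C_psi j 1 1 1 else if q = (0,3,0) then C_psi j 2 2 2 else if q = (0,0,3) then C_psi j 3 3 3
    else if q = (2,1,0) then 3 * C_psi j 1 1 2 else if q = (2,0,1) then 3 * C_psi j 1 1 3 else if q = (1,2,0) then 3 * C_psi j 1 2 2
    else if q = (0,2,1) then 3 * C_psi j 2 2 3 else if q = (1,0,2) then 3 * C_psi j 1 3 3 else if q = (0,1,2) then 3 * C_psi j 2 3 3
    else 6 * C_psi j 1 2 3)"

lemma f31_nth: "f31 S z $ j = cubic (C_coeff j) z"
proof -
  have c: "continuous_on I (\<lambda>\<theta>. z $ k *s Phi k \<theta>)" for k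
    by (intro continuous_on_vscale_const continuous_on_Phi)
  have 1: "Cm S (center_hist z) \<phi> \<psi> = (\<Sum>k\<in>UNIV. z $ k *s Cm S (Phi k) \<phi> \<psi>)" for \<phi> \<psi>
    unfolding center_hist_def[abs_def]
    by (simp only: history_linear_sum[OF history_linear_Cm_left c] history_linear_scale[OF history_linear_Cm_left continuous_on_Phi])
  have 2: "Cm S \<phi> (center_hist z) \<psi> = (\<Sum>k\<in>UNIV. z $ k *s Cm S \<phi> (Phi k) \<psi>)" for \<phi> \<psi>
    using 1[of \<phi> \<psi>] by (simp add: Cm_swap12[of \<phi>])
  have 3: "Cm S \<phi> \<psi> (center_hist z) = (\<Sum>k\<in>UNIV. z $ k *s Cm S \<phi> \<psi> (Phi k))" for \<phi> \<psi>
    using 2[of \<phi> \<psi>] by (simp add: Cm_swap23[of \<phi> \<psi>])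
  have "f31 S z $ j = psi_vec j \<odot> Cm S (center_hist z) (center_hist z) (center_hist z)"
    by (simp add: f31_def center_part_nth F3_def wc_eq Cm_def)
  also have "\<dots> = (\<Sum>k\<in>UNIV. z $ k * (\<Sum>l\<in>UNIV. z $ l * (\<Sum>m\<in>UNIV. z $ m * C_psi j k l m)))"
    by (subst 1, subst 2, subst 3) (simp add: dotc_sum C_psi_def)
  also have "\<dots> = cubic (C_coeff j) z"
    using C_psi_swap(1)[of j 2 1] C_psi_swap(1)[of j 3 1] C_psi_swap(1)[of j 3 2]
      C_psi_swap(2)[of j 1 2 1] C_psi_swap(2)[of j 1 3 1] C_psi_swap(2)[of j 1 3 2] C_psi_swap(2)[of j 2 2 1]
      C_psi_swap(2)[of j 2 3 1] C_psi_swap(2)[of j 2 3 2] C_psi_swap(2)[of j 3 2 1] C_psi_swap(2)[of j 3 3 1] C_psi_swap(2)[of j 3 3 2]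
    by (simp add: sum_3 cubic_expand C_coeff_def algebra_simps power2_eq_square power3_eq_cube)
  finally show ?thesis .
qed

lemma linear_wc: "linear (wc S)"
proof (rule linearI)
  fix z z' :: "complex^3" and r :: real
  have "center_hist (z + z') = (\<lambda>\<theta>. center_hist z \<theta> + center_hist z' \<theta>)"
    by (simp add: fun_eq_iff center_hist_def vec.scale_left_distrib sum.distrib)
  then show "wc S (z + z') = wc S z + wc S z'"
    by (simp add: wc_eq htens_add continuous_on_center_hist)
  have "center_hist (r *\<^sub>R z) = (\<lambda>\<theta>. r *\<^sub>R center_hist z \<theta>)"
    by (simp add: fun_eq_iff center_hist_def scaleR_eq_vscale vec.scale_sum_right)
  then show "wc S (r *\<^sub>R z) = r *\<^sub>R wc S z"
    by (simp add: wc_eq htens_beta0 emb.scaleR hist_scaleR continuous_on_emb continuous_on_center_hist)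
qed

lemma bounded_linear_center_part: "bounded_linear (center_part S)"
proof -
  have "center_part S = (\<lambda>F. \<Sum>j\<in>UNIV. (psi_vec j \<odot> mode S 0 F) *s axis j 1)"
    by (simp add: fun_eq_iff vec_eq_iff axis_def if_distrib center_part_nth cong: if_cong)
  moreover have "bounded_linear (\<lambda>F. (psi_vec j \<odot> mode S 0 F) *s axis j (1::complex) :: complex^3)" for j
    by (rule bounded_linear_compose[OF vscale.bounded_linear_left
          bounded_linear_compose[OF bounded_linear_dotc bounded_linear_mode0]])
  ultimately show ?thesis by (simp add: bounded_linear_sum)
qed

text \<open>
  \<open>f\<^sub>2\<^sup>1(z,y,0)\<close> is a bounded quadratic form in \<open>w(z) + y\<close>.  The derivative is taken in \<open>z\<close> and \<open>y\<close> together.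
\<close>

lemma f21_y_derivative:
  "frechet_derivative (\<lambda>(z, y). f21 S z y 0) (at (z, 0)) (d, y)
    = center_part S (2 *\<^sub>R Qop S (wc S z) (wc S d + y))"
proof -
  define V where "V = (\<lambda>p :: (complex^3) \<times> (real \<Rightarrow>\<^sub>C ('x^'m)). wc S (fst p) + snd p)"
  have wc: "bounded_linear (wc S)"
    using linear_wc by (simp add: linear_conv_bounded_linear)
  have V: "bounded_linear V"
    unfolding V_def
    by (intro bounded_linear_add bounded_linear_compose[OF wc] bounded_linear_fst bounded_linear_snd)
  have f: "(\<lambda>(z, y). f21 S z y 0) = (\<lambda>p. center_part S (Qop S (V p) (V p)))"
    by (auto simp: fun_eq_iff f21_def F2_def V_def)
  have "((\<lambda>p. center_part S (Qop S (V p) (V p))) has_derivative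
      (\<lambda>h. center_part S (Qop S (V (z, 0)) (V h) + Qop S (V h) (V (z, 0))))) (at (z, 0))"
    by (rule bounded_linear.has_derivative[OF bounded_linear_center_part],
        rule Qop.FDERIV; rule bounded_linear_imp_has_derivative[OF V])
  from frechet_derivative_at[OF this, symmetric] show ?thesis
    unfolding f by (simp add: V_def Qop_commute[of _ "wc S z"] scaleR_2)
qed

text \<open>
  Half the derivative of \<open>f\<^sub>2\<^sup>1\<close> in the direction \<open>(U\<^sub>2\<^sup>1, 2h)\<close> is a sum of products of \<open>z\<^sub>k\<close> with a quadratic
  form, whose coefficients these are; the first summand comes from \<open>U\<^sub>2\<^sup>1\<close>, the second from \<open>2h\<close>.
\<close>

definition DF_coeff :: "(nat \<times> nat \<times> nat \<Rightarrow> real \<Rightarrow> 'x^'m) \<Rightarrow> 3 \<Rightarrow> 3 \<Rightarrow> nat \<times> nat \<times> nat \<Rightarrow> complex"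
  where "DF_coeff h j k q = (\<Sum>l\<in>UNIV. U_coeff l q * Q_psi j k l) + 2 * Qh_psi h j k q"

text \<open>
  The coefficients of the cubic form to which the projection in the definition of \<open>g\<^sub>3\<^sup>1\<close> is applied.
\<close>

definition cubic_coeff :: "(nat \<times> nat \<times> nat \<Rightarrow> real \<Rightarrow> 'x^'m) \<Rightarrow> 3 \<Rightarrow> nat \<times> nat \<times> nat \<Rightarrow> complex"
  where "cubic_coeff h j q = C_coeff j q + (3/2) * ((\<Sum>k\<in>UNIV. 2 * lin_quad (\<lambda>m. if m = k then 1 else 0) (DF_coeff h j k) q)
     - (\<Sum>k\<in>UNIV. lin_quad (dquad (U_coeff j) k) (g_coeff k) q))"

lemma is_h_continuous:
  assumes "is_h S h" "q \<in> hexpos"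
  shows "continuous_on I (h q)"
proof -
  have "h q \<in> Q1 S" using assms unfolding is_h_def by blast
  then obtain h' where "\<And>\<theta>. \<theta> \<in> I \<Longrightarrow> (h q has_vector_derivative h' \<theta>) (at \<theta> within I)"
    unfolding Q1_def by blast
  then show ?thesis by (rule continuous_on_vector_derivative)
qed

text \<open>
  Here the mean of \<open>Q(\<phi>\<^sub>k,h\<^sub>q)\<close> enters for the history \<open>h\<^sub>q\<close> that may depend on \<open>x\<close>; \<open>mode0_Qop\<close>
  replaces \<open>h\<^sub>q\<close> by its mean.
\<close>

lemma second_order_term:
  assumes U: "is_U21 S U" and h: "is_h S h"
  shows "frechet_derivative (\<lambda>(z, y). f21 S z y 0) (at (z, 0)) (U z, hist S (\<lambda>\<theta>. 2 *\<^sub>R hpoly S h z \<theta>)) $ j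
    = (\<Sum>k\<in>UNIV. 2 * (z $ k * quad (DF_coeff h j k) z))"
proof -
  let ?H = "\<lambda>q \<theta>. mode S 0 (h q \<theta>)"
  have cp: "continuous_on I (\<lambda>\<theta>. 2 *\<^sub>R hpoly S h z \<theta>)"
    unfolding hpoly_eq by (intro continuous_intros continuous_on_cscale is_h_continuous[OF h])
  have cH: "continuous_on I (?H q)" if "q \<in> hexpos" for q
    by (rule continuous_on_mode0[OF is_h_continuous[OF h that]])
  have y: "mode S 0 (Qop S (wc S z) (hist S (\<lambda>\<theta>. 2 *\<^sub>R hpoly S h z \<theta>)))
      = (\<Sum>k\<in>UNIV. z $ k *s (2 *s (\<Sum>q\<in>hexpos. monomial q z *s Qm S (Phi k) (?H q))))"
  proof -
    have "mode S 0 (Qop S (wc S z) (hist S (\<lambda>\<theta>. 2 *\<^sub>R hpoly S h z \<theta>)))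
        = Qm S (center_hist z) (\<lambda>\<theta>. mode S 0 (2 *\<^sub>R hpoly S h z \<theta>))"
      unfolding wc_eq by (rule mode0_Qop[OF continuous_on_center_hist cp])
    also have "(\<lambda>\<theta>. mode S 0 (2 *\<^sub>R hpoly S h z \<theta>)) = (\<lambda>\<theta>. 2 *s (\<Sum>q\<in>hexpos. monomial q z *s ?H q \<theta>))"
      by (simp add: fun_eq_iff mode0.scaleR mode0_hpoly scaleR_eq_vscale)
    also have "Qm S (center_hist z) (\<lambda>\<theta>. 2 *s (\<Sum>q\<in>hexpos. monomial q z *s ?H q \<theta>))
        = (\<Sum>k\<in>UNIV. z $ k *s (2 *s (\<Sum>q\<in>hexpos. monomial q z *s Qm S (Phi k) (?H q))))"
    proof -
      have "Qm S \<phi> (\<lambda>\<theta>. 2 *s (\<Sum>q\<in>hexpos. monomial q z *s ?H q \<theta>)) = 2 *s (\<Sum>q\<in>hexpos. monomial q z *s Qm S \<phi> (?H q))" for \<phi>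
      proof -
        have "Qm S \<phi> (\<lambda>\<theta>. 2 *s (\<Sum>q\<in>hexpos. monomial q z *s ?H q \<theta>)) = 2 *s Qm S \<phi> (\<lambda>\<theta>. \<Sum>q\<in>hexpos. monomial q z *s ?H q \<theta>)"
          by (rule history_linear_scale[OF history_linear_Qm]) (intro continuous_on_sum continuous_on_vscale_const cH)
        also have "Qm S \<phi> (\<lambda>\<theta>. \<Sum>q\<in>hexpos. monomial q z *s ?H q \<theta>) = (\<Sum>q\<in>hexpos. Qm S \<phi> (\<lambda>\<theta>. monomial q z *s ?H q \<theta>))"
          by (rule history_linear_sum[OF history_linear_Qm]) (rule continuous_on_vscale_const[OF cH])
        also have "\<dots> = (\<Sum>q\<in>hexpos. monomial q z *s Qm S \<phi> (?H q))"
          by (rule sum.cong[OF refl]) (rule history_linear_scale[OF history_linear_Qm cH])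
        finally show ?thesis .
      qed
      then show ?thesis by (subst Qm_center_hist_left) (simp only:)
    qed
    finally show ?thesis .
  qed
  have w: "mode S 0 (Qop S (wc S z) (wc S (U z))) = (\<Sum>k\<in>UNIV. z $ k *s (\<Sum>l\<in>UNIV. U z $ l *s Q_phi k l))"
    unfolding wc_eq Qop_emb[OF continuous_on_center_hist continuous_on_center_hist] mode0_emb
    by (subst Qm_center_hist_left) (simp only: Qm_center_hist_right Q_phi_def)
  have "frechet_derivative (\<lambda>(z, y). f21 S z y 0) (at (z, 0)) (U z, hist S (\<lambda>\<theta>. 2 *\<^sub>R hpoly S h z \<theta>)) $ j
      = 2 * ((\<Sum>k\<in>UNIV. z $ k * (\<Sum>l\<in>UNIV. U z $ l * Q_psi j k l))
           + (\<Sum>k\<in>UNIV. z $ k * (2 * (\<Sum>q\<in>hexpos. monomial q z * Qh_psi h j k q))))"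
    unfolding f21_y_derivative center_part_nth mode0.scaleR Qop.add_right mode0.add y w scaleR_eq_vscale
    by (simp add: dotc_sum Q_psi_def Qh_psi_def mult.assoc)
  also have "\<dots> = (\<Sum>k\<in>UNIV. 2 * (z $ k * ((\<Sum>l\<in>UNIV. U z $ l * Q_psi j k l) + 2 * (\<Sum>q\<in>hexpos. monomial q z * Qh_psi h j k q))))"
    by (simp add: sum.distrib sum_distrib_left distrib_left)
  finally have expand: "frechet_derivative (\<lambda>(z, y). f21 S z y 0) (at (z, 0)) (U z, hist S (\<lambda>\<theta>. 2 *\<^sub>R hpoly S h z \<theta>)) $ j = \<dots>" .
  have "(\<Sum>l\<in>UNIV. U z $ l * Q_psi j k l) + 2 * (\<Sum>q\<in>hexpos. monomial q z * Qh_psi h j k q) = quad (DF_coeff h j k) z" for k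
  proof -
    have "U z $ l = (\<Sum>q\<in>hexpos. U_coeff l q * monomial q z)" for l
      using U unfolding is_U21_iff quad_monomial by blast
    then have "(\<Sum>l\<in>UNIV. U z $ l * Q_psi j k l) = (\<Sum>l\<in>UNIV. \<Sum>q\<in>hexpos. U_coeff l q * Q_psi j k l * monomial q z)"
      by (simp add: sum_distrib_right sum_distrib_left mult_ac)
    also have "\<dots> = (\<Sum>q\<in>hexpos. \<Sum>l\<in>UNIV. U_coeff l q * Q_psi j k l * monomial q z)"
      by (rule sum.swap)
    finally show ?thesis
      by (simp add: quad_monomial DF_coeff_def distrib_right distrib_left sum.distrib sum_distrib_left sum_distrib_right mult_ac)
  qed
  then show ?thesis unfolding expand by simp
qed

lemma g31_nth:
  assumes U: "is_U21 S U" and h: "is_h S h"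
  shows "g31 S U h z $ j = (\<Sum>q\<in>res3 j. (case q of (a, b, c, s, t) \<Rightarrow> cubic_coeff h j (a, b, c)) * zmono q z 0)"
proof -
  have Uq: "U z $ i = quad (U_coeff i) z" for z i
    using U unfolding is_U21_iff by blast
  define p where "p = (\<lambda>z (\<alpha> :: real^2). f31 S z + (3/2) *\<^sub>R
      (frechet_derivative (\<lambda>(z, y). f21 S z y 0) (at (z, 0)) (U z, hist S (\<lambda>\<theta>. 2 *\<^sub>R hpoly S h z \<theta>))
       - frechet_derivative U (at z) (g21 S z 0)))"
  have ind: "(if 1 = k then 1 else 0) * z $ 1 + (if 2 = k then 1 else 0) * z $ 2 + (if 3 = k then 1 else 0) * z $ 3 = z $ k"
    for z :: "complex^3" and k
    using exhaust_index3[of k] by auto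
  have cubic_cubic_coeff: "cubic (cubic_coeff h j) z = cubic (C_coeff j) z + (3/2) * ((\<Sum>k\<in>UNIV. 2 * cubic (lin_quad (\<lambda>m. if m = k then 1 else 0) (DF_coeff h j k)) z)
      - (\<Sum>k\<in>UNIV. cubic (lin_quad (dquad (U_coeff j) k) (g_coeff k)) z))" for j z
    unfolding cubic_expand cubic_coeff_def sum_3 by (simp add: algebra_simps)
  have p: "p z \<alpha> $ j = cubic (cubic_coeff h j) z" for z \<alpha> j
  proof -
    have "p z \<alpha> $ j = cubic (C_coeff j) z + (3/2) * ((\<Sum>k\<in>UNIV. 2 * (z $ k * quad (DF_coeff h j k) z))
        - (\<Sum>k\<in>UNIV. (dquad (U_coeff j) k 1 * z$1 + dquad (U_coeff j) k 2 * z$2 + dquad (U_coeff j) k 3 * z$3) * quad (g_coeff k) z))"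
      unfolding p_def
      by (simp add: f31_nth second_order_term[OF U h] frechet_vector_polynomial[OF Uq] g21_zero scaleR_conv_of_real[where 'a = complex])
    then show ?thesis
      unfolding cubic_cubic_coeff cubic_lin_quad ind by simp
  qed
  define K :: "expo set" where "K = {(3,0,0,0,0), (0,3,0,0,0), (0,0,3,0,0), (2,1,0,0,0), (2,0,1,0,0), (1,2,0,0,0),
    (0,2,1,0,0), (1,0,2,0,0), (0,1,2,0,0), (1,1,1,0,0)}"
  have rep: "p z \<alpha> $ i = (\<Sum>q\<in>K. (case q of (a, b, c, s, t) \<Rightarrow> cubic_coeff h i (a, b, c)) * zmono q z \<alpha>)" for z \<alpha> i
    unfolding p cubic_expand by (simp add: K_def zmono_def)
  have "Proj 3 res3 p z 0 $ j = (\<Sum>q\<in>res3 j. (case q of (a, b, c, s, t) \<Rightarrow> cubic_coeff h j (a, b, c)) * zmono q z 0)"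
    by (rule Proj_eq[OF rep]) (auto simp: K_def expos_def res3_def)
  then show ?thesis
    unfolding g31_def p_def by simp
qed


subsection \<open>Complex conjugation\<close>

lemma Phi_conj3_fun: "Phi (conj3 k) = (\<lambda>\<theta>. vcnj (Phi k \<theta>))"
  by (simp add: fun_eq_iff Phi_conj3)

lemma Q_phi_conj: "Q_phi (conj3 k) (conj3 l) = vcnj (Q_phi k l)"
  unfolding Q_phi_def Phi_conj3_fun by (rule Qm_conj) (rule continuous_on_Phi)+

lemma Q_psi_conj: "Q_psi (conj3 j) (conj3 k) (conj3 l) = cnj (Q_psi j k l)"
  by (simp add: Q_psi_def Q_phi_conj psi_vec_conj3 cnj_dotc)

lemma C_psi_conj: "C_psi (conj3 j) (conj3 k) (conj3 l) (conj3 m) = cnj (C_psi j k l m)"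
  unfolding C_psi_def Phi_conj3_fun psi_vec_conj3
  by (subst Cm_conj) (simp_all add: continuous_on_Phi cnj_dotc)

definition conj_expo :: "nat \<times> nat \<times> nat \<Rightarrow> nat \<times> nat \<times> nat"
  where "conj_expo q = (case q of (a, b, c) \<Rightarrow> (a, c, b))"

lemma weight_conj_expo: "weight (conj_expo q) = cnj (weight q)"
  by (cases q) (simp add: weight_def conj_expo_def)

lemma F_coeff_conj_expo: "q \<in> hexpos \<Longrightarrow> F_coeff (conj_expo q) = vcnj (F_coeff q)"
  using Q_phi_conj[of 1 1] Q_phi_conj[of 2 2] Q_phi_conj[of 3 3] Q_phi_conj[of 1 2] Q_phi_conj[of 1 3] Q_phi_conj[of 2 3]
    Q_phi_commute[of 3 2]
  by (auto simp: hexpos_def F_coeff_def conj_expo_def conj3_def)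

lemma conj_expo_hexpos: "q \<in> hexpos \<Longrightarrow> conj_expo q \<in> hexpos"
  by (auto simp: hexpos_def conj_expo_def)

text \<open>
  The conjugate of the mean of \<open>h\<^sub>q\<close> solves the boundary value problem that belongs to the exponent with the last
  two entries exchanged, and solutions are unique.
\<close>

lemma h_conj_expo:
  assumes h: "is_h S h" and q: "q \<in> hexpos" and \<theta>: "\<theta> \<in> I"
  shows "mode S 0 (h (conj_expo q) \<theta>) = vcnj (mode S 0 (h q \<theta>))"
proof (rule solves_unique[OF _ is_h_solves[OF h conj_expo_hexpos[OF q]] _ \<theta>])
  show "solves (weight (conj_expo q)) (F_coeff (conj_expo q)) (\<lambda>\<theta>. vcnj (mode S 0 (h q \<theta>)))"
    using solves_conj[OF is_h_solves[OF h q]] by (simp add: weight_conj_expo F_coeff_conj_expo[OF q])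
qed (rule Re_weight)

lemma Qh_psi_conj:
  assumes h: "is_h S h" and q: "q \<in> hexpos"
  shows "Qh_psi h (conj3 j) (conj3 k) (conj_expo q) = cnj (Qh_psi h j k q)"
proof -
  have c: "continuous_on I (\<lambda>\<theta>. mode S 0 (h q \<theta>))"
    by (rule solves_continuous[OF is_h_solves[OF h q]])
  have "Qm S (Phi (conj3 k)) (\<lambda>\<theta>. mode S 0 (h (conj_expo q) \<theta>))
      = Qm S (\<lambda>\<theta>. vcnj (Phi k \<theta>)) (\<lambda>\<theta>. vcnj (mode S 0 (h q \<theta>)))"
    unfolding Phi_conj3_fun by (rule history_linear_cong[OF history_linear_Qm]) (rule h_conj_expo[OF h q])
  also have "\<dots> = vcnj (Qm S (Phi k) (\<lambda>\<theta>. mode S 0 (h q \<theta>)))"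
    by (rule Qm_conj[OF continuous_on_Phi c])
  finally show ?thesis
    by (simp add: Qh_psi_def psi_vec_conj3 cnj_dotc)
qed


subsection \<open>Explicit values\<close>

lemma lam2_nonzero: "lam 2 \<noteq> 0"
  using om0_pos by simp

lemma lam3_eq: "lam 3 = - lam 2"
  by simp

lemma U_coeff_values:
  "U_coeff 1 (2,0,0) = 0" "U_coeff 1 (0,1,1) = 0"
  "U_coeff 1 (0,2,0) = Q_psi 1 2 2 / (2 * lam 2)" "U_coeff 1 (0,0,2) = - Q_psi 1 3 3 / (2 * lam 2)"
  "U_coeff 1 (1,1,0) = 2 * Q_psi 1 1 2 / lam 2" "U_coeff 1 (1,0,1) = - 2 * Q_psi 1 1 3 / lam 2"
  "U_coeff 2 (1,1,0) = 0" "U_coeff 2 (2,0,0) = - Q_psi 2 1 1 / lam 2" "U_coeff 2 (0,2,0) = Q_psi 2 2 2 / lam 2"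
  "U_coeff 2 (0,0,2) = - Q_psi 2 3 3 / (3 * lam 2)" "U_coeff 2 (1,0,1) = - Q_psi 2 1 3 / lam 2"
  "U_coeff 2 (0,1,1) = - 2 * Q_psi 2 2 3 / lam 2"
  "U_coeff 3 (1,0,1) = 0" "U_coeff 3 (2,0,0) = Q_psi 3 1 1 / lam 2" "U_coeff 3 (0,0,2) = - Q_psi 3 3 3 / lam 2"
  "U_coeff 3 (0,2,0) = Q_psi 3 2 2 / (3 * lam 2)" "U_coeff 3 (1,1,0) = Q_psi 3 1 2 / lam 2"
  "U_coeff 3 (0,1,1) = 2 * Q_psi 3 2 3 / lam 2"
  using lam2_nonzero
  by (simp_all add: U_coeff_def resonant_def F_coeff_def weight_def Q_psi_def lam3_eq field_simps del: lam_simps(2,3))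

lemma g_coeff_values:
  "g_coeff 1 q = (if q = (2,0,0) then Q_psi 1 1 1 else if q = (0,1,1) then 2 * Q_psi 1 2 3 else 0)"
  "g_coeff 2 q = (if q = (1,1,0) then 2 * Q_psi 2 1 2 else 0)"
  "g_coeff 3 q = (if q = (1,0,1) then 2 * Q_psi 3 1 3 else 0)"
  by (auto simp: g_coeff_def resonant_def F_coeff_def Q_psi_def)

lemmas cubic_coeff_simps = cubic_coeff_def DF_coeff_def lin_quad_def dquad_def C_coeff_def sum_3 g_coeff_values U_coeff_values[unfolded One_nat_def]

text \<open>
  The resonant coefficients of the three components.  They follow by inserting the values of \<open>U\<^sub>2\<^sup>1\<close> and \<open>g\<^sub>2\<^sup>1\<close> and
  collecting terms.  In the notation \<open>Q_psi j k l\<close> a product such as \<open>Q_psi 2 1 3 * Q_psi 3 1 2\<close> is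
  \<open>\<psi>\<^sub>2(0) Q(\<phi>\<^sub>1,\<phi>\<^sub>3) \<psi>\<^sub>3(0) Q(\<phi>\<^sub>1,\<phi>\<^sub>2)\<close>.
\<close>

lemma T1_300: "(1/6) * cubic_coeff h 1 (3,0,0) = (1/6) * C_psi 1 1 1 1 + Qh_psi h 1 1 (2,0,0)
    + (Q_psi 1 1 3 * Q_psi 3 1 1 - Q_psi 1 1 2 * Q_psi 2 1 1) / (2 * lam 2)"
  using lam2_nonzero by (simp add: cubic_coeff_simps field_simps del: lam_simps)

lemma T1_111: "(1/6) * cubic_coeff h 1 (1,1,1) = C_psi 1 1 2 3 + (Qh_psi h 1 1 (0,1,1) + Qh_psi h 1 2 (1,0,1) + Qh_psi h 1 3 (1,1,0))
    + (Q_psi 1 1 3 * Q_psi 3 2 3 - Q_psi 1 1 2 * Q_psi 2 2 3) / lam 2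
    + (Q_psi 1 3 3 * Q_psi 3 1 2 - Q_psi 1 2 2 * Q_psi 2 1 3) / (2 * lam 2)"
  using lam2_nonzero Q_psi_commute[of 1 2 1] Q_psi_commute[of 1 3 1] Q_psi_commute[of 1 3 2]
  by (simp add: cubic_coeff_simps field_simps del: lam_simps)

lemma T2_210: "(1/6) * cubic_coeff h 2 (2,1,0) = (1/2) * C_psi 2 1 1 2 + (Qh_psi h 2 1 (1,1,0) + Qh_psi h 2 2 (2,0,0))
    + (2 * Q_psi 2 1 1 * Q_psi 1 1 2 + Q_psi 2 1 3 * Q_psi 3 1 2 - Q_psi 2 2 2 * Q_psi 2 1 1 + Q_psi 2 2 3 * Q_psi 3 1 1) / (2 * lam 2)"
  using lam2_nonzero Q_psi_commute[of 2 2 1] Q_psi_commute[of 2 3 1] Q_psi_commute[of 2 3 2]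
  by (simp add: cubic_coeff_simps field_simps del: lam_simps)

lemma T2_021: "(1/6) * cubic_coeff h 2 (0,2,1) = (1/2) * C_psi 2 2 2 3 + (Qh_psi h 2 2 (0,1,1) + Qh_psi h 2 3 (0,2,0))
    + (Q_psi 2 1 3 * Q_psi 1 2 2 + (2/3) * Q_psi 2 3 3 * Q_psi 3 2 2 - 2 * Q_psi 2 2 2 * Q_psi 2 2 3 + 4 * Q_psi 2 2 3 * Q_psi 3 2 3) / (4 * lam 2)"
  using lam2_nonzero Q_psi_commute[of 2 2 1] Q_psi_commute[of 2 3 1] Q_psi_commute[of 2 3 2]
  by (simp add: cubic_coeff_simps field_simps del: lam_simps)

lemma T3_201: "(1/6) * cubic_coeff h 3 (2,0,1) = (1/2) * C_psi 3 1 1 3 + (Qh_psi h 3 1 (1,0,1) + Qh_psi h 3 3 (2,0,0))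
    - (2 * Q_psi 3 1 1 * Q_psi 1 1 3 + Q_psi 3 1 2 * Q_psi 2 1 3 - Q_psi 3 3 3 * Q_psi 3 1 1 + Q_psi 3 2 3 * Q_psi 2 1 1) / (2 * lam 2)"
  using lam2_nonzero Q_psi_commute[of 3 2 1] Q_psi_commute[of 3 3 1] Q_psi_commute[of 3 3 2]
  by (simp add: cubic_coeff_simps field_simps del: lam_simps)

lemma T3_012: "(1/6) * cubic_coeff h 3 (0,1,2) = (1/2) * C_psi 3 2 3 3 + (Qh_psi h 3 3 (0,1,1) + Qh_psi h 3 2 (0,0,2))
    - (Q_psi 3 1 2 * Q_psi 1 3 3 + (2/3) * Q_psi 3 2 2 * Q_psi 2 3 3 - 2 * Q_psi 3 3 3 * Q_psi 3 2 3 + 4 * Q_psi 3 2 3 * Q_psi 2 2 3) / (4 * lam 2)"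
  using lam2_nonzero Q_psi_commute[of 3 2 1] Q_psi_commute[of 3 3 1] Q_psi_commute[of 3 3 2]
  by (simp add: cubic_coeff_simps field_simps del: lam_simps)

lemma Q_psi_conj_values:
  "Q_psi 1 1 1 = cnj (Q_psi 1 1 1)" "Q_psi 1 1 3 = cnj (Q_psi 1 1 2)" "Q_psi 1 3 3 = cnj (Q_psi 1 2 2)" "Q_psi 1 2 3 = cnj (Q_psi 1 2 3)"
  "Q_psi 3 1 1 = cnj (Q_psi 2 1 1)" "Q_psi 3 1 3 = cnj (Q_psi 2 1 2)" "Q_psi 3 1 2 = cnj (Q_psi 2 1 3)" "Q_psi 3 3 3 = cnj (Q_psi 2 2 2)"
  "Q_psi 3 2 2 = cnj (Q_psi 2 3 3)" "Q_psi 3 2 3 = cnj (Q_psi 2 2 3)"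
  using Q_psi_conj[of 1 1 1] Q_psi_conj[of 1 1 2] Q_psi_conj[of 1 2 2] Q_psi_conj[of 1 2 3] Q_psi_conj[of 2 1 1] Q_psi_conj[of 2 1 2]
    Q_psi_conj[of 2 1 3] Q_psi_conj[of 2 2 2] Q_psi_conj[of 2 3 3] Q_psi_conj[of 2 2 3] Q_psi_commute[of 1 3 2] Q_psi_commute[of 3 3 2]
  by (simp_all add: conj3_def)

lemma cnj_lam2: "cnj (lam 2) = - lam 2"
  by simp

text \<open>
  Conjugation exchanges the indices \<open>2\<close> and \<open>3\<close> everywhere and changes the sign of \<open>\<lambda>\<^sub>2\<close>.
\<close>

lemma T_conj:
  assumes h: "is_h S h"
  shows "(1/6) * cubic_coeff h 3 (2,0,1) = cnj ((1/6) * cubic_coeff h 2 (2,1,0))"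
    and "(1/6) * cubic_coeff h 3 (0,1,2) = cnj ((1/6) * cubic_coeff h 2 (0,2,1))"
proof -
  have q: "(2,0,0) \<in> hexpos" "(1,1,0) \<in> hexpos" "(0,1,1) \<in> hexpos" "(0,2,0) \<in> hexpos"
    by (simp_all add: hexpos_def)
  have s: "Qh_psi h 3 1 (1,0,1) = cnj (Qh_psi h 2 1 (1,1,0))" "Qh_psi h 3 3 (2,0,0) = cnj (Qh_psi h 2 2 (2,0,0))"
    "Qh_psi h 3 3 (0,1,1) = cnj (Qh_psi h 2 2 (0,1,1))" "Qh_psi h 3 2 (0,0,2) = cnj (Qh_psi h 2 3 (0,2,0))"
    using Qh_psi_conj[OF h q(2), of 2 1] Qh_psi_conj[OF h q(1), of 2 2] Qh_psi_conj[OF h q(3), of 2 2] Qh_psi_conj[OF h q(4), of 2 3]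
    by (simp_all add: conj3_def conj_expo_def)
  have c: "C_psi 3 1 1 3 = cnj (C_psi 2 1 1 2)" "C_psi 3 2 3 3 = cnj (C_psi 2 2 2 3)"
    using C_psi_conj[of 2 1 1 2] C_psi_conj[of 2 2 2 3] C_psi_swap(2)[of 3 3 3 2] C_psi_swap(1)[of 3 3 2 3]
    by (simp_all add: conj3_def)
  show "(1/6) * cubic_coeff h 3 (2,0,1) = cnj ((1/6) * cubic_coeff h 2 (2,1,0))"
    unfolding T3_201 T2_210 complex_cnj_add complex_cnj_divide complex_cnj_mult complex_cnj_diff cnj_lam2 s c Q_psi_conj_values(2-)
    using lam2_nonzero by (simp add: field_simps del: lam_simps)
  show "(1/6) * cubic_coeff h 3 (0,1,2) = cnj ((1/6) * cubic_coeff h 2 (0,2,1))"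
    unfolding T3_012 T2_021 complex_cnj_add complex_cnj_divide complex_cnj_mult complex_cnj_diff cnj_lam2 s c Q_psi_conj_values(2-)
    using lam2_nonzero by (simp add: field_simps del: lam_simps)
qed

lemma Lm1_conj3: "psi_vec 3 \<odot> Lm S (Lop1 S \<alpha>) (Phi 3) = cnj (psi_vec 2 \<odot> Lm S (Lop1 S \<alpha>) (Phi 2))"
  using Lm1_conj[OF continuous_on_Phi, of \<alpha> 2] Phi_conj3_fun[of 2] psi_vec_conj3[of 2]
  by (simp add: conj3_def cnj_dotc)

lemma normal_form_nth:
  assumes U: "is_U21 S U" and h: "is_h S h"
  shows "normal_form S U h z \<alpha> $ 1 = (1/2) * (psi_vec 1 \<odot> Lm S (Lop1 S \<alpha>) (Phi 1)) * z$1
      + (1/2) * Q_psi 1 1 1 * (z$1)^2 + Q_psi 1 2 3 * z$2 * z$3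
      + (1/6) * cubic_coeff h 1 (3,0,0) * (z$1)^3 + (1/6) * cubic_coeff h 1 (1,1,1) * z$1 * z$2 * z$3" (is ?th1)
    and "normal_form S U h z \<alpha> $ 2 = lam 2 * z$2 + (1/2) * (psi_vec 2 \<odot> Lm S (Lop1 S \<alpha>) (Phi 2)) * z$2
      + Q_psi 2 1 2 * z$1 * z$2
      + (1/6) * cubic_coeff h 2 (2,1,0) * (z$1)^2 * z$2 + (1/6) * cubic_coeff h 2 (0,2,1) * (z$2)^2 * z$3" (is ?th2)
    and "normal_form S U h z \<alpha> $ 3 = - lam 2 * z$3 + (1/2) * (psi_vec 3 \<odot> Lm S (Lop1 S \<alpha>) (Phi 3)) * z$3
      + Q_psi 3 1 3 * z$1 * z$3
      + (1/6) * cubic_coeff h 3 (2,0,1) * (z$1)^2 * z$3 + (1/6) * cubic_coeff h 3 (0,1,2) * z$2 * (z$3)^2" (is ?th3)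
proof -
  have nf: "normal_form S U h z \<alpha> $ j = lam j * z $ j
      + (1/2) * (z $ j * (psi_vec j \<odot> Lm S (Lop1 S \<alpha>) (Phi j)) + quad (g_coeff j) z)
      + (1/6) * (\<Sum>q\<in>res3 j. (case q of (a, b, c, s, t) \<Rightarrow> cubic_coeff h j (a, b, c)) * zmono q z 0)" for j
    by (simp only: normal_form_def vector_add_component vector_scaleR_component Bz_nth g21_nth g31_nth[OF U h])
       (simp add: scaleR_conv_of_real[where 'a = complex])
  show ?th1 unfolding nf by (simp add: res3_def zmono_def quad_expand g_coeff_values algebra_simps)
  show ?th2 unfolding nf by (simp add: res3_def zmono_def quad_expand g_coeff_values algebra_simps del: lam_simps)
  show ?th3 unfolding nf lam3_eq by (simp add: res3_def zmono_def quad_expand g_coeff_values algebra_simps del: lam_simps)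
qed


subsection \<open>The coefficients in terms of the given data\<close>

abbreviation w :: complex where "w \<equiv> complex_of_real (om0 S)"

lemma w_nonzero: "w \<noteq> 0"
  using om0_pos by simp

lemma lam2_eq: "lam 2 = \<i> * w"
  by simp

lemma psi_0: "psi1 S 0 = psi_vec 1" "psi2 S 0 = psi_vec 2" "psi2b S 0 = psi_vec 3"
  by (simp_all add: psi1_eq psi2_eq psi2b_eq)

lemma phi_0: "phi1 S 0 = phi_vec 1" "phi2 S 0 = phi_vec 2" "phi2b S 0 = phi_vec 3"
  by (simp_all add: phi1_eq phi2_eq phi2b_eq)

lemma vcnj_psi2: "vcnj (psi_vec 2) = psi_vec 3"
  using psi_vec_conj3[of 2] by (simp add: conj3_def)

lemma vcnj_Qm: "vcnj (Qm S (Phi 1) (Phi 2)) = Qm S (Phi 1) (Phi 3)"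
  "vcnj (Qm S (Phi 2) (Phi 2)) = Qm S (Phi 3) (Phi 3)"
  using Q_phi_conj[of 1 2] Q_phi_conj[of 2 2] by (simp_all add: conj3_def Q_phi_def)

lemmas fold_coefficients = psi_0 phi1_eq phi2_eq phi2b_eq

lemma a111_eq: "(1/6) * cubic_coeff h 1 (3,0,0) = (1/6) * (psi1 S 0 \<odot> Cm S (phi1 S) (phi1 S) (phi1 S))
    + (1/w) * (psi1 S 0 \<odot> (mRe (\<i> *m (Qm S (phi1 S) (phi2 S) \<otimes>\<^sub>v psi2 S 0)) *v Qm S (phi1 S) (phi1 S)))
    + psi1 S 0 \<odot> Qm S (phi1 S) (\<lambda>\<theta>. mode S 0 (h (2,0,0) \<theta>))"
  unfolding T1_300 fold_coefficients mRe_outer_mult_vec vcnj_psi2 vcnj_Qm C_psi_def Q_psi_def Qh_psi_def Q_phi_def lam2_eq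
  using w_nonzero by (simp add: field_simps)

lemma a123_eq: "(1/6) * cubic_coeff h 1 (1,1,1) = psi1 S 0 \<odot> Cm S (phi1 S) (phi2 S) (phi2b S)
    + (2/w) * (psi1 S 0 \<odot> (mRe (\<i> *m (Qm S (phi1 S) (phi2 S) \<otimes>\<^sub>v psi2 S 0)) *v Qm S (phi2 S) (phi2b S)))
    + (1/w) * (psi1 S 0 \<odot> vRe (\<i> *s ((Qm S (phi2 S) (phi2 S) \<otimes>\<^sub>v psi2 S 0) *v Qm S (phi1 S) (phi2b S))))
    + psi1 S 0 \<odot> (Qm S (phi1 S) (\<lambda>\<theta>. mode S 0 (h (0,1,1) \<theta>)) + Qm S (phi2 S) (\<lambda>\<theta>. mode S 0 (h (1,0,1) \<theta>))
        + Qm S (phi2b S) (\<lambda>\<theta>. mode S 0 (h (1,1,0) \<theta>)))"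
proof -
  have "cnj (psi_vec 2 \<odot> Qm S (Phi 1) (Phi 3)) = psi_vec 3 \<odot> Qm S (Phi 1) (Phi 2)"
    using Q_psi_conj_values(7) by (simp add: Q_psi_def Q_phi_def)
  then show ?thesis
    unfolding T1_111 fold_coefficients mRe_outer_mult_vec vRe_eq outer_mult_vec vcnj_scale vcnj_psi2 vcnj_Qm
      C_psi_def Q_psi_def Qh_psi_def Q_phi_def lam2_eq
    using w_nonzero by (simp add: field_simps)
qed

lemma b112_eq: "(1/6) * cubic_coeff h 2 (2,1,0) = (1/2) * (psi2 S 0 \<odot> Cm S (phi1 S) (phi1 S) (phi2 S))
    + (1/(2 * \<i> * w)) * (psi2 S 0 \<odot>
        ((2 *m (Qm S (phi1 S) (phi1 S) \<otimes>\<^sub>v psi1 S 0) + Qm S (phi1 S) (phi2b S) \<otimes>\<^sub>v psi2b S 0) *v Qm S (phi1 S) (phi2 S)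
         + (- (Qm S (phi2 S) (phi2 S) \<otimes>\<^sub>v psi2 S 0) + Qm S (phi2 S) (phi2b S) \<otimes>\<^sub>v psi2b S 0) *v Qm S (phi1 S) (phi1 S)))
    + psi2 S 0 \<odot> (Qm S (phi1 S) (\<lambda>\<theta>. mode S 0 (h (1,1,0) \<theta>)) + Qm S (phi2 S) (\<lambda>\<theta>. mode S 0 (h (2,0,0) \<theta>)))"
  unfolding T2_210 fold_coefficients C_psi_def Q_psi_def Qh_psi_def Q_phi_def lam2_eq
  using w_nonzero by (simp add: matrix_vector_mult_add_rdistrib matrix_vector_mult_diff_rdistrib field_simps)

lemma b223_eq: "(1/6) * cubic_coeff h 2 (0,2,1) = (1/2) * (psi2 S 0 \<odot> Cm S (phi2 S) (phi2 S) (phi2b S))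
    + (1/(4 * \<i> * w)) * (psi2 S 0 \<odot>
        ((Qm S (phi1 S) (phi2b S) \<otimes>\<^sub>v psi1 S 0) *v Qm S (phi2 S) (phi2 S)
         + (2/3) *s ((Qm S (phi2b S) (phi2b S) \<otimes>\<^sub>v psi2b S 0) *v Qm S (phi2 S) (phi2 S))
         + (- (2 *m (Qm S (phi2 S) (phi2 S) \<otimes>\<^sub>v psi2 S 0)) + 4 *m (Qm S (phi2 S) (phi2b S) \<otimes>\<^sub>v psi2b S 0)) *v Qm S (phi2 S) (phi2b S)))
    + psi2 S 0 \<odot> (Qm S (phi2 S) (\<lambda>\<theta>. mode S 0 (h (0,1,1) \<theta>)) + Qm S (phi2b S) (\<lambda>\<theta>. mode S 0 (h (0,2,0) \<theta>)))"
  unfolding T2_021 fold_coefficients C_psi_def Q_psi_def Qh_psi_def Q_phi_def lam2_eq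
  using w_nonzero by (simp add: matrix_vector_mult_add_rdistrib matrix_vector_mult_diff_rdistrib field_simps)


subsection \<open>The boundary conditions\<close>

lemma stieltjes_identity: "stieltjes (delay S) (eta S 0) (\<lambda>\<theta> A. A) = eta_integral (\<lambda>_. 1)"
proof -
  have "(1::complex) *m A = A" for A :: "complex^'m^'m" by (simp add: vec_eq_iff mscale_def)
  then show ?thesis by (simp add: eta_integral_def)
qed

lemma char_matrix_0: "char_matrix 0 *v E = - (stieltjes (delay S) (eta S 0) (\<lambda>\<theta> A. A) *v E)"
  unfolding stieltjes_identity char_matrix_mult_vec
  by (subst eta_integral_mult_vec) (simp_all add: expo_fun_def[abs_def])

lemma theta_integral:
  "stieltjes (delay S) (eta S 0) (\<lambda>\<theta> A. complex_of_real \<theta> *m A) *v phi_vec 1 = \<Lambda> (\<lambda>\<theta>. complex_of_real \<theta> *s Phi 1 \<theta>)"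
  unfolding eta_integral_def[symmetric]
  by (subst eta_integral_mult_vec) (auto intro!: continuous_intros simp: Phi_def expo_fun_def)

lemma theta_phi2_integral:
  "stieltjes (delay S) (eta S 0) (\<lambda>\<theta> A. complex_of_real \<theta> *s (A *v Phi 2 \<theta>)) = \<Lambda> (\<lambda>\<theta>. complex_of_real \<theta> *s Phi 2 \<theta>)"
proof (rule stieltjes_eqI)
  have "continuous_on I (\<lambda>\<theta>. complex_of_real \<theta> *s Phi 2 \<theta>)"
    by (rule continuous_on_vscale[OF _ continuous_on_Phi]) (intro continuous_intros)
  from has_stieltjes_eta[OF this]
  show "has_stieltjes (delay S) (eta S 0) (\<lambda>\<theta> A. complex_of_real \<theta> *s (A *v Phi 2 \<theta>)) (\<Lambda> (\<lambda>\<theta>. complex_of_real \<theta> *s Phi 2 \<theta>))"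
    by (rule has_stieltjes_cong) (simp add: vector_scalar_commute)
qed

lemma resonant_modes: "{j. lam j = 0} = {1}" "{j. lam j = lam 2} = {2}" "{j. lam j = 2 * lam 2} = {}"
proof -
  show "{j. lam j = 0} = {1}" using lam_inj[of _ 1] by auto
  show "{j. lam j = lam 2} = {2}" using lam_inj[of _ 2] by auto
  show "{j. lam j = 2 * lam 2} = {}"
    using om0_pos by (auto simp: lam_def split: if_splits)
qed

text \<open>
  At \<open>\<zeta> = 0\<close> the resonant index is \<open>1\<close>, and \<open>\<phi>\<^sub>1\<close> is constant in \<open>\<theta>\<close>.
\<close>

lemma boundary_condition_0:
  "stieltjes (delay S) (eta S 0) (\<lambda>\<theta> A. A) *v E = (1/2) *s ((- mat 1 + (mat 1 - stieltjes (delay S) (eta S 0) (\<lambda>\<theta> A. complex_of_real \<theta> *m A))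
      ** (phi1 S 0 \<otimes>\<^sub>v psi1 S 0)) *v F) \<longleftrightarrow> char_matrix 0 *v E = boundary_rhs 0 F"
proof -
  have "(1/2) *s ((- mat 1 + (mat 1 - stieltjes (delay S) (eta S 0) (\<lambda>\<theta> A. complex_of_real \<theta> *m A))
      ** (phi1 S 0 \<otimes>\<^sub>v psi1 S 0)) *v F) = - boundary_rhs 0 F"
    unfolding boundary_rhs_eq resonant_modes psi_0 phi_0
    by (simp add: matrix_vector_mult_add_rdistrib matrix_vector_mult_diff_rdistrib matrix_vector_mul_assoc[symmetric]
        vector_scalar_commute theta_integral vec.scale_right_diff_distrib vec.scale_right_distrib)
  then show ?thesis unfolding char_matrix_0 by (metis minus_equation_iff)
qed

text \<open>
  At \<open>\<zeta> = \<i>\<omega>\<^sub>0\<close> the resonant index is \<open>2\<close>.  The factor \<open>2\<close> occurs because the coefficient of \<open>z\<^sub>1z\<^sub>2\<close> in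
  \<open>Q(w(z),w(z))\<close> is \<open>2Q(\<phi>\<^sub>1,\<phi>\<^sub>2)\<close>.
\<close>

lemma boundary_condition_2:
  "(mat (\<i> * w) - stieltjes (delay S) (eta S 0) (\<lambda>\<theta> A. exp (\<i> * w * complex_of_real \<theta>) *m A)) *v E
    = (mat 1 - phi2 S 0 \<otimes>\<^sub>v psi2 S 0 + stieltjes (delay S) (eta S 0) (\<lambda>\<theta> A. complex_of_real \<theta> *s (A *v phi2 S \<theta>)) \<otimes>\<^sub>v psi2 S 0) *v F
    \<longleftrightarrow> char_matrix (lam 2) *v E = boundary_rhs (lam 2) (2 *s F)"
  unfolding boundary_rhs_eq resonant_modes
  unfolding psi_0 phi_0 char_matrix_def eta_integral_def lam2_eq phi2_eq theta_phi2_integral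
  by (simp add: matrix_vector_mult_add_rdistrib matrix_vector_mult_diff_rdistrib vec.scale_right_diff_distrib
      diff_diff_eq2 diff_add_eq)

lemma boundary_rhs_4: "boundary_rhs (2 * lam 2) F = (1/2) *s F"
  unfolding boundary_rhs_eq resonant_modes by simp

lemma partic_0: "(\<lambda>\<theta>. (1/2) *s ((complex_of_real \<theta> *m (phi1 S 0 \<otimes>\<^sub>v psi1 S 0)
      + (1/(\<i> * w)) *m (phi2 S \<theta> \<otimes>\<^sub>v psi2 S 0 - phi2b S \<theta> \<otimes>\<^sub>v psi2b S 0)) *v F) + E)
    = (\<lambda>\<theta>. partic 0 F \<theta> + expo_fun 0 E \<theta>)"
proof
  fix \<theta>
  have "Phi 1 \<theta> = phi_vec 1" by (simp add: Phi_def expo_fun_def)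
  then show "(1/2) *s ((complex_of_real \<theta> *m (phi1 S 0 \<otimes>\<^sub>v psi1 S 0)
      + (1/(\<i> * w)) *m (phi2 S \<theta> \<otimes>\<^sub>v psi2 S 0 - phi2b S \<theta> \<otimes>\<^sub>v psi2b S 0)) *v F) + E = partic 0 F \<theta> + expo_fun 0 E \<theta>"
    using w_nonzero unfolding psi_0 phi_0 phi2_eq phi2b_eq
    by (simp add: partic_def sum_3 resonance_def expo_fun_def matrix_vector_mult_add_rdistrib
        matrix_vector_mult_diff_rdistrib vec_eq_iff field_simps)
qed

lemma partic_2: "(\<lambda>\<theta>. (1/(\<i> * w)) *s ((- (phi1 S 0 \<otimes>\<^sub>v psi1 S 0) + (\<i> * w * complex_of_real \<theta>) *m (phi2 S \<theta> \<otimes>\<^sub>v psi2 S 0)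
      - (1/2) *m (phi2b S \<theta> \<otimes>\<^sub>v psi2b S 0)) *v F) + exp (\<i> * w * complex_of_real \<theta>) *s E)
    = (\<lambda>\<theta>. partic (lam 2) (2 *s F) \<theta> + expo_fun (lam 2) E \<theta>)"
proof
  fix \<theta>
  have "Phi 1 \<theta> = phi_vec 1" by (simp add: Phi_def expo_fun_def)
  then show "(1/(\<i> * w)) *s ((- (phi1 S 0 \<otimes>\<^sub>v psi1 S 0) + (\<i> * w * complex_of_real \<theta>) *m (phi2 S \<theta> \<otimes>\<^sub>v psi2 S 0)
      - (1/2) *m (phi2b S \<theta> \<otimes>\<^sub>v psi2b S 0)) *v F) + exp (\<i> * w * complex_of_real \<theta>) *s E
      = partic (lam 2) (2 *s F) \<theta> + expo_fun (lam 2) E \<theta>"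
    using w_nonzero unfolding psi_0 phi_0 phi2_eq phi2b_eq
    by (simp add: partic_def sum_3 resonance_def expo_fun_def matrix_vector_mult_add_rdistrib
        matrix_vector_mult_diff_rdistrib vec_eq_iff field_simps)
qed

lemma partic_4: "(\<lambda>\<theta>. - (1/(2 * \<i> * w)) *s (((1/2) *m (phi1 S 0 \<otimes>\<^sub>v psi1 S 0) + phi2 S \<theta> \<otimes>\<^sub>v psi2 S 0
      + (1/3) *m (phi2b S \<theta> \<otimes>\<^sub>v psi2b S 0)) *v F) + exp (2 * \<i> * w * complex_of_real \<theta>) *s E)
    = (\<lambda>\<theta>. partic (2 * lam 2) F \<theta> + expo_fun (2 * lam 2) E \<theta>)"
proof
  fix \<theta>
  have "Phi 1 \<theta> = phi_vec 1" by (simp add: Phi_def expo_fun_def)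
  then show "- (1/(2 * \<i> * w)) *s (((1/2) *m (phi1 S 0 \<otimes>\<^sub>v psi1 S 0) + phi2 S \<theta> \<otimes>\<^sub>v psi2 S 0
      + (1/3) *m (phi2b S \<theta> \<otimes>\<^sub>v psi2b S 0)) *v F) + exp (2 * \<i> * w * complex_of_real \<theta>) *s E
      = partic (2 * lam 2) F \<theta> + expo_fun (2 * lam 2) E \<theta>"
    using w_nonzero unfolding psi_0 phi_0 phi2_eq phi2b_eq
    by (simp add: partic_def sum_3 resonance_def expo_fun_def matrix_vector_mult_add_rdistrib
        matrix_vector_mult_diff_rdistrib vec_eq_iff field_simps)
qed

lemma pairing_orthogonal_iff:
  assumes "continuous_on I f"
  shows "pairing S 0 (psi1 S) f = 0 \<and> pairing S 0 (psi2 S) f = 0 \<and> pairing S 0 (psi2b S) f = 0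
    \<longleftrightarrow> (\<forall>j. form j f = 0)"
  unfolding psi1_eq psi2_eq psi2b_eq pairing_eq_form[OF assms]
  using exhaust_index3 by metis

abbreviation orth :: "(real \<Rightarrow> complex^'m) \<Rightarrow> bool" where
  "orth f \<equiv> pairing S 0 (psi1 S) f = 0 \<and> pairing S 0 (psi2 S) f = 0 \<and> pairing S 0 (psi2b S) f = 0"

text \<open>
  Two vectors \<open>E\<close> that satisfy the boundary condition and the orthogonality relations give two solutions, which coincide
  by \<open>solves_unique\<close>; at \<open>\<theta> = 0\<close> this means equality of the vectors.
\<close>

lemma solves_explicit:
  assumes \<zeta>: "Re \<zeta> = 0" and H: "solves \<zeta> F H"
  obtains E where "char_matrix \<zeta> *v E = boundary_rhs \<zeta> F"
    "\<forall>\<theta>\<in>I. H \<theta> = partic \<zeta> F \<theta> + expo_fun \<zeta> E \<theta>"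
    "\<forall>E'. char_matrix \<zeta> *v E' = boundary_rhs \<zeta> F \<and> orth (\<lambda>\<theta>. partic \<zeta> F \<theta> + expo_fun \<zeta> E' \<theta>) \<longrightarrow> E' = E"
proof -
  obtain E where E: "\<forall>\<theta>\<in>I. H \<theta> = partic \<zeta> F \<theta> + expo_fun \<zeta> E \<theta>"
    using solves_shape[OF H] by blast
  have sol: "solves \<zeta> F (\<lambda>\<theta>. partic \<zeta> F \<theta> + expo_fun \<zeta> E \<theta>)"
    by (rule solves_cong[OF H]) (use E in blast)
  show ?thesis
  proof
    show "char_matrix \<zeta> *v E = boundary_rhs \<zeta> F" using sol solves_iff by blast
    show "\<forall>\<theta>\<in>I. H \<theta> = partic \<zeta> F \<theta> + expo_fun \<zeta> E \<theta>" by (rule E)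
    show "\<forall>E'. char_matrix \<zeta> *v E' = boundary_rhs \<zeta> F \<and> orth (\<lambda>\<theta>. partic \<zeta> F \<theta> + expo_fun \<zeta> E' \<theta>) \<longrightarrow> E' = E"
    proof (rule allI, rule impI, erule conjE)
      fix E' assume bc: "char_matrix \<zeta> *v E' = boundary_rhs \<zeta> F"
        and o: "orth (\<lambda>\<theta>. partic \<zeta> F \<theta> + expo_fun \<zeta> E' \<theta>)"
      have "continuous_on I (\<lambda>\<theta>. partic \<zeta> F \<theta> + expo_fun \<zeta> E' \<theta>)"
        by (intro continuous_on_add continuous_on_partic continuous_on_expo_fun)
      from iffD1[OF pairing_orthogonal_iff[OF this] o] bc
      have "solves \<zeta> F (\<lambda>\<theta>. partic \<zeta> F \<theta> + expo_fun \<zeta> E' \<theta>)" using solves_iff by blast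
      from solves_unique[OF \<zeta> this sol zero_in_I] show "E' = E" by simp
    qed
  qed
qed

lemma h_orthogonal:
  assumes "is_h S h" "q \<in> hexpos"
  shows "orth (\<lambda>\<theta>. mode S 0 (h q \<theta>))"
proof -
  have s: "solves (weight q) (F_coeff q) (\<lambda>\<theta>. mode S 0 (h q \<theta>))" by (rule is_h_solves[OF assms])
  show ?thesis
    by (rule iffD2[OF pairing_orthogonal_iff[OF solves_continuous[OF s]]]) (use s in \<open>simp add: solves_def\<close>)
qed

end

theorem proposition4p1:
  fixes S :: "('x::{real_inner,banach}, 'm::finite) pfde"
  assumes setting: "pfde_setting S"
    and bifurcation: "hopf_steady_bifurcation S"
    and bases: "hopf_steady_bases S"
    and modes: "kS S = 0" "kH S = 0"
  shows
    "(\<exists>U h. is_U21 S U \<and> is_h S h) \<and>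
     (\<forall>U h. is_U21 S U \<and> is_h S h \<longrightarrow>
      (let r = delay S; \<omega> = complex_of_real (om0 S);
           \<phi>1 = phi1 S; \<phi>2 = phi2 S; \<phi>b = phi2b S;
           p1 = psi1 S 0; p2 = psi2 S 0; pb = psi2b S 0;
           Q = Qm S; C = Cm S;
           h0 = (\<lambda>q \<theta>. mode S 0 (h q \<theta>));
           h200 = h0 (2,0,0); h020 = h0 (0,2,0); h002 = h0 (0,0,2);
           h110 = h0 (1,1,0); h101 = h0 (1,0,1); h011 = h0 (0,1,1);
           S0 = stieltjes r (eta S 0) (\<lambda>\<theta> A. A);
           S1 = stieltjes r (eta S 0) (\<lambda>\<theta> A. complex_of_real \<theta> *m A);
           Se = (\<lambda>\<zeta>. stieltjes r (eta S 0) (\<lambda>\<theta> A. exp (\<zeta> * complex_of_real \<theta>) *m A));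
           Sphi2 = stieltjes r (eta S 0) (\<lambda>\<theta> A. complex_of_real \<theta> *s (A *v \<phi>2 \<theta>));
           R200 = (\<lambda>E. S0 *v E = (1/2) *s ((- mat 1 + (mat 1 - S1) ** (\<phi>1 0 \<otimes>\<^sub>v p1)) *v Q \<phi>1 \<phi>1));
           R011 = (\<lambda>E. S0 *v E = (- mat 1 + (mat 1 - S1) ** (\<phi>1 0 \<otimes>\<^sub>v p1)) *v Q \<phi>2 \<phi>b);
           R110 = (\<lambda>E. (mat (\<i> * \<omega>) - Se (\<i> * \<omega>)) *v E
                     = (mat 1 - \<phi>2 0 \<otimes>\<^sub>v p2 + Sphi2 \<otimes>\<^sub>v p2) *v Q \<phi>1 \<phi>2);
           H200 = (\<lambda>E \<theta>. (1/2) *s ((complex_of_real \<theta> *m (\<phi>1 0 \<otimes>\<^sub>v p1)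
                     + (1/(\<i> * \<omega>)) *m (\<phi>2 \<theta> \<otimes>\<^sub>v p2 - \<phi>b \<theta> \<otimes>\<^sub>v pb)) *v Q \<phi>1 \<phi>1) + E);
           H011 = (\<lambda>E \<theta>. (complex_of_real \<theta> *m (\<phi>1 0 \<otimes>\<^sub>v p1)
                     + (1/(\<i> * \<omega>)) *m (\<phi>2 \<theta> \<otimes>\<^sub>v p2 - \<phi>b \<theta> \<otimes>\<^sub>v pb)) *v Q \<phi>2 \<phi>b + E);
           H020 = (\<lambda>E \<theta>. - (1/(2 * \<i> * \<omega>)) *s (((1/2) *m (\<phi>1 0 \<otimes>\<^sub>v p1) + \<phi>2 \<theta> \<otimes>\<^sub>v p2
                     + (1/3) *m (\<phi>b \<theta> \<otimes>\<^sub>v pb)) *v Q \<phi>2 \<phi>2) + exp (2 * \<i> * \<omega> * complex_of_real \<theta>) *s E);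
           H110 = (\<lambda>E \<theta>. (1/(\<i> * \<omega>)) *s ((- (\<phi>1 0 \<otimes>\<^sub>v p1)
                     + (\<i> * \<omega> * complex_of_real \<theta>) *m (\<phi>2 \<theta> \<otimes>\<^sub>v p2)
                     - (1/2) *m (\<phi>b \<theta> \<otimes>\<^sub>v pb)) *v Q \<phi>1 \<phi>2) + exp (\<i> * \<omega> * complex_of_real \<theta>) *s E);
           orth = (\<lambda>f. pairing S 0 (psi1 S) f = 0 \<and> pairing S 0 (psi2 S) f = 0 \<and> pairing S 0 (psi2b S) f = 0);
           a1 = (\<lambda>\<alpha>. (1/2) * (p1 \<odot> (Lm S (Lop1 S \<alpha>) \<phi>1
                  - complex_of_real (mu S 0) *s (\<chi> i. complex_of_real (dcoef1 S \<alpha> $ i) * \<phi>1 0 $ i))));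
           b2 = (\<lambda>\<alpha>. (1/2) * (p2 \<odot> (Lm S (Lop1 S \<alpha>) \<phi>2
                  - complex_of_real (mu S 0) *s (\<chi> i. complex_of_real (dcoef1 S \<alpha> $ i) * \<phi>2 0 $ i))))
       in \<exists>a11 a23 a111 a123 b12 b112 b223 E200 E011 E020 E110.
          (\<forall>z \<alpha>. normal_form S U h z \<alpha> $ 1 =
              a1 \<alpha> * z$1 + a11 * (z$1)^2 + a23 * z$2 * z$3 + a111 * (z$1)^3 + a123 * z$1 * z$2 * z$3) \<and>
          (\<forall>z \<alpha>. normal_form S U h z \<alpha> $ 2 = \<i> * \<omega> * z$2
              + b2 \<alpha> * z$2 + b12 * z$1 * z$2 + b112 * (z$1)^2 * z$2 + b223 * (z$2)^2 * z$3) \<and>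
          (\<forall>z \<alpha>. normal_form S U h z \<alpha> $ 3 = - \<i> * \<omega> * z$3
              + cnj (b2 \<alpha>) * z$3 + cnj b12 * z$1 * z$3 + cnj b112 * (z$1)^2 * z$3 + cnj b223 * z$2 * (z$3)^2) \<and>
          a11 = (1/2) * (p1 \<odot> Q \<phi>1 \<phi>1) \<and>
          a23 = p1 \<odot> Q \<phi>b \<phi>2 \<and>
          b12 = p2 \<odot> Q \<phi>1 \<phi>2 \<and>
          a111 = (1/6) * (p1 \<odot> C \<phi>1 \<phi>1 \<phi>1)
            + (1/\<omega>) * (p1 \<odot> (mRe (\<i> *m (Q \<phi>1 \<phi>2 \<otimes>\<^sub>v p2)) *v Q \<phi>1 \<phi>1))
            + p1 \<odot> Q \<phi>1 h200 \<and>
          a123 = p1 \<odot> C \<phi>1 \<phi>2 \<phi>b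
            + (2/\<omega>) * (p1 \<odot> (mRe (\<i> *m (Q \<phi>1 \<phi>2 \<otimes>\<^sub>v p2)) *v Q \<phi>2 \<phi>b))
            + (1/\<omega>) * (p1 \<odot> vRe (\<i> *s ((Q \<phi>2 \<phi>2 \<otimes>\<^sub>v p2) *v Q \<phi>1 \<phi>b)))
            + p1 \<odot> (Q \<phi>1 h011 + Q \<phi>2 h101 + Q \<phi>b h110) \<and>
          b112 = (1/2) * (p2 \<odot> C \<phi>1 \<phi>1 \<phi>2)
            + (1/(2 * \<i> * \<omega>)) * (p2 \<odot>
                ((2 *m (Q \<phi>1 \<phi>1 \<otimes>\<^sub>v p1) + Q \<phi>1 \<phi>b \<otimes>\<^sub>v pb) *v Q \<phi>1 \<phi>2
                 + (- (Q \<phi>2 \<phi>2 \<otimes>\<^sub>v p2) + Q \<phi>2 \<phi>b \<otimes>\<^sub>v pb) *v Q \<phi>1 \<phi>1))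
            + p2 \<odot> (Q \<phi>1 h110 + Q \<phi>2 h200) \<and>
          b223 = (1/2) * (p2 \<odot> C \<phi>2 \<phi>2 \<phi>b)
            + (1/(4 * \<i> * \<omega>)) * (p2 \<odot>
                ((Q \<phi>1 \<phi>b \<otimes>\<^sub>v p1) *v Q \<phi>2 \<phi>2
                 + (2/3) *s ((Q \<phi>b \<phi>b \<otimes>\<^sub>v pb) *v Q \<phi>2 \<phi>2)
                 + (- (2 *m (Q \<phi>2 \<phi>2 \<otimes>\<^sub>v p2)) + 4 *m (Q \<phi>2 \<phi>b \<otimes>\<^sub>v pb)) *v Q \<phi>2 \<phi>b))
            + p2 \<odot> (Q \<phi>2 h011 + Q \<phi>b h020) \<and>
          (\<forall>\<theta>\<in>{- r..0}. h200 \<theta> = H200 E200 \<theta> \<and> h011 \<theta> = H011 E011 \<theta> \<and>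
             h020 \<theta> = H020 E020 \<theta> \<and> h110 \<theta> = H110 E110 \<theta> \<and>
             h002 \<theta> = vcnj (h020 \<theta>) \<and> h101 \<theta> = vcnj (h110 \<theta>)) \<and>
          R200 E200 \<and> R011 E011 \<and> R110 E110 \<and>
          invertible (mat (2 * \<i> * \<omega>) - Se (2 * \<i> * \<omega>)) \<and>
          E020 = (1/2) *s (matrix_inv (mat (2 * \<i> * \<omega>) - Se (2 * \<i> * \<omega>)) *v Q \<phi>2 \<phi>2) \<and>
          orth h200 \<and> orth h011 \<and> orth h020 \<and> orth h002 \<and> orth h110 \<and> orth h101 \<and>
          (\<forall>E. R200 E \<and> orth (H200 E) \<longrightarrow> E = E200) \<and>
          (\<forall>E. R011 E \<and> orth (H011 E) \<longrightarrow> E = E011) \<and>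
          (\<forall>E. R110 E \<and> orth (H110 E) \<longrightarrow> E = E110)))"
proof -
  interpret hopf_steady S
    by unfold_locales (rule setting bifurcation bases modes)+
  let ?r = "delay S" let ?\<eta> = "eta S 0"
  let ?\<phi>1 = "phi1 S" let ?\<phi>2 = "phi2 S" let ?\<phi>b = "phi2b S"
  let ?p1 = "psi1 S 0" let ?p2 = "psi2 S 0" let ?pb = "psi2b S 0"
  let ?Q = "Qm S" let ?C = "Cm S"
  let ?S0 = "stieltjes ?r ?\<eta> (\<lambda>\<theta> A. A)"
  let ?S1 = "stieltjes ?r ?\<eta> (\<lambda>\<theta> A. complex_of_real \<theta> *m A)"
  let ?Se = "\<lambda>\<zeta>. stieltjes ?r ?\<eta> (\<lambda>\<theta> A. exp (\<zeta> * complex_of_real \<theta>) *m A)"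
  let ?Sphi2 = "stieltjes ?r ?\<eta> (\<lambda>\<theta> A. complex_of_real \<theta> *s (A *v ?\<phi>2 \<theta>))"
  let ?R200 = "\<lambda>E. ?S0 *v E = (1/2) *s ((- mat 1 + (mat 1 - ?S1) ** (?\<phi>1 0 \<otimes>\<^sub>v ?p1)) *v ?Q ?\<phi>1 ?\<phi>1)"
  let ?R011 = "\<lambda>E. ?S0 *v E = (- mat 1 + (mat 1 - ?S1) ** (?\<phi>1 0 \<otimes>\<^sub>v ?p1)) *v ?Q ?\<phi>2 ?\<phi>b"
  let ?R110 = "\<lambda>E. (mat (\<i> * w) - ?Se (\<i> * w)) *v E
      = (mat 1 - ?\<phi>2 0 \<otimes>\<^sub>v ?p2 + ?Sphi2 \<otimes>\<^sub>v ?p2) *v ?Q ?\<phi>1 ?\<phi>2"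
  let ?H200 = "\<lambda>E \<theta>. (1/2) *s ((complex_of_real \<theta> *m (?\<phi>1 0 \<otimes>\<^sub>v ?p1)
      + (1/(\<i> * w)) *m (?\<phi>2 \<theta> \<otimes>\<^sub>v ?p2 - ?\<phi>b \<theta> \<otimes>\<^sub>v ?pb)) *v ?Q ?\<phi>1 ?\<phi>1) + E"
  let ?H011 = "\<lambda>E \<theta>. (complex_of_real \<theta> *m (?\<phi>1 0 \<otimes>\<^sub>v ?p1)
      + (1/(\<i> * w)) *m (?\<phi>2 \<theta> \<otimes>\<^sub>v ?p2 - ?\<phi>b \<theta> \<otimes>\<^sub>v ?pb)) *v ?Q ?\<phi>2 ?\<phi>b + E"
  let ?H020 = "\<lambda>E \<theta>. - (1/(2 * \<i> * w)) *s (((1/2) *m (?\<phi>1 0 \<otimes>\<^sub>v ?p1) + ?\<phi>2 \<theta> \<otimes>\<^sub>v ?p2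
      + (1/3) *m (?\<phi>b \<theta> \<otimes>\<^sub>v ?pb)) *v ?Q ?\<phi>2 ?\<phi>2) + exp (2 * \<i> * w * complex_of_real \<theta>) *s E"
  let ?H110 = "\<lambda>E \<theta>. (1/(\<i> * w)) *s ((- (?\<phi>1 0 \<otimes>\<^sub>v ?p1)
      + (\<i> * w * complex_of_real \<theta>) *m (?\<phi>2 \<theta> \<otimes>\<^sub>v ?p2)
      - (1/2) *m (?\<phi>b \<theta> \<otimes>\<^sub>v ?pb)) *v ?Q ?\<phi>1 ?\<phi>2) + exp (\<i> * w * complex_of_real \<theta>) *s E"
  let ?a1 = "\<lambda>\<alpha>. (1/2) * (?p1 \<odot> (Lm S (Lop1 S \<alpha>) ?\<phi>1
      - complex_of_real (mu S 0) *s (\<chi> i. complex_of_real (dcoef1 S \<alpha> $ i) * ?\<phi>1 0 $ i)))"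
  let ?b2 = "\<lambda>\<alpha>. (1/2) * (?p2 \<odot> (Lm S (Lop1 S \<alpha>) ?\<phi>2
      - complex_of_real (mu S 0) *s (\<chi> i. complex_of_real (dcoef1 S \<alpha> $ i) * ?\<phi>2 0 $ i)))"
  have hex: "(2,0,0) \<in> hexpos" "(0,2,0) \<in> hexpos" "(0,0,2) \<in> hexpos"
    "(1,1,0) \<in> hexpos" "(1,0,1) \<in> hexpos" "(0,1,1) \<in> hexpos"
    by (simp_all add: hexpos_def)
  have lq: "weight (2,0,0) = 0" "weight (0,1,1) = 0" "weight (0,2,0) = 2 * lam 2" "weight (1,1,0) = lam 2"
    by (simp_all add: weight_def lam3_eq del: lam_simps)
  have Fv: "F_coeff (2,0,0) = ?Q ?\<phi>1 ?\<phi>1" "F_coeff (0,1,1) = 2 *s ?Q ?\<phi>2 ?\<phi>b"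
    "F_coeff (0,2,0) = ?Q ?\<phi>2 ?\<phi>2" "F_coeff (1,1,0) = 2 *s ?Q ?\<phi>1 ?\<phi>2"
    by (simp_all add: F_coeff_def Q_phi_def phi1_eq phi2_eq phi2b_eq)
  have ReL: "Re (2 * lam 2) = 0" "Re (lam 2) = 0" "Re 0 = 0" by simp_all
  \<comment> \<open>The coefficient of \<open>z\<^sub>2z\<^sub>3\<close> in \<open>Q(w(z),w(z))\<close> is \<open>2Q(\<phi>\<^sub>2,\<phi>\<^sub>3)\<close>, which is why
    the factor \<open>\<onehalf>\<close> is absent from the formulas for \<open>h\<^sub>0\<^sub>1\<^sub>1\<close>.\<close>
  have R011_iff: "?R011 E \<longleftrightarrow> char_matrix 0 *v E = boundary_rhs 0 (2 *s ?Q ?\<phi>2 ?\<phi>b)" for E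
    unfolding boundary_condition_0[symmetric] by (simp add: vector_scalar_commute)
  have H011_eq: "?H011 E = (\<lambda>\<theta>. partic 0 (2 *s ?Q ?\<phi>2 ?\<phi>b) \<theta> + expo_fun 0 E \<theta>)" for E
    unfolding partic_0[symmetric] by (simp add: vector_scalar_commute)
  show ?thesis
  proof (rule conjI, goal_cases)
    case 1
    show ?case using is_U21_exists is_h_exists by blast
  next
    case 2
    show ?case
    proof (rule allI, rule allI, rule impI, erule conjE, goal_cases)
      case (1 U h)
      have U: "is_U21 S U" and h: "is_h S h" by (rule 1)+
      let ?h = "\<lambda>q \<theta>. mode S 0 (h q \<theta>)"
      obtain E200 where E200: "char_matrix (0) *v E200 = boundary_rhs (0) (?Q ?\<phi>1 ?\<phi>1)"
        "\<forall>\<theta>\<in>I. ?h (2,0,0) \<theta> = partic (0) (?Q ?\<phi>1 ?\<phi>1) \<theta> + expo_fun (0) E200 \<theta>"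
        "\<forall>E. char_matrix (0) *v E = boundary_rhs (0) (?Q ?\<phi>1 ?\<phi>1) \<and>
           orth (\<lambda>\<theta>. partic (0) (?Q ?\<phi>1 ?\<phi>1) \<theta> + expo_fun (0) E \<theta>) \<longrightarrow> E = E200"
        by (rule solves_explicit[OF ReL(3) is_h_solves[OF h hex(1), unfolded lq Fv]])
      obtain E011 where E011: "char_matrix (0) *v E011 = boundary_rhs (0) (2 *s ?Q ?\<phi>2 ?\<phi>b)"
        "\<forall>\<theta>\<in>I. ?h (0,1,1) \<theta> = partic (0) (2 *s ?Q ?\<phi>2 ?\<phi>b) \<theta> + expo_fun (0) E011 \<theta>"
        "\<forall>E. char_matrix (0) *v E = boundary_rhs (0) (2 *s ?Q ?\<phi>2 ?\<phi>b) \<and>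
           orth (\<lambda>\<theta>. partic (0) (2 *s ?Q ?\<phi>2 ?\<phi>b) \<theta> + expo_fun (0) E \<theta>) \<longrightarrow> E = E011"
        by (rule solves_explicit[OF ReL(3) is_h_solves[OF h hex(6), unfolded lq Fv]])
      obtain E020 where E020: "char_matrix (2 * lam 2) *v E020 = boundary_rhs (2 * lam 2) (?Q ?\<phi>2 ?\<phi>2)"
        "\<forall>\<theta>\<in>I. ?h (0,2,0) \<theta> = partic (2 * lam 2) (?Q ?\<phi>2 ?\<phi>2) \<theta> + expo_fun (2 * lam 2) E020 \<theta>"
        "\<forall>E. char_matrix (2 * lam 2) *v E = boundary_rhs (2 * lam 2) (?Q ?\<phi>2 ?\<phi>2) \<and>
           orth (\<lambda>\<theta>. partic (2 * lam 2) (?Q ?\<phi>2 ?\<phi>2) \<theta> + expo_fun (2 * lam 2) E \<theta>) \<longrightarrow> E = E020"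
        by (rule solves_explicit[OF ReL(1) is_h_solves[OF h hex(2), unfolded lq Fv]])
      obtain E110 where E110: "char_matrix (lam 2) *v E110 = boundary_rhs (lam 2) (2 *s ?Q ?\<phi>1 ?\<phi>2)"
        "\<forall>\<theta>\<in>I. ?h (1,1,0) \<theta> = partic (lam 2) (2 *s ?Q ?\<phi>1 ?\<phi>2) \<theta> + expo_fun (lam 2) E110 \<theta>"
        "\<forall>E. char_matrix (lam 2) *v E = boundary_rhs (lam 2) (2 *s ?Q ?\<phi>1 ?\<phi>2) \<and>
           orth (\<lambda>\<theta>. partic (lam 2) (2 *s ?Q ?\<phi>1 ?\<phi>2) \<theta> + expo_fun (lam 2) E \<theta>) \<longrightarrow> E = E110"
        by (rule solves_explicit[OF ReL(2) is_h_solves[OF h hex(4), unfolded lq Fv]])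
      have nf1: "\<forall>z \<alpha>. normal_form S U h z \<alpha> $ 1 = ?a1 \<alpha> * z$1 + ((1/2) * (?p1 \<odot> ?Q ?\<phi>1 ?\<phi>1)) * (z$1)^2
          + (?p1 \<odot> ?Q ?\<phi>b ?\<phi>2) * z$2 * z$3 + ((1/6) * cubic_coeff h 1 (3,0,0)) * (z$1)^3 + ((1/6) * cubic_coeff h 1 (1,1,1)) * z$1 * z$2 * z$3"
        unfolding normal_form_nth[OF U h] psi_0 phi1_eq phi2_eq phi2b_eq
        by (simp add: Q_psi_def Q_phi_def Qm_commute[of "Phi 3"])
      have nf2: "\<forall>z \<alpha>. normal_form S U h z \<alpha> $ 2 = \<i> * w * z$2 + ?b2 \<alpha> * z$2 + (?p2 \<odot> ?Q ?\<phi>1 ?\<phi>2) * z$1 * z$2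
          + ((1/6) * cubic_coeff h 2 (2,1,0)) * (z$1)^2 * z$2 + ((1/6) * cubic_coeff h 2 (0,2,1)) * (z$2)^2 * z$3"
        unfolding normal_form_nth[OF U h] psi_0 phi1_eq phi2_eq phi2b_eq
        by (simp add: Q_psi_def Q_phi_def)
      have nf3: "\<forall>z \<alpha>. normal_form S U h z \<alpha> $ 3 = - \<i> * w * z$3 + cnj (?b2 \<alpha>) * z$3 + cnj (?p2 \<odot> ?Q ?\<phi>1 ?\<phi>2) * z$1 * z$3
          + cnj ((1/6) * cubic_coeff h 2 (2,1,0)) * (z$1)^2 * z$3 + cnj ((1/6) * cubic_coeff h 2 (0,2,1)) * z$2 * (z$3)^2"
      proof -
        have "Q_psi 3 1 3 = cnj (?p2 \<odot> ?Q ?\<phi>1 ?\<phi>2)"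
          using Q_psi_conj_values(6) by (simp add: Q_psi_def Q_phi_def psi_0 phi1_eq phi2_eq)
        moreover have "(1/2) * (psi_vec 3 \<odot> Lm S (Lop1 S \<alpha>) (Phi 3)) = cnj (?b2 \<alpha>)" for \<alpha>
          by (simp add: Lm1_conj3 psi_0 phi2_eq)
        ultimately show ?thesis
          unfolding normal_form_nth(3)[OF U h] T_conj[OF h] by simp
      qed
      have twice: "2 * lam 2 = 2 * \<i> * w" by simp
      have inv: "invertible (mat (2 * \<i> * w) - ?Se (2 * \<i> * w))"
        unfolding twice[symmetric] eta_integral_def[symmetric] char_matrix_def[symmetric]
        by (rule invertible_char_matrix) (use resonant_modes(3) in auto)
      have E020_eq: "E020 = (1/2) *s (matrix_inv (mat (2 * \<i> * w) - ?Se (2 * \<i> * w)) *v ?Q ?\<phi>2 ?\<phi>2)"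
      proof -
        let ?M = "mat (2 * \<i> * w) - ?Se (2 * \<i> * w)"
        have "?M *v E020 = (1/2) *s ?Q ?\<phi>2 ?\<phi>2"
          using E020(1)[unfolded boundary_rhs_4] unfolding char_matrix_def eta_integral_def twice .
        then have "matrix_inv ?M *v (?M *v E020) = (1/2) *s (matrix_inv ?M *v ?Q ?\<phi>2 ?\<phi>2)"
          by (simp add: vector_scalar_commute)
        moreover have "matrix_inv ?M *v (?M *v E020) = E020"
        proof -
          have "?M ** matrix_inv ?M = mat 1 \<and> matrix_inv ?M ** ?M = mat 1"
            using inv unfolding invertible_def matrix_inv_def by (rule someI_ex)
          then show ?thesis by (simp add: matrix_vector_mul_assoc)
        qed
        ultimately show ?thesis by simp
      qed
      have shapes: "\<forall>\<theta>\<in>{- ?r..0}. ?h (2,0,0) \<theta> = ?H200 E200 \<theta> \<and> ?h (0,1,1) \<theta> = ?H011 E011 \<theta> \<and>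
          ?h (0,2,0) \<theta> = ?H020 E020 \<theta> \<and> ?h (1,1,0) \<theta> = ?H110 E110 \<theta> \<and>
          ?h (0,0,2) \<theta> = vcnj (?h (0,2,0) \<theta>) \<and> ?h (1,0,1) \<theta> = vcnj (?h (1,1,0) \<theta>)"
      proof
        fix \<theta> assume \<theta>: "\<theta> \<in> {- ?r..0}"
        have "?h (2,0,0) \<theta> = ?H200 E200 \<theta>"
          using bspec[OF E200(2) \<theta>] fun_cong[OF partic_0, of \<theta>] by (rule trans[OF _ sym])
        moreover have "?h (0,1,1) \<theta> = ?H011 E011 \<theta>"
          using bspec[OF E011(2) \<theta>] fun_cong[OF H011_eq, of \<theta>] by (rule trans[OF _ sym])
        moreover have "?h (0,2,0) \<theta> = ?H020 E020 \<theta>"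
          using bspec[OF E020(2) \<theta>] fun_cong[OF partic_4, of \<theta>] by (rule trans[OF _ sym])
        moreover have "?h (1,1,0) \<theta> = ?H110 E110 \<theta>"
          using bspec[OF E110(2) \<theta>] fun_cong[OF partic_2, of \<theta>] by (rule trans[OF _ sym])
        moreover have "?h (0,0,2) \<theta> = vcnj (?h (0,2,0) \<theta>)" "?h (1,0,1) \<theta> = vcnj (?h (1,1,0) \<theta>)"
          using h_conj_expo[OF h hex(2) \<theta>] h_conj_expo[OF h hex(4) \<theta>] by (simp_all add: conj_expo_def)
        ultimately show "?h (2,0,0) \<theta> = ?H200 E200 \<theta> \<and> ?h (0,1,1) \<theta> = ?H011 E011 \<theta> \<and>
          ?h (0,2,0) \<theta> = ?H020 E020 \<theta> \<and> ?h (1,1,0) \<theta> = ?H110 E110 \<theta> \<and>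
          ?h (0,0,2) \<theta> = vcnj (?h (0,2,0) \<theta>) \<and> ?h (1,0,1) \<theta> = vcnj (?h (1,1,0) \<theta>)"
          by (intro conjI)
      qed
      have R: "?R200 E200" "?R011 E011" "?R110 E110"
        using E200(1) E011(1) E110(1) unfolding boundary_condition_0 R011_iff boundary_condition_2 by - assumption+
      have uniq200: "\<forall>E. ?R200 E \<and> orth (?H200 E) \<longrightarrow> E = E200"
        unfolding boundary_condition_0 partic_0 by (rule E200(3))
      have uniq011: "\<forall>E. ?R011 E \<and> orth (?H011 E) \<longrightarrow> E = E011"
        unfolding R011_iff H011_eq by (rule E011(3))
      have uniq110: "\<forall>E. ?R110 E \<and> orth (?H110 E) \<longrightarrow> E = E110"
        unfolding boundary_condition_2 partic_2 by (rule E110(3))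
      show ?case
        unfolding Let_def
        by ((rule exI)+, (rule conjI[OF nf1] conjI[OF nf2] conjI[OF nf3])+, (rule conjI[OF refl])+,
            rule conjI[OF a111_eq], rule conjI[OF a123_eq], rule conjI[OF b112_eq],
            rule conjI[OF b223_eq], rule conjI[OF shapes],
            (rule conjI[OF R(1)] conjI[OF R(2)] conjI[OF R(3)])+, rule conjI[OF inv], rule conjI[OF E020_eq],
            (intro conjI h_orthogonal[OF h] hex uniq200 uniq011 uniq110)+)
    qed
  qed
qed

end
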